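(* Consider a Hamiltonian of the form $$H(p,q)=\omega_0\cdot p+h(p)+\epsilon H_1(p,q;\epsilon),\qquad h(p)=\mathcal{O}(p^2),$$ in action-angle variables $(p,q)\in\mathcal{G}\times\mathbb{T}^n$, satisfying the analyticity and boundedness assumptions stated in the context, where $h$ and $H_1$ are given and $\omega_0\in\mathbb{R}^n$ is a frequency vector to be determined. Let $\omega\in\mathbb{R}^n$ satisfy the Diophantine condition $$|k\cdot\omega|>\gamma|k|^{-\tau}\qquad\text{for all }k\in\mathbb{Z}^n,\ k\neq0,$$ with some $\gamma>0$ and $\tau\geq n-1$. Then there exists $\epsilon^*>0$ such that the following holds: for $|\epsilon|<\epsilon^*$ there exist a frequency vector $\omega_0\in\mathbb{R}^n$ and a real analytic, near to the identity, canonical transformation $(p,q)=\mathcal{C}^{(\infty)}(p^{(\infty)},q^{(\infty)})$, defined in a neighbourhood of $\{0\}\times\mathbb{T}^n$, which brings the Hamiltonian $H$ (with this $\omega_0$) into the normal form $$H^{(\infty)}(p^{(\infty)},q^{(\infty)})=\omega\cdot p^{(\infty)}+\mathcal{O}\big((p^{(\infty)})^2\big),$$ up to an additive constant.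
   Context: $\mathcal{G}\subseteq\mathbb{R}^n$ is an open set containing the origin, $\mathbb{T}^n=(\mathbb{R}/2\pi\mathbb{Z})^n$, and $(p,q)\in\mathcal{G}\times\mathbb{T}^n$ are canonical action-angle variables. For $k\in\mathbb{Z}^n$, $|k|=\sum_{j}|k_j|$. Standing assumptions: the integrable part $H_0(p)=\omega_0\cdot p+h(p)$ and the perturbation $H_1(p,q;\epsilon)$ are real analytic; $H=H_0+\epsilon H_1$ is a bounded real analytic function of $\epsilon$ for sufficiently small $\epsilon$, and a bounded real holomorphic function of $(p,q)$ in the complex domain $\mathcal{D}_{\rho_0,\sigma_0}=\mathcal{G}_{\rho_0}\times\mathbb{T}^n_{\sigma_0}$ for some $\rho_0,\sigma_0>0$, where $\mathcal{G}_{\rho_0}=\bigcup_{p\in\mathcal{G}}\Delta_{\rho_0}(p)$, $\Delta_{\rho_0}(p)=\{z\in\mathbb{C}^n:|p_j-z_j|<\rho_0,\ j=1,\dots,n\}$, and $\mathbb{T}^n_{\sigma_0}=\{q\in\mathbb{C}^n:|\mathrm{Im}(q_j)|<\sigma_0,\ j=1,\dots,n\}$ (with $q$ taken modulo $2\pi$ in the real parts). The function $h$ depends only on $p$ and vanishes at $p=0$ together with its first derivatives. In the final normal form, $\mathcal{O}((p^{(\infty)})^2)$ denotes an analytic function of $(p^{(\infty)},q^{(\infty)})$, possibly depending on the angles, which vanishes at $p^{(\infty)}=0$ together with its first derivatives with respect to $p^{(\infty)}$. Additive constants in Hamiltonians are neglected. "Near to the identity" means that the transformation differs from the identity by a quantity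 that tends to $0$ as $\epsilon\to0$. No nondegeneracy assumption is made on $h$. *)

theory Defs
  imports "HOL-Analysis.Analysis"
begin

text \<open>
  The dimension \<open>n\<close> is \<open>CARD('n)\<close>. Angles are lifted from \<open>\<real>\<^sup>n / 2\<pi>\<int>\<^sup>n\<close> (and its complex strip)
  to the universal cover: functions on the torus become functions that are \<open>2\<pi>\<close>-periodic in each
  angle, and subsets become sets invariant under the translations by \<open>2\<pi>\<int>\<^sup>n\<close>.
\<close>

type_synonym 'n rphase = "(real^'n) \<times> (real^'n)"
type_synonym 'n cphase = "(complex^'n) \<times> (complex^'n)"

definition lattice_vec :: "int^'n \<Rightarrow> real^'n" where
  "lattice_vec k = (\<chi> j. 2 * pi * of_int (k $ j))"

definition cvec :: "real^'n \<Rightarrow> complex^'n" where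
  "cvec x = (\<chi> j. complex_of_real (x $ j))"

text \<open>Bilinear, not sesquilinear, so that it extends the real scalar product holomorphically.\<close>

definition cdot :: "complex^'n \<Rightarrow> complex^'n \<Rightarrow> complex" where
  "cdot a b = (\<Sum>j\<in>UNIV. a $ j * b $ j)"

definition polydisc :: "real \<Rightarrow> real^'n \<Rightarrow> (complex^'n) set" where
  "polydisc \<rho> p = {z. \<forall>j. cmod (complex_of_real (p $ j) - z $ j) < \<rho>}"

definition complex_actions :: "real \<Rightarrow> (real^'n) set \<Rightarrow> (complex^'n) set" where
  "complex_actions \<rho> G = (\<Union>p\<in>G. polydisc \<rho> p)"

definition complex_angles :: "real \<Rightarrow> (complex^'n) set" where
  "complex_angles \<sigma> = {q. \<forall>j. \<bar>Im (q $ j)\<bar> < \<sigma>}"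

definition complex_domain :: "(real^'n) set \<Rightarrow> real \<Rightarrow> real \<Rightarrow> 'n cphase set" where
  "complex_domain G \<rho> \<sigma> = complex_actions \<rho> G \<times> complex_angles \<sigma>"

text \<open>
  Real holomorphic functions on the complex domain, an open set on whose second factor the angles
  are taken modulo \<open>2\<pi>\<close>: Frechet differentiable with complex linear derivative (\<open>a\<close> and \<open>b\<close> are the
  complex gradients in \<open>p\<close> and \<open>q\<close>), real at real points, periodic in the angles.
\<close>

definition real_holomorphic_on :: "(('n::finite) cphase \<Rightarrow> complex) \<Rightarrow> 'n cphase set \<Rightarrow> bool" where
  "real_holomorphic_on f D \<longleftrightarrow>
     (\<forall>z\<in>D. \<exists>a b. (f has_derivative (\<lambda>(u, v). cdot a u + cdot b v)) (at z)) \<and>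
     (\<forall>p q. (cvec p, cvec q) \<in> D \<longrightarrow> f (cvec p, cvec q) \<in> \<real>) \<and>
     (\<forall>p q k. (p, q) \<in> D \<longrightarrow> f (p, q + cvec (lattice_vec k)) = f (p, q))"

text \<open>
  Real analyticity on an open set \<open>S\<close>: near each point, the sum of a convergent power series.
  The multi-indices \<open>\<alpha>\<close> assign an exponent to each coordinate, that is, to each basis vector.
\<close>

definition real_analytic_on :: "('a::euclidean_space \<Rightarrow> 'b::real_normed_vector) \<Rightarrow> 'a set \<Rightarrow> bool" where
  "real_analytic_on f S \<longleftrightarrow>
     (\<forall>x\<in>S. \<exists>r>0. \<exists>a. \<forall>y\<in>ball x r.
        ((\<lambda>\<alpha>. (\<Prod>b\<in>Basis. ((y - x) \<bullet> b) ^ \<alpha> b) *\<^sub>R a \<alpha>) has_sum f y) (Basis \<rightarrow>\<^sub>E (UNIV :: nat set)))"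

definition hamiltonian ::
  "real^'n \<Rightarrow> (complex^'n \<Rightarrow> complex) \<Rightarrow> ('n cphase \<Rightarrow> real \<Rightarrow> complex) \<Rightarrow> real \<Rightarrow> 'n cphase \<Rightarrow> complex"
  where
  "hamiltonian \<omega>0 h H1 \<epsilon> = (\<lambda>(p, q). cdot (cvec \<omega>0) p + h p + complex_of_real \<epsilon> * H1 (p, q) \<epsilon>)"

definition diophantine :: "real \<Rightarrow> real \<Rightarrow> real^'n \<Rightarrow> bool" where
  "diophantine \<gamma> \<tau> \<omega> \<longleftrightarrow>
     (\<forall>k::int^'n. k \<noteq> 0 \<longrightarrow>
        \<bar>\<Sum>j\<in>UNIV. of_int (k $ j) * \<omega> $ j\<bar> > \<gamma> * (of_int (\<Sum>j\<in>UNIV. \<bar>k $ j\<bar>)) powr (- \<tau>))"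

text \<open>A neighbourhood of \<open>{0} \<times> \<real>\<^sup>n / 2\<pi>\<int>\<^sup>n\<close>.\<close>

definition torus_neighbourhood :: "('n::finite) rphase set \<Rightarrow> bool" where
  "torus_neighbourhood U \<longleftrightarrow>
     open U \<and> {0} \<times> UNIV \<subseteq> U \<and>
     (\<forall>p q k. (p, q) \<in> U \<longrightarrow> (p, q + lattice_vec k) \<in> U)"

definition symplectic_form :: "('n::finite) rphase \<Rightarrow> 'n rphase \<Rightarrow> real" where
  "symplectic_form = (\<lambda>(u, v) (u', v'). u \<bullet> v' - v \<bullet> u')"

text \<open>
  The lift of a symplectic diffeomorphism from (the quotient of) \<open>U\<close> onto its image. The third clause
  lets it descend to angles modulo \<open>2\<pi>\<close>; given that clause, injectivity of the lift is the same as
  injectivity of the descended map. No smoothness of the inverse is required, as it follows from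
  the invertibility of symplectic linear maps.
\<close>

definition canonical_on :: "(('n::finite) rphase \<Rightarrow> 'n rphase) \<Rightarrow> 'n rphase set \<Rightarrow> bool" where
  "canonical_on C U \<longleftrightarrow>
     inj_on C U \<and>
     (\<forall>x\<in>U. \<exists>C'. (C has_derivative C') (at x) \<and>
        (\<forall>a b. symplectic_form (C' a) (C' b) = symplectic_form a b)) \<and>
     (\<forall>p q k. (p, q) \<in> U \<longrightarrow> C (p, q + lattice_vec k) = C (p, q) + (0, lattice_vec k))"

text \<open>
  The remainder \<open>\<O>(p\<^sup>2)\<close>: a real analytic function of actions and angles vanishing at \<open>p = 0\<close> together
  with its first derivatives with respect to \<open>p\<close>.
\<close>

definition quadratic_remainder :: "(('n::finite) rphase \<Rightarrow> real) \<Rightarrow> 'n rphase set \<Rightarrow> bool" where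
  "quadratic_remainder R U \<longleftrightarrow>
     real_analytic_on R U \<and>
     (\<forall>p q k. (p, q) \<in> U \<longrightarrow> R (p, q + lattice_vec k) = R (p, q)) \<and>
     (\<forall>q. R (0, q) = 0 \<and> ((\<lambda>p. R (p, q)) has_derivative (\<lambda>_. 0)) (at 0))"

end

theory Submission
  imports Defs "HOL-Complex_Analysis.Conformal_Mappings"
begin

text \<open>
  Lift the angles to a complex strip and call \<open>f\<close> in normal form if on \<open>p = 0\<close> it is constant and its
  gradient in \<open>p\<close> is \<open>\<omega>\<close>. The error of \<open>f\<close> is the supremum over the strip of the deviation from
  these two identities (\<open>normal_form_error\<close>); for \<open>\<omega> \<cdot> p + h + \<epsilon> H1\<close> it tends to \<open>0\<close> with \<open>\<epsilon>\<close>. As in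
  Kolmogorov's proof, canonical transformations near the identity are composed, each of which makes
  the error quadratically smaller.

  One step (\<open>kam_step\<close>). A gradient \<open>grad s\<close> of a function of the angles is added to the actions, so that
  \<open>f (0, \<theta>)\<close> becomes constant to first order; then the angles are changed to \<open>\<theta> + v \<theta>\<close>, with the actions
  transformed by the inverse transposed Jacobian, so that the gradient in \<open>p\<close> becomes constant to
  first order. Such a map is affine in the actions and exactly symplectic (locale \<open>angle_lift\<close>).
  Both \<open>s\<close> and \<open>v\<close> solve equations \<open>D\<^sub>\<omega> u = g - mean g\<close>, where \<open>D\<^sub>\<omega>\<close> is the derivative in the direction
  \<open>\<omega>\<close>. In Fourier series this is a division by \<open>\<i> k \<cdot> \<omega>\<close>. The Diophantine condition and the
  exponential decay of the coefficients make the series converge on a strip narrower by \<open>\<delta>\<close>, with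
  a bound that deteriorates like a power of \<open>1 / \<delta>\<close> (\<open>cohomological_solution\<close>).

  The free frequency: the equation for \<open>v\<close> can be solved only if the gradient in \<open>p\<close>, as changed by
  \<open>s\<close>, has mean \<open>\<omega>\<close>. Classically the torus is moved to reach this, and that takes an invertible second
  derivative of \<open>h\<close>. Here the frequency \<open>\<omega>\<^sub>0\<close> is free. To change it by \<open>\<mu>\<close> is to add \<open>\<mu> \<cdot> p\<close> in
  the original coordinates, hence \<open>\<Sum>k. \<mu>\<^sub>k l\<^sub>k\<close> in the current ones, where \<open>l\<^sub>k\<close> is the \<open>k\<close>-th original action,
  close to the \<open>k\<close>-th current one. So the condition on the mean is a linear system for \<open>\<mu>\<close> with a
  matrix close to the identity, whatever \<open>h\<close> is (\<open>linearised_equations\<close>).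

  Convergence. All losses in a step are Cauchy estimates for suprema on complex domains, which give a
  new error of at most \<open>A E\<^sup>2 / \<delta>\<^sup>m\<close> with fixed \<open>A\<close> and \<open>m\<close>. With the widths \<open>\<delta>\<^sub>0 / 2\<^sup>j\<close> a small initial error
  already decreases geometrically, faster than \<open>\<delta>\<^sup>m\<close>, and the transformations converge uniformly on a
  fixed complex domain (\<open>kam_iteration\<close>). Uniform limits of holomorphic functions are holomorphic, and
  the derivatives converge too; so the limit is holomorphic, symplectic and real, and its restriction
  to real points is real analytic and canonical (locale \<open>complex_normal_form\<close>).

  It remains that \<open>\<epsilon> H1\<close> tends to \<open>0\<close> uniformly. It does so pointwise, by analyticity in \<open>\<epsilon>\<close>; being uniformly
  bounded and holomorphic it is equicontinuous, and modulo \<open>2\<pi>\<close> the domain is relatively compact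
  (\<open>uniform_vanishing\<close>).
\<close>

section \<open>Cauchy estimates in one variable\<close>

text \<open>
  The bound is assumed on the open disc only, so Cauchy's inequality is applied on smaller circles,
  whose radii then tend to \<open>R\<close>.
\<close>

lemma Cauchy_coefficient_bound:
  fixes f :: "complex \<Rightarrow> complex"
  assumes f: "f holomorphic_on ball 0 R" and R: "R > 0"
    and B: "\<And>z. cmod z < R \<Longrightarrow> cmod (f z) \<le> B"
  shows "cmod ((deriv ^^ n) f 0 / fact n) \<le> B / R ^ n"
proof -
  have *: "cmod ((deriv ^^ n) f 0) \<le> fact n * B / r ^ n" if "0 < r" "r < R" for r
  proof (rule Cauchy_inequality)
    show "f holomorphic_on ball 0 r"
      using f by (rule holomorphic_on_subset) (use that in auto)
    show "continuous_on (cball 0 r) f"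
      using f by (intro holomorphic_on_imp_continuous_on, rule holomorphic_on_subset) (use that in auto)
  qed (use that B in auto)
  have "((\<lambda>r. fact n * B / r ^ n) \<longlongrightarrow> fact n * B / R ^ n) (at_left R)"
    using R by (intro tendsto_intros) auto
  moreover have "eventually (\<lambda>r. cmod ((deriv ^^ n) f 0) \<le> fact n * B / r ^ n) (at_left R)"
    using eventually_at_left_real[OF R] by eventually_elim (use * in auto)
  ultimately have "cmod ((deriv ^^ n) f 0) \<le> fact n * B / R ^ n"
    by (rule tendsto_lowerbound) auto
  then show ?thesis
    by (simp add: norm_divide field_simps)
qed

text \<open>
  In the inner half of the disc the terms from the \<open>m\<close>-th on are dominated by a geometric series of
  ratio at most \<open>1 / 2\<close>; this is the factor \<open>2\<close>.
\<close>

lemma Taylor_remainder_bound: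
  fixes f :: "complex \<Rightarrow> complex"
  assumes f: "f holomorphic_on ball 0 R" and R: "R > 0"
    and B: "\<And>z. cmod z < R \<Longrightarrow> cmod (f z) \<le> B"
    and z: "cmod z \<le> R / 2"
  shows "cmod (f z - (\<Sum>n<m. (deriv ^^ n) f 0 / fact n * z ^ n)) \<le> 2 * B * (cmod z / R) ^ m"
proof -
  define a where "a n = (deriv ^^ n) f 0 / fact n * z ^ n" for n
  define q where "q = cmod z / R"
  have q: "0 \<le> q" "q \<le> 1 / 2"
    using R z by (auto simp: q_def field_simps)
  have B0: "B \<ge> 0"
    using B[of 0] R by (auto intro: order_trans[OF norm_ge_zero])
  have "a sums f z"
    using holomorphic_power_series[OF f, of z] z R by (simp add: a_def[abs_def])
  then have s: "(\<lambda>n. a (n + m)) sums (f z - (\<Sum>n<m. a n))"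
    by (rule sums_split_initial_segment)
  have an: "cmod (a (n + m)) \<le> (B * q ^ m) * q ^ n" for n
  proof -
    have "cmod (a (n + m)) = cmod ((deriv ^^ (n + m)) f 0 / fact (n + m)) * cmod z ^ (n + m)"
      by (simp add: a_def norm_mult norm_power norm_divide)
    also have "\<dots> \<le> B / R ^ (n + m) * cmod z ^ (n + m)"
      by (intro mult_right_mono Cauchy_coefficient_bound[OF f R B]) auto
    also have "\<dots> = (B * q ^ m) * q ^ n"
      by (simp add: q_def power_divide power_add mult_ac)
    finally show ?thesis .
  qed
  have g: "(\<lambda>n. (B * q ^ m) * q ^ n) sums ((B * q ^ m) * (1 / (1 - q)))"
    using q by (intro sums_mult geometric_sums) auto
  have "cmod (f z - (\<Sum>n<m. a n)) \<le> (B * q ^ m) * (1 / (1 - q))"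
    using norm_sums_le[OF s g an] .
  also have "\<dots> \<le> (B * q ^ m) * 2"
    using q B0 by (intro mult_left_mono) (auto simp: field_simps)
  finally show ?thesis
    by (simp add: a_def q_def mult_ac)
qed

section \<open>Holomorphic maps between complex vector spaces\<close>

text \<open>
  Phase space is a product of two spaces of vectors, and the torus is only one of them. A class of
  normed spaces with a compatible multiplication by complex scalars serves both, and also the values.
\<close>

class complex_space = real_normed_vector +
  fixes cscale :: "complex \<Rightarrow> 'a \<Rightarrow> 'a"  (infixr "*\<^sub>C" 75)
  assumes cscale_add_right: "c *\<^sub>C (x + y) = c *\<^sub>C x + c *\<^sub>C y"
    and cscale_add_left: "(c + d) *\<^sub>C x = c *\<^sub>C x + d *\<^sub>C x"
    and cscale_cscale [simp]: "c *\<^sub>C (d *\<^sub>C x) = (c * d) *\<^sub>C x"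
    and cscale_of_real [simp]: "complex_of_real r *\<^sub>C x = r *\<^sub>R x"
    and norm_cscale [simp]: "norm (c *\<^sub>C x) = cmod c * norm x"

lemma cscale_zero_left [simp]: "0 *\<^sub>C x = (0::'a::complex_space)"
  using cscale_of_real[of 0 x] by simp

lemma cscale_one [simp]: "1 *\<^sub>C x = (x::'a::complex_space)"
  using cscale_of_real[of 1 x] by simp

lemma cscale_zero_right [simp]: "c *\<^sub>C 0 = (0::'a::complex_space)"
  using cscale_add_right[of c 0 0] by simp

lemma cscale_scaleR: "c *\<^sub>C (r *\<^sub>R (x::'a::complex_space)) = (c * of_real r) *\<^sub>C x"
  by (metis cscale_cscale cscale_of_real)

lemma cscale_scaleR': "r *\<^sub>R (c *\<^sub>C (x::'a::complex_space)) = (of_real r * c) *\<^sub>C x"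
  by (metis cscale_cscale cscale_of_real)

instantiation complex :: complex_space
begin
definition cscale_complex :: "complex \<Rightarrow> complex \<Rightarrow> complex" where
  [simp]: "cscale_complex c x = c * x"
instance
  by standard (auto simp: algebra_simps norm_mult scaleR_conv_of_real)
end

instantiation prod :: (complex_space, complex_space) complex_space
begin
definition cscale_prod :: "complex \<Rightarrow> 'a \<times> 'b \<Rightarrow> 'a \<times> 'b" where
  "cscale_prod c x = (c *\<^sub>C fst x, c *\<^sub>C snd x)"
instance
  by standard
    (auto simp: cscale_prod_def cscale_add_right cscale_add_left scaleR_prod_def norm_prod_def
      power_mult_distrib real_sqrt_mult simp flip: distrib_left)
end

instantiation vec :: (complex_space, finite) complex_space
begin
definition cscale_vec :: "complex \<Rightarrow> 'a^'b \<Rightarrow> 'a^'b" where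
  "cscale_vec c x = (\<chi> i. c *\<^sub>C x $ i)"
instance
  by standard
    (auto simp: cscale_vec_def cscale_add_right cscale_add_left vec_eq_iff norm_vec_def
      L2_set_right_distrib)
end

lemma cscale_nth [simp]: "(c *\<^sub>C x) $ i = c *\<^sub>C (x $ i)"
  by (simp add: cscale_vec_def)

lemma fst_cscale [simp]: "fst (c *\<^sub>C x) = c *\<^sub>C fst x"
  and snd_cscale [simp]: "snd (c *\<^sub>C x) = c *\<^sub>C snd x"
  by (simp_all add: cscale_prod_def)

lemma cscale_Pair [simp]: "c *\<^sub>C (x, y) = (c *\<^sub>C x, c *\<^sub>C y)"
  by (simp add: cscale_prod_def)

lemma has_vector_derivative_cscale_left [derivative_intros]:
  "((\<lambda>t. t *\<^sub>C v) has_derivative (\<lambda>t. t *\<^sub>C v)) (at z)"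
proof (rule bounded_linear_imp_has_derivative, unfold_locales)
  show "\<exists>K. \<forall>x. norm (x *\<^sub>C v) \<le> norm x * K"
    by (intro exI[of _ "norm v"]) auto
qed (auto simp: cscale_add_left scaleR_conv_of_real cscale_scaleR')

definition hol :: "('a::complex_space \<Rightarrow> 'b::complex_space) \<Rightarrow> 'a set \<Rightarrow> bool" where
  "hol f D \<longleftrightarrow> (\<forall>x\<in>D. \<exists>f'. (f has_derivative f') (at x) \<and> (\<forall>c v. f' (c *\<^sub>C v) = c *\<^sub>C f' v))"

definition dv :: "('a::complex_space \<Rightarrow> 'b::complex_space) \<Rightarrow> 'a \<Rightarrow> 'a \<Rightarrow> 'b" where
  "dv f x v = frechet_derivative f (at x) v"

lemma dv_eqI: "(f has_derivative f') (at x) \<Longrightarrow> dv f x = f'"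
  unfolding dv_def[abs_def] by (metis frechet_derivative_at)

lemma hol_has_derivative: "hol f D \<Longrightarrow> x \<in> D \<Longrightarrow> (f has_derivative dv f x) (at x)"
  unfolding hol_def using dv_eqI by metis

lemma hol_has_derivative_compose:
  "hol f D \<Longrightarrow> g z \<in> D \<Longrightarrow> (g has_derivative g') (at z within S) \<Longrightarrow>
    ((\<lambda>z. f (g z)) has_derivative (\<lambda>v. dv f (g z) (g' v))) (at z within S)"
  by (rule has_derivative_compose[OF _ hol_has_derivative])

lemma dv_cscale: "hol f D \<Longrightarrow> x \<in> D \<Longrightarrow> dv f x (c *\<^sub>C v) = c *\<^sub>C dv f x v"
  unfolding hol_def using dv_eqI by metis

lemma dv_linear: "hol f D \<Longrightarrow> x \<in> D \<Longrightarrow> linear (dv f x)"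
  by (rule has_derivative_linear[OF hol_has_derivative])

lemma dv_sum: "hol f D \<Longrightarrow> x \<in> D \<Longrightarrow> dv f x (\<Sum>i\<in>I. g i) = (\<Sum>i\<in>I. dv f x (g i))"
  by (simp add: dv_linear linear_sum)

lemma holI:
  assumes "\<And>x. x \<in> D \<Longrightarrow> (f has_derivative f' x) (at x)"
    and "\<And>x c v. x \<in> D \<Longrightarrow> f' x (c *\<^sub>C v) = c *\<^sub>C f' x v"
  shows "hol f D"
  using assms unfolding hol_def by blast

lemma hol_subset: "hol f D \<Longrightarrow> E \<subseteq> D \<Longrightarrow> hol f E"
  by (auto simp: hol_def)

lemma hol_localI: "(\<And>x. x \<in> D \<Longrightarrow> \<exists>E. x \<in> E \<and> hol f E) \<Longrightarrow> hol f D"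
  by (auto simp: hol_def)

lemma hol_continuous: "hol f D \<Longrightarrow> continuous_on D f"
  by (intro continuous_at_imp_continuous_on ballI has_derivative_continuous[OF hol_has_derivative])

lemma hol_compose:
  assumes "hol f E" "hol g D" "g ` D \<subseteq> E"
  shows "hol (\<lambda>x. f (g x)) D"
proof (rule holI)
  fix x assume x: "x \<in> D"
  show "((\<lambda>x. f (g x)) has_derivative (\<lambda>v. dv f (g x) (dv g x v))) (at x)"
    by (rule hol_has_derivative_compose[OF assms(1)]) (use assms x hol_has_derivative in auto)
  show "dv f (g x) (dv g x (c *\<^sub>C v)) = c *\<^sub>C dv f (g x) (dv g x v)" for c v
    using assms x by (subst dv_cscale[OF assms(2) x], subst dv_cscale[OF assms(1)]) auto
qed

lemma dv_compose:
  assumes "hol f E" "hol g D" "x \<in> D" "g x \<in> E"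
  shows "dv (\<lambda>x. f (g x)) x v = dv f (g x) (dv g x v)"
  using dv_eqI[OF hol_has_derivative_compose[OF assms(1,4) hol_has_derivative[OF assms(2,3)]]] by simp

lemma hol_bounded_linear:
  assumes "bounded_linear f" "\<And>c v. f (c *\<^sub>C v) = c *\<^sub>C f v"
  shows "hol f D"
  using assms by (intro holI[where f'="\<lambda>_. f"] bounded_linear_imp_has_derivative) auto

lemma hol_const: "hol (\<lambda>_. c) D"
  by (rule holI[where f'="\<lambda>_ _. 0"]) auto

lemma hol_id: "hol (\<lambda>x. x) D"
  by (rule holI[where f'="\<lambda>_ v. v"]) auto

lemma hol_fst: "hol f D \<Longrightarrow> hol (\<lambda>x. fst (f x)) D"
  by (rule hol_compose[of fst UNIV]) (auto intro: hol_bounded_linear bounded_linear_fst)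

lemma hol_snd: "hol f D \<Longrightarrow> hol (\<lambda>x. snd (f x)) D"
  by (rule hol_compose[of snd UNIV]) (auto intro: hol_bounded_linear bounded_linear_snd)

lemma hol_nth: "hol f D \<Longrightarrow> hol (\<lambda>x. f x $ i) D"
  by (rule hol_compose[of "\<lambda>x. x $ i" UNIV]) (auto intro: hol_bounded_linear bounded_linear_vec_nth)


lemma hol_Pair: "hol f D \<Longrightarrow> hol g D \<Longrightarrow> hol (\<lambda>x. (f x, g x)) D"
  by (rule holI[where f'="\<lambda>x v. (dv f x v, dv g x v)"])
    (auto intro: has_derivative_Pair hol_has_derivative simp: dv_cscale)

lemma has_derivative_vec_lambda:
  fixes f :: "'i::finite \<Rightarrow> 'a::real_normed_vector \<Rightarrow> 'b::real_normed_vector"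
  assumes "\<And>i. (f i has_derivative f' i) (at x)"
  shows "((\<lambda>x. \<chi> i. f i x) has_derivative (\<lambda>v. \<chi> i. f' i v)) (at x)"
proof -
  have bl: "bounded_linear (\<lambda>y::'b. \<chi> j. if j = i then y else 0)" for i :: 'i
  proof (unfold_locales, goal_cases)
    case 3
    have "norm ((\<chi> j. if j = i then y else 0) :: 'b^'i) \<le> norm y * 1" for y :: 'b
      unfolding norm_vec_def by (rule order_trans[OF L2_set_le_sum]) (auto simp: if_distrib sum.If_cases)
    then show ?case by blast
  qed (auto simp: vec_eq_iff)
  have "((\<lambda>x. \<Sum>i\<in>UNIV. (\<chi> j. if j = i then f i x else 0) :: 'b^'i) has_derivative
     (\<lambda>v. \<Sum>i\<in>UNIV. \<chi> j. if j = i then f' i v else 0)) (at x)"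
    by (intro has_derivative_sum bounded_linear.has_derivative[OF bl] assms)
  moreover have "(\<Sum>i\<in>UNIV. (\<chi> j. if j = i then g i else 0) :: 'b^'i) = (\<chi> i. g i)" for g
    by (simp add: vec_eq_iff sum.delta if_distrib cong: if_cong)
  ultimately show ?thesis by simp
qed

lemma hol_vec: "(\<And>i. hol (f i) D) \<Longrightarrow> hol (\<lambda>x. \<chi> i. f i x) D"
  by (rule holI[where f'="\<lambda>x v. \<chi> i. dv (f i) x v"])
    (auto intro!: has_derivative_vec_lambda hol_has_derivative simp: vec_eq_iff dv_cscale[where D=D])

lemma hol_add: "hol f D \<Longrightarrow> hol g D \<Longrightarrow> hol (\<lambda>x. f x + g x) D"
  by (rule holI[where f'="\<lambda>x v. dv f x v + dv g x v"])
    (auto intro!: has_derivative_add hol_has_derivative simp: dv_cscale cscale_add_right)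

lemma hol_minus: "hol f D \<Longrightarrow> hol (\<lambda>x. - f x) D"
proof (rule holI[where f'="\<lambda>x v. - dv f x v"])
  show "- dv f x (c *\<^sub>C v) = c *\<^sub>C - dv f x v" if "hol f D" "x \<in> D" for x c v
    using that cscale_add_right[of c "dv f x v" "- dv f x v"]
    by (simp add: dv_cscale eq_neg_iff_add_eq_0 add.commute neg_eq_iff_add_eq_0)
qed (auto intro!: has_derivative_minus hol_has_derivative)

lemma hol_diff: "hol f D \<Longrightarrow> hol g D \<Longrightarrow> hol (\<lambda>x. f x - g x) D"
  using hol_add[OF _ hol_minus] by fastforce

lemma hol_mult:
  fixes f g :: "'a::complex_space \<Rightarrow> complex"
  shows "hol f D \<Longrightarrow> hol g D \<Longrightarrow> hol (\<lambda>x. f x * g x) D"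
  by (rule holI[where f'="\<lambda>x v. f x * dv g x v + dv f x v * g x"])
    (rule has_derivative_mult hol_has_derivative | assumption | simp add: dv_cscale algebra_simps)+

lemma hol_inverse:
  fixes f :: "'a::complex_space \<Rightarrow> complex"
  shows "hol f D \<Longrightarrow> (\<And>x. x \<in> D \<Longrightarrow> f x \<noteq> 0) \<Longrightarrow> hol (\<lambda>x. inverse (f x)) D"
  by (rule holI[where f'="\<lambda>x v. - (inverse (f x) * dv f x v * inverse (f x))"])
    (rule Deriv.has_derivative_inverse hol_has_derivative | assumption | simp add: dv_cscale algebra_simps)+

lemma hol_sum: "(\<And>i. i \<in> I \<Longrightarrow> hol (f i) D) \<Longrightarrow> hol (\<lambda>x. \<Sum>i\<in>I. f i x) D"
  by (induction I rule: infinite_finite_induct) (auto intro: hol_const hol_add)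

lemma hol_prod:
  fixes f :: "'i \<Rightarrow> 'a::complex_space \<Rightarrow> complex"
  shows "(\<And>i. i \<in> I \<Longrightarrow> hol (f i) D) \<Longrightarrow> hol (\<lambda>x. \<Prod>i\<in>I. f i x) D"
  by (induction I rule: infinite_finite_induct) (auto intro: hol_const hol_mult)

lemma dv_fst: "hol f D \<Longrightarrow> x \<in> D \<Longrightarrow> dv (\<lambda>x. fst (f x)) x v = fst (dv f x v)"
  using dv_eqI[OF has_derivative_fst[OF hol_has_derivative]] by metis

lemma dv_snd: "hol f D \<Longrightarrow> x \<in> D \<Longrightarrow> dv (\<lambda>x. snd (f x)) x v = snd (dv f x v)"
  using dv_eqI[OF has_derivative_snd[OF hol_has_derivative]] by metis

lemma dv_nth: "hol f D \<Longrightarrow> x \<in> D \<Longrightarrow> dv (\<lambda>x. f x $ i) x v = dv f x v $ i"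
  using dv_eqI[OF bounded_linear.has_derivative[OF bounded_linear_vec_nth hol_has_derivative]] by metis

lemma dv_Pair: "hol f D \<Longrightarrow> hol g D \<Longrightarrow> x \<in> D \<Longrightarrow> dv (\<lambda>x. (f x, g x)) x v = (dv f x v, dv g x v)"
  using dv_eqI[OF has_derivative_Pair[OF hol_has_derivative hol_has_derivative]] by metis

lemma dv_vec: "(\<And>i. hol (f i) D) \<Longrightarrow> x \<in> D \<Longrightarrow> dv (\<lambda>x. \<chi> i. f i x) x v = (\<chi> i. dv (f i) x v)"
  using dv_eqI[OF has_derivative_vec_lambda[of f "\<lambda>i. dv (f i) x"]] hol_has_derivative by metis

lemma dv_plus: "hol f D \<Longrightarrow> hol g D \<Longrightarrow> x \<in> D \<Longrightarrow> dv (\<lambda>x. f x + g x) x v = dv f x v + dv g x v"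
  using dv_eqI[OF has_derivative_add[OF hol_has_derivative hol_has_derivative]] by metis

lemma dv_minus: "hol f D \<Longrightarrow> hol g D \<Longrightarrow> x \<in> D \<Longrightarrow> dv (\<lambda>x. f x - g x) x v = dv f x v - dv g x v"
  using dv_eqI[OF has_derivative_diff[OF hol_has_derivative hol_has_derivative]] by metis

lemma dv_mult:
  fixes f g :: "'a::complex_space \<Rightarrow> complex"
  shows "hol f D \<Longrightarrow> hol g D \<Longrightarrow> x \<in> D \<Longrightarrow> dv (\<lambda>x. f x * g x) x v = f x * dv g x v + dv f x v * g x"
  using dv_eqI[OF has_derivative_mult[OF hol_has_derivative hol_has_derivative]] by metis

lemma dv_sum_fun: "(\<And>i. i \<in> I \<Longrightarrow> hol (f i) D) \<Longrightarrow> x \<in> D \<Longrightarrow>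
    dv (\<lambda>x. \<Sum>i\<in>I. f i x) x v = (\<Sum>i\<in>I. dv (f i) x v)"
  using dv_eqI[OF has_derivative_sum[of I f "\<lambda>i. dv (f i) x"]] hol_has_derivative by metis

lemma dv_const [simp]: "dv (\<lambda>_. c) x v = 0"
  using dv_eqI[of "\<lambda>_. c" "\<lambda>_. 0" x] by simp

lemma dv_id [simp]: "dv (\<lambda>x. x) x v = v"
  using dv_eqI[of "\<lambda>x. x" "\<lambda>v. v" x] by simp

lemma dv_cong_open: "open D \<Longrightarrow> x \<in> D \<Longrightarrow> (\<And>y. y \<in> D \<Longrightarrow> f y = g y) \<Longrightarrow> hol f D \<Longrightarrow> dv f x v = dv g x v"
  using dv_eqI[of g "dv f x" x] has_derivative_transform_within_open[OF hol_has_derivative, of f D x D g]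
  by metis

lemma hol_cong_open: "open D \<Longrightarrow> hol f D \<Longrightarrow> (\<And>y. y \<in> D \<Longrightarrow> f y = g y) \<Longrightarrow> hol g D"
  by (rule holI[where f'="dv f"])
    (auto intro: has_derivative_transform_within_open[OF hol_has_derivative] simp: dv_cscale)

lemma hol_line:
  fixes f :: "'a::complex_space \<Rightarrow> complex"
  assumes "hol f D" "\<And>t. t \<in> T \<Longrightarrow> x + t *\<^sub>C v \<in> D"
  shows "(\<lambda>t. f (x + t *\<^sub>C v)) holomorphic_on T"
    and "t \<in> T \<Longrightarrow> ((\<lambda>t. f (x + t *\<^sub>C v)) has_field_derivative dv f (x + t *\<^sub>C v) v) (at t)"
proof -
  show *: "((\<lambda>t. f (x + t *\<^sub>C v)) has_field_derivative dv f (x + t *\<^sub>C v) v) (at t)" if "t \<in> T" for t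
  proof -
    have "((\<lambda>t. f (x + t *\<^sub>C v)) has_derivative (\<lambda>s. dv f (x + t *\<^sub>C v) (s *\<^sub>C v))) (at t)"
      using assms(2)[OF that] 
      by (intro hol_has_derivative_compose[OF assms(1)]) (auto intro!: derivative_eq_intros)
    moreover have "(\<lambda>s. dv f (x + t *\<^sub>C v) (s *\<^sub>C v)) = (*) (dv f (x + t *\<^sub>C v) v)"
      using assms(2)[OF that] by (simp add: fun_eq_iff dv_cscale[OF assms(1)] mult.commute)
    ultimately show ?thesis
      by (simp add: has_field_derivative_def)
  qed
  show "(\<lambda>t. f (x + t *\<^sub>C v)) holomorphic_on T"
    unfolding holomorphic_on_def field_differentiable_def using *[THEN has_field_derivative_at_within] by blast
qed

lemma dv_eq_deriv:
  fixes f :: "'a::complex_space \<Rightarrow> complex"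
  assumes "hol f D" "x \<in> D"
  shows "dv f x v = deriv (\<lambda>t. f (x + t *\<^sub>C v)) 0"
  using hol_line(2)[of f "{x}" "{0}" x v 0] hol_subset[OF assms(1), of "{x}"] assms(2)
  by (simp add: DERIV_imp_deriv)

text \<open>Cauchy estimates along a complex line: \<open>R\<close> is the size of the disc in the direction \<open>v\<close>.\<close>

lemma hol_Cauchy_bounds:
  fixes f :: "'a::complex_space \<Rightarrow> complex"
  assumes f: "hol f D" and D: "\<And>t. cmod t < R \<Longrightarrow> x + t *\<^sub>C v \<in> D" and R: "R > 0"
    and B: "\<And>t. cmod t < R \<Longrightarrow> cmod (f (x + t *\<^sub>C v)) \<le> B"
  shows "cmod (dv f x v) \<le> B / R"
    and "R \<ge> 2 \<Longrightarrow> cmod (f (x + v) - f x) \<le> 2 * B / R"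
    and "R \<ge> 2 \<Longrightarrow> cmod (f (x + v) - f x - dv f x v) \<le> 2 * B / R\<^sup>2"
proof -
  define \<phi> where "\<phi> t = f (x + t *\<^sub>C v)" for t
  have h: "\<phi> holomorphic_on ball 0 R"
    unfolding \<phi>_def by (rule hol_line[OF f]) (auto intro: D)
  have x: "x \<in> D" using D[of 0] R by simp
  have B': "cmod (\<phi> t) \<le> B" if "cmod t < R" for t
    using B[OF that] by (simp add: \<phi>_def)
  have d: "deriv \<phi> 0 = dv f x v"
    using dv_eq_deriv[OF f x, of v] by (simp add: \<phi>_def[abs_def])
  show "cmod (dv f x v) \<le> B / R"
    using Cauchy_coefficient_bound[OF h R B', of 1] d by simp
  assume R2: "R \<ge> 2"
  show "cmod (f (x + v) - f x) \<le> 2 * B / R"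
    using Taylor_remainder_bound[OF h R B', of 1 1] R2 R by (simp add: \<phi>_def)
  show "cmod (f (x + v) - f x - dv f x v) \<le> 2 * B / R\<^sup>2"
    using Taylor_remainder_bound[OF h R B', of 1 2] R2 R unfolding d[symmetric]
    by (simp add: \<phi>_def[abs_def] numeral_2_eq_2 power_divide algebra_simps)
qed


lemma eventually_mult_less_at_right:
  fixes K e :: real
  assumes "e > 0"
  shows "eventually (\<lambda>h. h * K < e) (at_right 0)"
proof -
  have "((\<lambda>h. h * K) \<longlongrightarrow> 0 * K) (at_right 0)"
    by (intro tendsto_intros)
  then show ?thesis
    using assms by (intro order_tendstoD(2)) auto
qed

text \<open>
  A continuous function that is holomorphic along every complex line is holomorphic. The
  Cauchy estimates give a quadratic remainder, uniformly in the base point, hence continuity of the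
  directional derivative in the base point; additivity follows by comparing increments along
  \<open>u\<close> and then along \<open>v\<close>.
\<close>

lemma hol_if_holomorphic_on_lines:
  fixes f :: "'a::complex_space \<Rightarrow> complex"
  assumes D: "open D" and cont: "continuous_on D f"
    and lines: "\<And>x v. x \<in> D \<Longrightarrow> \<exists>r>0. (\<lambda>t. f (x + t *\<^sub>C v)) holomorphic_on ball 0 r"
  shows "hol f D"
proof -
  define L where "L y v = deriv (\<lambda>t. f (y + t *\<^sub>C v)) 0" for y v
  have "\<exists>f'. (f has_derivative f') (at x) \<and> (\<forall>c v. f' (c *\<^sub>C v) = c *\<^sub>C f' v)" if x: "x \<in> D" for x
  proof -
    define B where "B = cmod (f x) + 1"
    have "eventually (\<lambda>y. y \<in> D) (nhds x)"
      using D x by (rule eventually_nhds_in_open)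
    moreover have "eventually (\<lambda>y. cmod (f y) < B) (nhds x)"
    proof -
      have "isCont f x"
        using cont D x by (simp add: continuous_on_eq_continuous_at)
      then have "((\<lambda>y. cmod (f y)) \<longlongrightarrow> cmod (f x)) (nhds x)"
        by (simp add: isCont_def tendsto_norm tendsto_at_iff_tendsto_nhds)
      then show ?thesis
        by (rule order_tendstoD(2)) (simp add: B_def)
    qed
    ultimately have "eventually (\<lambda>y. y \<in> D \<and> cmod (f y) < B) (nhds x)"
      by eventually_elim auto
    then obtain \<rho> where \<rho>: "\<rho> > 0" "\<And>y. dist y x < \<rho> \<Longrightarrow> y \<in> D \<and> cmod (f y) < B"
      unfolding eventually_nhds_metric by blast
    have near: "y + t *\<^sub>C v \<in> D \<and> cmod (f (y + t *\<^sub>C v)) \<le> B"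
      if "dist y x < \<rho> / 2" "cmod t * norm v < \<rho> / 2" for y t v
    proof -
      have "dist (y + t *\<^sub>C v) x \<le> dist y x + norm (t *\<^sub>C v)"
        using dist_triangle[of "y + t *\<^sub>C v" x y] by (simp add: dist_norm)
      also have "\<dots> < \<rho>" using that by simp
      finally show ?thesis using \<rho>(2) by (auto simp: less_imp_le)
    qed
    have holo: "(\<lambda>t. f (y + t *\<^sub>C v)) holomorphic_on ball 0 R"
      if "dist y x < \<rho> / 2" "R * norm v \<le> \<rho> / 2" "R > 0" for y v R
    proof -
      have "(\<lambda>t. f (y + t *\<^sub>C v)) field_differentiable at t0" if t0: "cmod t0 < R" for t0
      proof -
        have "cmod t0 * norm v < \<rho> / 2"
        proof (cases "v = 0")
          case False
          then have "cmod t0 * norm v < R * norm v"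
            using t0 by (intro mult_strict_right_mono) auto
          then show ?thesis using \<open>R * norm v \<le> \<rho> / 2\<close> by simp
        qed (use \<rho> in auto)
        then have "y + t0 *\<^sub>C v \<in> D"
          using near \<open>dist y x < \<rho> / 2\<close> by blast
        from lines[OF this, of v] obtain r where r: "r > 0"
          "(\<lambda>t. f ((y + t0 *\<^sub>C v) + t *\<^sub>C v)) holomorphic_on ball 0 r" by blast
        then have "(\<lambda>t. f ((y + t0 *\<^sub>C v) + t *\<^sub>C v)) field_differentiable at (t0 - t0)"
          by (auto simp: holomorphic_on_open field_differentiable_def)
        then have "(\<lambda>t. f ((y + t0 *\<^sub>C v) + t *\<^sub>C v)) \<circ> (\<lambda>t. t - t0) field_differentiable at t0"
          by (intro field_differentiable_compose) (auto intro!: derivative_intros)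
        then show ?thesis
          by (simp add: o_def add.assoc flip: cscale_add_left)
      qed
      then show ?thesis
        by (auto simp: holomorphic_on_open field_differentiable_def)
    qed
    have bounds: "cmod (L y v) \<le> 2 * B / \<rho> * norm v"
      "norm v \<le> \<rho> / 4 \<Longrightarrow> cmod (f (y + v) - f y - L y v) \<le> 8 * B / \<rho>\<^sup>2 * (norm v)\<^sup>2"
      if y: "dist y x < \<rho> / 2" for y v
    proof -
      have "cmod (L y v) \<le> 2 * B / \<rho> * norm v \<and>
        (norm v \<le> \<rho> / 4 \<longrightarrow> cmod (f (y + v) - f y - L y v) \<le> 8 * B / \<rho>\<^sup>2 * (norm v)\<^sup>2)"
      proof (cases "v = 0")
        case False
        define R where "R = \<rho> / (2 * norm v)"
        have R: "R > 0" "R * norm v = \<rho> / 2"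
          using False \<rho> by (auto simp: R_def)
        define \<phi> where "\<phi> t = f (y + t *\<^sub>C v)" for t
        have h: "\<phi> holomorphic_on ball 0 R"
          unfolding \<phi>_def by (rule holo[OF y]) (use R in auto)
        have B': "cmod (\<phi> t) \<le> B" if "cmod t < R" for t
        proof -
          have "cmod t * norm v < \<rho> / 2"
            using that R False by (metis mult_strict_right_mono zero_less_norm_iff)
          then show ?thesis using near[OF y] by (simp add: \<phi>_def)
        qed
        have "cmod (L y v) \<le> B / R"
          using Cauchy_coefficient_bound[OF h R(1) B', of 1] by (simp add: L_def \<phi>_def[abs_def])
        also have "\<dots> = 2 * B / \<rho> * norm v" using False \<rho> by (simp add: R_def field_simps)
        finally have 1: "cmod (L y v) \<le> 2 * B / \<rho> * norm v" .
        have 2: "cmod (f (y + v) - f y - L y v) \<le> 8 * B / \<rho>\<^sup>2 * (norm v)\<^sup>2" if "norm v \<le> \<rho> / 4"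
        proof -
          have "R \<ge> 2" using that False \<rho> by (simp add: R_def field_simps)
          then have "cmod (f (y + v) - f y - L y v) \<le> 2 * B * (1 / R)\<^sup>2"
            using Taylor_remainder_bound[OF h R(1) B', of 1 2]
            by (simp add: \<phi>_def[abs_def] L_def numeral_2_eq_2 algebra_simps)
          also have "\<dots> = 8 * B / \<rho>\<^sup>2 * (norm v)\<^sup>2"
            using False \<rho> by (simp add: R_def field_simps power2_eq_square)
          finally show ?thesis .
        qed
        show ?thesis using 1 2 by blast
      qed (auto simp: L_def)
      then show "cmod (L y v) \<le> 2 * B / \<rho> * norm v"
        "norm v \<le> \<rho> / 4 \<Longrightarrow> cmod (f (y + v) - f y - L y v) \<le> 8 * B / \<rho>\<^sup>2 * (norm v)\<^sup>2" by auto
    qed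
    have L_cscale: "L y (c *\<^sub>C v) = c * L y v" if "dist y x < \<rho> / 2" for y c v
    proof -
      obtain R where R: "R * norm v \<le> \<rho> / 2" "R > 0"
      proof
        show "\<rho> / 2 / (norm v + 1) * norm v \<le> \<rho> / 2"
          using \<rho> by (simp add: divide_le_eq add_nonneg_pos mult_left_mono)
        show "\<rho> / 2 / (norm v + 1) > 0"
          using \<rho> by (simp add: add_nonneg_pos)
      qed
      define \<phi> where "\<phi> t = f (y + t *\<^sub>C v)" for t
      have "\<phi> holomorphic_on ball 0 R"
        unfolding \<phi>_def using holo[OF that R] .
      then have "(\<phi> has_field_derivative deriv \<phi> 0) (at (c * 0))"
        using R by (auto intro!: holomorphic_derivI[of \<phi> "ball 0 R"])
      then have "((\<lambda>t. \<phi> (c * t)) has_field_derivative deriv \<phi> 0 * c) (at 0)"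
        by (rule DERIV_chain2) (auto intro!: derivative_eq_intros)
      then show ?thesis
        unfolding L_def \<phi>_def by (simp add: DERIV_imp_deriv mult.commute)
    qed
    \<comment> \<open>Continuity of \<open>y \<mapsto> L y v\<close> at \<open>x\<close>, as a uniform limit of difference quotients.\<close>
    have L_cont: "((\<lambda>y. L y v) \<longlongrightarrow> L x v) (at x)" for v
    proof -
      have "isCont (\<lambda>y. L y v) x"
      proof (rule continuous_on_interior)
        have "uniform_limit (ball x (\<rho> / 2)) (\<lambda>h y. (f (y + h *\<^sub>R v) - f y) / of_real h) (\<lambda>y. L y v) (at_right 0)"
        proof (rule uniform_limitI)
          fix e :: real assume e: "e > 0"
          define K where "K = 8 * B / \<rho>\<^sup>2 * (norm v)\<^sup>2"
          have "eventually (\<lambda>h. h * norm v < \<rho> / 4) (at_right 0)" "eventually (\<lambda>h. h * K < e) (at_right 0)"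
            by (rule eventually_mult_less_at_right, use e \<rho> in simp)+
          then show "\<forall>\<^sub>F h in at_right 0. \<forall>y\<in>ball x (\<rho> / 2). dist ((f (y + h *\<^sub>R v) - f y) / of_real h) (L y v) < e"
            using eventually_at_right_less[of "0::real"]
          proof eventually_elim
            case (elim h)
            show ?case
            proof
              fix y assume "y \<in> ball x (\<rho> / 2)"
              then have y: "dist y x < \<rho> / 2" by (simp add: dist_commute)
              have "(f (y + h *\<^sub>R v) - f y) / of_real h - L y v = (f (y + h *\<^sub>R v) - f y - L y (of_real h *\<^sub>C v)) / of_real h"
                using elim by (subst L_cscale[OF y]) (simp add: field_simps)
              then have "dist ((f (y + h *\<^sub>R v) - f y) / of_real h) (L y v) = cmod (f (y + h *\<^sub>R v) - f y - L y (h *\<^sub>R v)) / h"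
                using elim by (simp add: dist_norm norm_divide)
              also have "\<dots> \<le> (8 * B / \<rho>\<^sup>2 * (norm (h *\<^sub>R v))\<^sup>2) / h"
                using elim by (intro divide_right_mono bounds(2)[OF y]) auto
              also have "\<dots> = h * K"
                using elim by (simp add: K_def power2_eq_square field_simps)
              finally show "dist ((f (y + h *\<^sub>R v) - f y) / of_real h) (L y v) < e"
                using elim by simp
            qed
          qed
        qed
        moreover have "\<forall>\<^sub>F h in at_right 0. continuous_on (ball x (\<rho> / 2)) (\<lambda>y. (f (y + h *\<^sub>R v) - f y) / of_real h)"
        proof -
          have "eventually (\<lambda>h. h * norm v < \<rho> / 2) (at_right 0)"
            by (rule eventually_mult_less_at_right, use \<rho> in simp)
          then show ?thesis
            using eventually_at_right_less[of "0::real"]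
          proof eventually_elim
            case (elim h)
            have "y + h *\<^sub>R v \<in> D \<and> y \<in> D" if "y \<in> ball x (\<rho> / 2)" for y
              using near[of y "of_real h" v] near[of y 0 v] that elim \<rho> by (auto simp: dist_commute)
            then show ?case
              using elim by (intro continuous_intros continuous_on_compose2[OF cont]) auto
          qed
        qed
        ultimately show "continuous_on (ball x (\<rho> / 2)) (\<lambda>y. L y v)"
          by (intro uniform_limit_theorem[where F="at_right (0::real)"]) auto
      qed (use \<rho> in auto)
      then show ?thesis by (simp add: isCont_def)
    qed
    have L_add: "L x (u + v) = L x u + L x v" for u v
    proof (cases "u = 0")
      case False
      define K where "K = 8 * B / \<rho>\<^sup>2 * ((norm (u + v))\<^sup>2 + (norm u)\<^sup>2 + (norm v)\<^sup>2)"
      have B0: "B \<ge> 0" by (simp add: B_def)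
      have ev: "eventually (\<lambda>h. h * (norm (u + v) + norm u + norm v) < \<rho> / 4) (at_right 0)"
        by (rule eventually_mult_less_at_right, use \<rho> in simp)
      have lim: "((\<lambda>h. L (x + h *\<^sub>R u) v) \<longlongrightarrow> L x v) (at_right 0)"
      proof (rule filterlim_compose[OF L_cont])
        have "((\<lambda>h. x + h *\<^sub>R u) \<longlongrightarrow> x + 0 *\<^sub>R u) (at_right 0)"
          by (intro tendsto_intros)
        then show "filterlim (\<lambda>h. x + h *\<^sub>R u) (at x) (at_right 0)"
          using False eventually_at_right_less[of "0::real"]
          by (auto simp: filterlim_at elim!: eventually_mono)
      qed
      have "((\<lambda>h. L (x + h *\<^sub>R u) v - (L x (u + v) - L x u)) \<longlongrightarrow> 0) (at_right 0)"
      proof (rule Lim_null_comparison)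
        show "((\<lambda>h. h * K) \<longlongrightarrow> 0) (at_right 0)"
          by (auto intro!: tendsto_eq_intros)
        show "\<forall>\<^sub>F h in at_right 0. cmod (L (x + h *\<^sub>R u) v - (L x (u + v) - L x u)) \<le> h * K"
          using ev eventually_at_right_less[of "0::real"]
        proof eventually_elim
          case (elim h)
          have h0: "h * norm (u + v) \<ge> 0" "h * norm u \<ge> 0" "h * norm v \<ge> 0"
            using elim by auto
          then have le: "h * norm (u + v) \<le> \<rho> / 4" "h * norm u \<le> \<rho> / 4" "h * norm v \<le> \<rho> / 4"
            using elim h0 unfolding distrib_left by linarith+
          define y where "y = x + h *\<^sub>R u"
          have y: "dist y x < \<rho> / 2" and x': "dist x x < \<rho> / 2"
            using le elim \<rho> by (auto simp: y_def dist_norm)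
          have *: "h * L z w = L z (h *\<^sub>R w)" if "dist z x < \<rho> / 2" for z w
            using L_cscale[OF that, of "of_real h" w] by simp
          have "h * (L y v - (L x (u + v) - L x u)) =
            (f (x + h *\<^sub>R (u + v)) - f x - L x (h *\<^sub>R (u + v))) - (f (x + h *\<^sub>R u) - f x - L x (h *\<^sub>R u))
             - (f (y + h *\<^sub>R v) - f y - L y (h *\<^sub>R v))"
            unfolding *[OF y, symmetric] *[OF x', symmetric]
            by (simp add: y_def algebra_simps)
          also have "cmod \<dots> \<le> 8 * B / \<rho>\<^sup>2 * (norm (h *\<^sub>R (u + v)))\<^sup>2 + 8 * B / \<rho>\<^sup>2 * (norm (h *\<^sub>R u))\<^sup>2
              + 8 * B / \<rho>\<^sup>2 * (norm (h *\<^sub>R v))\<^sup>2"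
            by (intro order_trans[OF norm_triangle_ineq4] add_mono bounds(2)[OF y] bounds(2)[OF x'])
              (use le elim in auto)
          also have "\<dots> = h * (h * K)"
            unfolding norm_scaleR power_mult_distrib power2_abs K_def by algebra
          finally have "h * cmod (L y v - (L x (u + v) - L x u)) \<le> h * (h * K)"
            using elim by (simp add: norm_mult)
          then show ?case using elim by (simp add: y_def)
        qed
      qed
      then have "((\<lambda>h. L (x + h *\<^sub>R u) v) \<longlongrightarrow> L x (u + v) - L x u) (at_right 0)"
        by (simp add: LIM_zero_iff)
      then have "L x v = L x (u + v) - L x u"
        using tendsto_unique[OF _ lim] by simp
      then show ?thesis by simp
    qed (simp add: L_def)
    have x': "dist x x < \<rho> / 2" using \<rho> by simp
    have bl: "bounded_linear (L x)"
    proof (rule bounded_linear_intro)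
      show "L x (r *\<^sub>R u) = r *\<^sub>R L x u" for r u
        using L_cscale[OF x', of "of_real r" u] by (simp add: scaleR_conv_of_real)
      show "norm (L x u) \<le> norm u * (2 * B / \<rho>)" for u
        using bounds(1)[OF x', of u] by (simp add: mult.commute)
    qed (rule L_add)
    have "(f has_derivative L x) (at x)"
      unfolding has_derivative_at
    proof (intro conjI bl)
      show "(\<lambda>h. norm (f (x + h) - f x - L x h) / norm h) \<midarrow>0\<rightarrow> 0"
      proof (rule Lim_null_comparison)
        have "((\<lambda>h::'a. 8 * B / \<rho>\<^sup>2 * norm h) \<longlongrightarrow> 8 * B / \<rho>\<^sup>2 * norm (0::'a)) (at 0)"
          by (intro tendsto_intros)
        then show "((\<lambda>h::'a. 8 * B / \<rho>\<^sup>2 * norm h) \<longlongrightarrow> 0) (at 0)" by simp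
        have "eventually (\<lambda>h::'a. norm h < \<rho> / 4) (at 0)"
          using \<rho> by (intro order_tendstoD(2)[where y="0::real"] tendsto_eq_intros) auto
        then show "\<forall>\<^sub>F h in at 0. norm (norm (f (x + h) - f x - L x h) / norm h) \<le> 8 * B / \<rho>\<^sup>2 * norm h"
          using eventually_neq_at_within[of 0]
        proof eventually_elim
          case (elim h)
          then show ?case using bounds(2)[OF x', of h] \<rho>
            by (simp add: divide_le_eq power2_eq_square mult_ac)
        qed
      qed
    qed
    then show ?thesis using L_cscale[OF x'] by auto
  qed
  then show ?thesis by (simp add: hol_def)
qed

lemma line_disc_in_open:
  fixes x :: "'a::complex_space"
  assumes "open D" "x \<in> D"
  obtains r where "r > 0" "\<And>t. cmod t \<le> r \<Longrightarrow> x + t *\<^sub>C v \<in> D"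
proof -
  obtain e where e: "e > 0" "ball x e \<subseteq> D"
    using assms by (meson open_contains_ball)
  define w where "w = norm v + 1"
  have w: "w > 0" "norm v \<le> w" by (auto simp: w_def add_nonneg_pos)
  have *: "x + t *\<^sub>C v \<in> D" if "cmod t \<le> e / (2 * w)" for t
  proof -
    have "cmod t * norm v \<le> e / (2 * w) * w"
      by (rule mult_mono[OF that]) (use e w in auto)
    also have "\<dots> < e" using w e by simp
    finally have "dist x (x + t *\<^sub>C v) < e"
      by (simp add: dist_norm)
    then show ?thesis using e by auto
  qed
  show ?thesis
    by (rule that[OF _ *]) (use e w in auto)
qed

text \<open>
  Along a complex line this is the theorem of Weierstrass in one variable; as the limit is continuous,
  holomorphy along lines is enough.
\<close>

lemma hol_uniform_limit:
  fixes f :: "'i \<Rightarrow> 'a::complex_space \<Rightarrow> complex"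
  assumes D: "open D" and f: "eventually (\<lambda>n. hol (f n) D) F"
    and lim: "uniform_limit D f g F" and F: "F \<noteq> bot"
  shows hol_uniform_limit_hol: "hol g D"
    and tendsto_dv: "x \<in> D \<Longrightarrow> ((\<lambda>n. dv (f n) x v) \<longlongrightarrow> dv g x v) F"
proof -
  have cont: "continuous_on D g"
    by (rule uniform_limit_theorem[OF _ lim F]) (use f in \<open>auto elim!: eventually_mono intro: hol_continuous\<close>)
  have line: "\<exists>r>0. (\<lambda>t. g (x + t *\<^sub>C v)) holomorphic_on ball 0 r \<and> (\<forall>t. cmod t < r \<longrightarrow> x + t *\<^sub>C v \<in> D) \<and>
      (\<exists>g'. ((\<lambda>t. g (x + t *\<^sub>C v)) has_field_derivative g') (at 0) \<and> ((\<lambda>n. dv (f n) x v) \<longlongrightarrow> g') F)"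
    if x: "x \<in> D" for x v
  proof -
    obtain r where r: "r > 0" "\<And>t. cmod t \<le> r \<Longrightarrow> x + t *\<^sub>C v \<in> D"
      using line_disc_in_open[OF D x] by blast
    have ulim: "uniform_limit (cball 0 r) (\<lambda>n t. f n (x + t *\<^sub>C v)) (\<lambda>t. g (x + t *\<^sub>C v)) F"
      using lim r(2) unfolding uniform_limit_iff by (force elim: eventually_mono)
    have ev: "\<forall>\<^sub>F n in F. continuous_on (cball 0 r) (\<lambda>t. f n (x + t *\<^sub>C v)) \<and>
       (\<forall>w\<in>ball 0 r. ((\<lambda>t. f n (x + t *\<^sub>C v)) has_field_derivative dv (f n) (x + w *\<^sub>C v) v) (at w))"
      using f
    proof eventually_elim
      case (elim n)
      then show ?case using r
        by (intro conjI ballI hol_line(2)[OF elim, where T="cball 0 r"] holomorphic_on_imp_continuous_on hol_line(1)[OF elim]) auto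
    qed
    obtain g' where g': "\<And>w. w \<in> ball 0 r \<Longrightarrow> ((\<lambda>t. g (x + t *\<^sub>C v)) has_field_derivative g' w) (at w) \<and>
        ((\<lambda>n. dv (f n) (x + w *\<^sub>C v) v) \<longlongrightarrow> g' w) F"
      using has_complex_derivative_uniform_limit[OF ev ulim F r(1)] by blast
    have "(\<lambda>t. g (x + t *\<^sub>C v)) holomorphic_on ball 0 r"
      unfolding holomorphic_on_def field_differentiable_def
      using g' has_field_derivative_at_within by blast
    then show ?thesis
      using r g'[of 0] by (intro exI[of _ r]) auto
  qed
  show hg: "hol g D"
    using line by (intro hol_if_holomorphic_on_lines[OF D cont]) blast
  show "((\<lambda>n. dv (f n) x v) \<longlongrightarrow> dv g x v) F" if x: "x \<in> D"
  proof -
    obtain g' where g': "((\<lambda>t. g (x + t *\<^sub>C v)) has_field_derivative g') (at 0)" "((\<lambda>n. dv (f n) x v) \<longlongrightarrow> g') F"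
      using line[OF x, of v] by blast
    moreover have "dv g x v = g'"
      using dv_eq_deriv[OF hg x, of v] DERIV_imp_deriv[OF g'(1)] by simp
    ultimately show ?thesis by simp
  qed
qed

text \<open>
  Second-order Cauchy estimates are uniform in the base point. So a directional derivative is locally a
  uniform limit of holomorphic functions, which makes it holomorphic.
\<close>

lemma difference_quotient_uniform_limit:
  fixes f :: "'a::complex_space \<Rightarrow> complex"
  assumes D: "open D" and f: "hol f D" and x: "x \<in> D"
  obtains r where "r > 0" "ball x r \<subseteq> D"
    "\<forall>\<^sub>F h in at_right 0. \<forall>y\<in>ball x r. y + h *\<^sub>R v \<in> D"
    "uniform_limit (ball x r) (\<lambda>h y. of_real (1 / h) * (f (y + h *\<^sub>R v) - f y)) (\<lambda>y. dv f y v) (at_right 0)"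
proof -
  define B where "B = cmod (f x) + 1"
  have "eventually (\<lambda>y. y \<in> D) (nhds x)"
    using D x by (rule eventually_nhds_in_open)
  moreover have "eventually (\<lambda>y. cmod (f y) < B) (nhds x)"
  proof -
    have "isCont f x"
      using hol_continuous[OF f] D x by (simp add: continuous_on_eq_continuous_at)
    then have "((\<lambda>y. cmod (f y)) \<longlongrightarrow> cmod (f x)) (nhds x)"
      by (simp add: isCont_def tendsto_norm tendsto_at_iff_tendsto_nhds)
    then show ?thesis
      by (rule order_tendstoD(2)) (simp add: B_def)
  qed
  ultimately have "eventually (\<lambda>y. y \<in> D \<and> cmod (f y) < B) (nhds x)"
    by eventually_elim auto
  then obtain \<rho> where \<rho>: "\<rho> > 0" "\<And>y. dist y x < \<rho> \<Longrightarrow> y \<in> D \<and> cmod (f y) < B"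
    unfolding eventually_nhds_metric by blast
  define w where "w = norm v + 1"
  have w: "w > 0" "norm v \<le> w" by (auto simp: w_def add_nonneg_pos)
  have near: "y + t *\<^sub>C v \<in> D \<and> cmod (f (y + t *\<^sub>C v)) \<le> B"
    if "dist y x < \<rho> / 2" "cmod t * w < \<rho> / 2" for y t
  proof -
    have "dist (y + t *\<^sub>C v) x \<le> dist y x + norm (t *\<^sub>C v)"
      using dist_triangle[of "y + t *\<^sub>C v" x y] by (simp add: dist_norm)
    also have "\<dots> \<le> dist y x + cmod t * w"
      using w by (simp add: mult_left_mono)
    also have "\<dots> < \<rho>" using that by simp
    finally show ?thesis using \<rho>(2) by (auto simp: less_imp_le)
  qed
  have ev: "eventually (\<lambda>h. h * w < \<rho> / 4) (at_right 0)"
    by (rule eventually_mult_less_at_right, use \<rho> in simp)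
  show ?thesis
  proof (rule that)
    show "\<rho> / 2 > 0" using \<rho> by simp
    show "ball x (\<rho> / 2) \<subseteq> D" using \<rho> by (auto simp: dist_commute)
    show "\<forall>\<^sub>F h in at_right 0. \<forall>y\<in>ball x (\<rho> / 2). y + h *\<^sub>R v \<in> D"
      using ev eventually_at_right_less[of "0::real"]
    proof eventually_elim
      case (elim h)
      then show ?case
        using near[of _ "of_real h"] \<rho> by (auto simp: dist_commute)
    qed
    show "uniform_limit (ball x (\<rho> / 2)) (\<lambda>h y. of_real (1 / h) * (f (y + h *\<^sub>R v) - f y)) (\<lambda>y. dv f y v) (at_right 0)"
    proof (rule uniform_limitI)
      fix e :: real assume e: "e > 0"
      define K where "K = 8 * B * w\<^sup>2 / \<rho>\<^sup>2"
      have "eventually (\<lambda>h. h * K < e) (at_right 0)"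
        by (rule eventually_mult_less_at_right, use e in simp)
      then show "\<forall>\<^sub>F h in at_right 0. \<forall>y\<in>ball x (\<rho> / 2). dist (of_real (1 / h) * (f (y + h *\<^sub>R v) - f y)) (dv f y v) < e"
        using ev eventually_at_right_less[of "0::real"]
      proof eventually_elim
        case (elim h)
        show ?case
        proof
          fix y assume "y \<in> ball x (\<rho> / 2)"
          then have y: "dist y x < \<rho> / 2" by (simp add: dist_commute)
          then have yD: "y \<in> D" using \<rho> by auto
          define R where "R = \<rho> / (2 * h * w)"
          have R: "R > 0" "R \<ge> 2" using elim \<rho> w by (auto simp: R_def field_simps)
          have *: "cmod (t * of_real h) * w < \<rho> / 2" if "cmod t < R" for t
            using that elim w by (simp add: R_def norm_mult field_simps)
          have **: "y + t *\<^sub>C (h *\<^sub>R v) \<in> D \<and> cmod (f (y + t *\<^sub>C (h *\<^sub>R v))) \<le> B" if "cmod t < R" for t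
            using near[OF y *[OF that]] by (simp add: cscale_scaleR)
          have dvh: "dv f y (h *\<^sub>R v) = of_real h * dv f y v"
            using dv_cscale[OF f yD, of "of_real h" v] by simp
          have "of_real (1 / h) * (f (y + h *\<^sub>R v) - f y) - dv f y v
              = (f (y + h *\<^sub>R v) - f y - dv f y (h *\<^sub>R v)) / of_real h"
            using elim by (simp add: dvh field_simps)
          then have "dist (of_real (1 / h) * (f (y + h *\<^sub>R v) - f y)) (dv f y v)
              = cmod (f (y + h *\<^sub>R v) - f y - dv f y (h *\<^sub>R v)) / h"
            using elim by (simp add: dist_norm norm_divide)
          also have "\<dots> \<le> (2 * B / R\<^sup>2) / h"
            using elim R(2) ** by (intro divide_right_mono hol_Cauchy_bounds(3)[OF f _ R(1)]) auto
          also have "\<dots> = h * K"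
            using elim w \<rho> by (simp add: K_def R_def power2_eq_square field_simps)
          finally show "dist (of_real (1 / h) * (f (y + h *\<^sub>R v) - f y)) (dv f y v) < e"
            using elim by simp
        qed
      qed
    qed
  qed
qed

lemma difference_quotient_has_derivative:
  fixes f :: "'a::complex_space \<Rightarrow> complex"
  assumes f: "hol f D" and "y \<in> D" "y + w \<in> D"
  shows "((\<lambda>y. c * (f (y + w) - f y)) has_derivative (\<lambda>u. c * (dv f (y + w) u - dv f y u))) (at y)"
proof -
  have "((\<lambda>y. f (y + w)) has_derivative (\<lambda>u. dv f (y + w) u)) (at y)"
    by (rule hol_has_derivative_compose[OF f, where g="\<lambda>y. y + w"]) (use assms in \<open>auto intro!: derivative_eq_intros\<close>)
  then show ?thesis
    using hol_has_derivative[OF f] assms by (intro has_derivative_mult_right has_derivative_diff) auto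
qed

lemma hol_difference_quotient:
  fixes f :: "'a::complex_space \<Rightarrow> complex"
  assumes f: "hol f D" and "E \<subseteq> D" "\<And>y. y \<in> E \<Longrightarrow> y + w \<in> D"
  shows "hol (\<lambda>y. c * (f (y + w) - f y)) E"
proof (rule holI)
  fix y assume y: "y \<in> E"
  show "((\<lambda>y. c * (f (y + w) - f y)) has_derivative (\<lambda>u. c * (dv f (y + w) u - dv f y u))) (at y)"
    using difference_quotient_has_derivative[OF f] assms y by blast
  show "c * (dv f (y + w) (a *\<^sub>C u) - dv f y (a *\<^sub>C u)) = a *\<^sub>C (c * (dv f (y + w) u - dv f y u))" for a u
    using dv_cscale[OF f assms(3)[OF y]] dv_cscale[OF f subsetD[OF assms(2) y]] by (simp add: algebra_simps)
qed

lemma hol_dv: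
  fixes f :: "'a::complex_space \<Rightarrow> complex"
  assumes D: "open D" and f: "hol f D"
  shows "hol (\<lambda>x. dv f x v) D"
proof (rule hol_localI)
  fix x assume "x \<in> D"
  from difference_quotient_uniform_limit[OF D f this, of v] obtain r where r: "r > 0" "ball x r \<subseteq> D"
    "\<forall>\<^sub>F h in at_right 0. \<forall>y\<in>ball x r. y + h *\<^sub>R v \<in> D"
    "uniform_limit (ball x r) (\<lambda>h y. of_real (1 / h) * (f (y + h *\<^sub>R v) - f y)) (\<lambda>y. dv f y v) (at_right 0)" .
  have "hol (\<lambda>x. dv f x v) (ball x r)"
  proof (rule hol_uniform_limit_hol[OF _ _ r(4)])
    show "\<forall>\<^sub>F h in at_right 0. hol (\<lambda>y. of_real (1 / h) * (f (y + h *\<^sub>R v) - f y)) (ball x r)"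
      using r(3) by eventually_elim (intro hol_difference_quotient[OF f r(2)], blast)
  qed auto
  then show "\<exists>E. x \<in> E \<and> hol (\<lambda>x. dv f x v) E"
    using r(1) by (intro exI[of _ "ball x r"]) auto
qed

text \<open>
  The derivative along \<open>v\<close> of a difference quotient along \<open>u\<close> is the difference quotient of the
  derivative; both converge, as derivatives of uniform limits are limits of derivatives.
\<close>

lemma dv_commute:
  fixes f :: "'a::complex_space \<Rightarrow> complex"
  assumes D: "open D" and f: "hol f D" and x: "x \<in> D"
  shows "dv (\<lambda>y. dv f y u) x v = dv (\<lambda>y. dv f y v) x u"
proof -
  from difference_quotient_uniform_limit[OF D f x, of u] obtain r where r: "r > 0" "ball x r \<subseteq> D"
    "\<forall>\<^sub>F h in at_right 0. \<forall>y\<in>ball x r. y + h *\<^sub>R u \<in> D"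
    "uniform_limit (ball x r) (\<lambda>h y. of_real (1 / h) * (f (y + h *\<^sub>R u) - f y)) (\<lambda>y. dv f y u) (at_right 0)" .
  have "((\<lambda>h. dv (\<lambda>y. of_real (1 / h) * (f (y + h *\<^sub>R u) - f y)) x v) \<longlongrightarrow> dv (\<lambda>y. dv f y u) x v) (at_right 0)"
  proof (rule tendsto_dv[OF _ _ r(4)])
    show "\<forall>\<^sub>F h in at_right 0. hol (\<lambda>y. of_real (1 / h) * (f (y + h *\<^sub>R u) - f y)) (ball x r)"
      using r(3) by eventually_elim (intro hol_difference_quotient[OF f r(2)], blast)
  qed (use r(1) in auto)
  moreover have "\<forall>\<^sub>F h in at_right 0. dv (\<lambda>y. of_real (1 / h) * (f (y + h *\<^sub>R u) - f y)) x v
      = of_real (1 / h) * (dv f (x + h *\<^sub>R u) v - dv f x v)"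
    using r(3)
  proof eventually_elim
    case (elim h)
    then show ?case
      using dv_eqI[OF difference_quotient_has_derivative[OF f, of x "h *\<^sub>R u" "of_real (1 / h)"]] x r(1) by simp
  qed
  ultimately have 1: "((\<lambda>h. of_real (1 / h) * (dv f (x + h *\<^sub>R u) v - dv f x v)) \<longlongrightarrow> dv (\<lambda>y. dv f y u) x v) (at_right 0)"
    using tendsto_cong by force
  from difference_quotient_uniform_limit[OF D hol_dv[OF D f, of v] x, of u] obtain r' where r': "r' > 0"
    "uniform_limit (ball x r') (\<lambda>h y. of_real (1 / h) * (dv f (y + h *\<^sub>R u) v - dv f y v)) (\<lambda>y. dv (\<lambda>y. dv f y v) y u) (at_right 0)" by blast
  have "((\<lambda>h. of_real (1 / h) * (dv f (x + h *\<^sub>R u) v - dv f x v)) \<longlongrightarrow> dv (\<lambda>y. dv f y v) x u) (at_right 0)"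
    by (rule tendsto_uniform_limitI[OF r'(2)]) (use r' in auto)
  then show ?thesis
    using tendsto_unique[OF _ 1] by simp
qed

section \<open>Fourier coefficients on a strip\<close>

definition coef :: "int \<Rightarrow> (complex \<Rightarrow> complex) \<Rightarrow> complex" where
  "coef m \<phi> = integral {0..2*pi} (\<lambda>t. \<phi> (of_real t) * exp (- \<i> * of_int m * of_real t)) / (2 * pi)"

definition strip :: "real \<Rightarrow> real \<Rightarrow> complex set" where
  "strip a b = {z. a < Im z \<and> Im z < b}"

lemma open_strip: "open (strip a b)"
  unfolding strip_def by (intro open_Collect_conj open_Collect_less continuous_intros)

lemma convex_strip: "convex (strip a b)"
proof -
  have "strip a b = {z. Im z > a} \<inter> {z. Im z < b}" by (auto simp: strip_def)
  then show ?thesis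
    using convex_halfspace_Im_gt convex_halfspace_Im_lt by (auto intro: convex_Int)
qed

text \<open>
  A primitive of a periodic function grows by a constant over each period, so the mean over a
  period is the same on every horizontal line. For the coefficients this is the source of their
  exponential decay.
\<close>

lemma periodic_mean_shift:
  assumes \<phi>: "\<phi> holomorphic_on strip a b" and per: "\<And>z. z \<in> strip a b \<Longrightarrow> \<phi> (z + 2 * pi) = \<phi> z"
    and z: "z \<in> strip a b" and ab: "a < 0" "0 < b"
  shows "integral {0..2*pi} (\<lambda>t. \<phi> (of_real t + z)) = integral {0..2*pi} (\<lambda>t. \<phi> (of_real t))"
proof -
  obtain \<Phi> where \<Phi>: "\<And>x. x \<in> strip a b \<Longrightarrow> (\<Phi> has_field_derivative \<phi> x) (at x within strip a b)"
    using holomorphic_convex_primitive'[OF convex_strip open_strip \<phi>] by blast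
  have \<Phi>': "(\<Phi> has_field_derivative \<phi> x) (at x)" if "x \<in> strip a b" for x
    using \<Phi>[OF that] unfolding at_within_open[OF that open_strip] .
  have str: "of_real t + z \<in> strip a b" "z + of_real t \<in> strip a b" if "z \<in> strip a b" for t z
    using that by (auto simp: strip_def)
  have int: "integral {0..2*pi} (\<lambda>t. \<phi> (of_real t + z)) = \<Phi> (z + 2 * pi) - \<Phi> z" if z: "z \<in> strip a b" for z
  proof -
    have "((\<lambda>t. \<phi> (of_real t + z)) has_integral \<Phi> (of_real (2 * pi) + z) - \<Phi> (of_real 0 + z)) {0..2*pi}"
    proof (rule fundamental_theorem_of_calculus)
      fix t :: real
      have "((\<lambda>t. of_real t + z) has_vector_derivative 1) (at t within {0..2*pi})"
        by (auto intro!: derivative_eq_intros)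
      then show "((\<lambda>t. \<Phi> (of_real t + z)) has_vector_derivative \<phi> (of_real t + z)) (at t within {0..2*pi})"
        using field_vector_diff_chain_within[of "\<lambda>t. of_real t + z" 1 t "{0..2*pi}" \<Phi>]
          has_field_derivative_at_within[OF \<Phi>'[OF str(1)[OF z]]]
        by (auto simp: o_def)
    qed auto
    then show ?thesis by (simp add: integral_unique add.commute)
  qed
  have "((\<lambda>x. \<Phi> (x + 2 * pi) - \<Phi> x) has_field_derivative 0) (at x within strip a b)" if x: "x \<in> strip a b" for x
  proof -
    have "((\<lambda>x. \<Phi> (x + 2 * pi)) has_field_derivative \<phi> (x + 2 * pi) * 1) (at x)"
      by (rule DERIV_chain2[OF \<Phi>']) (use str(2)[OF x, of "2 * pi"] in \<open>auto intro!: derivative_eq_intros\<close>)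
    then have "((\<lambda>x. \<Phi> (x + 2 * pi) - \<Phi> x) has_field_derivative \<phi> (x + 2 * pi) * 1 - \<phi> x) (at x)"
      by (intro DERIV_diff \<Phi>' x)
    then show ?thesis using per[OF x] by (simp add: has_field_derivative_at_within)
  qed
  from has_field_derivative_zero_constant[OF convex_strip this]
  obtain c where "\<forall>x\<in>strip a b. \<Phi> (x + 2 * pi) - \<Phi> x = c" by blast
  moreover have "0 \<in> strip a b" using ab by (simp add: strip_def)
  ultimately show ?thesis using int[OF z] int[of 0] z by auto
qed

lemma exp_of_int_periodic: "exp (- \<i> * of_int m * (z + 2 * of_real pi)) = exp (- \<i> * of_int m * z)"
proof -
  have "exp (- \<i> * of_int m * (z + 2 * of_real pi)) = exp (- \<i> * of_int m * z) * exp (2 * of_int (- m) * of_real pi * \<i>)"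
    by (simp add: algebra_simps flip: exp_add)
  then show ?thesis using exp_integer_2pi[of "of_int (- m)"] by simp
qed

lemma coef_shift:
  assumes \<phi>: "\<phi> holomorphic_on strip a b" and per: "\<And>z. z \<in> strip a b \<Longrightarrow> \<phi> (z + 2 * pi) = \<phi> z"
    and z: "z \<in> strip a b" and ab: "a < 0" "0 < b"
  shows "coef m (\<lambda>w. \<phi> (w + z)) = exp (\<i> * of_int m * z) * coef m \<phi>"
proof -
  define \<psi> where "\<psi> w = \<phi> w * exp (- \<i> * of_int m * w)" for w
  have "integral {0..2*pi} (\<lambda>t. \<psi> (of_real t + z)) = integral {0..2*pi} (\<lambda>t. \<psi> (of_real t))"
  proof (rule periodic_mean_shift[OF _ _ z ab])
    show "\<psi> holomorphic_on strip a b" unfolding \<psi>_def by (intro holomorphic_intros \<phi>)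
    show "\<psi> (z + 2 * pi) = \<psi> z" if "z \<in> strip a b" for z
      using per[OF that] exp_of_int_periodic[of m z] by (simp add: \<psi>_def)
  qed
  then have I: "integral {0..2*pi} (\<lambda>t. exp (\<i> * of_int m * z) * \<psi> (of_real t + z))
      = exp (\<i> * of_int m * z) * integral {0..2*pi} (\<lambda>t. \<psi> (of_real t))"
    by simp
  have E: "(\<lambda>t. exp (\<i> * of_int m * z) * \<psi> (of_real t + z)) = (\<lambda>t. \<phi> (of_real t + z) * exp (- \<i> * of_int m * of_real t))"
    by (simp add: fun_eq_iff \<psi>_def algebra_simps flip: exp_add)
  show ?thesis
    using I[unfolded E] by (simp only: coef_def \<psi>_def times_divide_eq_right)
qed

lemma coef_le:
  assumes \<phi>: "\<phi> holomorphic_on strip a b" and per: "\<And>z. z \<in> strip a b \<Longrightarrow> \<phi> (z + 2 * pi) = \<phi> z"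
    and z: "z \<in> strip a b" and ab: "a < 0" "0 < b"
    and B: "\<And>t::real. 0 \<le> t \<Longrightarrow> t \<le> 2 * pi \<Longrightarrow> cmod (\<phi> (of_real t + z)) \<le> B"
  shows "cmod (coef m \<phi>) \<le> B * exp (of_int m * Im z)"
proof -
  have "continuous_on {0..2*pi} (\<lambda>t. \<phi> (of_real t + z) * exp (- \<i> * of_int m * of_real t))"
    by (intro continuous_intros continuous_on_compose2[OF holomorphic_on_imp_continuous_on[OF \<phi>]])
      (use z in \<open>auto simp: strip_def\<close>)
  then have "cmod (integral {0..2*pi} (\<lambda>t. \<phi> (of_real t + z) * exp (- \<i> * of_int m * of_real t))) \<le> B * (2 * pi - 0)"
    by (rule integral_bound[rotated]) (use B in \<open>auto simp: norm_mult\<close>)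
  then have "cmod (coef m (\<lambda>w. \<phi> (w + z))) \<le> B"
    by (simp add: coef_def norm_divide divide_le_eq)
  then have "cmod (exp (\<i> * of_int m * z)) * cmod (coef m \<phi>) \<le> B"
    using coef_shift[OF assms(1-5), of m] by (simp only: norm_mult)
  then have "exp (- (of_int m * Im z)) * cmod (coef m \<phi>) \<le> B"
    by simp
  then have "exp (of_int m * Im z) * (exp (- (of_int m * Im z)) * cmod (coef m \<phi>)) \<le> exp (of_int m * Im z) * B"
    by (rule mult_left_mono) simp
  moreover have "exp (of_int m * Im z) * exp (- (of_int m * Im z)) = (1::real)"
    by (simp flip: exp_add)
  ultimately have "1 * cmod (coef m \<phi>) \<le> exp (of_int m * Im z) * B"
    by (metis mult.assoc)
  then show ?thesis by (simp only: mult_1 mult.commute)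
qed


lemma has_sum_int_geometric:
  fixes x :: real
  assumes "0 \<le> x" "x < 1"
  shows "((\<lambda>m::int. x ^ nat \<bar>m\<bar>) has_sum (1 + x) / (1 - x)) UNIV"
proof -
  have "((\<lambda>n. x ^ n) has_sum 1 / (1 - x)) UNIV"
    using assms by (intro sums_nonneg_imp_has_sum geometric_sums) auto
  then have 1: "((\<lambda>m. x ^ nat \<bar>m\<bar>) has_sum 1 / (1 - x)) (int ` UNIV)"
    by (subst has_sum_reindex) (auto simp: o_def)
  have "((\<lambda>n. x * x ^ n) has_sum x * (1 / (1 - x))) UNIV"
    using assms by (intro sums_nonneg_imp_has_sum sums_mult geometric_sums) auto
  then have 2: "((\<lambda>m. x ^ nat \<bar>m\<bar>) has_sum x * (1 / (1 - x))) ((\<lambda>n. - 1 - int n) ` UNIV)"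
    by (subst has_sum_reindex) (auto simp: o_def inj_on_def nat_add_distrib)
  have "m \<in> int ` UNIV \<union> (\<lambda>n. - 1 - int n) ` UNIV" for m :: int
  proof (cases "m \<ge> 0")
    case True
    then show ?thesis by (auto intro!: image_eqI[of _ _ "nat m"])
  next
    case False
    then show ?thesis by (auto intro!: image_eqI[of _ _ "nat (- 1 - m)"])
  qed
  then have "int ` UNIV \<union> (\<lambda>n. - 1 - int n) ` UNIV = UNIV" by blast
  moreover have "int ` UNIV \<inter> (\<lambda>n. - 1 - int n) ` UNIV = {}" by auto
  ultimately have "((\<lambda>m. x ^ nat \<bar>m\<bar>) has_sum 1 / (1 - x) + x * (1 / (1 - x))) (UNIV :: int set)"
    using has_sum_Un_disjoint[OF 1 2] by simp
  moreover have "1 / (1 - x) + x * (1 / (1 - x)) = (1 + x) / (1 - x)"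
    by (simp add: add_divide_distrib)
  ultimately show ?thesis by simp
qed

lemma exp_abs_int: "exp (- (c * \<bar>of_int m\<bar>)) = exp (- c) ^ nat \<bar>m\<bar>" for c :: real
proof -
  have "\<bar>of_int m\<bar> = real (nat \<bar>m\<bar>)" by simp
  then show ?thesis by (metis exp_of_nat_mult mult.commute mult_minus_left)
qed

lemma summable_exp_abs_int:
  fixes c :: real
  assumes "c > 0"
  shows "(\<lambda>m::int. exp (- (c * \<bar>of_int m\<bar>))) summable_on UNIV"
  unfolding exp_abs_int using has_sum_int_geometric[of "exp (- c)"] assms
  by (auto simp: summable_on_def)

lemma coef_cong_periodic:
  "(\<And>t. \<phi> (of_real t) = \<psi> (of_real t)) \<Longrightarrow> coef m \<phi> = coef m \<psi>"
  by (simp add: coef_def)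

text \<open>
  Move the line of integration towards the boundary of the strip, upwards or downwards according to
  the sign of \<open>m\<close>.
\<close>

lemma coef_decay:
  assumes \<phi>: "\<phi> holomorphic_on strip a b" and per: "\<And>z. z \<in> strip a b \<Longrightarrow> \<phi> (z + 2 * pi) = \<phi> z"
    and \<eta>: "0 \<le> \<eta>" "a < - \<eta>" "\<eta> < b"
  obtains B where "\<And>m. cmod (coef m \<phi>) \<le> B * exp (- (\<eta> * \<bar>of_int m\<bar>))"
proof -
  have ex: "\<exists>B. \<forall>t\<in>{0..2*pi}. cmod (\<phi> (of_real t + z)) \<le> B" if "z \<in> strip a b" for z
  proof -
    have "continuous_on {0..2*pi} (\<lambda>t. \<phi> (of_real t + z))"
      by (intro continuous_intros continuous_on_compose2[OF holomorphic_on_imp_continuous_on[OF \<phi>]])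
        (use that in \<open>auto simp: strip_def\<close>)
    then have "bounded ((\<lambda>t. \<phi> (of_real t + z)) ` {0..2*pi})"
      by (intro compact_imp_bounded compact_continuous_image) auto
    then show ?thesis by (auto simp: bounded_iff)
  qed
  have s: "\<i> * \<eta> \<in> strip a b" "- \<i> * \<eta> \<in> strip a b" using \<eta> by (auto simp: strip_def)
  obtain B1 where B1: "\<forall>t\<in>{0..2*pi}. cmod (\<phi> (of_real t + \<i> * \<eta>)) \<le> B1" using ex[OF s(1)] by blast
  obtain B2 where B2: "\<forall>t\<in>{0..2*pi}. cmod (\<phi> (of_real t + - \<i> * \<eta>)) \<le> B2" using ex[OF s(2)] by blast
  have B0: "0 \<le> B1" "0 \<le> B2"
    using order_trans[OF norm_ge_zero bspec[OF B1, of 0]] order_trans[OF norm_ge_zero bspec[OF B2, of 0]] by auto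
  have "cmod (coef m \<phi>) \<le> max B1 B2 * exp (- (\<eta> * \<bar>of_int m\<bar>))" for m
  proof (cases "m \<ge> 0")
    case True
    have "cmod (coef m \<phi>) \<le> B2 * exp (of_int m * Im (- \<i> * \<eta>))"
      by (rule coef_le[OF \<phi> per s(2)]) (use \<eta> B2 in auto)
    also have "\<dots> \<le> max B1 B2 * exp (- (\<eta> * \<bar>of_int m\<bar>))"
      using True by (intro mult_mono) (use B0 in \<open>auto simp: mult.commute\<close>)
    finally show ?thesis .
  next
    case False
    have "cmod (coef m \<phi>) \<le> B1 * exp (of_int m * Im (\<i> * \<eta>))"
      by (rule coef_le[OF \<phi> per s(1)]) (use \<eta> B1 in auto)
    also have "\<dots> \<le> max B1 B2 * exp (- (\<eta> * \<bar>of_int m\<bar>))"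
      using False by (intro mult_mono) (use B0 in \<open>auto simp: mult.commute\<close>)
    finally show ?thesis .
  qed
  then show ?thesis by (rule that)
qed

text \<open>
  With \<open>\<phi> z - \<phi> 0 = (exp (\<i> z) - 1) g z\<close>, where \<open>g\<close> is again holomorphic and periodic, the
  coefficients of \<open>\<phi>\<close> other than the constant \<open>\<phi> 0\<close> are differences of consecutive coefficients of
  \<open>g\<close>, so the Fourier series at \<open>0\<close> telescopes.
\<close>

lemma Fourier_series_at_0:
  assumes \<phi>: "\<phi> holomorphic_on strip a b" and per: "\<And>z. z \<in> strip a b \<Longrightarrow> \<phi> (z + 2 * pi) = \<phi> z"
    and ab: "a < 0" "0 < b"
  shows "((\<lambda>m. coef m \<phi>) has_sum \<phi> 0) UNIV"
proof -
  define g where "g z = (if exp (\<i> * z) = 1 then deriv \<phi> 0 / \<i> else (\<phi> z - \<phi> 0) / (exp (\<i> * z) - 1))" for z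
  have exp_per: "exp (\<i> * (z + of_real (2 * pi))) = exp (\<i> * z)" for z
    using exp_of_int_periodic[of "- 1" z] by simp
  have g_per: "g (z + 2 * pi) = g z" if "z \<in> strip a b" for z
    unfolding g_def exp_per per[OF that] ..
  have strip_real: "z + of_real t \<in> strip a b \<longleftrightarrow> z \<in> strip a b" "z - of_real t \<in> strip a b \<longleftrightarrow> z \<in> strip a b" for z t
    by (auto simp: strip_def)
  have per_int: "\<psi> (z + of_real (2 * pi * of_int l)) = \<psi> z"
    if "z \<in> strip a b" "\<And>z. z \<in> strip a b \<Longrightarrow> \<psi> (z + 2 * pi) = \<psi> z" for z l and \<psi> :: "complex \<Rightarrow> complex"
  proof (induction l rule: int_induct[where k=0])
    case base show ?case by simp
  next
    case (step1 i)
    have "\<psi> (z + of_real (2 * pi * of_int (i + 1))) = \<psi> ((z + of_real (2 * pi * of_int i)) + 2 * pi)"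
      by (simp add: algebra_simps)
    then show ?case using step1 that by (simp only: that(2) strip_real)
  next
    case (step2 i)
    have "\<psi> (z + of_real (2 * pi * of_int i)) = \<psi> ((z + of_real (2 * pi * of_int (i - 1))) + 2 * pi)"
      by (simp add: algebra_simps)
    then show ?case using step2 that by (simp only: that(2) strip_real)
  qed
  have s0: "0 \<in> strip a b" using ab by (simp add: strip_def)
  have g0: "g field_differentiable at 0"
  proof -
    define A where "A z = (if z = 0 then deriv \<phi> 0 else (\<phi> z - \<phi> 0) / (z - 0))" for z
    define E where "E z = (if z = 0 then deriv (\<lambda>z. exp (\<i> * z)) 0 else (exp (\<i> * z) - exp (\<i> * 0)) / (z - 0))" for z :: complex
    have A: "A holomorphic_on strip a b" unfolding A_def by (rule pole_lemma_open[OF \<phi> open_strip])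
    have E: "E holomorphic_on UNIV" unfolding E_def by (rule pole_lemma_open) (auto intro!: holomorphic_intros)
    have dexp: "deriv (\<lambda>z. exp (\<i> * z)) 0 = \<i>"
      by (rule DERIV_imp_deriv) (auto intro!: derivative_eq_intros)
    have ne: "exp (\<i> * z) \<noteq> 1" if "cmod z < 1" "z \<noteq> 0" for z
    proof
      assume "exp (\<i> * z) = 1"
      then have "Re (\<i> * z) = 0 \<and> (\<exists>n::int. Im (\<i> * z) = of_int (2 * n) * pi)"
        by (simp add: exp_eq_1)
      then obtain n :: int where n: "Im z = 0" "Re z = of_int (2 * n) * pi" by auto
      have "\<bar>Re z\<bar> < 1" using that abs_Re_le_cmod[of z] by linarith
      then have small: "\<bar>of_int (2 * n)\<bar> * pi < 1" using n by (simp add: abs_mult)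
      have "n = 0"
      proof (rule ccontr)
        assume "n \<noteq> 0"
        then have "\<bar>real_of_int (2 * n)\<bar> * pi \<ge> 1 * pi"
          by (intro mult_right_mono) auto
        then show False using small pi_gt3 by linarith
      qed
      then show False using n that by (simp add: complex_eq_iff)
    qed
    have "(\<lambda>z. A z / E z) holomorphic_on (strip a b \<inter> ball 0 1)"
      by (intro holomorphic_intros holomorphic_on_subset[OF A] holomorphic_on_subset[OF E])
        (auto simp: E_def dexp ne)
    moreover have "A z / E z = g z" if "z \<in> strip a b \<inter> ball 0 1" for z
    proof (cases "z = 0")
      case True
      moreover have "E 0 = \<i>" by (simp add: E_def) (use dexp in \<open>simp add: mult.commute\<close>)
      ultimately show ?thesis by (simp add: A_def g_def field_simps)
    qed (use that ne[of z] in \<open>auto simp: A_def E_def g_def field_simps\<close>)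
    ultimately have "g holomorphic_on (strip a b \<inter> ball 0 1)"
      using holomorphic_transform by blast
    then show ?thesis
      using s0 by (auto simp: open_strip open_Int holomorphic_on_open field_differentiable_def)
  qed
  have g: "g holomorphic_on strip a b"
  proof -
    have "g field_differentiable at z" if z: "z \<in> strip a b" for z
    proof (cases "exp (\<i> * z) = 1")
      case True
      then have "Re (\<i> * z) = 0 \<and> (\<exists>n::int. Im (\<i> * z) = of_int (2 * n) * pi)"
        by (simp add: exp_eq_1)
      then obtain n :: int where n: "Im z = 0" "Re z = of_int (2 * n) * pi" by auto
      then have zn: "z = of_real (2 * pi * of_int n)" by (simp add: complex_eq_iff)
      have "g \<circ> (\<lambda>w. w - z) field_differentiable at z"
        using g0 by (intro field_differentiable_compose) (auto intro!: derivative_intros)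
      then obtain g' where g': "(g \<circ> (\<lambda>w. w - z) has_field_derivative g') (at z)"
        by (auto simp: field_differentiable_def)
      have "(g has_field_derivative g') (at z)"
      proof (rule DERIV_cong_ev[THEN iffD1, OF refl _ refl g'])
        have "(g \<circ> (\<lambda>w. w - z)) w = g w" if "w \<in> strip a b" for w
        proof -
          have "w - z \<in> strip a b" unfolding zn by (rule strip_real(2)[THEN iffD2, OF that])
          from per_int[where \<psi>=g, OF this g_per, of n] have "g (w - z + z) = g (w - z)" unfolding zn[symmetric] by blast
          then show ?thesis by simp
        qed
        then show "\<forall>\<^sub>F x in nhds z. (g \<circ> (\<lambda>w. w - z)) x = g x"
          using eventually_nhds_in_open[OF open_strip z] by (auto elim: eventually_mono)
      qed
      then show ?thesis by (auto simp: field_differentiable_def)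
    next
      case False
      define S where "S = strip a b \<inter> - {z. exp (\<i> * z) = 1}"
      have oS: "open S"
        unfolding S_def by (intro open_Int open_strip open_Compl closed_Collect_eq continuous_intros)
      have "(\<lambda>z. (\<phi> z - \<phi> 0) / (exp (\<i> * z) - 1)) holomorphic_on S"
        by (intro holomorphic_intros holomorphic_on_subset[OF \<phi>]) (auto simp: S_def)
      then have "g holomorphic_on S"
        by (rule holomorphic_transform) (auto simp: S_def g_def)
      then show ?thesis
        using False z oS by (auto simp: S_def holomorphic_on_open field_differentiable_def)
    qed
    then show ?thesis by (simp add: holomorphic_on_def field_differentiable_at_within)
  qed
  have cont: "continuous_on {0..2*pi} (\<lambda>t. \<psi> (of_real t) * exp (- \<i> * of_int m * of_real t))"
    if "\<psi> holomorphic_on strip a b" for \<psi> m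
    by (intro continuous_intros continuous_on_compose2[OF holomorphic_on_imp_continuous_on[OF that]])
      (use ab in \<open>auto simp: strip_def\<close>)
  have int: "(\<lambda>t. \<psi> (of_real t) * exp (- \<i> * of_int m * of_real t)) integrable_on {0..2*pi}"
    if "\<psi> holomorphic_on strip a b" for \<psi> m
    using integrable_continuous_interval[OF cont[OF that]] .
  have coef_const: "coef m (\<lambda>_. c) = (if m = 0 then c else 0)" for m c
  proof (cases "m = 0")
    case False
    have "coef m (\<lambda>_. c) = exp (\<i> * of_int m * \<i>) * coef m (\<lambda>_. c)"
      using coef_shift[of "\<lambda>_. c" "- 2" 2 \<i> m] by (simp add: strip_def)
    moreover have "exp (\<i> * of_int m * \<i>) \<noteq> 1"
      using False by (auto simp: exp_eq_1)
    ultimately have "(exp (\<i> * of_int m * \<i>) - 1) * coef m (\<lambda>_. c) = 0" by (simp add: algebra_simps)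
    with \<open>exp (\<i> * of_int m * \<i>) \<noteq> 1\<close> show ?thesis using False by simp
  qed (simp add: coef_def scaleR_conv_of_real)
  have tele: "coef m \<phi> = (if m = 0 then \<phi> 0 else 0) + coef (m - 1) g - coef m g" for m
  proof -
    have eq: "\<phi> z = \<phi> 0 + exp (\<i> * z) * g z - g z" if z: "z \<in> strip a b" for z
    proof (cases "exp (\<i> * z) = 1")
      case True
      then have "Re (\<i> * z) = 0 \<and> (\<exists>n::int. Im (\<i> * z) = of_int (2 * n) * pi)"
        by (simp add: exp_eq_1)
      then obtain n :: int where n: "Im z = 0" "Re z = of_int (2 * n) * pi" by auto
      then have zn: "z = 0 + of_real (2 * pi * of_int n)" by (simp add: complex_eq_iff)
      have "\<phi> z = \<phi> 0"
        using per_int[where \<psi>=\<phi>, OF s0 per, of n] zn by simp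
      then show ?thesis using True by simp
    next
      case False
      then have "g z * (exp (\<i> * z) - 1) = \<phi> z - \<phi> 0" by (simp add: g_def)
      then show ?thesis by (simp add: algebra_simps)
    qed
    have "coef m \<phi> = coef m (\<lambda>z. \<phi> 0 + exp (\<i> * z) * g z - g z)"
      by (rule coef_cong_periodic, rule eq) (use ab in \<open>simp add: strip_def\<close>)
    also have "\<dots> = coef m (\<lambda>_. \<phi> 0) + coef m (\<lambda>z. exp (\<i> * z) * g z) - coef m g"
    proof -
      have i1: "(\<lambda>t. \<phi> 0 * exp (- \<i> * of_int m * of_real t)) integrable_on {0..2*pi}"
        using int[of "\<lambda>_. \<phi> 0"] by (simp add: holomorphic_on_const)
      have i2: "(\<lambda>t. exp (\<i> * of_real t) * g (of_real t) * exp (- \<i> * of_int m * of_real t)) integrable_on {0..2*pi}"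
        by (rule int[of "\<lambda>z. exp (\<i> * z) * g z"]) (intro holomorphic_intros g)
      show ?thesis
        unfolding coef_def ring_distribs
        by (subst integral_diff integral_add; (intro integrable_add i1 i2 int[OF g])?)+
          (simp add: add_divide_distrib diff_divide_distrib)
    qed
    also have "coef m (\<lambda>z. exp (\<i> * z) * g z) = coef (m - 1) g"
      by (simp add: coef_def algebra_simps flip: exp_add)
    finally show ?thesis by (simp add: coef_const)
  qed
  define \<eta> where "\<eta> = min (- a) b / 2"
  have \<eta>: "0 < \<eta>" "0 \<le> \<eta>" "a < - \<eta>" "\<eta> < b" using ab by (auto simp: \<eta>_def min_def)
  obtain B where B: "\<And>m. cmod (coef m \<phi>) \<le> B * exp (- (\<eta> * \<bar>of_int m\<bar>))"
    using coef_decay[OF \<phi> per \<eta>(2-)] by blast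
  obtain C where C: "\<And>m. cmod (coef m g) \<le> C * exp (- (\<eta> * \<bar>of_int m\<bar>))"
    using coef_decay[OF g g_per \<eta>(2-)] by blast
  have "(\<lambda>m::int. B * exp (- (\<eta> * \<bar>of_int m\<bar>))) summable_on UNIV"
    by (rule summable_on_cmult_right[OF summable_exp_abs_int[OF \<eta>(1)]])
  then have "(\<lambda>m. cmod (coef m \<phi>)) summable_on UNIV"
    by (rule Infinite_Sum.abs_summable_on_comparison_test') (rule B)
  then have "(\<lambda>m. coef m \<phi>) summable_on UNIV"
    by (rule abs_summable_summable)
  then obtain S where S: "((\<lambda>m. coef m \<phi>) has_sum S) UNIV" by (auto simp: summable_on_def)
  have sub: "filterlim (\<lambda>N. {- int N..int N}) (finite_subsets_at_top UNIV) sequentially"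
    unfolding filterlim_finite_subsets_at_top
  proof (intro allI impI)
    fix X :: "int set" assume "finite X \<and> X \<subseteq> UNIV"
    then have "finite X" by simp
    then have "X \<subseteq> {- int N..int N}" if "N \<ge> (\<Sum>x\<in>X. nat \<bar>x\<bar>)" for N
    proof -
      have "nat \<bar>x\<bar> \<le> N" if "x \<in> X" for x
        using member_le_sum[OF that, of "\<lambda>x. nat \<bar>x\<bar>"] \<open>finite X\<close> \<open>N \<ge> _\<close> by simp
      then show ?thesis by force
    qed
    then show "\<forall>\<^sub>F N in sequentially. finite {- int N..int N} \<and> X \<subseteq> {- int N..int N} \<and> {- int N..int N} \<subseteq> UNIV"
      by (auto simp: eventually_sequentially)
  qed
  have lim1: "(\<lambda>N. \<Sum>m\<in>{- int N..int N}. coef m \<phi>) \<longlonglongrightarrow> S"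
    using filterlim_compose[OF _ sub] S unfolding has_sum_def by blast
  have part: "(\<Sum>m\<in>{- int N..int N}. coef m \<phi>) = \<phi> 0 + coef (- int N - 1) g - coef (int N) g" for N
  proof (induction N)
    case (Suc N)
    have "{- int (Suc N)..int (Suc N)} = insert (- int (Suc N)) (insert (int (Suc N)) {- int N..int N})" by auto
    then have "(\<Sum>m\<in>{- int (Suc N)..int (Suc N)}. coef m \<phi>) = coef (- int (Suc N)) \<phi> + (coef (int (Suc N)) \<phi> + (\<Sum>m\<in>{- int N..int N}. coef m \<phi>))"
      by (simp only:) (subst sum.insert; auto)+
    moreover have "coef (- int (Suc N)) \<phi> = coef (- int (Suc N) - 1) g - coef (- int N - 1) g"
    proof -
      have "- int (Suc N) = - int N - 1" by simp
      then show ?thesis using tele[of "- int (Suc N)"] by (simp only: if_False) (simp split: if_splits)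
    qed
    moreover have "coef (int (Suc N)) \<phi> = coef (int N) g - coef (int (Suc N)) g"
      using tele[of "int (Suc N)"] by simp
    ultimately show ?case
      unfolding Suc.IH by algebra
  qed (simp add: tele[of 0])
  have expN: "(\<lambda>N. exp (- (\<eta> * real N))) \<longlonglongrightarrow> 0"
  proof -
    have "(\<lambda>N. exp (- \<eta>) ^ N) \<longlonglongrightarrow> 0" using \<eta> by (intro LIMSEQ_realpow_zero) auto
    then show ?thesis by (simp add: mult.commute flip: exp_of_nat_mult)
  qed
  have z1: "(\<lambda>N. coef (int N) g) \<longlonglongrightarrow> 0"
    by (rule Lim_null_comparison[OF always_eventually[OF allI], of _ "\<lambda>N. C * exp (- (\<eta> * real N))"])
      (use C[of "int _"] tendsto_mult_right_zero[OF expN] in auto)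
  have z2: "(\<lambda>N. coef (- int N - 1) g) \<longlonglongrightarrow> 0"
  proof (rule Lim_null_comparison[OF always_eventually[OF allI], of _ "\<lambda>N. C * exp (- (\<eta> * real (Suc N)))"])
    show "cmod (coef (- int N - 1) g) \<le> C * exp (- (\<eta> * real (Suc N)))" for N
      using C[of "- int N - 1"] by (simp add: algebra_simps)
    show "(\<lambda>N. C * exp (- (\<eta> * real (Suc N)))) \<longlonglongrightarrow> 0"
      using tendsto_mult_right_zero[OF LIMSEQ_Suc[OF expN]] .
  qed
  have "(\<lambda>N. \<Sum>m\<in>{- int N..int N}. coef m \<phi>) \<longlonglongrightarrow> \<phi> 0 + 0 - 0"
    unfolding part by (intro tendsto_intros z1 z2)
  then have "S = \<phi> 0" using LIMSEQ_unique[OF lim1] by simp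
  then show ?thesis using S by simp
qed

section \<open>Sums over multi-indices\<close>

lemma has_sum_PiE_insert:
  assumes j: "j \<notin> J"
    and sum: "((\<lambda>(m, k). h (k(j := m))) has_sum S) (UNIV \<times> PiE J (\<lambda>_. UNIV))"
  shows "(h has_sum S) (PiE (insert j J) (\<lambda>_. UNIV))"
proof -
  have "((\<lambda>(m, k). h (k(j := m))) has_sum S) (UNIV \<times> PiE J (\<lambda>_. UNIV)) \<longleftrightarrow> (h has_sum S) (PiE (insert j J) (\<lambda>_. UNIV))"
    by (rule has_sum_reindex_bij_witness[of _ "\<lambda>k. (k j, k(j := undefined))" "\<lambda>(m, k). k(j := m)"])
      (use j in \<open>auto simp: PiE_def extensional_def fun_eq_iff\<close>)
  then show ?thesis using sum by simp
qed

lemma has_sum_PiE_insert':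
  assumes j: "j \<notin> J"
    and sum: "((\<lambda>(k, m). h (k(j := m))) has_sum S) (PiE J (\<lambda>_. UNIV) \<times> UNIV)"
  shows "(h has_sum S) (PiE (insert j J) (\<lambda>_. UNIV))"
proof -
  have "((\<lambda>(k, m). h (k(j := m))) has_sum S) (PiE J (\<lambda>_. UNIV) \<times> UNIV) \<longleftrightarrow> (h has_sum S) (PiE (insert j J) (\<lambda>_. UNIV))"
    by (rule has_sum_reindex_bij_witness[of _ "\<lambda>k. (k(j := undefined), k j)" "\<lambda>(k, m). k(j := m)"])
      (use j in \<open>auto simp: PiE_def extensional_def fun_eq_iff\<close>)
  then show ?thesis using sum by simp
qed

lemma has_sum_prod_PiE:
  fixes q :: "'i \<Rightarrow> 'k \<Rightarrow> real"
  assumes "finite J" "\<And>j. j \<in> J \<Longrightarrow> (q j has_sum s j) UNIV" "\<And>j m. j \<in> J \<Longrightarrow> q j m \<ge> 0"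
  shows "((\<lambda>k. \<Prod>j\<in>J. q j (k j)) has_sum (\<Prod>j\<in>J. s j)) (PiE J (\<lambda>_. UNIV))"
  using assms
proof (induction J rule: finite_induct)
  case empty
  then show ?case by (simp add: has_sum_finiteI)
next
  case (insert j J)
  show ?case
  proof (rule has_sum_PiE_insert'[OF insert.hyps(2)])
    have eq: "(\<Prod>i\<in>insert j J. q i ((k(j := m)) i)) = (\<Prod>i\<in>J. q i (k i)) * q j m" for k m
      using insert.hyps by (simp add: mult.commute) (intro disjI2 prod.cong, auto)
    have 1: "((\<lambda>m. (\<Prod>i\<in>J. q i (k i)) * q j m) has_sum (\<Prod>i\<in>J. q i (k i)) * s j) UNIV" for k
      by (intro has_sum_cmult_right insert.prems) auto
    have 2: "((\<lambda>k. (\<Prod>i\<in>J. q i (k i)) * s j) has_sum (\<Prod>i\<in>J. s i) * s j) (PiE J (\<lambda>_. UNIV))"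
      by (intro has_sum_cmult_left insert.IH insert.prems) auto
    have "((\<lambda>(k, m). (\<Prod>i\<in>J. q i (k i)) * q j m) has_sum (\<Prod>i\<in>J. s i) * s j) (PiE J (\<lambda>_. UNIV) \<times> UNIV)"
      by (rule has_sum_SigmaI[OF _ 2 summable_on_SigmaI])
        (use 1 2 insert.prems in \<open>auto intro!: mult_nonneg_nonneg prod_nonneg simp: summable_on_def\<close>)
    then show "((\<lambda>(k, m). \<Prod>i\<in>insert j J. q i ((k(j := m)) i)) has_sum (\<Prod>i\<in>insert j J. s i)) (PiE J (\<lambda>_. UNIV) \<times> UNIV)"
      unfolding eq using insert.hyps by (simp add: mult.commute)
  qed
qed

section \<open>Functions on a complex neighbourhood of the torus\<close>

abbreviation e\<^sub>C :: "'n::finite \<Rightarrow> complex^'n" where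
  "e\<^sub>C j \<equiv> axis j 1"

lemma axis_add_nth: "(\<theta> + w *\<^sub>C e\<^sub>C j) $ i = \<theta> $ i + (if i = j then w else 0)"
  by (simp add: axis_def)

lemma cvec_sum_axis: "cvec x = (\<Sum>j\<in>UNIV. of_real (x $ j) *\<^sub>C e\<^sub>C j)"
  by (simp add: vec_eq_iff cvec_def axis_def sum_component if_distrib of_real_def[symmetric] cong: if_cong)

lemma vec_sum_axis: "x = (\<Sum>j\<in>UNIV. x $ j *\<^sub>C e\<^sub>C j)"
  by (simp add: vec_eq_iff axis_def sum_component if_distrib cong: if_cong)

lemma cvec_nth [simp]: "cvec x $ j = of_real (x $ j)"
  by (simp add: cvec_def)

lemma lattice_vec_nth [simp]: "lattice_vec k $ j = 2 * pi * of_int (k $ j)"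
  by (simp add: lattice_vec_def)

lemma complex_angles_iff: "\<theta> \<in> complex_angles \<sigma> \<longleftrightarrow> (\<forall>j. \<bar>Im (\<theta> $ j)\<bar> < \<sigma>)"
  by (simp add: complex_angles_def)

lemma open_complex_angles: "open (complex_angles \<sigma> :: (complex^'n::finite) set)"
proof -
  have "complex_angles \<sigma> = (\<Inter>j\<in>UNIV. {q :: complex^'n. \<bar>Im (q $ j)\<bar> < \<sigma>})"
    by (auto simp: complex_angles_def)
  moreover have "open {q :: complex^'n. \<bar>Im (q $ j)\<bar> < \<sigma>}" for j
    by (intro open_Collect_less continuous_intros)
  ultimately show ?thesis by (auto intro: open_INT)
qed

lemma convex_complex_angles: "convex (complex_angles \<sigma> :: (complex^'n::finite) set)"
proof (rule convexI)
  fix x y :: "complex^'n" and u v :: real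
  assume a: "x \<in> complex_angles \<sigma>" "y \<in> complex_angles \<sigma>" "0 \<le> u" "0 \<le> v" "u + v = 1"
  have "\<bar>u * Im (x $ j) + v * Im (y $ j)\<bar> < \<sigma>" for j
  proof -
    have "\<bar>u * Im (x $ j) + v * Im (y $ j)\<bar> \<le> u * \<bar>Im (x $ j)\<bar> + v * \<bar>Im (y $ j)\<bar>"
      using a abs_triangle_ineq[of "u * Im (x $ j)" "v * Im (y $ j)"] by (simp add: abs_mult)
    also have "\<dots> < \<sigma>"
      by (rule convex_bound_lt) (use a in \<open>auto simp: complex_angles_def\<close>)
    finally show ?thesis .
  qed
  then show "u *\<^sub>R x + v *\<^sub>R y \<in> complex_angles \<sigma>"
    by (simp add: complex_angles_def)
qed

lemma complex_angles_mono: "\<sigma>' \<le> \<sigma> \<Longrightarrow> complex_angles \<sigma>' \<subseteq> complex_angles \<sigma>"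
  unfolding complex_angles_def using less_le_trans by blast

lemma complex_angles_shift [simp]: "\<theta> + cvec x \<in> complex_angles \<sigma> \<longleftrightarrow> \<theta> \<in> complex_angles \<sigma>"
  by (simp add: complex_angles_def)

lemma cvec_in_complex_angles [simp]: "\<sigma> > 0 \<Longrightarrow> cvec x \<in> complex_angles \<sigma>"
  by (simp add: complex_angles_def)

lemma complex_angles_add:
  "\<theta> \<in> complex_angles \<sigma> \<Longrightarrow> (\<And>j. cmod (w $ j) \<le> \<delta>) \<Longrightarrow> \<theta> + w \<in> complex_angles (\<sigma> + \<delta>)"
  unfolding complex_angles_iff vector_add_component plus_complex.sel
  by (meson abs_Im_le_cmod abs_triangle_ineq add_less_le_mono le_less_trans order_trans)

lemma complex_angles_real_shift:
  "\<theta> + of_real t *\<^sub>C e\<^sub>C j \<in> complex_angles \<sigma> \<longleftrightarrow> \<theta> \<in> complex_angles \<sigma>"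
proof -
  have "of_real t *\<^sub>C e\<^sub>C j = cvec (t *\<^sub>R axis j 1)"
    by (simp add: vec_eq_iff axis_def of_real_def[symmetric])
  then show ?thesis by (simp only: complex_angles_shift)
qed

definition ang_periodic :: "real \<Rightarrow> (complex^'n \<Rightarrow> 'b) \<Rightarrow> bool" where
  "ang_periodic \<sigma> f \<longleftrightarrow> (\<forall>\<theta>\<in>complex_angles \<sigma>. \<forall>k. f (\<theta> + cvec (lattice_vec k)) = f \<theta>)"

lemma slice:
  fixes f :: "complex^'n::finite \<Rightarrow> complex" and j :: 'n
  assumes f: "hol f (complex_angles \<sigma>)" "ang_periodic \<sigma> f" and \<theta>: "\<theta> \<in> complex_angles \<sigma>"
  defines "a \<equiv> - \<sigma> - Im (\<theta> $ j)" and "b \<equiv> \<sigma> - Im (\<theta> $ j)"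
  shows slice_in: "z \<in> strip a b \<longleftrightarrow> \<theta> + z *\<^sub>C e\<^sub>C j \<in> complex_angles \<sigma>"
    and slice_holomorphic: "(\<lambda>w. f (\<theta> + w *\<^sub>C e\<^sub>C j)) holomorphic_on strip a b"
    and slice_periodic: "z \<in> strip a b \<Longrightarrow> f (\<theta> + (z + 2 * pi) *\<^sub>C e\<^sub>C j) = f (\<theta> + z *\<^sub>C e\<^sub>C j)"
    and slice_neg: "a < 0" and slice_pos: "b > 0"
proof -
  show *: "z \<in> strip a b \<longleftrightarrow> \<theta> + z *\<^sub>C e\<^sub>C j \<in> complex_angles \<sigma>" for z
  proof -
    have "(\<theta> + z *\<^sub>C e\<^sub>C j \<in> complex_angles \<sigma>) = (\<bar>Im (\<theta> $ j) + Im z\<bar> < \<sigma>)"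
    proof
      assume "\<theta> + z *\<^sub>C e\<^sub>C j \<in> complex_angles \<sigma>"
      then have "\<bar>Im ((\<theta> + z *\<^sub>C e\<^sub>C j) $ j)\<bar> < \<sigma>" unfolding complex_angles_iff ..
      then show "\<bar>Im (\<theta> $ j) + Im z\<bar> < \<sigma>" unfolding axis_add_nth by simp
    next
      assume "\<bar>Im (\<theta> $ j) + Im z\<bar> < \<sigma>"
      then show "\<theta> + z *\<^sub>C e\<^sub>C j \<in> complex_angles \<sigma>"
        using \<theta> unfolding complex_angles_iff axis_add_nth by auto
    qed
    then show ?thesis by (auto simp: strip_def a_def b_def abs_less_iff)
  qed
  show "(\<lambda>w. f (\<theta> + w *\<^sub>C e\<^sub>C j)) holomorphic_on strip a b"
    by (rule hol_line(1)[OF f(1)]) (simp add: * )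
  show "f (\<theta> + (z + 2 * pi) *\<^sub>C e\<^sub>C j) = f (\<theta> + z *\<^sub>C e\<^sub>C j)" if "z \<in> strip a b"
  proof -
    have eq: "\<theta> + (z + 2 * pi) *\<^sub>C e\<^sub>C j = \<theta> + z *\<^sub>C e\<^sub>C j + cvec (lattice_vec (axis j 1))"
      by (simp add: vec_eq_iff axis_def cscale_add_left)
    show ?thesis using f(2) that unfolding ang_periodic_def * eq by blast
  qed
  show "a < 0" "b > 0" using \<theta> by (auto simp: a_def b_def complex_angles_iff abs_less_iff minus_less_iff)
qed

section \<open>Multiple Fourier series\<close>

definition proj :: "'n::finite \<Rightarrow> int \<Rightarrow> (complex^'n \<Rightarrow> complex) \<Rightarrow> complex^'n \<Rightarrow> complex" where
  "proj j m f \<theta> = coef m (\<lambda>w. f (\<theta> + w *\<^sub>C e\<^sub>C j))"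

lemma proj_shift:
  fixes f :: "complex^'n::finite \<Rightarrow> complex"
  assumes f: "hol f (complex_angles \<sigma>)" "ang_periodic \<sigma> f" and \<theta>: "\<theta> \<in> complex_angles \<sigma>" "\<theta> + w *\<^sub>C e\<^sub>C j \<in> complex_angles \<sigma>"
  shows "proj j m f (\<theta> + w *\<^sub>C e\<^sub>C j) = exp (\<i> * of_int m * w) * proj j m f \<theta>"
  using coef_shift[OF slice_holomorphic[OF f \<theta>(1)] slice_periodic[OF f \<theta>(1)] slice_in[OF f \<theta>(1), THEN iffD2, OF \<theta>(2)]
      slice_neg[OF f \<theta>(1)] slice_pos[OF f \<theta>(1)], of m]
  by (simp add: proj_def cscale_add_left add_ac)

lemma proj_bound:
  fixes f :: "complex^'n::finite \<Rightarrow> complex"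
  assumes f: "hol f (complex_angles \<sigma>)" "ang_periodic \<sigma> f" and \<theta>: "\<theta> \<in> complex_angles \<sigma>"
    and \<eta>: "0 < \<eta>" "\<eta> < \<sigma>"
    and M: "\<And>w. \<theta> + w *\<^sub>C e\<^sub>C j \<in> complex_angles \<sigma> \<Longrightarrow> cmod (f (\<theta> + w *\<^sub>C e\<^sub>C j)) \<le> M"
  shows "cmod (proj j m f \<theta>) \<le> M * exp (- ((\<eta> - \<bar>Im (\<theta> $ j)\<bar>) * \<bar>of_int m\<bar>))"
proof -
  define y where "y = Im (\<theta> $ j)"
  define z where "z = Complex 0 (if m \<ge> 0 then - y - \<eta> else - y + \<eta>)"
  have z: "z \<in> strip (- \<sigma> - Im (\<theta> $ j)) (\<sigma> - Im (\<theta> $ j))"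
    using \<eta> by (auto simp: strip_def z_def y_def)
  have zt: "\<theta> + (of_real t + z) *\<^sub>C e\<^sub>C j \<in> complex_angles \<sigma>" for t
    by (rule slice_in[OF f \<theta>, THEN iffD1]) (use z in \<open>simp add: strip_def\<close>)
  have M0: "M \<ge> 0"
    using M[of 0] \<theta> by (auto intro: order_trans[OF norm_ge_zero])
  have "cmod (proj j m f \<theta>) \<le> M * exp (of_int m * Im z)"
    unfolding proj_def
    by (rule coef_le[OF slice_holomorphic[OF f \<theta>] slice_periodic[OF f \<theta>] z slice_neg[OF f \<theta>] slice_pos[OF f \<theta>]])
      (use M zt in auto)
  also have "of_int m * Im z \<le> - ((\<eta> - \<bar>y\<bar>) * \<bar>of_int m\<bar>)"
  proof -
    have "- (of_int m * y) \<le> \<bar>of_int m\<bar> * \<bar>y\<bar>"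
      by (metis abs_ge_minus_self abs_mult)
    then show ?thesis by (auto simp: z_def algebra_simps)
  qed
  finally show ?thesis using M0 by (simp add: y_def mult_left_mono)
qed

lemma proj_hol:
  fixes f :: "complex^'n::finite \<Rightarrow> complex"
  assumes f: "hol f (complex_angles \<sigma>)" and \<sigma>: "\<sigma> > 0"
  shows "hol (proj j m f) (complex_angles \<sigma>)"
proof -
  let ?A = "complex_angles \<sigma> :: (complex^'n) set"
  have in_A: "\<theta> + of_real t *\<^sub>C e\<^sub>C j \<in> ?A" if "\<theta> \<in> ?A" for \<theta> and t :: real
    using that by (simp only: complex_angles_real_shift)
  have cont: "continuous_on (?A \<times> cbox 0 (2 * pi)) (\<lambda>(\<theta>, t). F (\<theta> + of_real t *\<^sub>C e\<^sub>C j) * exp (- \<i> * of_int m * of_real t))"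
    if "hol F ?A" for F :: "complex^'n \<Rightarrow> complex"
  proof -
    have "continuous_on (?A \<times> cbox 0 (2 * pi)) (\<lambda>x. fst x + of_real (snd x) *\<^sub>C e\<^sub>C j)"
      by (simp add: continuous_intros)
    then have "continuous_on (?A \<times> cbox 0 (2 * pi)) (\<lambda>x. F (fst x + of_real (snd x) *\<^sub>C e\<^sub>C j))"
      by (rule continuous_on_compose2[OF hol_continuous[OF that]]) (use in_A in auto)
    then show ?thesis
      unfolding split_def by (intro continuous_on_mult) (auto intro!: continuous_intros)
  qed
  have "hol (\<lambda>\<theta>. integral (cbox 0 (2 * pi)) (\<lambda>t. f (\<theta> + of_real t *\<^sub>C e\<^sub>C j) * exp (- \<i> * of_int m * of_real t))) ?A" (is "hol ?I ?A")
  proof (rule hol_if_holomorphic_on_lines[OF open_complex_angles])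
    show "continuous_on ?A ?I"
      by (rule integral_continuous_on_param[OF cont[OF f]])
    fix \<theta> v :: "complex^'n" assume \<theta>: "\<theta> \<in> ?A"
    obtain r where r: "r > 0" "\<And>t. cmod t \<le> r \<Longrightarrow> \<theta> + t *\<^sub>C v \<in> ?A"
      using line_disc_in_open[OF open_complex_angles \<theta>] by blast
    have lines: "\<theta> + x *\<^sub>C v + of_real t *\<^sub>C e\<^sub>C j \<in> ?A" if "x \<in> ball 0 r" for x t
      using in_A[OF r(2)[of x], of t] that by simp
    have c2: "continuous_on (ball 0 r \<times> cbox 0 (2 * pi)) (\<lambda>(x, t). F (\<theta> + x *\<^sub>C v + of_real t *\<^sub>C e\<^sub>C j) * exp (- \<i> * of_int m * of_real t))"
      if "hol F ?A" for F :: "complex^'n \<Rightarrow> complex"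
    proof -
      have "continuous_on (ball 0 r) (\<lambda>x. x *\<^sub>C v)"
        by (intro continuous_at_imp_continuous_on ballI has_derivative_continuous[OF has_vector_derivative_cscale_left])
      then have "continuous_on (ball 0 r \<times> cbox 0 (2 * pi)) (\<lambda>p. (\<theta> + fst p *\<^sub>C v, snd p))"
        by (intro continuous_intros continuous_on_compose2[of "ball 0 r" "\<lambda>x. x *\<^sub>C v" _ fst]) auto
      then have "continuous_on (ball 0 r \<times> cbox 0 (2 * pi)) (\<lambda>p. (\<lambda>(\<theta>, t). F (\<theta> + of_real t *\<^sub>C e\<^sub>C j) * exp (- \<i> * of_int m * of_real t)) (\<theta> + fst p *\<^sub>C v, snd p))"
        by (rule continuous_on_compose2[OF cont[OF that]]) (use r(2) in auto)
      then show ?thesis by (simp add: split_def)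
    qed
    have "(\<lambda>x. integral (cbox 0 (2 * pi)) (\<lambda>t. f (\<theta> + x *\<^sub>C v + of_real t *\<^sub>C e\<^sub>C j) * exp (- \<i> * of_int m * of_real t))) holomorphic_on ball 0 r"
    proof (rule leibniz_rule_holomorphic)
      fix x :: complex and t :: real assume x: "x \<in> ball 0 r"
      have swap: "\<theta> + x *\<^sub>C v + of_real t *\<^sub>C e\<^sub>C j = (\<theta> + of_real t *\<^sub>C e\<^sub>C j) + x *\<^sub>C v" for x
        by (simp only: add_ac)
      have "((\<lambda>x. f ((\<theta> + of_real t *\<^sub>C e\<^sub>C j) + x *\<^sub>C v)) has_field_derivative dv f ((\<theta> + of_real t *\<^sub>C e\<^sub>C j) + x *\<^sub>C v) v) (at x)"
        by (rule hol_line(2)[OF f, where T="ball 0 r"], unfold swap[symmetric], erule lines, rule x)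
      then show "((\<lambda>x. f (\<theta> + x *\<^sub>C v + of_real t *\<^sub>C e\<^sub>C j) * exp (- \<i> * of_int m * of_real t)) has_field_derivative
          dv f (\<theta> + x *\<^sub>C v + of_real t *\<^sub>C e\<^sub>C j) v * exp (- \<i> * of_int m * of_real t)) (at x within ball 0 r)"
        unfolding swap by (rule has_field_derivative_at_within[OF DERIV_cmult_right])
    next
      fix x :: complex assume x: "x \<in> ball 0 r"
      have "continuous_on (cbox 0 (2 * pi)) (\<lambda>t. (\<lambda>(x, t). f (\<theta> + x *\<^sub>C v + of_real t *\<^sub>C e\<^sub>C j) * exp (- \<i> * of_int m * of_real t)) (x, t))"
        by (rule continuous_on_compose2[OF c2[OF f]]) (use x in \<open>auto intro!: continuous_intros\<close>)
      then show "(\<lambda>t. f (\<theta> + x *\<^sub>C v + of_real t *\<^sub>C e\<^sub>C j) * exp (- \<i> * of_int m * of_real t)) integrable_on cbox 0 (2 * pi)"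
        by (intro integrable_continuous) simp
    qed (use c2[OF hol_dv[OF open_complex_angles f, of v]] in auto)
    then show "\<exists>r>0. (\<lambda>t. ?I (\<theta> + t *\<^sub>C v)) holomorphic_on ball 0 r"
      using r(1) by blast
  qed
  from hol_mult[OF this hol_const[of "inverse (complex_of_real (2 * pi))"]] show ?thesis
    unfolding proj_def[abs_def] coef_def divide_inverse cbox_interval .
qed

text \<open>
  The angles are expanded one after the other. The component \<open>g k\<close> is still a function of all
  angles, and its dependence on an expanded angle is an exponential. This form, without coefficients,
  carries the induction and is convenient later: dividing \<open>g k\<close> by \<open>\<i> k \<cdot> \<omega>\<close> inverts the derivative
  along \<open>\<omega>\<close>.
\<close>

lemma Fourier_decomposition:
  fixes f :: "complex^'n::finite \<Rightarrow> complex"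
  assumes \<sigma>: "\<sigma> > 0" and J: "finite J"
    and f: "hol f (complex_angles \<sigma>)" "ang_periodic \<sigma> f" "\<forall>\<theta>\<in>complex_angles \<sigma>. cmod (f \<theta>) \<le> B"
  shows "\<exists>g. (\<forall>k\<in>PiE J (\<lambda>_. UNIV). hol (g k) (complex_angles \<sigma>) \<and> ang_periodic \<sigma> (g k) \<and>
      (\<forall>\<theta>\<in>complex_angles \<sigma>. \<forall>\<eta>. 0 < \<eta> \<longrightarrow> \<eta> < \<sigma> \<longrightarrow>
        cmod (g k \<theta>) \<le> B * (\<Prod>j\<in>J. exp (- ((\<eta> - \<bar>Im (\<theta> $ j)\<bar>) * \<bar>of_int (k j)\<bar>)))) \<and>
      (\<forall>j\<in>J. \<forall>\<theta>\<in>complex_angles \<sigma>. \<forall>w. \<theta> + w *\<^sub>C e\<^sub>C j \<in> complex_angles \<sigma> \<longrightarrow>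
        g k (\<theta> + w *\<^sub>C e\<^sub>C j) = exp (\<i> * of_int (k j) * w) * g k \<theta>)) \<and>
    (\<forall>\<theta>\<in>complex_angles \<sigma>. ((\<lambda>k. g k \<theta>) has_sum f \<theta>) (PiE J (\<lambda>_. UNIV)))"
  using J
proof (induction J rule: finite_induct)
  case empty
  show ?case
    by (rule exI[of _ "\<lambda>_. f"]) (use f in \<open>auto simp: has_sum_finiteI\<close>)
next
  case (insert j J)
  from insert.IH show ?case
  proof (elim exE conjE, goal_cases)
    case (1 g)
    have g: "hol (g k) (complex_angles \<sigma>)" "ang_periodic \<sigma> (g k)" if "k \<in> PiE J (\<lambda>_. UNIV)" for k
      using bspec[OF 1(1) that] by simp_all
    have g_bound: "cmod (g k \<theta>) \<le> B * (\<Prod>j\<in>J. exp (- ((\<eta> - \<bar>Im (\<theta> $ j)\<bar>) * \<bar>of_int (k j)\<bar>)))"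
      if "k \<in> PiE J (\<lambda>_. UNIV)" "\<theta> \<in> complex_angles \<sigma>" "0 < \<eta>" "\<eta> < \<sigma>" for k \<theta> \<eta>
      using bspec[OF 1(1) that(1), THEN conjunct2, THEN conjunct2, THEN conjunct1, THEN bspec, OF that(2)] that(3,4) by blast
    have g_hom: "g k (\<theta> + w *\<^sub>C e\<^sub>C i) = exp (\<i> * of_int (k i) * w) * g k \<theta>"
      if "k \<in> PiE J (\<lambda>_. UNIV)" "i \<in> J" "\<theta> \<in> complex_angles \<sigma>" "\<theta> + w *\<^sub>C e\<^sub>C i \<in> complex_angles \<sigma>" for k i \<theta> w
      using bspec[OF 1(1) that(1), THEN conjunct2, THEN conjunct2, THEN conjunct2, THEN bspec, OF that(2), THEN bspec, OF that(3)] that(4) by blast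
    have g_sum: "((\<lambda>k. g k \<theta>) has_sum f \<theta>) (PiE J (\<lambda>_. UNIV))" if "\<theta> \<in> complex_angles \<sigma>" for \<theta>
      using bspec[OF 1(2) that] .
    define G where "G k = proj j (k j) (g (k(j := undefined)))" for k
    have res: "k(j := undefined) \<in> PiE J (\<lambda>_. UNIV)" if "k \<in> PiE (insert j J) (\<lambda>_. UNIV)" for k :: "'n \<Rightarrow> int"
      using that insert.hyps by (auto simp: PiE_def extensional_def)
    have real_shift: "\<theta> + of_real t *\<^sub>C e\<^sub>C i \<in> complex_angles \<sigma>" if "\<theta> \<in> complex_angles \<sigma>" for \<theta> :: "complex^'n" and t i
      using that by (simp only: complex_angles_real_shift)
    have bound: "cmod (proj j m (g k) \<theta>) \<le> B * (\<Prod>i\<in>J. exp (- ((\<eta> - \<bar>Im (\<theta> $ i)\<bar>) * \<bar>of_int (k i)\<bar>)))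
         * exp (- ((\<eta> - \<bar>Im (\<theta> $ j)\<bar>) * \<bar>of_int m\<bar>))"
      if k: "k \<in> PiE J (\<lambda>_. UNIV)" and \<theta>: "\<theta> \<in> complex_angles \<sigma>" and \<eta>: "0 < \<eta>" "\<eta> < \<sigma>" for k m \<theta> \<eta>
    proof (rule proj_bound[OF g(1)[OF k] g(2)[OF k] \<theta> \<eta>])
      fix w assume w: "\<theta> + w *\<^sub>C e\<^sub>C j \<in> complex_angles \<sigma>"
      have "(\<Prod>i\<in>J. exp (- ((\<eta> - \<bar>Im ((\<theta> + w *\<^sub>C e\<^sub>C j) $ i)\<bar>) * \<bar>of_int (k i)\<bar>)))
          = (\<Prod>i\<in>J. exp (- ((\<eta> - \<bar>Im (\<theta> $ i)\<bar>) * \<bar>of_int (k i)\<bar>)))"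
        by (rule prod.cong[OF refl]) (use insert.hyps in \<open>auto simp: axis_def\<close>)
      then show "cmod (g k (\<theta> + w *\<^sub>C e\<^sub>C j)) \<le> B * (\<Prod>i\<in>J. exp (- ((\<eta> - \<bar>Im (\<theta> $ i)\<bar>) * \<bar>of_int (k i)\<bar>)))"
        using g_bound[OF k w \<eta>] by simp
    qed
    show ?case
    proof (intro exI[of _ G] conjI ballI allI impI)
      fix k :: "'n \<Rightarrow> int" assume k: "k \<in> PiE (insert j J) (\<lambda>_. UNIV)"
      note r = res[OF k]
      show "hol (G k) (complex_angles \<sigma>)" unfolding G_def by (rule proj_hol[OF g(1)[OF r] \<sigma>])
      show "ang_periodic \<sigma> (G k)"
        unfolding ang_periodic_def G_def proj_def
      proof (intro ballI allI coef_cong_periodic)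
        fix \<theta> :: "complex^'n" and l :: "int^'n" and t :: real assume "\<theta> \<in> complex_angles \<sigma>"
        from real_shift[OF this, of t j] g(2)[OF r]
        have "g (k(j := undefined)) ((\<theta> + of_real t *\<^sub>C e\<^sub>C j) + cvec (lattice_vec l)) = g (k(j := undefined)) (\<theta> + of_real t *\<^sub>C e\<^sub>C j)"
          unfolding ang_periodic_def by blast
        then show "g (k(j := undefined)) (\<theta> + cvec (lattice_vec l) + of_real t *\<^sub>C e\<^sub>C j) = g (k(j := undefined)) (\<theta> + of_real t *\<^sub>C e\<^sub>C j)"
          by (simp only: add_ac)
      qed
      show "cmod (G k \<theta>) \<le> B * (\<Prod>i\<in>insert j J. exp (- ((\<eta> - \<bar>Im (\<theta> $ i)\<bar>) * \<bar>of_int (k i)\<bar>)))"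
        if \<theta>: "\<theta> \<in> complex_angles \<sigma>" and \<eta>: "0 < \<eta>" "\<eta> < \<sigma>" for \<theta> \<eta>
      proof -
        have "(\<Prod>i\<in>J. exp (- ((\<eta> - \<bar>Im (\<theta> $ i)\<bar>) * \<bar>of_int ((k(j := undefined)) i)\<bar>)))
          = (\<Prod>i\<in>J. exp (- ((\<eta> - \<bar>Im (\<theta> $ i)\<bar>) * \<bar>of_int (k i)\<bar>)))"
          by (rule prod.cong[OF refl]) (use insert.hyps in auto)
        then show ?thesis
          using bound[OF r \<theta> \<eta>, of "k j"] insert.hyps by (simp add: G_def mult_ac)
      qed
      show "G k (\<theta> + w *\<^sub>C e\<^sub>C i) = exp (\<i> * of_int (k i) * w) * G k \<theta>"
        if i: "i \<in> insert j J" and \<theta>: "\<theta> \<in> complex_angles \<sigma>" "\<theta> + w *\<^sub>C e\<^sub>C i \<in> complex_angles \<sigma>" for i \<theta> w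
      proof (cases "i = j")
        case True
        then show ?thesis
          using proj_shift[OF g(1)[OF r] g(2)[OF r] \<theta>(1)] \<theta>(2) by (simp add: G_def)
      next
        case False
        then have iJ: "i \<in> J" using i by simp
        have "g (k(j := undefined)) (\<theta> + w *\<^sub>C e\<^sub>C i + of_real t *\<^sub>C e\<^sub>C j) = exp (\<i> * of_int (k i) * w) * g (k(j := undefined)) (\<theta> + of_real t *\<^sub>C e\<^sub>C j)" for t
          using g_hom[OF r iJ real_shift[OF \<theta>(1), of t j], of w] real_shift[OF \<theta>(2), of t j] False
          by (simp add: add_ac)
        then have "G k (\<theta> + w *\<^sub>C e\<^sub>C i) = coef (k j) (\<lambda>u. exp (\<i> * of_int (k i) * w) * g (k(j := undefined)) (\<theta> + u *\<^sub>C e\<^sub>C j))"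
          unfolding G_def proj_def by (intro coef_cong_periodic)
        also have "\<dots> = exp (\<i> * of_int (k i) * w) * G k \<theta>"
          unfolding G_def proj_def coef_def by (simp add: mult.assoc)
        finally show ?thesis .
      qed
    next
      fix \<theta> :: "complex^'n" assume \<theta>: "\<theta> \<in> complex_angles \<sigma>"
      define M where "M = Max (range (\<lambda>i. \<bar>Im (\<theta> $ i)\<bar>))"
      define \<eta> where "\<eta> = (M + \<sigma>) / 2"
      have mx: "\<bar>Im (\<theta> $ i)\<bar> \<le> M" for i unfolding M_def by (rule Max_ge) auto
      have mx2: "M < \<sigma>" unfolding M_def using \<theta> by (subst Max_less_iff) (auto simp: complex_angles_iff)
      have "0 \<le> M" using mx order_trans[OF abs_ge_zero] by blast
      then have \<eta>: "0 < \<eta>" "\<eta> < \<sigma>" "M < \<eta>"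
        using mx2 \<sigma> by (simp_all add: \<eta>_def field_simps)
      have \<eta>M: "\<bar>Im (\<theta> $ i)\<bar> < \<eta>" for i
        using mx \<eta>(3) by (rule le_less_trans)
      define q where "q i m = exp (- ((\<eta> - \<bar>Im (\<theta> $ i)\<bar>) * \<bar>real_of_int m\<bar>))" for i m
      have qs: "q i summable_on UNIV" for i
        unfolding q_def by (rule summable_exp_abs_int) (use \<eta>M in simp)
      have qh: "(q i has_sum infsum (q i) UNIV) UNIV" and q0: "q i m \<ge> 0" for i m
        using qs[of i] by (simp_all add: q_def)
      show "((\<lambda>k. G k \<theta>) has_sum f \<theta>) (PiE (insert j J) (\<lambda>_. UNIV))"
      proof (rule has_sum_PiE_insert'[OF insert.hyps(2)])
        have Geq: "G (k(j := m)) = proj j m (g k)" if "k \<in> PiE J (\<lambda>_. UNIV)" for k m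
        proof -
          have "k(j := undefined) = k" using that insert.hyps by (auto simp: PiE_def extensional_def)
          then show ?thesis by (simp add: G_def)
        qed
        have inner: "((\<lambda>m. proj j m (g k) \<theta>) has_sum g k \<theta>) UNIV" if k: "k \<in> PiE J (\<lambda>_. UNIV)" for k
          using Fourier_series_at_0[OF slice_holomorphic[OF g(1)[OF k] g(2)[OF k] \<theta>] slice_periodic[OF g(1)[OF k] g(2)[OF k] \<theta>]
              slice_neg[OF g(1)[OF k] g(2)[OF k] \<theta>] slice_pos[OF g(1)[OF k] g(2)[OF k] \<theta>]]
          by (simp add: proj_def)
        have "(\<lambda>(k, m). q j m * (\<Prod>i\<in>J. q i (k i))) summable_on (PiE J (\<lambda>_. UNIV) \<times> UNIV)"
        proof (rule summable_on_SigmaI)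
          show "((\<lambda>m. case (k, m) of (k, m) \<Rightarrow> q j m * (\<Prod>i\<in>J. q i (k i))) has_sum infsum (q j) UNIV * (\<Prod>i\<in>J. q i (k i))) UNIV" for k
            using has_sum_cmult_left[OF qh] by simp
          have "((\<lambda>k. \<Prod>i\<in>J. q i (k i)) has_sum (\<Prod>i\<in>J. infsum (q i) UNIV)) (PiE J (\<lambda>_. UNIV))"
            by (rule has_sum_prod_PiE[OF insert.hyps(1) qh q0])
          then show "(\<lambda>k. infsum (q j) UNIV * (\<Prod>i\<in>J. q i (k i))) summable_on PiE J (\<lambda>_. UNIV)"
            by (intro summable_on_cmult_right) (auto simp: summable_on_def)
        qed (auto simp: q_def intro!: mult_nonneg_nonneg prod_nonneg)
        then have "(\<lambda>p. B * (case p of (k, m) \<Rightarrow> q j m * (\<Prod>i\<in>J. q i (k i)))) summable_on (PiE J (\<lambda>_. UNIV) \<times> UNIV)"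
          by (rule summable_on_cmult_right)
        then have "(\<lambda>p. cmod (case p of (k, m) \<Rightarrow> proj j m (g k) \<theta>)) summable_on (PiE J (\<lambda>_. UNIV) \<times> UNIV)"
          by (rule Infinite_Sum.abs_summable_on_comparison_test') (use bound[OF _ \<theta> \<eta>(1,2)] in \<open>auto simp: q_def mult_ac\<close>)
        then have "(\<lambda>(k, m). proj j m (g k) \<theta>) summable_on (PiE J (\<lambda>_. UNIV) \<times> UNIV)"
          by (rule abs_summable_summable)
        then have "((\<lambda>(k, m). proj j m (g k) \<theta>) has_sum f \<theta>) (PiE J (\<lambda>_. UNIV) \<times> UNIV)"
          by (intro has_sum_SigmaI[OF _ g_sum[OF \<theta>]]) (use inner in auto)
        then show "((\<lambda>(k, m). G (k(j := m)) \<theta>) has_sum f \<theta>) (PiE J (\<lambda>_. UNIV) \<times> UNIV)"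
          by (rule has_sum_cong[THEN iffD1, rotated]) (auto simp: Geq)
      qed
    qed
  qed
qed

section \<open>The cohomological equation\<close>

lemma power_le_fact_exp:
  fixes x :: real
  assumes "x \<ge> 0"
  shows "x ^ N \<le> fact N * exp x"
proof -
  have "(\<lambda>n. x ^ n /\<^sub>R fact n) sums exp x" by (rule exp_converges)
  then have "sum (\<lambda>n. x ^ n /\<^sub>R fact n) {N} \<le> exp x"
    using assms sum_le_suminf[of "\<lambda>n. x ^ n /\<^sub>R fact n" "{N}"] by (auto simp: sums_iff)
  then show ?thesis by (simp add: field_simps)
qed

text \<open>
  A product of geometric series; each factor is at most \<open>16 / \<delta>\<close>.
\<close>

lemma sum_exp_weights:
  fixes \<delta> :: real
  assumes \<delta>: "0 < \<delta>" "\<delta> \<le> 1"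
  obtains S where "((\<lambda>k::'n::finite \<Rightarrow> int. \<Prod>j\<in>UNIV. exp (- (\<delta> / 4 * \<bar>of_int (k j)\<bar>))) has_sum S) UNIV"
    "S \<le> (16 / \<delta>) ^ CARD('n)"
proof -
  define x where "x = exp (- (\<delta> / 4))"
  have x: "0 \<le> x" "x < 1" using \<delta> by (auto simp: x_def)
  have "1 + \<delta> / 4 \<le> exp (\<delta> / 4)" by (rule exp_ge_add_one_self)
  then have "x \<le> 1 / (1 + \<delta> / 4)"
    using \<delta> by (simp add: x_def exp_minus field_simps)
  also have "\<dots> \<le> 1 - \<delta> / 8"
    using \<delta> by (simp add: field_simps)
  finally have x8: "\<delta> / 8 \<le> 1 - x" by simp
  have "((\<lambda>m::int. exp (- (\<delta> / 4 * \<bar>of_int m\<bar>))) has_sum (1 + x) / (1 - x)) UNIV"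
    unfolding exp_abs_int x_def[symmetric] by (rule has_sum_int_geometric[OF x])
  then have "((\<lambda>k::'n \<Rightarrow> int. \<Prod>j\<in>UNIV. exp (- (\<delta> / 4 * \<bar>of_int (k j)\<bar>))) has_sum (\<Prod>j\<in>(UNIV::'n set). (1 + x) / (1 - x))) (PiE UNIV (\<lambda>_. UNIV))"
    by (intro has_sum_prod_PiE) auto
  moreover have "(\<Prod>j\<in>(UNIV::'n set). (1 + x) / (1 - x)) \<le> (16 / \<delta>) ^ CARD('n)"
  proof -
    have "(1 + x) / (1 - x) \<le> 2 / (\<delta> / 8)"
      using x x8 \<delta> by (intro frac_le) auto
    then show ?thesis
      using x by (auto intro!: power_mono)
  qed
  ultimately show ?thesis by (intro that) (simp_all add: PiE_UNIV_domain)
qed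

text \<open>The small divisors: a polynomial loss in \<open>\<bar>k\<bar>\<close>, absorbed by part of the exponential decay.\<close>

lemma small_divisor_bound:
  fixes \<omega> :: "real^'n::finite" and k :: "'n \<Rightarrow> int"
  assumes dioph: "\<gamma> > 0" "diophantine \<gamma> \<tau> \<omega>" and k: "k \<noteq> (\<lambda>_. 0)" and \<delta>: "0 < \<delta>"
    and N: "\<tau> \<le> real N"
  defines "d \<equiv> \<Sum>j\<in>UNIV. of_int (k j) * \<omega> $ j"
  shows "d \<noteq> 0" "(\<Prod>j\<in>UNIV. exp (- (\<delta> / 2 * \<bar>of_int (k j)\<bar>))) / \<bar>d\<bar>
     \<le> fact N * (4 / \<delta>) ^ N / \<gamma> * (\<Prod>j\<in>UNIV. exp (- (\<delta> / 4 * \<bar>of_int (k j)\<bar>)))"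
proof -
  define s :: real where "s = (\<Sum>j\<in>UNIV. \<bar>of_int (k j)\<bar>)"
  obtain i where i: "k i \<noteq> 0" using k by auto
  have "\<bar>real_of_int (k i)\<bar> \<le> s" unfolding s_def by (rule member_le_sum) auto
  moreover have "\<bar>real_of_int (k i)\<bar> \<ge> 1" using i by linarith
  ultimately have s1: "s \<ge> 1" by linarith
  have "(\<chi> j. k j) \<noteq> 0" using i by (auto simp: vec_eq_iff)
  from dioph(2)[unfolded diophantine_def, rule_format, OF this]
  have d: "\<gamma> * s powr - \<tau> < \<bar>d\<bar>" by (simp add: d_def s_def)
  moreover have "\<gamma> * s powr - \<tau> \<ge> 0" using dioph(1) by simp
  ultimately show "d \<noteq> 0" by auto
  have "s powr \<tau> \<le> s ^ N"
    using s1 N powr_mono[of \<tau> "real N" s] by (simp add: powr_realpow)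
  then have "1 / s ^ N \<le> s powr - \<tau>"
    using s1 by (simp add: powr_minus divide_inverse le_imp_inverse_le)
  then have "\<gamma> / s ^ N \<le> \<bar>d\<bar>"
    using d dioph(1) mult_left_mono[of "1 / s ^ N" "s powr - \<tau>" \<gamma>] by simp
  then have inv_d: "1 / \<bar>d\<bar> \<le> s ^ N / \<gamma>"
    using dioph(1) s1 \<open>d \<noteq> 0\<close> by (simp add: field_simps)
  have "s ^ N = (4 / \<delta>) ^ N * (\<delta> / 4 * s) ^ N"
    using \<delta> by (simp flip: power_mult_distrib)
  also have "\<dots> \<le> (4 / \<delta>) ^ N * (fact N * exp (\<delta> / 4 * s))"
    using \<delta> s1 by (intro mult_left_mono power_le_fact_exp) auto
  finally have sN: "s ^ N \<le> (4 / \<delta>) ^ N * (fact N * exp (\<delta> / 4 * s))" .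
  have prod: "(\<Prod>j\<in>UNIV. exp (- (c * \<bar>real_of_int (k j)\<bar>))) = exp (- (c * s))" for c
    by (simp add: s_def sum_distrib_left sum_negf exp_sum flip: sum_negf)
  have "exp (- (\<delta> / 2 * s)) / \<bar>d\<bar> \<le> exp (- (\<delta> / 2 * s)) * (s ^ N / \<gamma>)"
    using mult_left_mono[OF inv_d, of "exp (- (\<delta> / 2 * s))"] by (simp only: exp_ge_zero times_divide_eq_right mult_1_right)
  also have "\<dots> \<le> exp (- (\<delta> / 2 * s)) * ((4 / \<delta>) ^ N * (fact N * exp (\<delta> / 4 * s)) / \<gamma>)"
    using sN dioph(1) by (intro mult_left_mono divide_right_mono) auto
  also have "\<dots> = fact N * (4 / \<delta>) ^ N / \<gamma> * (exp (- (\<delta> / 2 * s)) * exp (\<delta> / 4 * s))"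
    by simp
  also have "exp (- (\<delta> / 2 * s)) * exp (\<delta> / 4 * s) = exp (- (\<delta> / 4 * s))"
    by (simp flip: exp_add)
  finally show "(\<Prod>j\<in>UNIV. exp (- (\<delta> / 2 * \<bar>of_int (k j)\<bar>))) / \<bar>d\<bar>
     \<le> fact N * (4 / \<delta>) ^ N / \<gamma> * (\<Prod>j\<in>UNIV. exp (- (\<delta> / 4 * \<bar>of_int (k j)\<bar>)))"
    unfolding prod .
qed

lemma dv_homogeneous:
  fixes g :: "complex^'n::finite \<Rightarrow> complex"
  assumes g: "hol g (complex_angles \<sigma>)" and \<theta>: "\<theta> \<in> complex_angles \<sigma>"
    and hom: "\<And>j w. \<theta> + w *\<^sub>C e\<^sub>C j \<in> complex_angles \<sigma> \<Longrightarrow> g (\<theta> + w *\<^sub>C e\<^sub>C j) = exp (\<i> * of_int (k j) * w) * g \<theta>"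
  shows "dv g \<theta> (e\<^sub>C j) = \<i> * of_int (k j) * g \<theta>"
    and "dv g \<theta> (cvec x) = \<i> * of_real (\<Sum>j\<in>UNIV. of_int (k j) * x $ j) * g \<theta>"
proof -
  show *: "dv g \<theta> (e\<^sub>C j) = \<i> * of_int (k j) * g \<theta>" for j
  proof -
    obtain r where r: "r > 0" "\<And>t. cmod t \<le> r \<Longrightarrow> \<theta> + t *\<^sub>C e\<^sub>C j \<in> complex_angles \<sigma>"
      using line_disc_in_open[OF open_complex_angles \<theta>] by blast
    have "((\<lambda>w. exp (\<i> * of_int (k j) * w) * g \<theta>) has_field_derivative \<i> * of_int (k j) * g \<theta>) (at 0)"
      by (auto intro!: derivative_eq_intros)
    then have "((\<lambda>w. g (\<theta> + w *\<^sub>C e\<^sub>C j)) has_field_derivative \<i> * of_int (k j) * g \<theta>) (at 0)"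
      by (rule has_field_derivative_transform_within_open[of _ _ _ "ball 0 r"])
        (use r hom in \<open>auto simp: less_imp_le\<close>)
    then show ?thesis
      using dv_eq_deriv[OF g \<theta>] DERIV_imp_deriv by metis
  qed
  show "dv g \<theta> (cvec x) = \<i> * of_real (\<Sum>j\<in>UNIV. of_int (k j) * x $ j) * g \<theta>"
    unfolding cvec_sum_axis dv_sum[OF g \<theta>] dv_cscale[OF g \<theta>] *
    by (simp add: sum_distrib_left sum_distrib_right mult_ac)
qed

lemma constant_if_dv_axes_zero:
  fixes g :: "complex^'n::finite \<Rightarrow> complex"
  assumes g: "hol g (complex_angles \<sigma>)"
    and z: "\<And>\<theta> j. \<theta> \<in> complex_angles \<sigma> \<Longrightarrow> dv g \<theta> (e\<^sub>C j) = 0"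
  obtains c where "\<And>\<theta>. \<theta> \<in> complex_angles \<sigma> \<Longrightarrow> g \<theta> = c"
proof -
  have "(g has_derivative (\<lambda>_. 0)) (at \<theta> within complex_angles \<sigma>)" if \<theta>: "\<theta> \<in> complex_angles \<sigma>" for \<theta>
  proof -
    have "dv g \<theta> v = 0" for v
    proof -
      have "dv g \<theta> (\<Sum>j\<in>UNIV. v $ j *\<^sub>C e\<^sub>C j) = 0"
        unfolding dv_sum[OF g \<theta>] dv_cscale[OF g \<theta>] by (simp add: z[OF \<theta>])
      then show ?thesis by (simp flip: vec_sum_axis)
    qed
    then have "dv g \<theta> = (\<lambda>_. 0)" by (simp add: fun_eq_iff)
    then show ?thesis using has_derivative_at_withinI[OF hol_has_derivative[OF g \<theta>]] by simp
  qed
  from has_derivative_zero_constant[OF convex_complex_angles this]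
  obtain c where "\<forall>\<theta>\<in>complex_angles \<sigma>. g \<theta> = c" by blast
  then show ?thesis by (intro that[of c]) blast
qed

lemma dv_axis_bound:
  fixes s :: "complex^'n::finite \<Rightarrow> complex"
  assumes s: "hol s (complex_angles \<sigma>)" and \<delta>: "0 < \<delta>"
    and B: "\<And>\<theta>. \<theta> \<in> complex_angles \<sigma> \<Longrightarrow> cmod (s \<theta>) \<le> B"
    and \<theta>: "\<theta> \<in> complex_angles (\<sigma> - \<delta>)"
  shows "cmod (dv s \<theta> (e\<^sub>C j)) \<le> B / \<delta>"
proof -
  have *: "\<theta> + t *\<^sub>C e\<^sub>C j \<in> complex_angles \<sigma>" if "cmod t < \<delta>" for t
    using complex_angles_add[OF \<theta>, of "t *\<^sub>C e\<^sub>C j" \<delta>] that \<delta> by (simp add: axis_def less_imp_le)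
  show ?thesis
    by (rule hol_Cauchy_bounds(1)[OF s * \<delta>]) (use * B in auto)
qed

text \<open>
  Divide each Fourier component by its small divisor. Part of the exponential decay gained on the
  narrower strip absorbs the divisor, the rest makes the series converge; each costs powers of \<open>1 / \<delta>\<close>.
\<close>

lemma complex_cohomological_solution:
  fixes \<omega> :: "real^'n::finite"
  assumes dioph: "\<gamma> > 0" "diophantine \<gamma> \<tau> \<omega>"
  obtains K \<nu> where "K \<ge> 1" "\<And>\<sigma> f B. 0 < \<sigma> \<Longrightarrow> hol f (complex_angles \<sigma>) \<Longrightarrow> ang_periodic \<sigma> f \<Longrightarrow>
    \<forall>\<theta>\<in>complex_angles \<sigma>. cmod (f \<theta>) \<le> B \<Longrightarrow>
    \<exists>c s. hol s (complex_angles \<sigma>) \<and> ang_periodic \<sigma> s \<and>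
      (\<forall>\<theta>\<in>complex_angles \<sigma>. dv s \<theta> (cvec \<omega>) = f \<theta> - c) \<and>
      (\<forall>\<delta>. 0 < \<delta> \<longrightarrow> \<delta> \<le> 1 \<longrightarrow> \<delta> < \<sigma> \<longrightarrow> (\<forall>\<theta>\<in>complex_angles (\<sigma> - \<delta>). cmod (s \<theta>) \<le> K * B / \<delta> ^ \<nu>))"
proof -
  define N where "N = nat \<lceil>\<tau>\<rceil>"
  have N: "\<tau> \<le> real N" unfolding N_def by linarith
  define n where "n = CARD('n)"
  define K where "K = max 1 (fact N * 4 ^ N * 16 ^ n / \<gamma>)"
  define \<nu> where "\<nu> = N + n"
  have "\<exists>c s. hol s (complex_angles \<sigma>) \<and> ang_periodic \<sigma> s \<and>
      (\<forall>\<theta>\<in>complex_angles \<sigma>. dv s \<theta> (cvec \<omega>) = f \<theta> - c) \<and>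
      (\<forall>\<delta>. 0 < \<delta> \<longrightarrow> \<delta> \<le> 1 \<longrightarrow> \<delta> < \<sigma> \<longrightarrow> (\<forall>\<theta>\<in>complex_angles (\<sigma> - \<delta>). cmod (s \<theta>) \<le> K * B / \<delta> ^ \<nu>))"
    if \<sigma>: "0 < \<sigma>" and f: "hol f (complex_angles \<sigma>)" "ang_periodic \<sigma> f"
      and B: "\<forall>\<theta>\<in>complex_angles \<sigma>. cmod (f \<theta>) \<le> B" for \<sigma> and f :: "complex^'n \<Rightarrow> complex" and B
    using Fourier_decomposition[OF \<sigma> finite_class.finite_UNIV f B]
  proof (elim exE conjE, goal_cases)
    case (1 g)
    have B0: "B \<ge> 0"
      using bspec[OF B, of "cvec 0"] \<sigma> by (intro order_trans[OF norm_ge_zero]) auto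
    let ?A = "complex_angles \<sigma> :: (complex^'n) set"
    let ?F = "finite_subsets_at_top (UNIV :: ('n \<Rightarrow> int) set)"
    have all: "(\<forall>k\<in>PiE UNIV (\<lambda>_. UNIV). P k) \<longleftrightarrow> (\<forall>k. P k)" for P :: "('n \<Rightarrow> int) \<Rightarrow> bool"
      by (simp add: PiE_UNIV_domain)
    note g0 = 1(1)[unfolded all, rule_format]
    have g: "hol (g k) ?A" "ang_periodic \<sigma> (g k)" for k
      using g0[of k] by simp_all
    have g_bound: "cmod (g k \<theta>) \<le> B * (\<Prod>j\<in>UNIV. exp (- ((\<eta> - \<bar>Im (\<theta> $ j)\<bar>) * \<bar>of_int (k j)\<bar>)))"
      if "\<theta> \<in> ?A" "0 < \<eta>" "\<eta> < \<sigma>" for k \<theta> \<eta>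
      using g0[of k, THEN conjunct2, THEN conjunct2, THEN conjunct1, THEN bspec, OF that(1)] that(2,3) by blast
    have g_hom: "g k (\<theta> + w *\<^sub>C e\<^sub>C i) = exp (\<i> * of_int (k i) * w) * g k \<theta>"
      if "\<theta> \<in> ?A" "\<theta> + w *\<^sub>C e\<^sub>C i \<in> ?A" for k i \<theta> w
      using g0[of k, THEN conjunct2, THEN conjunct2, THEN conjunct2, THEN bspec, OF UNIV_I, THEN bspec, OF that(1)] that(2) by blast
    have g_sum: "((\<lambda>k. g k \<theta>) has_sum f \<theta>) UNIV" if "\<theta> \<in> ?A" for \<theta>
      using bspec[OF 1(2) that] by (simp add: PiE_UNIV_domain)
    define d where "d k = (\<Sum>j\<in>UNIV. of_int (k j) * \<omega> $ j)" for k :: "'n \<Rightarrow> int"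
    note dv_g = dv_homogeneous[OF g(1) _ g_hom]
    obtain c where c: "\<And>\<theta>. \<theta> \<in> ?A \<Longrightarrow> g (\<lambda>_. 0) \<theta> = c"
    proof (rule constant_if_dv_axes_zero[OF g(1)[of "\<lambda>_. 0"]])
      show "dv (g (\<lambda>_. 0)) \<theta> (e\<^sub>C j) = 0" if "\<theta> \<in> ?A" for \<theta> j
        using dv_g(1)[of \<theta> "\<lambda>_. 0" j] that by simp
    qed auto
    define h where "h k \<theta> = (if k = (\<lambda>_. 0) then 0 else inverse (\<i> * of_real (d k)) * g k \<theta>)" for k \<theta>
    define s where "s \<theta> = (\<Sum>\<^sub>\<infinity>k\<in>UNIV. h k \<theta>)" for \<theta>
    define C where "C \<delta> = B * (fact N * (4 / \<delta>) ^ N / \<gamma>)" for \<delta> :: real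
    define W where "W \<delta> k = (\<Prod>j\<in>UNIV. exp (- (\<delta> / 4 * \<bar>of_int (k j)\<bar>)))" for \<delta> :: real and k :: "'n \<Rightarrow> int"
    have h_hol: "hol (h k) ?A" for k
    proof (cases "k = (\<lambda>_. 0)")
      case False
      show ?thesis unfolding h_def by (simp only: False if_False) (rule hol_mult[OF hol_const g(1)])
    qed (simp add: h_def[abs_def] hol_const)
    have h_bound: "cmod (h k \<theta>) \<le> C \<delta> * W \<delta> k"
      if \<delta>: "0 < \<delta>" "\<delta> < \<sigma>" and \<theta>: "\<theta> \<in> complex_angles (\<sigma> - \<delta>)" for k \<delta> \<theta>
    proof (cases "k = (\<lambda>_. 0)")
      case True
      then show ?thesis using B0 \<delta> dioph by (simp add: h_def C_def W_def)
    next
      case False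
      have \<theta>A: "\<theta> \<in> ?A" using \<theta> complex_angles_mono[of "\<sigma> - \<delta>" \<sigma>] \<delta> by auto
      have "cmod (g k \<theta>) \<le> B * (\<Prod>j\<in>UNIV. exp (- ((\<sigma> - \<delta> / 2 - \<bar>Im (\<theta> $ j)\<bar>) * \<bar>of_int (k j)\<bar>)))"
        by (rule g_bound[OF \<theta>A]) (use \<delta> in auto)
      also have "\<dots> \<le> B * (\<Prod>j\<in>UNIV. exp (- (\<delta> / 2 * \<bar>of_int (k j)\<bar>)))"
      proof (intro mult_left_mono prod_mono conjI B0)
        fix j
        have "\<bar>Im (\<theta> $ j)\<bar> < \<sigma> - \<delta>" using \<theta> unfolding complex_angles_iff ..
        then have "\<delta> / 2 \<le> \<sigma> - \<delta> / 2 - \<bar>Im (\<theta> $ j)\<bar>" by (simp add: field_simps)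
        then have "\<delta> / 2 * \<bar>real_of_int (k j)\<bar> \<le> (\<sigma> - \<delta> / 2 - \<bar>Im (\<theta> $ j)\<bar>) * \<bar>real_of_int (k j)\<bar>"
          by (rule mult_right_mono) simp
        then show "exp (- ((\<sigma> - \<delta> / 2 - \<bar>Im (\<theta> $ j)\<bar>) * \<bar>real_of_int (k j)\<bar>)) \<le> exp (- (\<delta> / 2 * \<bar>real_of_int (k j)\<bar>))"
          by simp
      qed auto
      finally have "cmod (g k \<theta>) / \<bar>d k\<bar> \<le> B * (\<Prod>j\<in>UNIV. exp (- (\<delta> / 2 * \<bar>of_int (k j)\<bar>))) / \<bar>d k\<bar>"
        by (rule divide_right_mono) simp
      moreover have "cmod (h k \<theta>) = cmod (g k \<theta>) / \<bar>d k\<bar>"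
        using False by (simp add: h_def norm_mult norm_inverse norm_divide divide_inverse)
      ultimately have "cmod (h k \<theta>) \<le> B * (\<Prod>j\<in>UNIV. exp (- (\<delta> / 2 * \<bar>of_int (k j)\<bar>))) / \<bar>d k\<bar>"
        by (simp only:)
      also have "\<dots> \<le> B * (fact N * (4 / \<delta>) ^ N / \<gamma> * (\<Prod>j\<in>UNIV. exp (- (\<delta> / 4 * \<bar>of_int (k j)\<bar>))))"
        using mult_left_mono[OF small_divisor_bound(2)[OF dioph False \<delta>(1) N] B0] unfolding d_def times_divide_eq_right .
      finally show ?thesis unfolding C_def W_def by (simp only: mult.assoc)
    qed
    have ulim: "uniform_limit (complex_angles (\<sigma> - \<delta>)) (\<lambda>X \<theta>. \<Sum>k\<in>X. h k \<theta>) s ?F"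
      if \<delta>: "0 < \<delta>" "\<delta> < \<sigma>" "\<delta> \<le> 1" for \<delta>
    proof -
      obtain S where "(W \<delta> has_sum S) UNIV"
        using sum_exp_weights[OF \<delta>(1,3)] unfolding W_def by metis
      then have "(\<lambda>k. C \<delta> * W \<delta> k) summable_on UNIV"
        by (intro summable_on_cmult_right) (auto simp: summable_on_def)
      then show ?thesis
        unfolding s_def[abs_def]
        by (intro Weierstrass_m_test_general[where M="\<lambda>k. C \<delta> * W \<delta> k"]) (use h_bound \<delta> in auto)
    qed
    have exhaust: "\<exists>\<delta>. 0 < \<delta> \<and> \<delta> < \<sigma> \<and> \<delta> \<le> 1 \<and> \<theta> \<in> complex_angles (\<sigma> - \<delta>)" if \<theta>: "\<theta> \<in> ?A" for \<theta>
    proof -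
      define M where "M = Max (range (\<lambda>i. \<bar>Im (\<theta> $ i)\<bar>))"
      have mx: "\<bar>Im (\<theta> $ i)\<bar> \<le> M" for i unfolding M_def by (rule Max_ge) auto
      have mx2: "M < \<sigma>" unfolding M_def using \<theta> by (subst Max_less_iff) (auto simp: complex_angles_iff)
      have "0 \<le> M" using mx order_trans[OF abs_ge_zero] by blast
      have "\<bar>Im (\<theta> $ i)\<bar> < \<sigma> - min 1 ((\<sigma> - M) / 2)" for i
      proof -
        have "min 1 ((\<sigma> - M) / 2) \<le> (\<sigma> - M) / 2" by (rule min.cobounded2)
        also have "\<dots> < \<sigma> - M" using mx2 by simp
        finally have "M < \<sigma> - min 1 ((\<sigma> - M) / 2)" by (simp only: less_diff_eq add.commute)
        with mx show ?thesis by (rule le_less_trans)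
      qed
      then show ?thesis
        using mx2 \<open>0 \<le> M\<close> \<sigma> by (intro exI[of _ "min 1 ((\<sigma> - M) / 2)"]) (auto simp: complex_angles_iff min_less_iff_disj)
    qed
    have finsum_hol: "\<forall>\<^sub>F X in ?F. hol (\<lambda>\<theta>. \<Sum>k\<in>X. h k \<theta>) (complex_angles (\<sigma> - \<delta>))" if "0 < \<delta>" for \<delta>
      by (intro always_eventually allI hol_sum hol_subset[OF h_hol] complex_angles_mono) (use that in auto)
    have s_hol: "hol s ?A"
    proof (rule hol_localI)
      fix \<theta> :: "complex^'n" assume "\<theta> \<in> ?A"
      then obtain \<delta> where \<delta>: "0 < \<delta>" "\<delta> < \<sigma>" "\<delta> \<le> 1" "\<theta> \<in> complex_angles (\<sigma> - \<delta>)" using exhaust by blast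
      have "hol s (complex_angles (\<sigma> - \<delta>))"
        by (rule hol_uniform_limit_hol[OF open_complex_angles finsum_hol[OF \<delta>(1)] ulim[OF \<delta>(1-3)]]) simp
      then show "\<exists>E. \<theta> \<in> E \<and> hol s E" using \<delta>(4) by blast
    qed
    have s_eq: "dv s \<theta> (cvec \<omega>) = f \<theta> - c" if \<theta>: "\<theta> \<in> ?A" for \<theta>
    proof -
      obtain \<delta> where \<delta>: "0 < \<delta>" "\<delta> < \<sigma>" "\<delta> \<le> 1" "\<theta> \<in> complex_angles (\<sigma> - \<delta>)" using exhaust[OF \<theta>] by blast
      have lim: "((\<lambda>X. dv (\<lambda>\<theta>. \<Sum>k\<in>X. h k \<theta>) \<theta> (cvec \<omega>)) \<longlongrightarrow> dv s \<theta> (cvec \<omega>)) ?F"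
        by (rule tendsto_dv[OF open_complex_angles finsum_hol[OF \<delta>(1)] ulim[OF \<delta>(1-3)] _ \<delta>(4)]) simp
      have dvh: "dv (h k) \<theta> (cvec \<omega>) = (if k = (\<lambda>_. 0) then 0 else g k \<theta>)" for k
      proof (cases "k = (\<lambda>_. 0)")
        case False
        have dk: "d k \<noteq> 0" using small_divisor_bound(1)[OF dioph False \<delta>(1) N] unfolding d_def .
        have hk: "h k = (\<lambda>\<theta>. inverse (\<i> * of_real (d k)) * g k \<theta>)"
          unfolding h_def by (simp only: False if_False)
        have "dv (g k) \<theta> (cvec \<omega>) = \<i> * of_real (d k) * g k \<theta>"
          using dv_g(2)[OF \<theta> \<theta>, of k \<omega>] unfolding d_def by simp
        then have "dv (h k) \<theta> (cvec \<omega>) = inverse (\<i> * of_real (d k)) * (\<i> * of_real (d k) * g k \<theta>)"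
          unfolding hk dv_mult[OF hol_const g(1) \<theta>] by (simp only: dv_const mult_zero_left add_0_right)
        also have "\<dots> = g k \<theta>" using dk by (simp add: field_simps)
        finally show ?thesis using False by (simp only: if_False)
      qed (simp add: h_def[abs_def])
      have ev: "\<forall>\<^sub>F X in ?F. dv (\<lambda>\<theta>. \<Sum>k\<in>X. h k \<theta>) \<theta> (cvec \<omega>) = (\<Sum>k\<in>X. g k \<theta>) - c"
      proof -
        have "\<forall>\<^sub>F X in ?F. finite X \<and> {\<lambda>_. 0} \<subseteq> X \<and> X \<subseteq> UNIV"
          by (auto simp: eventually_finite_subsets_at_top intro!: exI[of _ "{\<lambda>_. 0}"])
        then show ?thesis
        proof eventually_elim
          case (elim X)
          have "dv (\<lambda>\<theta>. \<Sum>k\<in>X. h k \<theta>) \<theta> (cvec \<omega>) = (\<Sum>k\<in>X. if k = (\<lambda>_. 0) then 0 else g k \<theta>)"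
            using dv_sum_fun[of X h, OF h_hol \<theta>, of "cvec \<omega>"] unfolding dvh .
          also have "\<dots> = (\<Sum>k\<in>X. g k \<theta>) - (\<Sum>k\<in>X. if k = (\<lambda>_. 0) then g k \<theta> else 0)"
            unfolding sum_subtractf[symmetric] by (intro sum.cong) auto
          also have "\<dots> = (\<Sum>k\<in>X. g k \<theta>) - c"
            using elim c[OF \<theta>] by (simp add: sum.delta)
          finally show ?case .
        qed
      qed
      have "((\<lambda>X. (\<Sum>k\<in>X. g k \<theta>) - c) \<longlongrightarrow> f \<theta> - c) ?F"
        using g_sum[OF \<theta>] unfolding has_sum_def by (intro tendsto_diff tendsto_const)
      then have "((\<lambda>X. dv (\<lambda>\<theta>. \<Sum>k\<in>X. h k \<theta>) \<theta> (cvec \<omega>)) \<longlongrightarrow> f \<theta> - c) ?F"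
        by (rule Lim_transform_eventually) (use ev in \<open>auto elim: eventually_mono\<close>)
      from tendsto_unique[OF _ lim this] show ?thesis by simp
    qed
    have s_per: "ang_periodic \<sigma> s"
    proof -
      have "h k (\<theta> + cvec (lattice_vec l)) = h k \<theta>" if "\<theta> \<in> ?A" for k \<theta> l
        using g(2)[of k] that by (simp add: ang_periodic_def h_def)
      then show ?thesis by (simp add: ang_periodic_def s_def)
    qed
    have s_bound: "cmod (s \<theta>) \<le> K * B / \<delta> ^ \<nu>"
      if \<delta>: "0 < \<delta>" "\<delta> \<le> 1" "\<delta> < \<sigma>" and \<theta>: "\<theta> \<in> complex_angles (\<sigma> - \<delta>)" for \<delta> \<theta>
    proof -
      obtain S where S: "(W \<delta> has_sum S) UNIV" "S \<le> (16 / \<delta>) ^ n"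
        using sum_exp_weights[OF \<delta>(1,2)] unfolding W_def n_def by metis
      have hs: "((\<lambda>k. C \<delta> * W \<delta> k) has_sum C \<delta> * S) UNIV"
        using S(1) by (rule has_sum_cmult_right)
      have C0: "C \<delta> \<ge> 0" using B0 dioph(1) \<delta> by (simp add: C_def)
      have abs: "(\<lambda>k. cmod (h k \<theta>)) summable_on UNIV"
        by (rule Infinite_Sum.abs_summable_on_comparison_test'[where g="\<lambda>k. C \<delta> * W \<delta> k"])
          (use hs h_bound[OF \<delta>(1,3) \<theta>] in \<open>auto simp: summable_on_def\<close>)
      have "cmod (s \<theta>) \<le> (\<Sum>\<^sub>\<infinity>k\<in>UNIV. cmod (h k \<theta>))"
        unfolding s_def by (rule norm_infsum_bound[OF abs])
      also have "\<dots> \<le> C \<delta> * S"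
        by (rule has_sum_mono[OF has_sum_infsum[OF abs] hs]) (use h_bound[OF \<delta>(1,3) \<theta>] in auto)
      also have "\<dots> \<le> C \<delta> * (16 / \<delta>) ^ n"
        using S(2) C0 by (rule mult_left_mono)
      also have "\<dots> = (fact N * 4 ^ N * 16 ^ n / \<gamma>) * B / \<delta> ^ \<nu>"
        by (simp add: C_def \<nu>_def power_divide power_add mult_ac)
      also have "\<dots> \<le> K * B / \<delta> ^ \<nu>"
        using B0 \<delta> by (intro divide_right_mono mult_right_mono) (auto simp: K_def)
      finally show ?thesis .
    qed
    show ?case
      by (rule exI[of _ c], rule exI[of _ s]) (intro conjI ballI allI impI s_hol s_per s_eq s_bound; assumption)
  qed
  note main = this
  show ?thesis by (rule that[OF _ main]) (simp_all add: K_def)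
qed


subsection \<open>Real solutions\<close>

definition torus_fun :: "real \<Rightarrow> (complex^'n::finite \<Rightarrow> complex) \<Rightarrow> bool" where
  "torus_fun \<sigma> f \<longleftrightarrow> hol f (complex_angles \<sigma>) \<and> ang_periodic \<sigma> f \<and> (\<forall>q. f (cvec q) \<in> \<real>)"

text \<open>
  With \<open>x\<close> and \<open>y\<close> the real and imaginary parts of \<open>\<theta>\<close>, the function \<open>t \<mapsto> h (x + t y)\<close> of one variable
  vanishes for real \<open>t\<close>, hence also at \<open>t = \<i>\<close>.
\<close>

lemma zero_if_zero_on_reals:
  fixes h :: "complex^'n::finite \<Rightarrow> complex"
  assumes h: "hol h (complex_angles \<sigma>)" and z: "\<And>q. h (cvec q) = 0" and \<theta>: "\<theta> \<in> complex_angles \<sigma>"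
  shows "h \<theta> = 0"
proof -
  define x where "x = (\<chi> j. Re (\<theta> $ j))"
  define y where "y = (\<chi> j. Im (\<theta> $ j))"
  define M where "M = Max (range (\<lambda>i. \<bar>Im (\<theta> $ i)\<bar>))"
  have mx: "\<bar>y $ i\<bar> \<le> M" for i unfolding M_def y_def by (auto intro: Max_ge)
  have M\<sigma>: "M < \<sigma>" unfolding M_def using \<theta> by (subst Max_less_iff) (auto simp: complex_angles_iff)
  have M0: "0 \<le> M" using mx order_trans[OF abs_ge_zero] by blast
  define c where "c = 2 * \<sigma> / (M + \<sigma>)"
  have c1: "c > 1" using M\<sigma> M0 by (simp add: c_def field_simps)
  have cM: "c * M < \<sigma>"
  proof -
    have "\<sigma> * (2 * M) < \<sigma> * (M + \<sigma>)" using M\<sigma> M0 by (intro mult_strict_left_mono) auto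
    then show ?thesis using M\<sigma> M0 by (simp add: c_def field_simps)
  qed
  define S where "S = strip (- c) c"
  have in_A: "cvec x + t *\<^sub>C cvec y \<in> complex_angles \<sigma>" if "t \<in> S" for t
    unfolding complex_angles_iff
  proof
    fix j
    have "\<bar>Im t\<bar> * \<bar>y $ j\<bar> \<le> c * M"
      using that mx[of j] c1 by (intro mult_mono) (auto simp: S_def strip_def)
    then have "\<bar>Im t\<bar> * \<bar>y $ j\<bar> < \<sigma>" using cM by (rule le_less_trans)
    then show "\<bar>Im ((cvec x + t *\<^sub>C cvec y) $ j)\<bar> < \<sigma>" by (simp add: abs_mult)
  qed
  have lim: "(0::complex) islimpt range of_real"
    unfolding islimpt_approachable
  proof (intro allI impI)
    fix e :: real assume "e > 0"
    then show "\<exists>x'\<in>range of_real. x' \<noteq> (0::complex) \<and> dist x' 0 < e"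
      by (intro bexI[of _ "of_real (e / 2)"] rangeI) auto
  qed
  have "h (cvec x + \<i> *\<^sub>C cvec y) = 0"
  proof (rule analytic_continuation[where f="\<lambda>t. h (cvec x + t *\<^sub>C cvec y)" and S=S and U="range of_real" and \<xi>=0])
    show "(\<lambda>t. h (cvec x + t *\<^sub>C cvec y)) holomorphic_on S"
      by (rule hol_line(1)[OF h in_A])
    show "open S" "connected S" unfolding S_def by (auto intro: open_strip convex_connected convex_strip)
    show "range of_real \<subseteq> S" "0 \<in> S" "\<i> \<in> S" using c1 by (auto simp: S_def strip_def)
    show "h (cvec x + t *\<^sub>C cvec y) = 0" if t: "t \<in> range of_real" for t
    proof -
      obtain r :: real where r: "t = of_real r" using t by auto
      have "cvec x + t *\<^sub>C cvec y = cvec (x + r *\<^sub>R y)"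
        unfolding r by (simp add: vec_eq_iff complex_eq_iff)
      then show ?thesis using z by simp
    qed
  qed (rule lim)
  moreover have "cvec x + \<i> *\<^sub>C cvec y = \<theta>"
    by (simp add: vec_eq_iff x_def y_def complex_eq_iff)
  ultimately show ?thesis by simp
qed

definition cnjv :: "complex^'n \<Rightarrow> complex^'n" where
  "cnjv \<theta> = (\<chi> j. cnj (\<theta> $ j))"

lemma cnjv_simps [simp]: "cnjv \<theta> $ j = cnj (\<theta> $ j)" "cnjv (cvec q) = cvec q" "cnjv (x + y) = cnjv x + cnjv y"
  by (simp_all add: cnjv_def vec_eq_iff)

lemma cnjv_in_complex_angles [simp]: "cnjv \<theta> \<in> complex_angles \<sigma> \<longleftrightarrow> \<theta> \<in> complex_angles \<sigma>"
  by (simp add: complex_angles_iff)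

lemma reflection_has_derivative:
  fixes f :: "complex^'n::finite \<Rightarrow> complex"
  assumes f: "hol f (complex_angles \<sigma>)" and \<theta>: "\<theta> \<in> complex_angles \<sigma>"
  shows "((\<lambda>\<theta>. cnj (f (cnjv \<theta>))) has_derivative (\<lambda>v. cnj (dv f (cnjv \<theta>) (cnjv v)))) (at \<theta>)"
proof -
  have "linear (cnjv :: complex^'n \<Rightarrow> complex^'n)"
    by (intro linearI) (simp_all add: vec_eq_iff)
  then have "(cnjv has_derivative cnjv) (at \<theta>)"
    by (intro bounded_linear_imp_has_derivative) (simp add: linear_conv_bounded_linear)
  then have "((\<lambda>\<theta>. f (cnjv \<theta>)) has_derivative (\<lambda>v. dv f (cnjv \<theta>) (cnjv v))) (at \<theta>)"
    by (rule hol_has_derivative_compose[OF f, rotated]) (use \<theta> in simp)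
  then show ?thesis
    by (rule bounded_linear.has_derivative[OF bounded_linear_cnj])
qed

lemma hol_reflection:
  fixes f :: "complex^'n::finite \<Rightarrow> complex"
  assumes f: "hol f (complex_angles \<sigma>)"
  shows "hol (\<lambda>\<theta>. cnj (f (cnjv \<theta>))) (complex_angles \<sigma>)"
proof (rule holI[OF reflection_has_derivative[OF f]])
  show "cnj (dv f (cnjv \<theta>) (cnjv (c *\<^sub>C v))) = c *\<^sub>C cnj (dv f (cnjv \<theta>) (cnjv v))"
    if "\<theta> \<in> complex_angles \<sigma>" for \<theta> c v
  proof -
    have "cnjv (c *\<^sub>C v) = cnj c *\<^sub>C cnjv v" by (simp add: vec_eq_iff)
    then show ?thesis using dv_cscale[OF f, of "cnjv \<theta>"] that by simp
  qed
qed

lemma reflection_symmetric: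
  fixes f :: "complex^'n::finite \<Rightarrow> complex"
  assumes f: "torus_fun \<sigma> f" and \<theta>: "\<theta> \<in> complex_angles \<sigma>"
  shows "cnj (f (cnjv \<theta>)) = f \<theta>"
proof -
  have "(\<lambda>\<theta>. cnj (f (cnjv \<theta>)) - f \<theta>) \<theta> = 0"
    by (rule zero_if_zero_on_reals[OF _ _ \<theta>])
      (use f in \<open>auto simp: torus_fun_def intro!: hol_diff hol_reflection elim: Reals_cnj_iff[THEN iffD1, elim_format]\<close>)
  then show ?thesis by simp
qed

text \<open>
  The mean of \<open>f\<close> along the linear flow with frequency \<open>\<omega>\<close>, characterised by the solvability of
  the cohomological equation: a bounded primitive of \<open>f - c\<close> along the flow.
\<close>

definition flow_average :: "real^'n::finite \<Rightarrow> (complex^'n \<Rightarrow> complex) \<Rightarrow> complex \<Rightarrow> bool" where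
  "flow_average \<omega> f c \<longleftrightarrow> (\<exists>\<sigma>>0. \<exists>s S. hol s (complex_angles \<sigma>) \<and> (\<forall>q. cmod (s (cvec q)) \<le> S) \<and>
     (\<forall>q. dv s (cvec q) (cvec \<omega>) = f (cvec q) - c))"

lemma flow_average_add_mult:
  assumes f: "flow_average \<omega> f c" and g: "flow_average \<omega> g d"
  shows "flow_average \<omega> (\<lambda>\<theta>. f \<theta> + a * g \<theta>) (c + a * d)"
proof -
  obtain \<sigma> s S where s: "\<sigma> > 0" "hol s (complex_angles \<sigma>)" "\<And>q. cmod (s (cvec q)) \<le> S"
    "\<And>q. dv s (cvec q) (cvec \<omega>) = f (cvec q) - c"
    using f unfolding flow_average_def by blast
  obtain \<sigma>' t T where t: "\<sigma>' > 0" "hol t (complex_angles \<sigma>')" "\<And>q. cmod (t (cvec q)) \<le> T"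
    "\<And>q. dv t (cvec q) (cvec \<omega>) = g (cvec q) - d"
    using g unfolding flow_average_def by blast
  define \<sigma>'' where "\<sigma>'' = min \<sigma> \<sigma>'"
  have \<sigma>'': "\<sigma>'' > 0" using s(1) t(1) by (simp add: \<sigma>''_def)
  have h: "hol s (complex_angles \<sigma>'')" "hol t (complex_angles \<sigma>'')"
    by (rule hol_subset[OF s(2)] hol_subset[OF t(2)], rule complex_angles_mono, simp add: \<sigma>''_def)+
  have ht: "hol (\<lambda>\<theta>. a * t \<theta>) (complex_angles \<sigma>'')" by (rule hol_mult[OF hol_const h(2)])
  have "dv (\<lambda>\<theta>. s \<theta> + a * t \<theta>) (cvec q) (cvec \<omega>) = f (cvec q) + a * g (cvec q) - (c + a * d)" for q
  proof -
    have q: "cvec q \<in> complex_angles \<sigma>''" using \<sigma>'' by simp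
    show ?thesis
      unfolding dv_plus[OF h(1) ht q] dv_mult[OF hol_const h(2) q] s(4) t(4) by (simp add: algebra_simps)
  qed
  moreover have "cmod (s (cvec q) + a * t (cvec q)) \<le> S + cmod a * T" for q
    by (intro order_trans[OF norm_triangle_ineq] add_mono s) (simp add: norm_mult mult_left_mono t)
  ultimately show ?thesis
    unfolding flow_average_def using \<sigma>'' hol_add[OF h(1) ht] by blast
qed

lemma flow_average_sum:
  assumes f: "flow_average \<omega> f c" and g: "\<And>i. i \<in> I \<Longrightarrow> flow_average \<omega> (g i) (d i)"
  shows "flow_average \<omega> (\<lambda>\<theta>. f \<theta> + (\<Sum>i\<in>I. a i * g i \<theta>)) (c + (\<Sum>i\<in>I. a i * d i))"
  using g
proof (induction I rule: infinite_finite_induct)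
  case (insert i I)
  have "flow_average \<omega> (\<lambda>\<theta>. (f \<theta> + (\<Sum>i\<in>I. a i * g i \<theta>)) + a i * g i \<theta>) ((c + (\<Sum>i\<in>I. a i * d i)) + a i * d i)"
    by (rule flow_average_add_mult) (use insert in auto)
  then show ?case using insert.hyps by (simp add: add_ac)
qed (use f in auto)

text \<open>
  Integrating along the flow over a long time, the bounded primitive contributes a bounded amount and
  \<open>c\<close> a multiple of the time. Only values on the real torus enter, and the bound on the frequency change
  in a step relies on that: it must not deteriorate with the width \<open>\<delta>\<close>.
\<close>

lemma flow_average_bound:
  assumes f: "flow_average \<omega> f c" and B: "\<And>q. cmod (f (cvec q)) \<le> B"
  shows "cmod c \<le> B"
proof -
  obtain \<sigma> s S where \<sigma>: "\<sigma> > 0" and s: "hol s (complex_angles \<sigma>)" "\<And>q. cmod (s (cvec q)) \<le> S"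
    "\<And>q. dv s (cvec q) (cvec \<omega>) = f (cvec q) - c"
    using f unfolding flow_average_def by blast
  have real_line: "of_real t *\<^sub>C cvec \<omega> = cvec (t *\<^sub>R \<omega>)" for t :: real
    by (simp add: vec_eq_iff complex_eq_iff)
  have le: "t * (cmod c - B) \<le> 2 * S" if t: "t \<ge> 0" for t
  proof -
    define W where "W z = s (0 + z *\<^sub>C cvec \<omega>) + c * z" for z
    have conv: "convex (of_real ` {0..t} :: complex set)"
      by (intro convex_linear_image linear_of_real) auto
    have "cmod (W (of_real t) - W 0) \<le> B * cmod (of_real t - 0)"
    proof (rule field_differentiable_bound[OF conv])
      fix z :: complex assume "z \<in> of_real ` {0..t}"
      then obtain r :: real where r: "z = of_real r" by auto
      have "((\<lambda>z. s (0 + z *\<^sub>C cvec \<omega>)) has_field_derivative dv s (0 + z *\<^sub>C cvec \<omega>) (cvec \<omega>)) (at z)"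
        by (rule hol_line(2)[OF s(1), where T="{z}"]) (use \<sigma> in \<open>auto simp: r real_line simp del: cscale_of_real\<close>)
      then have "(W has_field_derivative (f (cvec (r *\<^sub>R \<omega>)) - c) + c * 1) (at z)"
        unfolding W_def[abs_def] r add_0 real_line s(3)
        by (intro DERIV_add DERIV_cmult DERIV_ident) 
      then show "(W has_field_derivative f (cvec (Re z *\<^sub>R \<omega>))) (at z within of_real ` {0..t})"
        by (simp add: r has_field_derivative_at_within)
      show "cmod (f (cvec (Re z *\<^sub>R \<omega>))) \<le> B" by (rule B)
    qed (use t in auto)
    then have "cmod (s (cvec (t *\<^sub>R \<omega>)) + c * of_real t - s (cvec 0)) \<le> B * t"
      using t real_line[of t] real_line[of 0] by (simp add: W_def)
    moreover have "cmod (c * of_real t) \<le> cmod (s (cvec (t *\<^sub>R \<omega>)) + c * of_real t - s (cvec 0)) + cmod (s (cvec (t *\<^sub>R \<omega>))) + cmod (s (cvec 0))"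
      by norm
    moreover have "cmod (c * of_real t) = t * cmod c" using t by (simp add: norm_mult)
    ultimately have "t * cmod c \<le> B * t + S + S" using s(2)[of "t *\<^sub>R \<omega>"] s(2)[of 0] by linarith
    then show ?thesis by (simp add: algebra_simps)
  qed
  show ?thesis
  proof (rule ccontr)
    assume "\<not> cmod c \<le> B"
    then have pos: "cmod c - B > 0" by simp
    have S0: "S \<ge> 0" using order_trans[OF norm_ge_zero s(2)] .
    have "(2 * S + 1) / (cmod c - B) * (cmod c - B) \<le> 2 * S"
      by (rule le) (use pos S0 in simp)
    then show False using pos by simp
  qed
qed

lemma flow_average_unique:
  assumes "flow_average \<omega> f c" "flow_average \<omega> f d"
  shows "c = d"
proof -
  have "cmod (c + (- 1) * d) \<le> 0"
    by (rule flow_average_bound[OF flow_average_add_mult[OF assms, of "- 1"]]) simp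
  then show ?thesis by simp
qed

text \<open>
  Averaging a complex solution with its reflection gives a solution that is real at real points. The
  bound on the derivatives is a Cauchy estimate on half of the width, hence one more power of \<open>1 / \<delta>\<close>.
\<close>

lemma cohomological_solution:
  fixes \<omega> :: "real^'n::finite"
  assumes dioph: "\<gamma> > 0" "diophantine \<gamma> \<tau> \<omega>"
  obtains K \<nu> where "K \<ge> 1" "\<And>\<sigma> f B. 0 < \<sigma> \<Longrightarrow> torus_fun \<sigma> f \<Longrightarrow> \<forall>\<theta>\<in>complex_angles \<sigma>. cmod (f \<theta>) \<le> B \<Longrightarrow>
    \<exists>c s. torus_fun \<sigma> s \<and> flow_average \<omega> f (of_real c) \<and>
      (\<forall>\<theta>\<in>complex_angles \<sigma>. dv s \<theta> (cvec \<omega>) = f \<theta> - of_real c) \<and>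
      (\<forall>\<delta>. 0 < \<delta> \<longrightarrow> \<delta> \<le> 1 \<longrightarrow> \<delta> < \<sigma> \<longrightarrow> (\<forall>\<theta>\<in>complex_angles (\<sigma> - \<delta>).
        cmod (s \<theta>) \<le> K * B / \<delta> ^ \<nu> \<and> (\<forall>j. cmod (dv s \<theta> (e\<^sub>C j)) \<le> K * B / \<delta> ^ \<nu>)))"
proof -
  obtain K \<nu> where K: "K \<ge> 1" and sol: "\<And>\<sigma> f B. 0 < \<sigma> \<Longrightarrow> hol f (complex_angles \<sigma>) \<Longrightarrow> ang_periodic \<sigma> f \<Longrightarrow>
    \<forall>\<theta>\<in>complex_angles \<sigma>. cmod (f \<theta>) \<le> B \<Longrightarrow>
    \<exists>c s. hol s (complex_angles \<sigma>) \<and> ang_periodic \<sigma> s \<and>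
      (\<forall>\<theta>\<in>complex_angles \<sigma>. dv s \<theta> (cvec \<omega>) = f \<theta> - c) \<and>
      (\<forall>\<delta>. 0 < \<delta> \<longrightarrow> \<delta> \<le> 1 \<longrightarrow> \<delta> < \<sigma> \<longrightarrow> (\<forall>\<theta>\<in>complex_angles (\<sigma> - \<delta>). cmod (s \<theta>) \<le> K * B / \<delta> ^ \<nu>))"
    by (rule complex_cohomological_solution[OF dioph]) blast
  define K' where "K' = K * 2 ^ Suc \<nu>"
  have "\<exists>c s. torus_fun \<sigma> s \<and> flow_average \<omega> f (of_real c) \<and>
      (\<forall>\<theta>\<in>complex_angles \<sigma>. dv s \<theta> (cvec \<omega>) = f \<theta> - of_real c) \<and>
      (\<forall>\<delta>. 0 < \<delta> \<longrightarrow> \<delta> \<le> 1 \<longrightarrow> \<delta> < \<sigma> \<longrightarrow> (\<forall>\<theta>\<in>complex_angles (\<sigma> - \<delta>).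
        cmod (s \<theta>) \<le> K' * B / \<delta> ^ Suc \<nu> \<and> (\<forall>j. cmod (dv s \<theta> (e\<^sub>C j)) \<le> K' * B / \<delta> ^ Suc \<nu>)))"
    if \<sigma>: "0 < \<sigma>" and f: "torus_fun \<sigma> f" and B: "\<forall>\<theta>\<in>complex_angles \<sigma>. cmod (f \<theta>) \<le> B" for \<sigma> f B
  proof -
    let ?A = "complex_angles \<sigma> :: (complex^'n) set"
    have f': "hol f ?A" "ang_periodic \<sigma> f" using f by (auto simp: torus_fun_def)
    obtain c s where s: "hol s ?A" "ang_periodic \<sigma> s" "\<And>\<theta>. \<theta> \<in> ?A \<Longrightarrow> dv s \<theta> (cvec \<omega>) = f \<theta> - c"
      and s_bound: "\<And>\<delta> \<theta>. 0 < \<delta> \<Longrightarrow> \<delta> \<le> 1 \<Longrightarrow> \<delta> < \<sigma> \<Longrightarrow> \<theta> \<in> complex_angles (\<sigma> - \<delta>) \<Longrightarrow> cmod (s \<theta>) \<le> K * B / \<delta> ^ \<nu>"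
      using sol[OF \<sigma> f' B] by (elim exE conjE) blast
    define S where "S \<theta> = (1 / 2) * (s \<theta> + cnj (s (cnjv \<theta>)))" for \<theta>
    note r = hol_reflection[OF s(1)]
    have S_hol: "hol S ?A" unfolding S_def by (intro hol_mult hol_const hol_add s r)
    have S_per: "ang_periodic \<sigma> S" using s(2) by (simp add: S_def ang_periodic_def)
    have S_real: "S (cvec q) \<in> \<real>" for q by (simp add: S_def complex_is_Real_iff)
    have S_tf: "torus_fun \<sigma> S" using S_hol S_per S_real by (simp add: torus_fun_def)
    have S_dv: "dv S \<theta> (cvec \<omega>) = f \<theta> - of_real (Re c)" if \<theta>: "\<theta> \<in> ?A" for \<theta>
    proof -
      have "dv S \<theta> (cvec \<omega>) = (1 / 2) * (dv s \<theta> (cvec \<omega>) + dv (\<lambda>\<theta>. cnj (s (cnjv \<theta>))) \<theta> (cvec \<omega>))"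
        unfolding S_def dv_mult[OF hol_const hol_add[OF s(1) r] \<theta>] dv_plus[OF s(1) r \<theta>] by simp
      also have "dv (\<lambda>\<theta>. cnj (s (cnjv \<theta>))) \<theta> (cvec \<omega>) = cnj (dv s (cnjv \<theta>) (cvec \<omega>))"
        using dv_eqI[OF reflection_has_derivative[OF s(1) \<theta>]] by simp
      also have "dv s (cnjv \<theta>) (cvec \<omega>) = f (cnjv \<theta>) - c" using s(3) \<theta> by simp
      also have "cnj (f (cnjv \<theta>) - c) = f \<theta> - cnj c" using reflection_symmetric[OF f \<theta>] by simp
      finally show ?thesis using s(3)[OF \<theta>] by (simp add: complex_eq_iff)
    qed
    have S_bound: "cmod (S \<theta>) \<le> K * B / \<delta> ^ \<nu>" if "0 < \<delta>" "\<delta> \<le> 1" "\<delta> < \<sigma>" "\<theta> \<in> complex_angles (\<sigma> - \<delta>)" for \<delta> \<theta>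
    proof -
      have "cmod (s \<theta> + cnj (s (cnjv \<theta>))) \<le> K * B / \<delta> ^ \<nu> + K * B / \<delta> ^ \<nu>"
        using s_bound[OF that] s_bound[of \<delta> "cnjv \<theta>"] that
        by (intro order_trans[OF norm_triangle_ineq] add_mono) auto
      then show ?thesis by (simp add: S_def norm_mult norm_divide mult_ac)
    qed
    have B0: "B \<ge> 0"
      using bspec[OF B, of "cvec 0"] \<sigma> by (intro order_trans[OF norm_ge_zero]) auto
    have av: "flow_average \<omega> f (of_real (Re c))"
      unfolding flow_average_def
    proof (intro exI conjI allI)
      define \<delta> where "\<delta> = min 1 (\<sigma> / 2)"
      have \<delta>: "0 < \<delta>" "\<delta> \<le> 1" "\<delta> < \<sigma>" using \<sigma> by (auto simp: \<delta>_def)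
      show "cmod (S (cvec q)) \<le> K * B / \<delta> ^ \<nu>" for q by (rule S_bound[OF \<delta>]) (use \<delta> in simp)
    qed (use \<sigma> S_hol S_dv in auto)
    have bounds: "cmod (S \<theta>) \<le> K' * B / \<delta> ^ Suc \<nu> \<and> (\<forall>j. cmod (dv S \<theta> (e\<^sub>C j)) \<le> K' * B / \<delta> ^ Suc \<nu>)"
      if \<delta>: "0 < \<delta>" "\<delta> \<le> 1" "\<delta> < \<sigma>" and \<theta>: "\<theta> \<in> complex_angles (\<sigma> - \<delta>)" for \<delta> \<theta>
    proof (intro conjI allI)
      have p2: "(1::real) \<le> 2 ^ Suc \<nu>" by (rule one_le_power) simp
      have "cmod (S \<theta>) \<le> K * B * 1 / \<delta> ^ \<nu>" using S_bound[OF \<delta> \<theta>] by simp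
      also have "\<dots> \<le> K * B * 2 ^ Suc \<nu> / \<delta> ^ Suc \<nu>"
        using \<delta> B0 K p2 by (intro frac_le mult_left_mono power_decreasing mult_nonneg_nonneg) auto
      finally show "cmod (S \<theta>) \<le> K' * B / \<delta> ^ Suc \<nu>" by (simp add: K'_def mult_ac)
      fix j
      have "cmod (dv S \<theta> (e\<^sub>C j)) \<le> (K * B / (\<delta> / 2) ^ \<nu>) / (\<delta> / 2)"
      proof (rule dv_axis_bound)
        show "hol S (complex_angles (\<sigma> - \<delta> / 2))"
          by (rule hol_subset[OF S_hol complex_angles_mono]) (use \<delta> in simp)
        show "\<theta> \<in> complex_angles (\<sigma> - \<delta> / 2 - \<delta> / 2)" using \<theta> by simp
        show "cmod (S \<theta>') \<le> K * B / (\<delta> / 2) ^ \<nu>" if "\<theta>' \<in> complex_angles (\<sigma> - \<delta> / 2)" for \<theta>'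
          by (rule S_bound) (use \<delta> that in auto)
      qed (use \<delta> in auto)
      also have "\<dots> = K' * B / \<delta> ^ Suc \<nu>"
        by (simp add: K'_def power_divide field_simps)
      finally show "cmod (dv S \<theta> (e\<^sub>C j)) \<le> K' * B / \<delta> ^ Suc \<nu>" .
    qed
    show ?thesis
      by (rule exI[of _ "Re c"], rule exI[of _ S]) (intro conjI ballI allI impI S_tf av S_dv bounds[THEN conjunct1] bounds[THEN conjunct2, rule_format]; assumption)
  qed
  note main = this
  have "K' \<ge> 1" using K mult_mono[of 1 K 1 "2 ^ Suc \<nu>"] one_le_power[of "2::real" "Suc \<nu>"] by (simp add: K'_def)
  then show ?thesis by (rule that[OF _ main])
qed

section \<open>Power series of holomorphic functions of several variables\<close>

definition dv_iter :: "nat \<Rightarrow> 'a::complex_space \<Rightarrow> ('a \<Rightarrow> complex) \<Rightarrow> 'a \<Rightarrow> complex" where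
  "dv_iter m e F = ((\<lambda>G y. dv G y e) ^^ m) F"

lemma hol_dv_iter: "open D \<Longrightarrow> hol F D \<Longrightarrow> hol (dv_iter m e F) D"
  by (induction m) (auto simp: dv_iter_def intro: hol_dv)

lemma higher_deriv_line:
  fixes F :: "'a::complex_space \<Rightarrow> complex"
  assumes D: "open D" "hol F D" and y: "\<And>t. cmod t < R \<Longrightarrow> y + t *\<^sub>C e \<in> D"
  shows "cmod t < R \<Longrightarrow> (deriv ^^ m) (\<lambda>t. F (y + t *\<^sub>C e)) t = dv_iter m e F (y + t *\<^sub>C e)"
proof (induction m arbitrary: t)
  case (Suc m)
  have "\<forall>\<^sub>F t' in nhds t. t' \<in> ball 0 R"
    using Suc.prems by (intro eventually_nhds_in_open) auto
  then have "\<forall>\<^sub>F t' in nhds t. (deriv ^^ m) (\<lambda>t. F (y + t *\<^sub>C e)) t' = dv_iter m e F (y + t' *\<^sub>C e)"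
    by eventually_elim (simp add: Suc.IH)
  then have "deriv ((deriv ^^ m) (\<lambda>t. F (y + t *\<^sub>C e))) t = deriv (\<lambda>t'. dv_iter m e F (y + t' *\<^sub>C e)) t"
    by (rule deriv_cong_ev) simp
  also have "\<dots> = dv (dv_iter m e F) (y + t *\<^sub>C e) e"
    by (rule DERIV_imp_deriv, rule hol_line(2)[OF hol_dv_iter[OF D], where T="ball 0 R"]) (use y Suc.prems in auto)
  finally show ?case by (simp add: dv_iter_def)
qed (simp add: dv_iter_def)

text \<open>
  One coordinate at a time: the Taylor coefficients in one direction are holomorphic in the remaining
  variables and satisfy the Cauchy estimates, so they can be expanded in turn.
\<close>

lemma hol_power_series:
  fixes F :: "'a::complex_space \<Rightarrow> complex" and e :: "'i \<Rightarrow> 'a"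
  assumes "finite J" "R > 0" "open D" "hol F D"
    and "\<And>z. \<forall>b\<in>J. cmod (z b) < R \<Longrightarrow> x + (\<Sum>b\<in>J. z b *\<^sub>C e b) \<in> D \<and> cmod (F (x + (\<Sum>b\<in>J. z b *\<^sub>C e b))) \<le> B"
  shows "\<exists>a. (\<forall>\<alpha>\<in>PiE J (\<lambda>_. UNIV). cmod (a \<alpha>) \<le> B * (\<Prod>b\<in>J. (1 / R) ^ \<alpha> b)) \<and>
    (\<forall>z. (\<forall>b\<in>J. cmod (z b) < R) \<longrightarrow>
      ((\<lambda>\<alpha>. a \<alpha> * (\<Prod>b\<in>J. z b ^ \<alpha> b)) has_sum F (x + (\<Sum>b\<in>J. z b *\<^sub>C e b))) (PiE J (\<lambda>_. UNIV)))"
  using assms(1,4,5)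
proof (induction J arbitrary: F B rule: finite_induct)
  case empty
  show ?case
    by (rule exI[of _ "\<lambda>_. F x"]) (use empty(2)[of "\<lambda>_. 0"] in \<open>auto simp: has_sum_finiteI\<close>)
next
  case (insert j J F B)
  note R = assms(2) and D = assms(3)
  define Fm where "Fm m y = inverse (fact m) * dv_iter m (e j) F y" for m y
  define pt where "pt z = x + (\<Sum>b\<in>J. z b *\<^sub>C e b)" for z
  have line: "pt z + t *\<^sub>C e j \<in> D \<and> cmod (F (pt z + t *\<^sub>C e j)) \<le> B"
    if "\<forall>b\<in>J. cmod (z b) < R" "cmod t < R" for z t
  proof -
    have "x + (\<Sum>b\<in>insert j J. (z(j := t)) b *\<^sub>C e b) = pt z + t *\<^sub>C e j"
    proof -
      have "(\<Sum>b\<in>J. (z(j := t)) b *\<^sub>C e b) = (\<Sum>b\<in>J. z b *\<^sub>C e b)"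
        by (rule sum.cong) (use insert.hyps in auto)
      then show ?thesis using insert.hyps by (simp add: pt_def add_ac)
    qed
    moreover have "\<forall>b\<in>insert j J. cmod ((z(j := t)) b) < R"
      using that by auto
    ultimately show ?thesis using insert.prems(2)[of "z(j := t)"] by simp
  qed
  have Fm_hol: "hol (Fm m) D" for m
    unfolding Fm_def by (intro hol_mult hol_const hol_dv_iter D insert.prems(1))
  have Fm_eq: "Fm m (pt z) = (deriv ^^ m) (\<lambda>t. F (pt z + t *\<^sub>C e j)) 0 / fact m"
    if "\<forall>b\<in>J. cmod (z b) < R" for z m
    using higher_deriv_line[OF D insert.prems(1), of R "pt z" "e j" 0 m] line[OF that] R
    by (simp add: Fm_def divide_inverse mult.commute)
  have F_holo: "(\<lambda>t. F (pt z + t *\<^sub>C e j)) holomorphic_on ball 0 R" if "\<forall>b\<in>J. cmod (z b) < R" for z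
    by (rule hol_line(1)[OF insert.prems(1)]) (use line[OF that] in auto)
  have Fm_bound: "cmod (Fm m (pt z)) \<le> B * (1 / R) ^ m" if z: "\<forall>b\<in>J. cmod (z b) < R" for z m
    using Cauchy_coefficient_bound[OF F_holo[OF z] R, of B m] line[OF z] unfolding Fm_eq[OF z]
    by (simp add: power_divide)
  have "\<forall>m. \<exists>a. (\<forall>\<alpha>\<in>PiE J (\<lambda>_. UNIV). cmod (a \<alpha>) \<le> (B * (1 / R) ^ m) * (\<Prod>b\<in>J. (1 / R) ^ \<alpha> b)) \<and>
    (\<forall>z. (\<forall>b\<in>J. cmod (z b) < R) \<longrightarrow>
      ((\<lambda>\<alpha>. a \<alpha> * (\<Prod>b\<in>J. z b ^ \<alpha> b)) has_sum Fm m (x + (\<Sum>b\<in>J. z b *\<^sub>C e b))) (PiE J (\<lambda>_. UNIV)))"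
  proof
    fix m
    show "\<exists>a. (\<forall>\<alpha>\<in>PiE J (\<lambda>_. UNIV). cmod (a \<alpha>) \<le> (B * (1 / R) ^ m) * (\<Prod>b\<in>J. (1 / R) ^ \<alpha> b)) \<and>
    (\<forall>z. (\<forall>b\<in>J. cmod (z b) < R) \<longrightarrow>
      ((\<lambda>\<alpha>. a \<alpha> * (\<Prod>b\<in>J. z b ^ \<alpha> b)) has_sum Fm m (x + (\<Sum>b\<in>J. z b *\<^sub>C e b))) (PiE J (\<lambda>_. UNIV)))"
    proof (rule insert.IH[OF Fm_hol])
      fix z :: "'i \<Rightarrow> complex" assume z: "\<forall>b\<in>J. cmod (z b) < R"
      show "x + (\<Sum>b\<in>J. z b *\<^sub>C e b) \<in> D \<and> cmod (Fm m (x + (\<Sum>b\<in>J. z b *\<^sub>C e b))) \<le> B * (1 / R) ^ m"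
        using line[OF z, of 0] Fm_bound[OF z] R by (simp add: pt_def)
    qed
  qed
  from choice[OF this] obtain a where
    a_bound: "\<And>m \<alpha>. \<alpha> \<in> PiE J (\<lambda>_. UNIV) \<Longrightarrow> cmod (a m \<alpha>) \<le> (B * (1 / R) ^ m) * (\<Prod>b\<in>J. (1 / R) ^ \<alpha> b)"
    and a_sum: "\<And>m z. \<forall>b\<in>J. cmod (z b) < R \<Longrightarrow>
      ((\<lambda>\<alpha>. a m \<alpha> * (\<Prod>b\<in>J. z b ^ \<alpha> b)) has_sum Fm m (pt z)) (PiE J (\<lambda>_. UNIV))"
    unfolding pt_def by blast
  define a' where "a' \<alpha> = a (\<alpha> j) (\<alpha>(j := undefined))" for \<alpha>
  have upd: "\<alpha>(j := undefined) = \<alpha>" "a' (\<alpha>(j := m)) = a m \<alpha>" if "\<alpha> \<in> PiE J (\<lambda>_. UNIV)" for \<alpha> m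
  proof -
    show 1: "\<alpha>(j := undefined) = \<alpha>" using that insert.hyps by (auto simp: PiE_def extensional_def)
    show "a' (\<alpha>(j := m)) = a m \<alpha>" unfolding a'_def using 1 by simp
  qed
  have prod_upd: "(\<Prod>b\<in>insert j J. z b ^ ((\<alpha>(j := m)) b)) = z j ^ m * (\<Prod>b\<in>J. z b ^ \<alpha> b)" for z :: "'i \<Rightarrow> complex" and \<alpha> m
  proof -
    have "(\<Prod>b\<in>J. z b ^ ((\<alpha>(j := m)) b)) = (\<Prod>b\<in>J. z b ^ \<alpha> b)"
      by (rule prod.cong) (use insert.hyps in auto)
    then show ?thesis using insert.hyps by simp
  qed
  show ?case
  proof (intro exI[of _ a'] conjI ballI allI impI)
    fix \<alpha> :: "'i \<Rightarrow> nat" assume \<alpha>: "\<alpha> \<in> PiE (insert j J) (\<lambda>_. UNIV)"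
    have \<alpha>J: "\<alpha>(j := undefined) \<in> PiE J (\<lambda>_. UNIV)"
      using \<alpha> insert.hyps by (auto simp: PiE_def extensional_def)
    have "(\<Prod>b\<in>J. (1 / R) ^ ((\<alpha>(j := undefined)) b)) = (\<Prod>b\<in>J. (1 / R) ^ \<alpha> b)"
      by (rule prod.cong) (use insert.hyps in auto)
    then show "cmod (a' \<alpha>) \<le> B * (\<Prod>b\<in>insert j J. (1 / R) ^ \<alpha> b)"
      using a_bound[OF \<alpha>J, of "\<alpha> j"] insert.hyps by (simp add: a'_def mult.assoc)
  next
    fix z :: "'i \<Rightarrow> complex" assume z': "\<forall>b\<in>insert j J. cmod (z b) < R"
    then have z: "\<forall>b\<in>J. cmod (z b) < R" by simp
    have zj: "cmod (z j) < R" using z' by simp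
    define q where "q b = cmod (z b) / R" for b
    have q: "0 \<le> q b" "q b < 1" if "b \<in> insert j J" for b
      using z' that R by (auto simp: q_def)
    have geo: "((\<lambda>m. q b ^ m) has_sum (1 / (1 - q b))) UNIV" if "b \<in> insert j J" for b
      using q[OF that] by (intro sums_nonneg_imp_has_sum geometric_sums) auto
    have term_bound: "cmod (a m \<alpha> * (z j ^ m * (\<Prod>b\<in>J. z b ^ \<alpha> b))) \<le> B * (q j ^ m * (\<Prod>b\<in>J. q b ^ \<alpha> b))"
      if \<alpha>: "\<alpha> \<in> PiE J (\<lambda>_. UNIV)" for m \<alpha>
    proof -
      have "cmod (a m \<alpha> * (z j ^ m * (\<Prod>b\<in>J. z b ^ \<alpha> b))) = cmod (a m \<alpha>) * (cmod (z j) ^ m * (\<Prod>b\<in>J. cmod (z b) ^ \<alpha> b))"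
        by (simp add: norm_mult norm_power prod_norm[symmetric])
      also have "\<dots> \<le> ((B * (1 / R) ^ m) * (\<Prod>b\<in>J. (1 / R) ^ \<alpha> b)) * (cmod (z j) ^ m * (\<Prod>b\<in>J. cmod (z b) ^ \<alpha> b))"
        by (intro mult_right_mono a_bound \<alpha> mult_nonneg_nonneg prod_nonneg) auto
      also have "\<dots> = B * (((1 / R) ^ m * cmod (z j) ^ m) * ((\<Prod>b\<in>J. (1 / R) ^ \<alpha> b) * (\<Prod>b\<in>J. cmod (z b) ^ \<alpha> b)))"
        by (simp only: mult_ac)
      also have "\<dots> = B * (q j ^ m * (\<Prod>b\<in>J. q b ^ \<alpha> b))"
        by (simp add: q_def power_divide prod_dividef)
      finally show ?thesis .
    qed
    have prodsum: "((\<lambda>\<alpha>. \<Prod>b\<in>J. q b ^ \<alpha> b) has_sum (\<Prod>b\<in>J. 1 / (1 - q b))) (PiE J (\<lambda>_. UNIV))"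
      by (rule has_sum_prod_PiE) (use insert.hyps geo q in auto)
    have "(\<lambda>(m, \<alpha>). q j ^ m * (\<Prod>b\<in>J. q b ^ \<alpha> b)) summable_on (UNIV \<times> PiE J (\<lambda>_. UNIV))"
    proof (rule summable_on_SigmaI)
      show "((\<lambda>\<alpha>. case (m, \<alpha>) of (m, \<alpha>) \<Rightarrow> q j ^ m * (\<Prod>b\<in>J. q b ^ \<alpha> b)) has_sum q j ^ m * (\<Prod>b\<in>J. 1 / (1 - q b))) (PiE J (\<lambda>_. UNIV))" for m
        using has_sum_cmult_right[OF prodsum] by simp
      show "(\<lambda>m. q j ^ m * (\<Prod>b\<in>J. 1 / (1 - q b))) summable_on UNIV"
        by (intro summable_on_cmult_left) (use geo[of j] in \<open>auto simp: summable_on_def\<close>)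
    qed (use q in \<open>auto intro!: mult_nonneg_nonneg prod_nonneg\<close>)
    then have "(\<lambda>p. B * (case p of (m, \<alpha>) \<Rightarrow> q j ^ m * (\<Prod>b\<in>J. q b ^ \<alpha> b))) summable_on (UNIV \<times> PiE J (\<lambda>_. UNIV))"
      by (rule summable_on_cmult_right)
    then have "(\<lambda>p. cmod (case p of (m, \<alpha>) \<Rightarrow> a m \<alpha> * (z j ^ m * (\<Prod>b\<in>J. z b ^ \<alpha> b)))) summable_on (UNIV \<times> PiE J (\<lambda>_. UNIV))"
      by (rule Infinite_Sum.abs_summable_on_comparison_test') (use term_bound in \<open>simp add: split_def mem_Times_iff\<close>)
    then have summ: "(\<lambda>(m, \<alpha>). a m \<alpha> * (z j ^ m * (\<Prod>b\<in>J. z b ^ \<alpha> b))) summable_on (UNIV \<times> PiE J (\<lambda>_. UNIV))"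
      by (rule abs_summable_summable)
    have inner: "((\<lambda>\<alpha>. a m \<alpha> * (z j ^ m * (\<Prod>b\<in>J. z b ^ \<alpha> b))) has_sum z j ^ m * Fm m (pt z)) (PiE J (\<lambda>_. UNIV))" for m
      using has_sum_cmult_right[OF a_sum[OF z, of m], of "z j ^ m"] by (simp add: mult_ac)
    have outer: "((\<lambda>m. z j ^ m * Fm m (pt z)) has_sum F (pt z + z j *\<^sub>C e j)) UNIV"
    proof (rule norm_summable_imp_has_sum)
      show "(\<lambda>m. z j ^ m * Fm m (pt z)) sums F (pt z + z j *\<^sub>C e j)"
        using holomorphic_power_series[OF F_holo[OF z], of "z j"] zj unfolding Fm_eq[OF z] by (simp add: mult.commute)
      show "summable (\<lambda>m. cmod (z j ^ m * Fm m (pt z)))"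
      proof (rule summable_comparison_test)
        show "\<exists>N. \<forall>m\<ge>N. norm (cmod (z j ^ m * Fm m (pt z))) \<le> B * q j ^ m"
          using mult_left_mono[OF Fm_bound[OF z], of "cmod (z j) ^ _"]
          by (intro exI[of _ 0]) (simp add: norm_mult norm_power q_def power_divide field_simps)
        show "summable (\<lambda>m. B * q j ^ m)"
          using q[of j] by (intro summable_mult summable_geometric) auto
      qed
    qed
    show "((\<lambda>\<alpha>. a' \<alpha> * (\<Prod>b\<in>insert j J. z b ^ \<alpha> b)) has_sum F (x + (\<Sum>b\<in>insert j J. z b *\<^sub>C e b))) (PiE (insert j J) (\<lambda>_. UNIV))"
    proof (rule has_sum_PiE_insert[OF insert.hyps(2)])
      have eq: "x + (\<Sum>b\<in>insert j J. z b *\<^sub>C e b) = pt z + z j *\<^sub>C e j"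
        using insert.hyps by (simp add: pt_def add_ac)
      have "((\<lambda>(m, \<alpha>). a m \<alpha> * (z j ^ m * (\<Prod>b\<in>J. z b ^ \<alpha> b))) has_sum F (pt z + z j *\<^sub>C e j)) (UNIV \<times> PiE J (\<lambda>_. UNIV))"
        by (rule has_sum_SigmaI[OF _ outer summ]) (use inner in simp)
      then show "((\<lambda>(m, \<alpha>). a' (\<alpha>(j := m)) * (\<Prod>b\<in>insert j J. z b ^ ((\<alpha>(j := m)) b))) has_sum
          F (x + (\<Sum>b\<in>insert j J. z b *\<^sub>C e b))) (UNIV \<times> PiE J (\<lambda>_. UNIV))"
        unfolding prod_upd eq by (rule has_sum_cong[THEN iffD1, rotated]) (auto simp: upd(2))
    qed
  qed
qed

section \<open>Functions on phase space\<close>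

definition pdom :: "real \<Rightarrow> real \<Rightarrow> ('n::finite) cphase set" where
  "pdom r \<sigma> = {x. (\<forall>i. cmod (fst x $ i) < r) \<and> snd x \<in> complex_angles \<sigma>}"

abbreviation e\<^sub>P :: "'n::finite \<Rightarrow> 'n cphase" where
  "e\<^sub>P i \<equiv> (axis i 1, 0)"

abbreviation pd :: "'n::finite \<Rightarrow> ('n cphase \<Rightarrow> complex) \<Rightarrow> 'n cphase \<Rightarrow> complex" where
  "pd i f x \<equiv> dv f x (e\<^sub>P i)"

definition grad :: "(complex^'n::finite \<Rightarrow> complex) \<Rightarrow> complex^'n \<Rightarrow> complex^'n" where
  "grad s q = (\<chi> j. dv s q (e\<^sub>C j))"

definition shiftv :: "int^'n \<Rightarrow> ('n::finite) cphase" where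
  "shiftv k = (0, cvec (lattice_vec k))"

definition phase_fun :: "real \<Rightarrow> real \<Rightarrow> (('n::finite) cphase \<Rightarrow> complex) \<Rightarrow> bool" where
  "phase_fun r \<sigma> f \<longleftrightarrow> hol f (pdom r \<sigma>) \<and> (\<forall>x\<in>pdom r \<sigma>. \<forall>k. f (x + shiftv k) = f x) \<and>
     (\<forall>p q. (cvec p, cvec q) \<in> pdom r \<sigma> \<longrightarrow> f (cvec p, cvec q) \<in> \<real>)"

lemma pdom_Pair [simp]: "(P, \<theta>) \<in> pdom r \<sigma> \<longleftrightarrow> (\<forall>i. cmod (P $ i) < r) \<and> \<theta> \<in> complex_angles \<sigma>"
  by (simp add: pdom_def)

lemma open_pdom: "open (pdom r \<sigma> :: ('n::finite) cphase set)"
proof -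
  have "pdom r \<sigma> = (\<Inter>i\<in>UNIV. {P :: complex^'n. cmod (P $ i) < r}) \<times> complex_angles \<sigma>"
    by (auto simp: pdom_def)
  moreover have "open {P :: complex^'n. cmod (P $ i) < r}" for i
    by (intro open_Collect_less continuous_intros)
  ultimately show ?thesis by (auto intro!: open_Times open_INT open_complex_angles)
qed

lemma pdom_mono: "r' \<le> r \<Longrightarrow> \<sigma>' \<le> \<sigma> \<Longrightarrow> pdom r' \<sigma>' \<subseteq> pdom r \<sigma>"
  using complex_angles_mono[of \<sigma>' \<sigma>] unfolding pdom_def by (blast intro: less_le_trans)

lemma pdom_add:
  assumes "x \<in> pdom r \<sigma>" "\<And>i. cmod (fst w $ i) \<le> a" "\<And>i. cmod (snd w $ i) \<le> b"
  shows "x + w \<in> pdom (r + a) (\<sigma> + b)"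
proof -
  have "cmod (fst x $ i + fst w $ i) < r + a" for i
  proof -
    have "cmod (fst x $ i) < r" using assms(1) by (simp add: pdom_def)
    then have "cmod (fst x $ i) + cmod (fst w $ i) < r + a" using assms(2) by (rule add_less_le_mono)
    then show ?thesis using norm_triangle_ineq by (rule le_less_trans[rotated])
  qed
  then show ?thesis using complex_angles_add[of "snd x" \<sigma> "snd w" b] assms by (auto simp: pdom_def)
qed

lemma pdom_shiftv [simp]: "x + shiftv k \<in> pdom r \<sigma> \<longleftrightarrow> x \<in> pdom r \<sigma>"
  by (simp add: pdom_def shiftv_def)

lemma dv_translation_invariant:
  fixes f :: "'a::complex_space \<Rightarrow> complex"
  assumes f: "hol f D" and D: "open D" "x \<in> D" "\<And>y. y \<in> D \<Longrightarrow> y + c \<in> D" and inv: "\<And>y. y \<in> D \<Longrightarrow> f (y + c) = f y"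
  shows "dv f (x + c) v = dv f x v"
proof -
  have "((\<lambda>y. f (y + c)) has_derivative dv f (x + c)) (at x)"
    by (rule hol_has_derivative_compose[OF f, where g="\<lambda>y. y + c"]) (use D in \<open>auto intro!: derivative_eq_intros\<close>)
  then have "(f has_derivative dv f (x + c)) (at x)"
    by (rule has_derivative_transform_within_open[OF _ D(1,2)]) (rule inv)
  then show ?thesis using dv_eqI by metis
qed

lemma dv_real:
  fixes f :: "'a::complex_space \<Rightarrow> complex"
  assumes f: "hol f D" "x \<in> D" and re: "\<forall>\<^sub>F h in at_right 0. f (x + h *\<^sub>R v) \<in> \<real>" "f x \<in> \<real>"
  shows "dv f x v \<in> \<real>"
proof -
  have "((\<lambda>t. f (x + t *\<^sub>C v)) has_field_derivative dv f (x + 0 *\<^sub>C v) v) (at 0)"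
    by (rule hol_line(2)[OF hol_subset[OF f(1), of "{x}"], where T="{0}"]) (use f in auto)
  then have "((\<lambda>t. (f (x + t *\<^sub>C v) - f x) / t) \<longlongrightarrow> dv f x v) (at 0)"
    by (simp add: DERIV_def)
  moreover have "filterlim complex_of_real (at 0) (at_right 0)"
    unfolding filterlim_at
  proof
    show "\<forall>\<^sub>F h in at_right 0. complex_of_real h \<in> UNIV \<and> complex_of_real h \<noteq> 0"
      using eventually_at_right_less[of "0::real"] by (auto elim!: eventually_mono)
    show "(complex_of_real \<longlongrightarrow> 0) (at_right 0)"
      using tendsto_of_real[OF tendsto_ident_at[of "0::real" "{0<..}"]] by simp
  qed
  ultimately have "((\<lambda>h. (f (x + of_real h *\<^sub>C v) - f x) / of_real h) \<longlongrightarrow> dv f x v) (at_right 0)"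
    by (rule filterlim_compose)
  moreover have "\<forall>\<^sub>F h in at_right 0. (f (x + of_real h *\<^sub>C v) - f x) / of_real h \<in> \<real>"
    using re(1) by eventually_elim (use re(2) in \<open>auto intro!: Reals_divide Reals_diff\<close>)
  ultimately show ?thesis
    by (intro Lim_in_closed_set[of "\<real> :: complex set" _ "at_right (0::real)"]) (auto simp: closed_complex_Reals)
qed

lemma torus_funD: "torus_fun \<sigma> f \<Longrightarrow> hol f (complex_angles \<sigma>)"
  "torus_fun \<sigma> f \<Longrightarrow> ang_periodic \<sigma> f" "torus_fun \<sigma> f \<Longrightarrow> f (cvec q) \<in> \<real>"
  by (auto simp: torus_fun_def)

lemma torus_fun_dv:
  assumes f: "torus_fun \<sigma> f" and \<sigma>: "\<sigma> > 0"
  shows "torus_fun \<sigma> (\<lambda>\<theta>. dv f \<theta> (cvec a))"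
  unfolding torus_fun_def
proof (intro conjI allI)
  note h = torus_funD(1)[OF f]
  show "hol (\<lambda>\<theta>. dv f \<theta> (cvec a)) (complex_angles \<sigma>)" by (rule hol_dv[OF open_complex_angles h])
  show "ang_periodic \<sigma> (\<lambda>\<theta>. dv f \<theta> (cvec a))"
    unfolding ang_periodic_def
    by (intro ballI allI dv_translation_invariant[OF h open_complex_angles])
      (use torus_funD(2)[OF f] in \<open>auto simp: ang_periodic_def\<close>)
  fix q
  show "dv f (cvec q) (cvec a) \<in> \<real>"
  proof (rule dv_real[OF h])
    have "cvec q + h *\<^sub>R cvec a = cvec (q + h *\<^sub>R a)" for h
      by (simp add: vec_eq_iff complex_eq_iff)
    then show "\<forall>\<^sub>F h in at_right 0. f (cvec q + h *\<^sub>R cvec a) \<in> \<real>"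
      using torus_funD(3)[OF f] by simp
  qed (use \<sigma> torus_funD(3)[OF f] in auto)
qed

lemma axis_eq_cvec: "e\<^sub>C j = cvec (axis j 1)"
  by (simp add: vec_eq_iff axis_def)

lemma torus_fun_dv_axis: "torus_fun \<sigma> f \<Longrightarrow> \<sigma> > 0 \<Longrightarrow> torus_fun \<sigma> (\<lambda>\<theta>. dv f \<theta> (e\<^sub>C j))"
  unfolding axis_eq_cvec by (rule torus_fun_dv)

lemma torus_fun_const: "c \<in> \<real> \<Longrightarrow> torus_fun \<sigma> (\<lambda>_. c)"
  by (simp add: torus_fun_def hol_const ang_periodic_def)

lemma torus_fun_add: "torus_fun \<sigma> f \<Longrightarrow> torus_fun \<sigma> g \<Longrightarrow> torus_fun \<sigma> (\<lambda>\<theta>. f \<theta> + g \<theta>)"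
  and torus_fun_mult: "torus_fun \<sigma> f \<Longrightarrow> torus_fun \<sigma> g \<Longrightarrow> torus_fun \<sigma> (\<lambda>\<theta>. f \<theta> * g \<theta>)"
  and torus_fun_minus: "torus_fun \<sigma> f \<Longrightarrow> torus_fun \<sigma> (\<lambda>\<theta>. - f \<theta>)"
  by (auto simp: torus_fun_def ang_periodic_def intro: hol_add hol_mult hol_minus)

lemma torus_fun_sum: "(\<And>i. i \<in> I \<Longrightarrow> torus_fun \<sigma> (f i)) \<Longrightarrow> torus_fun \<sigma> (\<lambda>\<theta>. \<Sum>i\<in>I. f i \<theta>)"
  by (induction I rule: infinite_finite_induct) (auto intro: torus_fun_const torus_fun_add)

lemma torus_fun_subset: "torus_fun \<sigma> f \<Longrightarrow> \<sigma>' \<le> \<sigma> \<Longrightarrow> torus_fun \<sigma>' f"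
  using complex_angles_mono[of \<sigma>' \<sigma>] by (auto simp: torus_fun_def ang_periodic_def intro: hol_subset)

lemma phase_funD: "phase_fun r \<sigma> f \<Longrightarrow> hol f (pdom r \<sigma>)"
  "phase_fun r \<sigma> f \<Longrightarrow> x \<in> pdom r \<sigma> \<Longrightarrow> f (x + shiftv k) = f x"
  "phase_fun r \<sigma> f \<Longrightarrow> (cvec p, cvec q) \<in> pdom r \<sigma> \<Longrightarrow> f (cvec p, cvec q) \<in> \<real>"
  by (auto simp: phase_fun_def)

lemma hol_zero_section: "hol (\<lambda>\<theta>. (0, \<theta>)) D"
  by (intro hol_Pair hol_const hol_id)

lemma zero_section_in_pdom [simp]: "r > 0 \<Longrightarrow> (0, \<theta>) \<in> pdom r \<sigma> \<longleftrightarrow> \<theta> \<in> complex_angles \<sigma>"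
  by simp

lemma torus_fun_restriction:
  assumes f: "phase_fun r \<sigma> f" and r: "r > 0" and \<sigma>: "\<sigma> > 0"
  shows "torus_fun \<sigma> (\<lambda>\<theta>. f (0, \<theta>))"
  unfolding torus_fun_def ang_periodic_def
proof (intro conjI ballI allI)
  show "hol (\<lambda>\<theta>. f (0, \<theta>)) (complex_angles \<sigma>)"
    by (rule hol_compose[OF phase_funD(1)[OF f] hol_zero_section]) (use r in auto)
  show "f (0, \<theta> + cvec (lattice_vec k)) = f (0, \<theta>)" if "\<theta> \<in> complex_angles \<sigma>" for \<theta> k
    using phase_funD(2)[OF f, of "(0, \<theta>)" k] that r by (simp add: shiftv_def)
  have "(0 :: complex^'a) = cvec 0" by (simp add: vec_eq_iff)
  then show "f (0, cvec q) \<in> \<real>" for q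
    using phase_funD(3)[OF f, of 0 q] r \<sigma> by simp
qed

lemma phase_fun_pd:
  assumes f: "phase_fun r \<sigma> f"
  shows "phase_fun r \<sigma> (pd i f)"
  unfolding phase_fun_def
proof (intro conjI ballI allI impI)
  note h = phase_funD(1)[OF f]
  show "hol (pd i f) (pdom r \<sigma>)" by (rule hol_dv[OF open_pdom h])
  show "pd i f (x + shiftv k) = pd i f x" if "x \<in> pdom r \<sigma>" for x k
    by (rule dv_translation_invariant[OF h open_pdom that]) (use phase_funD(2)[OF f] in auto)
  show "pd i f (cvec p, cvec q) \<in> \<real>" if pq: "(cvec p, cvec q) \<in> pdom r \<sigma>" for p q
  proof (rule dv_real[OF h pq])
    have eq: "(cvec p, cvec q) + h *\<^sub>R e\<^sub>P i = (cvec (p + h *\<^sub>R axis i 1), cvec q)" for h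
      by (simp add: vec_eq_iff complex_eq_iff axis_def)
    have "((\<lambda>h. (cvec p, cvec q) + h *\<^sub>R e\<^sub>P i) \<longlongrightarrow> (cvec p, cvec q) + 0 *\<^sub>R e\<^sub>P i) (at_right 0)"
      by (intro tendsto_intros)
    then have "\<forall>\<^sub>F h in at_right 0. (cvec p, cvec q) + h *\<^sub>R e\<^sub>P i \<in> pdom r \<sigma>"
      by (rule topological_tendstoD[OF _ open_pdom]) (use pq in \<open>simp add: zero_prod_def[symmetric]\<close>)
    then show "\<forall>\<^sub>F h in at_right 0. f ((cvec p, cvec q) + h *\<^sub>R e\<^sub>P i) \<in> \<real>"
      unfolding eq by eventually_elim (rule phase_funD(3)[OF f])
    show "f (cvec p, cvec q) \<in> \<real>" by (rule phase_funD(3)[OF f pq])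
  qed
qed

lemma phase_fun_subset: "phase_fun r \<sigma> f \<Longrightarrow> r' \<le> r \<Longrightarrow> \<sigma>' \<le> \<sigma> \<Longrightarrow> phase_fun r' \<sigma>' f"
  using pdom_mono[of r' r \<sigma>' \<sigma>] unfolding phase_fun_def by (blast intro: hol_subset)

lemma dv_momentum_sum:
  assumes f: "hol f (pdom r \<sigma>)" and x: "x \<in> pdom r \<sigma>"
  shows "dv f x (u, 0) = (\<Sum>j\<in>UNIV. u $ j * pd j f x)"
proof -
  have "(u, 0) = (\<Sum>j\<in>UNIV. u $ j *\<^sub>C (axis j 1, 0 :: complex^'a))"
    by (simp add: prod_eq_iff fst_sum snd_sum flip: vec_sum_axis)
  then show ?thesis
    using dv_sum[OF f x, of "\<lambda>j. u $ j *\<^sub>C e\<^sub>P j" UNIV] by (simp add: dv_cscale[OF f x] del: cscale_Pair)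
qed

lemma dv_angle_sum:
  assumes "hol s (complex_angles \<sigma>)" "q \<in> complex_angles \<sigma>"
  shows "dv s q v = (\<Sum>j\<in>UNIV. v $ j * dv s q (e\<^sub>C j))"
proof -
  have "dv s q v = dv s q (\<Sum>j\<in>UNIV. v $ j *\<^sub>C e\<^sub>C j)" by (simp flip: vec_sum_axis)
  then show ?thesis unfolding dv_sum[OF assms] dv_cscale[OF assms] by simp
qed

text \<open>Cauchy estimates in the actions: the polydisc of radius \<open>r\<close>, increments of size \<open>S\<close>.\<close>

lemma action_Cauchy_bounds:
  assumes f: "hol f (pdom r \<sigma>)" and B: "\<And>x. x \<in> pdom r \<sigma> \<Longrightarrow> cmod (f x) \<le> B"
    and q: "q \<in> complex_angles \<sigma>" and u: "\<And>i. cmod (u $ i) \<le> S" and S: "0 < S" "2 * S \<le> r"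
  shows "cmod (f (u, q) - f (0, q)) \<le> 2 * B * S / r"
    and "cmod (f (u, q) - f (0, q) - dv f (0, q) (u, 0)) \<le> 2 * B * S\<^sup>2 / r\<^sup>2"
proof -
  have r: "r > 0" using S by simp
  have R: "r / S > 0" "r / S \<ge> 2" using S r by (auto simp: field_simps)
  have in_D: "(0, q) + t *\<^sub>C (u, 0) \<in> pdom r \<sigma>" if t: "cmod t < r / S" for t
  proof -
    have "cmod t * cmod (u $ i) < r" for i
    proof -
      have "cmod t * cmod (u $ i) \<le> cmod t * S" using u by (rule mult_left_mono) simp
      also have "\<dots> < r" using t S by (simp add: field_simps)
      finally show ?thesis .
    qed
    then show ?thesis using q by (simp add: norm_mult)
  qed
  note C = hol_Cauchy_bounds[OF f in_D R(1), of B]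
  show "cmod (f (u, q) - f (0, q)) \<le> 2 * B * S / r"
    using C(2) in_D B R S by simp
  show "cmod (f (u, q) - f (0, q) - dv f (0, q) (u, 0)) \<le> 2 * B * S\<^sup>2 / r\<^sup>2"
    using C(3) in_D B R S by (simp add: power_divide)
qed

lemma pd_bound:
  assumes f: "hol f (pdom r \<sigma>)" and B: "\<And>x. x \<in> pdom r \<sigma> \<Longrightarrow> cmod (f x) \<le> B" and r: "0 < a" "a \<le> r"
    and x: "x \<in> pdom (r - a) \<sigma>"
  shows "cmod (pd i f x) \<le> B / a"
proof -
  have "x + t *\<^sub>C e\<^sub>P i \<in> pdom r \<sigma>" if "cmod t < a" for t
    using pdom_add[OF x, of "t *\<^sub>C e\<^sub>P i" a 0] that r by (simp add: axis_def less_imp_le)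
  then show ?thesis
    by (intro hol_Cauchy_bounds(1)[OF f _ r(1)]) (use B in auto)
qed

lemma pd_bound_at_0:
  assumes f: "hol f (pdom r \<sigma>)" and B: "\<And>x. x \<in> pdom r \<sigma> \<Longrightarrow> cmod (f x) \<le> B" and r: "0 < r"
    and q: "q \<in> complex_angles \<sigma>"
  shows "cmod (pd i f (0, q)) \<le> B / r"
proof -
  have "(0, q) + t *\<^sub>C e\<^sub>P i \<in> pdom r \<sigma>" if "cmod t < r" for t
    using that r q by (simp add: axis_def)
  then show ?thesis
    by (intro hol_Cauchy_bounds(1)[OF f _ r]) (use B in auto)
qed

lemma norm_sum_le_card:
  fixes f :: "'n::finite \<Rightarrow> 'b::real_normed_vector"
  shows "(\<And>i. norm (f i) \<le> M) \<Longrightarrow> norm (\<Sum>i\<in>UNIV. f i) \<le> real CARD('n) * M"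
  using sum_norm_le[of UNIV f "\<lambda>_. M"] by simp

section \<open>Matrices near the identity\<close>

definition near_id :: "'a::real_normed_field^'n::finite^'n \<Rightarrow> bool" where
  "near_id A \<longleftrightarrow> (\<forall>i k. norm (A $ i $ k - (if i = k then 1 else 0)) \<le> 1 / (2 * real CARD('n)))"

lemma near_identity_error:
  fixes A :: "'a::real_normed_field^'n::finite^'n"
  assumes A: "\<And>i k. norm (A $ i $ k - (if i = k then 1 else 0)) \<le> a" and x: "\<And>i. norm (x $ i) \<le> b"
  shows "norm ((A *v x) $ i - x $ i) \<le> real CARD('n) * a * b"
proof -
  have "(A *v x) $ i - x $ i = (\<Sum>k\<in>UNIV. (A $ i $ k - (if i = k then 1 else 0)) * x $ k)"
    by (simp add: matrix_vector_mult_def left_diff_distrib sum_subtractf if_distrib[where f="\<lambda>y. y * _"] cong: if_cong)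
  also have "norm \<dots> \<le> real CARD('n) * (a * b)"
  proof (rule norm_sum_le_card)
    fix k
    show "norm ((A $ i $ k - (if i = k then 1 else 0)) * x $ k) \<le> a * b"
      unfolding norm_mult by (rule mult_mono[OF A x]) (use order_trans[OF norm_ge_zero A] in auto)
  qed
  finally show ?thesis by (simp add: mult.assoc)
qed

text \<open>
  The rows of \<open>A - 1\<close> have sums at most \<open>1 / 2\<close>, so the largest entry of \<open>x\<close> is at most doubled by the
  inverse. Invertibility follows.
\<close>

lemma near_id_norm:
  fixes A :: "'a::real_normed_field^'n::finite^'n"
  assumes A: "near_id A" and b: "\<And>i. norm ((A *v x) $ i) \<le> b"
  shows "norm (x $ i) \<le> 2 * b"
proof -
  define m where "m = Max (range (\<lambda>i. norm (x $ i)))"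
  have m: "norm (x $ i) \<le> m" for i unfolding m_def by (rule Max_ge) auto
  have "m \<in> range (\<lambda>i. norm (x $ i))" unfolding m_def by (rule Max_in) auto
  then obtain k where k: "m = norm (x $ k)" by auto
  have "norm ((A *v x) $ k - x $ k) \<le> real CARD('n) * (1 / (2 * real CARD('n))) * m"
    by (rule near_identity_error[OF _ m]) (use A in \<open>simp add: near_id_def\<close>)
  then have "norm ((A *v x) $ k - x $ k) \<le> m / 2" by simp
  moreover have "norm (x $ k) \<le> norm ((A *v x) $ k) + norm ((A *v x) $ k - x $ k)"
    by (metis norm_minus_commute norm_triangle_sub)
  ultimately have "m \<le> 2 * b" using b[of k] k by simp
  then show ?thesis using m[of i] by simp
qed

lemma near_id_transpose: "near_id A \<Longrightarrow> near_id (transpose A)"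
proof -
  assume A: "near_id A"
  have "norm (transpose A $ i $ k - (if i = k then 1 else 0)) \<le> 1 / (2 * real CARD('b))" for i k
    using A[unfolded near_id_def, rule_format, of k i] by (simp add: transpose_def eq_commute)
  then show ?thesis by (simp add: near_id_def)
qed

lemma near_id_invertible:
  fixes A :: "'a::real_normed_field^'n::finite^'n"
  assumes A: "near_id A"
  shows "invertible A"
proof -
  have "x = 0" if "A *v x = 0" for x
    using near_id_norm[OF A, of x 0] that by (simp add: vec_eq_iff)
  then show ?thesis
    unfolding invertible_left_inverse matrix_left_invertible_ker by blast
qed

lemma matrix_inv_mult:
  fixes A :: "'a::real_normed_field^'n::finite^'n"
  assumes "invertible A"
  shows "A ** matrix_inv A = mat 1" "matrix_inv A ** A = mat 1"
  using someI_ex[OF assms[unfolded invertible_def]] unfolding matrix_inv_def by auto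

section \<open>One step: the linearised equations\<close>

text \<open>
  What the Newton step uses of the Diophantine condition: the equation can be solved on every strip,
  with a loss of a power of \<open>\<delta>\<close> whose exponent and constant do not depend on the strip.
\<close>

definition cohom_solvable :: "real^'n::finite \<Rightarrow> real \<Rightarrow> nat \<Rightarrow> bool" where
  "cohom_solvable \<omega> K \<nu> \<longleftrightarrow> K \<ge> 1 \<and> (\<forall>\<sigma> f B. 0 < \<sigma> \<longrightarrow> torus_fun \<sigma> f \<longrightarrow>
    (\<forall>\<theta>\<in>complex_angles \<sigma>. cmod (f \<theta>) \<le> B) \<longrightarrow>
    (\<exists>c s. torus_fun \<sigma> s \<and> flow_average \<omega> f (of_real c) \<and>
      (\<forall>\<theta>\<in>complex_angles \<sigma>. dv s \<theta> (cvec \<omega>) = f \<theta> - of_real c) \<and>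
      (\<forall>\<delta>. 0 < \<delta> \<longrightarrow> \<delta> \<le> 1 \<longrightarrow> \<delta> < \<sigma> \<longrightarrow> (\<forall>\<theta>\<in>complex_angles (\<sigma> - \<delta>).
        cmod (s \<theta>) \<le> K * B / \<delta> ^ \<nu> \<and> (\<forall>j. cmod (dv s \<theta> (e\<^sub>C j)) \<le> K * B / \<delta> ^ \<nu>)))))"

lemma near_id_solve_bound:
  fixes T :: "real^'n::finite^'n"
  assumes T: "near_id T" and b: "\<And>i. \<bar>y $ i\<bar> \<le> b"
  obtains \<mu> where "T *v \<mu> = y" "\<And>i. \<bar>\<mu> $ i\<bar> \<le> 2 * b"
proof -
  define \<mu> where "\<mu> = matrix_inv T *v y"
  have eq: "T *v \<mu> = y"
    using matrix_inv_mult[OF near_id_invertible[OF T]] by (simp add: \<mu>_def matrix_vector_mul_assoc)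
  have "\<bar>\<mu> $ i\<bar> \<le> 2 * b" for i
    using near_id_norm[OF T, of \<mu> b i] b by (simp add: eq)
  then show ?thesis by (rule that[OF eq])
qed

text \<open>
  The data of a step. \<open>f\<close> is the current Hamiltonian, with error \<open>E\<close> in normal form, and the \<open>l k\<close>
  are the directions in which a change of the frequency moves it; they stay close to the actions.
  Constants are uniform as long as the domain has size at least \<open>\<rho>\<close>.
\<close>

locale step_data =
  fixes \<omega> :: "real^'n::finite" and K :: real and \<nu> :: nat
    and f :: "'n cphase \<Rightarrow> complex" and l :: "'n \<Rightarrow> 'n cphase \<Rightarrow> complex"
    and n \<rho> r \<sigma> \<delta> B \<kappa> E :: real
  assumes n: "n = real CARD('n)" and solvable: "cohom_solvable \<omega> K \<nu>"
    and sizes: "0 < \<rho>" "\<rho> \<le> r" "r \<le> 1" "\<rho> \<le> \<sigma>" "\<sigma> \<le> 1" "0 < \<delta>" "4 * \<delta> \<le> \<rho>" "B \<ge> 1" "E > 0" "0 \<le> \<kappa>" "\<kappa> \<le> 1"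
    and f: "phase_fun r \<sigma> f" "\<And>x. x \<in> pdom r \<sigma> \<Longrightarrow> cmod (f x) \<le> B"
    and l: "\<And>k. phase_fun r \<sigma> (l k)" "\<And>k x. x \<in> pdom r \<sigma> \<Longrightarrow> cmod (l k x - fst x $ k) \<le> \<kappa>"
    and err: "\<And>\<theta>. \<theta> \<in> complex_angles \<sigma> \<Longrightarrow> cmod (f (0, \<theta>) - f (0, 0)) \<le> E"
      "\<And>\<theta> i. \<theta> \<in> complex_angles \<sigma> \<Longrightarrow> cmod (pd i f (0, \<theta>) - of_real (\<omega> $ i)) \<le> E"
begin

definition c1 :: real where "c1 = 1 / \<rho> + n * (4 * B / \<rho>\<^sup>2) * (K * (2 / \<rho>) ^ \<nu>)"
definition c2 :: real where "c2 = 1 + n * (4 * B / \<rho>\<^sup>2) * (K * (2 / \<rho>) ^ \<nu>)"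
definition c3 :: real where "c3 = K * (1 + 2 * n * c2)"
definition c4 :: real where "c4 = 1 + n * (2 * c2 * (4 / \<rho>)) + n * (4 * B / \<rho>\<^sup>2 * c3)"
definition c5 :: real where "c5 = K * c4"
definition c6 :: real where "c6 = 2 * (B + 1) * c3\<^sup>2 / \<rho>\<^sup>2 + n * (c3 * (1 + n * (2 * c2 * (4 / \<rho>))))"
definition c7 :: real where "c7 = 2 * (2 * B / \<rho>) * c3\<^sup>2 / (\<rho> / 2)\<^sup>2 + n * (2 * c2 * (2 * (4 / \<rho>) * c3 / (\<rho> / 2)))"
definition A :: real where
  "A = 2 * c5 + 4 * c3 / \<rho> + 4 * n * c2 + 2 * n * c5 * 2 + 2 * c3 + c6 + c7 + 2 * c4 * c5 + 2 * c2"

end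

text \<open>
  The iteration converges because these constants are the same in all steps: they depend on \<open>n\<close>,
  \<open>K\<close>, \<open>\<nu>\<close>, \<open>\<rho>\<close> and \<open>B\<close> alone, and not on the shrinking widths.
\<close>

context step_data
begin

lemma K1: "K \<ge> 1" using solvable by (simp add: cohom_solvable_def)

lemma n1: "n \<ge> 1" by (simp add: n Suc_le_eq)

lemma norm_sum_le_n:
  fixes g :: "'n \<Rightarrow> complex"
  shows "(\<And>i. cmod (g i) \<le> M) \<Longrightarrow> cmod (\<Sum>i\<in>UNIV. g i) \<le> n * M"
  unfolding n by (rule norm_sum_le_card)

lemma c_pos: "0 < c1" "1 \<le> c2" "1 \<le> c3" "1 \<le> c4" "1 \<le> c5" "0 \<le> c6" "0 \<le> c7"
proof -
  have q: "0 \<le> n * (4 * B / \<rho>\<^sup>2) * (K * (2 / \<rho>) ^ \<nu>)"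
    using sizes K1 n1 by (intro mult_nonneg_nonneg divide_nonneg_nonneg zero_le_power) auto
  show "0 < c1" unfolding c1_def using q sizes by (intro add_pos_nonneg) auto
  show c2: "1 \<le> c2" unfolding c2_def using q by simp
  have "1 * 1 \<le> c3" unfolding c3_def using K1 c2 n1 by (intro mult_mono) auto
  then show c3: "1 \<le> c3" by simp
  have "0 \<le> n * (2 * c2 * (4 / \<rho>))" "0 \<le> n * (4 * B / \<rho>\<^sup>2 * c3)"
    using sizes c2 c3 n1 by (auto intro!: mult_nonneg_nonneg divide_nonneg_nonneg)
  then show c4: "1 \<le> c4" unfolding c4_def by linarith
  have "1 * 1 \<le> c5" unfolding c5_def using K1 c4 by (intro mult_mono) auto
  then show "1 \<le> c5" by simp
  show "0 \<le> c6" unfolding c6_def using sizes c2 c3 n1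
    by (intro add_nonneg_nonneg mult_nonneg_nonneg divide_nonneg_nonneg; simp)
  show "0 \<le> c7" unfolding c7_def using sizes c2 c3 n1
    by (intro add_nonneg_nonneg mult_nonneg_nonneg divide_nonneg_nonneg; simp)
qed

lemma pow_le: "a \<le> b \<Longrightarrow> 1 / \<delta> ^ a \<le> 1 / \<delta> ^ b"
  using sizes by (intro frac_le power_decreasing) auto

lemma r_pos: "0 < r" "0 < \<sigma>" "\<delta> \<le> 1" using sizes by auto

lemma f_hol: "hol f (pdom r \<sigma>)" and pdf_hol: "hol (pd i f) (pdom r \<sigma>)"
  and l_hol: "hol (l k) (pdom r \<sigma>)" and pdl_hol: "hol (pd i (l k)) (pdom r \<sigma>)"
  using f(1) l(1) by (auto intro: phase_funD(1) phase_fun_pd)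

lemma l_bound: "x \<in> pdom r \<sigma> \<Longrightarrow> cmod (l k x) \<le> 2"
proof -
  assume x: "x \<in> pdom r \<sigma>"
  have "cmod (fst x $ k) \<le> 1" using x sizes by (auto simp: pdom_def intro: order_trans[OF less_imp_le])
  moreover have "cmod (l k x) \<le> cmod (fst x $ k) + cmod (l k x - fst x $ k)"
    by (metis norm_minus_commute norm_triangle_sub)
  ultimately show "cmod (l k x) \<le> 2" using l(2)[OF x, of k] sizes by linarith
qed

lemma pdf_bound: "x \<in> pdom (r / 2) \<sigma> \<Longrightarrow> cmod (pd i f x) \<le> 2 * B / \<rho>"
proof -
  assume x: "x \<in> pdom (r / 2) \<sigma>"
  have "cmod (pd i f x) \<le> B / (r / 2)"
    by (rule pd_bound[OF f_hol f(2)]) (use x sizes in auto)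
  also have "\<dots> \<le> 2 * B / \<rho>" using sizes by (simp add: frac_le)
  finally show ?thesis .
qed

lemma pdl_bound: "x \<in> pdom (r / 2) \<sigma> \<Longrightarrow> cmod (pd i (l k) x) \<le> 4 / \<rho>"
proof -
  assume x: "x \<in> pdom (r / 2) \<sigma>"
  have "cmod (pd i (l k) x) \<le> 2 / (r / 2)"
    by (rule pd_bound[OF l_hol l_bound]) (use x sizes in auto)
  also have "\<dots> \<le> 4 / \<rho>" using sizes by (simp add: frac_le)
  finally show ?thesis .
qed

definition Q :: "'n \<Rightarrow> 'n \<Rightarrow> complex^'n \<Rightarrow> complex" where "Q i j \<theta> = pd j (pd i f) (0, \<theta>)"

lemma Q_bound: "\<theta> \<in> complex_angles \<sigma> \<Longrightarrow> cmod (Q i j \<theta>) \<le> 4 * B / \<rho>\<^sup>2"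
proof -
  assume \<theta>: "\<theta> \<in> complex_angles \<sigma>"
  have h: "hol (pd i f) (pdom (r / 2) \<sigma>)"
    by (rule hol_subset[OF pdf_hol pdom_mono]) (use r_pos in auto)
  have "cmod (Q i j \<theta>) \<le> (2 * B / \<rho>) / (r / 2)"
    unfolding Q_def by (rule pd_bound_at_0[OF h pdf_bound]) (use \<theta> r_pos in auto)
  also have "\<dots> \<le> (2 * B / \<rho>) / (\<rho> / 2)" using sizes by (intro divide_left_mono) auto
  also have "\<dots> = 4 * B / \<rho>\<^sup>2" by (simp add: power2_eq_square)
  finally show ?thesis .
qed

lemma pdl_near: "\<theta> \<in> complex_angles \<sigma> \<Longrightarrow> cmod (pd i (l k) (0, \<theta>) - (if i = k then 1 else 0)) \<le> \<kappa> / \<rho>"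
proof -
  assume \<theta>: "\<theta> \<in> complex_angles \<sigma>"
  have h: "hol (\<lambda>x. fst x $ k) (pdom r \<sigma>)" by (intro hol_nth hol_fst hol_id)
  have x: "(0, \<theta>) \<in> pdom r \<sigma>" using \<theta> r_pos by simp
  have "pd i (\<lambda>x. l k x - fst x $ k) (0, \<theta>) = pd i (l k) (0, \<theta>) - pd i (\<lambda>x. fst x $ k) (0, \<theta>)"
    by (rule dv_minus[OF l_hol h x])
  also have "pd i (\<lambda>x. fst x $ k) (0, \<theta>) = (if i = k then 1 else 0)"
    using dv_nth[OF hol_fst[OF hol_id] x, of k "e\<^sub>P i"] dv_fst[OF hol_id x, of "e\<^sub>P i"] by (simp add: axis_def)
  finally have "cmod (pd i (l k) (0, \<theta>) - (if i = k then 1 else 0)) = cmod (pd i (\<lambda>x. l k x - fst x $ k) (0, \<theta>))"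
    by simp
  also have "\<dots> \<le> \<kappa> / r"
    by (rule pd_bound_at_0[OF hol_diff[OF l_hol h] l(2)]) (use r_pos \<theta> in auto)
  also have "\<dots> \<le> \<kappa> / \<rho>" using sizes by (simp add: frac_le)
  finally show ?thesis .
qed

lemma torus_parts: "torus_fun \<sigma> (\<lambda>\<theta>. f (0, \<theta>))" "torus_fun \<sigma> (\<lambda>\<theta>. pd i f (0, \<theta>))"
  "torus_fun \<sigma> (\<lambda>\<theta>. l k (0, \<theta>))" "torus_fun \<sigma> (\<lambda>\<theta>. pd i (l k) (0, \<theta>))" "torus_fun \<sigma> (Q i j)"
  unfolding Q_def by (intro torus_fun_restriction[where r=r] phase_fun_pd f l r_pos)+

text \<open>
  The frequency change \<open>\<mu>\<close>, the action shift \<open>s\<close> and the angle change \<open>v\<close>. The equation for \<open>v\<close> needs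
  a right-hand side with zero mean. As \<open>s\<close> depends linearly on \<open>\<mu>\<close>, this is a linear system for
  \<open>\<mu>\<close>; it is close to the identity because its coefficients only see the real torus, which stays at
  a distance from the boundary of the domain, so that no power of \<open>\<delta>\<close> enters.
\<close>

lemma linearised_equations:
  assumes \<kappa>: "\<kappa> * c1 \<le> 1 / (2 * n)"
  obtains \<mu> :: "real^'n" and s :: "complex^'n \<Rightarrow> complex" and v :: "'n \<Rightarrow> complex^'n \<Rightarrow> complex" and c :: complex
    and \<beta> :: "'n \<Rightarrow> complex^'n \<Rightarrow> complex"
  where "\<And>i. \<bar>\<mu> $ i\<bar> \<le> 2 * c2 * E" "torus_fun \<sigma> s" "\<And>i. torus_fun (\<sigma> - \<delta>) (v i)" "\<And>i. hol (\<beta> i) (complex_angles \<sigma>)"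
    "\<And>\<theta>. \<theta> \<in> complex_angles \<sigma> \<Longrightarrow> f (0, \<theta>) + (\<Sum>k\<in>UNIV. of_real (\<mu> $ k) * l k (0, \<theta>)) + dv s \<theta> (cvec \<omega>) = c"
    "\<And>\<theta> i. \<theta> \<in> complex_angles \<sigma> \<Longrightarrow> \<beta> i \<theta> = pd i f (0, \<theta>) - of_real (\<omega> $ i) + (\<Sum>k\<in>UNIV. of_real (\<mu> $ k) * pd i (l k) (0, \<theta>)) + (\<Sum>j\<in>UNIV. Q i j \<theta> * dv s \<theta> (e\<^sub>C j))"
    "\<And>\<theta> i. \<theta> \<in> complex_angles (\<sigma> - \<delta>) \<Longrightarrow> dv (v i) \<theta> (cvec \<omega>) = \<beta> i \<theta>"
    "\<And>\<theta> j. \<theta> \<in> complex_angles (\<sigma> - \<delta>) \<Longrightarrow> cmod (dv s \<theta> (e\<^sub>C j)) \<le> c3 * E / \<delta> ^ \<nu>"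
    "\<And>\<theta> i. \<theta> \<in> complex_angles (\<sigma> - \<delta>) \<Longrightarrow> cmod (\<beta> i \<theta>) \<le> c4 * E / \<delta> ^ \<nu>"
    "\<And>\<theta> i. \<theta> \<in> complex_angles (\<sigma> - 2 * \<delta>) \<Longrightarrow> cmod (v i \<theta>) \<le> c5 * E / \<delta> ^ (2 * \<nu>)"
    "\<And>\<theta> i j. \<theta> \<in> complex_angles (\<sigma> - 2 * \<delta>) \<Longrightarrow> cmod (dv (v i) \<theta> (e\<^sub>C j)) \<le> c5 * E / \<delta> ^ (2 * \<nu>)"
proof -
  have sol: "\<exists>c s. torus_fun \<sigma>' s \<and> flow_average \<omega> g (of_real c) \<and>
      (\<forall>\<theta>\<in>complex_angles \<sigma>'. dv s \<theta> (cvec \<omega>) = g \<theta> - of_real c) \<and>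
      (\<forall>\<delta>. 0 < \<delta> \<longrightarrow> \<delta> \<le> 1 \<longrightarrow> \<delta> < \<sigma>' \<longrightarrow> (\<forall>\<theta>\<in>complex_angles (\<sigma>' - \<delta>).
        cmod (s \<theta>) \<le> K * M / \<delta> ^ \<nu> \<and> (\<forall>j. cmod (dv s \<theta> (e\<^sub>C j)) \<le> K * M / \<delta> ^ \<nu>)))"
    if "0 < \<sigma>'" "torus_fun \<sigma>' g" "\<forall>\<theta>\<in>complex_angles \<sigma>'. cmod (g \<theta>) \<le> M" for \<sigma>' g M
    using solvable that unfolding cohom_solvable_def by blast
  let ?Ah = "complex_angles (\<sigma> / 2) :: (complex^'n) set"
  have Ah: "\<theta> \<in> complex_angles \<sigma>" if "\<theta> \<in> ?Ah" for \<theta>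
    using that complex_angles_mono[of "\<sigma> / 2" \<sigma>] r_pos by auto
  have f00: "f (0, 0) \<in> \<real>"
    using torus_funD(3)[OF torus_parts(1), of 0] by (simp add: cvec_def zero_vec_def)
  obtain x0 s0 where s0: "torus_fun \<sigma> s0" "\<And>\<theta>. \<theta> \<in> complex_angles \<sigma> \<Longrightarrow> dv s0 \<theta> (cvec \<omega>) = - (f (0, \<theta>) + - f (0, 0)) - of_real x0"
    and s0_bound: "\<And>\<delta> \<theta> j. 0 < \<delta> \<Longrightarrow> \<delta> \<le> 1 \<Longrightarrow> \<delta> < \<sigma> \<Longrightarrow> \<theta> \<in> complex_angles (\<sigma> - \<delta>) \<Longrightarrow> cmod (dv s0 \<theta> (e\<^sub>C j)) \<le> K * E / \<delta> ^ \<nu>"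
  proof -
    have tf: "torus_fun \<sigma> (\<lambda>\<theta>. - (f (0, \<theta>) + - f (0, 0)))"
      by (intro torus_fun_minus torus_fun_add torus_parts torus_fun_const) (use f00 in auto)
    have bd: "\<forall>\<theta>\<in>complex_angles \<sigma>. cmod (- (f (0, \<theta>) + - f (0, 0))) \<le> E"
      using err(1) by (simp only: norm_minus_cancel) simp
    from sol[OF r_pos(2) tf bd] show ?thesis
      by (elim exE conjE) (rule that, assumption, blast+)
  qed
  have "\<forall>k. \<exists>c s. torus_fun \<sigma> s \<and> (\<forall>\<theta>\<in>complex_angles \<sigma>. dv s \<theta> (cvec \<omega>) = - l k (0, \<theta>) - of_real c) \<and>
      (\<forall>\<delta>. 0 < \<delta> \<longrightarrow> \<delta> \<le> 1 \<longrightarrow> \<delta> < \<sigma> \<longrightarrow> (\<forall>\<theta>\<in>complex_angles (\<sigma> - \<delta>). \<forall>j. cmod (dv s \<theta> (e\<^sub>C j)) \<le> K * \<kappa> / \<delta> ^ \<nu>))"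
  proof
    fix k
    have bd: "\<forall>\<theta>\<in>complex_angles \<sigma>. cmod (- l k (0, \<theta>)) \<le> \<kappa>"
      using l(2)[of "(0, _)" k] r_pos by simp
    from sol[OF r_pos(2) torus_fun_minus[OF torus_parts(3)[of k]] bd]
    show "\<exists>c s. torus_fun \<sigma> s \<and> (\<forall>\<theta>\<in>complex_angles \<sigma>. dv s \<theta> (cvec \<omega>) = - l k (0, \<theta>) - of_real c) \<and>
      (\<forall>\<delta>. 0 < \<delta> \<longrightarrow> \<delta> \<le> 1 \<longrightarrow> \<delta> < \<sigma> \<longrightarrow> (\<forall>\<theta>\<in>complex_angles (\<sigma> - \<delta>). \<forall>j. cmod (dv s \<theta> (e\<^sub>C j)) \<le> K * \<kappa> / \<delta> ^ \<nu>))"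
      by (elim exE conjE) blast
  qed
  from choice[OF this] obtain x1 where "\<forall>k. \<exists>s. torus_fun \<sigma> s \<and> (\<forall>\<theta>\<in>complex_angles \<sigma>. dv s \<theta> (cvec \<omega>) = - l k (0, \<theta>) - of_real (x1 k)) \<and>
      (\<forall>\<delta>. 0 < \<delta> \<longrightarrow> \<delta> \<le> 1 \<longrightarrow> \<delta> < \<sigma> \<longrightarrow> (\<forall>\<theta>\<in>complex_angles (\<sigma> - \<delta>). \<forall>j. cmod (dv s \<theta> (e\<^sub>C j)) \<le> K * \<kappa> / \<delta> ^ \<nu>))" ..
  from choice[OF this] obtain s1 where s1_all: "\<forall>k. torus_fun \<sigma> (s1 k) \<and> (\<forall>\<theta>\<in>complex_angles \<sigma>. dv (s1 k) \<theta> (cvec \<omega>) = - l k (0, \<theta>) - of_real (x1 k)) \<and>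
      (\<forall>\<delta>. 0 < \<delta> \<longrightarrow> \<delta> \<le> 1 \<longrightarrow> \<delta> < \<sigma> \<longrightarrow> (\<forall>\<theta>\<in>complex_angles (\<sigma> - \<delta>). \<forall>j. cmod (dv (s1 k) \<theta> (e\<^sub>C j)) \<le> K * \<kappa> / \<delta> ^ \<nu>))" ..
  have s1: "torus_fun \<sigma> (s1 k)" "\<theta> \<in> complex_angles \<sigma> \<Longrightarrow> dv (s1 k) \<theta> (cvec \<omega>) = - l k (0, \<theta>) - of_real (x1 k)" for k \<theta>
    using s1_all by blast+
  have s1_bound: "cmod (dv (s1 k) \<theta> (e\<^sub>C j)) \<le> K * \<kappa> / \<delta> ^ \<nu>"
    if "0 < \<delta>" "\<delta> \<le> 1" "\<delta> < \<sigma>" "\<theta> \<in> complex_angles (\<sigma> - \<delta>)" for k \<delta> \<theta> j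
    using s1_all that by blast

  define F where "F i k \<theta> = pd i (l k) (0, \<theta>) + (\<Sum>j\<in>UNIV. Q i j \<theta> * dv (s1 k) \<theta> (e\<^sub>C j))" for i k \<theta>
  define \<beta>0 where "\<beta>0 i \<theta> = (pd i f (0, \<theta>) + - of_real (\<omega> $ i)) + (\<Sum>j\<in>UNIV. Q i j \<theta> * dv s0 \<theta> (e\<^sub>C j))" for i \<theta>
  have F_tf: "torus_fun \<sigma> (F i k)" and \<beta>0_tf: "torus_fun \<sigma> (\<beta>0 i)" for i k
    unfolding F_def[abs_def] \<beta>0_def[abs_def]
    by (intro torus_fun_add torus_fun_sum torus_fun_mult torus_fun_dv_axis torus_parts torus_fun_const s0 s1 r_pos; simp)+
  have half: "0 < \<sigma> / 2" "\<sigma> / 2 \<le> 1" "\<sigma> / 2 < \<sigma>" using sizes by auto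
  have pw: "1 / (\<sigma> / 2) ^ \<nu> \<le> (2 / \<rho>) ^ \<nu>"
  proof -
    have "(1 / (\<sigma> / 2)) ^ \<nu> \<le> (2 / \<rho>) ^ \<nu>" using sizes by (intro power_mono) (auto simp: field_simps)
    then show ?thesis by (simp add: power_divide)
  qed
  have half_bound: "K * M / (\<sigma> / 2) ^ \<nu> \<le> M * (K * (2 / \<rho>) ^ \<nu>)" if "M \<ge> 0" for M
    using mult_left_mono[OF pw, of "K * M"] that K1 by (simp add: mult_ac)
  have Q_sum: "cmod (\<Sum>j\<in>UNIV. Q i j \<theta> * g j) \<le> n * (4 * B / \<rho>\<^sup>2 * M)"
    if "\<theta> \<in> complex_angles \<sigma>" "\<And>j. cmod (g j) \<le> M" for i \<theta> g M
  proof (rule norm_sum_le_n)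
    show "cmod (Q i j \<theta> * g j) \<le> 4 * B / \<rho>\<^sup>2 * M" for j
      unfolding norm_mult by (intro mult_mono Q_bound that) (use sizes in auto)
  qed
  have F_near: "cmod (F i k \<theta> - (if i = k then 1 else 0)) \<le> \<kappa> * c1" if \<theta>: "\<theta> \<in> ?Ah" for i k \<theta>
  proof -
    have "cmod (F i k \<theta> - (if i = k then 1 else 0)) \<le> cmod (pd i (l k) (0, \<theta>) - (if i = k then 1 else 0)) + cmod (\<Sum>j\<in>UNIV. Q i j \<theta> * dv (s1 k) \<theta> (e\<^sub>C j))"
      unfolding F_def by (rule order_trans[OF eq_refl norm_triangle_ineq]) (simp add: algebra_simps)
    also have "\<dots> \<le> \<kappa> / \<rho> + n * (4 * B / \<rho>\<^sup>2 * (\<kappa> * (K * (2 / \<rho>) ^ \<nu>)))"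
      by (intro add_mono pdl_near Q_sum Ah \<theta> order_trans[OF s1_bound[OF half] half_bound]) (use \<theta> sizes in auto)
    also have "\<dots> = \<kappa> * c1" by (simp add: c1_def algebra_simps)
    finally show ?thesis .
  qed
  have \<beta>0_small: "cmod (\<beta>0 i \<theta>) \<le> c2 * E" if \<theta>: "\<theta> \<in> ?Ah" for i \<theta>
  proof -
    have e2: "cmod (pd i f (0, \<theta>) + - of_real (\<omega> $ i)) \<le> E"
      using err(2)[OF Ah[OF \<theta>], of i] by simp
    have "cmod (\<beta>0 i \<theta>) \<le> cmod (pd i f (0, \<theta>) + - of_real (\<omega> $ i)) + cmod (\<Sum>j\<in>UNIV. Q i j \<theta> * dv s0 \<theta> (e\<^sub>C j))"
      unfolding \<beta>0_def by (rule norm_triangle_ineq)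
    also have "\<dots> \<le> E + n * (4 * B / \<rho>\<^sup>2 * (E * (K * (2 / \<rho>) ^ \<nu>)))"
      by (intro add_mono e2 Q_sum Ah \<theta> order_trans[OF s0_bound[OF half] half_bound])
        (use \<theta> sizes in auto)
    also have "\<dots> = c2 * E" by (simp add: c2_def algebra_simps)
    finally show ?thesis .
  qed
  have "\<forall>i k. \<exists>t::real. flow_average \<omega> (F i k) (of_real t)"
  proof (intro allI)
    fix i k
    have bd: "\<forall>\<theta>\<in>?Ah. cmod (F i k \<theta>) \<le> 1 + \<kappa> * c1"
    proof
      fix \<theta> assume that: "\<theta> \<in> ?Ah"
      have "cmod (F i k \<theta>) \<le> cmod (if i = k then 1 else 0) + cmod (F i k \<theta> - (if i = k then 1 else 0))"
        by (metis norm_minus_commute norm_triangle_sub)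
      also have "\<dots> \<le> 1 + \<kappa> * c1" by (intro add_mono F_near that) auto
      finally show "cmod (F i k \<theta>) \<le> 1 + \<kappa> * c1" .
    qed
    show "\<exists>t::real. flow_average \<omega> (F i k) (of_real t)"
    proof -
      have "torus_fun (\<sigma> / 2) (F i k)" by (rule torus_fun_subset[OF F_tf]) (use half in simp)
      from sol[OF half(1) this bd] show ?thesis by (elim exE conjE) blast
    qed
  qed
  then obtain Tf :: "'n \<Rightarrow> 'n \<Rightarrow> real" where Tf: "\<And>i k. flow_average \<omega> (F i k) (of_real (Tf i k))"
    by metis
  have "\<forall>i. \<exists>t::real. flow_average \<omega> (\<beta>0 i) (of_real t)"
  proof
    fix i
    have tfh: "torus_fun (\<sigma> / 2) (\<beta>0 i)" by (rule torus_fun_subset[OF \<beta>0_tf]) (use half in simp)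
    have bdh: "\<forall>\<theta>\<in>?Ah. cmod (\<beta>0 i \<theta>) \<le> c2 * E" using \<beta>0_small by blast
    from sol[OF half(1) tfh bdh] show "\<exists>t::real. flow_average \<omega> (\<beta>0 i) (of_real t)"
      by (elim exE conjE) blast
  qed
  then obtain tf :: "'n \<Rightarrow> real" where tf: "\<And>i. flow_average \<omega> (\<beta>0 i) (of_real (tf i))"
    by metis
  have real_Ah: "cvec q \<in> ?Ah" for q using half by simp
  define T :: "real^'n^'n" where "T = (\<chi> i k. Tf i k)"
  have T: "near_id T"
    unfolding near_id_def
  proof (intro allI)
    fix i k
    have one: "flow_average \<omega> (\<lambda>_. 1) 1"
      unfolding flow_average_def
      by (rule exI[of _ 1], rule conjI, simp, rule exI[of _ "\<lambda>_. 0"]) (auto simp: hol_const)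
    have "flow_average \<omega> (\<lambda>\<theta>. F i k \<theta> + - (if i = k then 1 else 0) * 1) (of_real (Tf i k) + - (if i = k then 1 else 0) * 1)"
      by (rule flow_average_add_mult[OF Tf one])
    then have "cmod (of_real (Tf i k) + - (if i = k then 1 else 0) * 1) \<le> \<kappa> * c1"
      by (rule flow_average_bound) (use F_near[OF real_Ah, of i k] in simp)
    moreover have "of_real (Tf i k) + - (if i = k then 1 else 0) * 1 = complex_of_real (T $ i $ k - (if i = k then 1 else 0))"
      by (simp add: T_def)
    ultimately have "\<bar>T $ i $ k - (if i = k then 1 else 0)\<bar> \<le> \<kappa> * c1"
      by (simp only: norm_of_real)
    then show "norm (T $ i $ k - (if i = k then 1 else 0)) \<le> 1 / (2 * real CARD('n))" using \<kappa> by (simp add: n)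
  qed
  have "\<bar>(\<chi> i. - tf i) $ i\<bar> \<le> c2 * E" for i
    using flow_average_bound[OF tf[of i] \<beta>0_small[OF real_Ah]] by simp
  from near_id_solve_bound[OF T this] obtain \<mu> where \<mu>: "T *v \<mu> = (\<chi> i. - tf i)" "\<And>i. \<bar>\<mu> $ i\<bar> \<le> 2 * (c2 * E)"
    by metis
  define s where "s \<theta> = s0 \<theta> + (\<Sum>k\<in>UNIV. of_real (\<mu> $ k) * s1 k \<theta>)" for \<theta>
  have s_tf: "torus_fun \<sigma> s"
    unfolding s_def by (intro torus_fun_add torus_fun_sum torus_fun_mult s0 s1 torus_fun_const) auto
  have s_dv: "dv s \<theta> u = dv s0 \<theta> u + (\<Sum>k\<in>UNIV. of_real (\<mu> $ k) * dv (s1 k) \<theta> u)" if \<theta>: "\<theta> \<in> complex_angles \<sigma>" for \<theta> u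
  proof -
    note h0 = torus_funD(1)[OF s0(1)] and h1 = torus_funD(1)[OF s1(1)]
    have hk: "hol (\<lambda>\<theta>. of_real (\<mu> $ k) * s1 k \<theta>) (complex_angles \<sigma>)" for k by (intro hol_mult hol_const h1)
    have "dv s \<theta> u = dv s0 \<theta> u + dv (\<lambda>\<theta>. \<Sum>k\<in>UNIV. of_real (\<mu> $ k) * s1 k \<theta>) \<theta> u"
      unfolding s_def by (rule dv_plus[OF h0 hol_sum[OF hk] \<theta>])
    also have "dv (\<lambda>\<theta>. \<Sum>k\<in>UNIV. of_real (\<mu> $ k) * s1 k \<theta>) \<theta> u = (\<Sum>k\<in>UNIV. dv (\<lambda>\<theta>. of_real (\<mu> $ k) * s1 k \<theta>) \<theta> u)"
      by (rule dv_sum_fun[OF hk \<theta>])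
    also have "\<dots> = (\<Sum>k\<in>UNIV. of_real (\<mu> $ k) * dv (s1 k) \<theta> u)"
      using dv_mult[OF hol_const h1 \<theta>] by simp
    finally show ?thesis .
  qed
  define \<beta> where "\<beta> i \<theta> = \<beta>0 i \<theta> + (\<Sum>k\<in>UNIV. of_real (\<mu> $ k) * F i k \<theta>)" for i \<theta>
  have \<beta>_tf: "torus_fun \<sigma> (\<beta> i)" for i
    unfolding \<beta>_def by (intro torus_fun_add torus_fun_sum torus_fun_mult \<beta>0_tf F_tf torus_fun_const) auto
  have \<delta>: "0 < \<delta>" "\<delta> \<le> 1" "\<delta> < \<sigma>" using sizes by auto
  have d1: "1 / \<delta> ^ \<nu> \<ge> 1" using pow_le[of 0 \<nu>] by simp
  have cE: "0 \<le> c2 * E" using c_pos sizes by simp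
  have s_bound: "cmod (dv s \<theta> (e\<^sub>C j)) \<le> c3 * E / \<delta> ^ \<nu>" if \<theta>: "\<theta> \<in> complex_angles (\<sigma> - \<delta>)" for \<theta> j
  proof -
    have \<theta>': "\<theta> \<in> complex_angles \<sigma>" using \<theta> complex_angles_mono[of "\<sigma> - \<delta>" \<sigma>] \<delta> by auto
    have "cmod (dv s \<theta> (e\<^sub>C j)) \<le> K * E / \<delta> ^ \<nu> + n * (2 * (c2 * E) * (K * \<kappa> / \<delta> ^ \<nu>))"
      unfolding s_dv[OF \<theta>']
    proof (intro order_trans[OF norm_triangle_ineq] add_mono s0_bound \<delta> \<theta> norm_sum_le_n)
      show "cmod (of_real (\<mu> $ k) * dv (s1 k) \<theta> (e\<^sub>C j)) \<le> 2 * (c2 * E) * (K * \<kappa> / \<delta> ^ \<nu>)" for k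
        unfolding norm_mult norm_of_real by (intro mult_mono \<mu> s1_bound \<delta> \<theta>) (use cE in auto)
    qed
    also have "\<dots> \<le> K * E / \<delta> ^ \<nu> + n * (2 * (c2 * E) * (K * 1 / \<delta> ^ \<nu>))"
      using sizes K1 n1 cE by (intro add_left_mono mult_left_mono divide_right_mono) auto
    also have "\<dots> = c3 * E / \<delta> ^ \<nu>" by (simp add: c3_def algebra_simps add_divide_distrib)
    finally show ?thesis .
  qed
  have \<beta>_eq: "\<beta> i \<theta> = pd i f (0, \<theta>) - of_real (\<omega> $ i) + (\<Sum>k\<in>UNIV. of_real (\<mu> $ k) * pd i (l k) (0, \<theta>)) + (\<Sum>j\<in>UNIV. Q i j \<theta> * dv s \<theta> (e\<^sub>C j))"
    if \<theta>: "\<theta> \<in> complex_angles \<sigma>" for i \<theta>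
  proof -
    have "(\<Sum>j\<in>UNIV. Q i j \<theta> * dv s \<theta> (e\<^sub>C j)) = (\<Sum>j\<in>UNIV. Q i j \<theta> * dv s0 \<theta> (e\<^sub>C j)) + (\<Sum>j\<in>UNIV. \<Sum>k\<in>UNIV. of_real (\<mu> $ k) * (Q i j \<theta> * dv (s1 k) \<theta> (e\<^sub>C j)))"
      unfolding s_dv[OF \<theta>] by (simp add: distrib_left sum.distrib sum_distrib_left mult_ac)
    also have "(\<Sum>j\<in>UNIV. \<Sum>k\<in>UNIV. of_real (\<mu> $ k) * (Q i j \<theta> * dv (s1 k) \<theta> (e\<^sub>C j))) = (\<Sum>k\<in>UNIV. \<Sum>j\<in>UNIV. of_real (\<mu> $ k) * (Q i j \<theta> * dv (s1 k) \<theta> (e\<^sub>C j)))"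
      by (rule sum.swap)
    also have "\<dots> = (\<Sum>k\<in>UNIV. of_real (\<mu> $ k) * (\<Sum>j\<in>UNIV. Q i j \<theta> * dv (s1 k) \<theta> (e\<^sub>C j)))"
      by (simp only: sum_distrib_left)
    finally show ?thesis
      by (simp add: \<beta>_def \<beta>0_def F_def distrib_left sum.distrib)
  qed
  have \<beta>_bound: "cmod (\<beta> i \<theta>) \<le> c4 * E / \<delta> ^ \<nu>" if \<theta>: "\<theta> \<in> complex_angles (\<sigma> - \<delta>)" for i \<theta>
  proof -
    have \<theta>': "\<theta> \<in> complex_angles \<sigma>" using \<theta> complex_angles_mono[of "\<sigma> - \<delta>" \<sigma>] \<delta> by auto
    have "cmod (\<beta> i \<theta>) \<le> E + n * (2 * (c2 * E) * (4 / \<rho>)) + n * (4 * B / \<rho>\<^sup>2 * (c3 * E / \<delta> ^ \<nu>))"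
      unfolding \<beta>_eq[OF \<theta>']
    proof (intro order_trans[OF norm_triangle_ineq] add_mono Q_sum s_bound \<theta> \<theta>' err norm_sum_le_n)
      show "cmod (of_real (\<mu> $ k) * pd i (l k) (0, \<theta>)) \<le> 2 * (c2 * E) * (4 / \<rho>)" for k
        unfolding norm_mult norm_of_real by (intro mult_mono \<mu> pdl_bound) (use cE \<theta>' r_pos in auto)
    qed
    also have "\<dots> = (1 + n * (2 * c2 * (4 / \<rho>))) * E * 1 + n * (4 * B / \<rho>\<^sup>2 * c3) * E * (1 / \<delta> ^ \<nu>)"
      by (simp add: algebra_simps)
    also have "\<dots> \<le> (1 + n * (2 * c2 * (4 / \<rho>))) * E * (1 / \<delta> ^ \<nu>) + n * (4 * B / \<rho>\<^sup>2 * c3) * E * (1 / \<delta> ^ \<nu>)"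
      using d1 c_pos sizes n1 by (intro add_right_mono mult_left_mono) (auto intro!: mult_nonneg_nonneg add_nonneg_nonneg divide_nonneg_nonneg)
    also have "\<dots> = c4 * E / \<delta> ^ \<nu>" by (simp add: c4_def algebra_simps add_divide_distrib)
    finally show ?thesis .
  qed
  have "\<forall>i. \<exists>v. torus_fun (\<sigma> - \<delta>) v \<and> (\<forall>\<theta>\<in>complex_angles (\<sigma> - \<delta>). dv v \<theta> (cvec \<omega>) = \<beta> i \<theta>) \<and>
     (\<forall>\<theta>\<in>complex_angles (\<sigma> - 2 * \<delta>). cmod (v \<theta>) \<le> c5 * E / \<delta> ^ (2 * \<nu>) \<and> (\<forall>j. cmod (dv v \<theta> (e\<^sub>C j)) \<le> c5 * E / \<delta> ^ (2 * \<nu>)))"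
  proof
    fix i
    have \<delta>': "0 < \<sigma> - \<delta>" using \<delta> by simp
    obtain c v where v: "torus_fun (\<sigma> - \<delta>) v" "flow_average \<omega> (\<beta> i) (of_real c)"
      "\<forall>\<theta>\<in>complex_angles (\<sigma> - \<delta>). dv v \<theta> (cvec \<omega>) = \<beta> i \<theta> - of_real c"
      and v_bound: "\<forall>\<theta>\<in>complex_angles (\<sigma> - \<delta> - \<delta>). cmod (v \<theta>) \<le> K * (c4 * E / \<delta> ^ \<nu>) / \<delta> ^ \<nu> \<and> (\<forall>j. cmod (dv v \<theta> (e\<^sub>C j)) \<le> K * (c4 * E / \<delta> ^ \<nu>) / \<delta> ^ \<nu>)"
    proof -
      have "\<delta> < \<sigma> - \<delta>" using sizes by simp
      have bd: "\<forall>\<theta>\<in>complex_angles (\<sigma> - \<delta>). cmod (\<beta> i \<theta>) \<le> c4 * E / \<delta> ^ \<nu>" using \<beta>_bound by blast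
      have "torus_fun (\<sigma> - \<delta>) (\<beta> i)" by (rule torus_fun_subset[OF \<beta>_tf]) (use \<delta> in simp)
      from sol[OF \<delta>' this bd] obtain c v where
        "torus_fun (\<sigma> - \<delta>) v" "flow_average \<omega> (\<beta> i) (of_real c)" "\<forall>\<theta>\<in>complex_angles (\<sigma> - \<delta>). dv v \<theta> (cvec \<omega>) = \<beta> i \<theta> - of_real c"
        "\<forall>d. 0 < d \<longrightarrow> d \<le> 1 \<longrightarrow> d < \<sigma> - \<delta> \<longrightarrow> (\<forall>\<theta>\<in>complex_angles (\<sigma> - \<delta> - d). cmod (v \<theta>) \<le> K * (c4 * E / \<delta> ^ \<nu>) / d ^ \<nu> \<and> (\<forall>j. cmod (dv v \<theta> (e\<^sub>C j)) \<le> K * (c4 * E / \<delta> ^ \<nu>) / d ^ \<nu>))"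
        by (elim exE conjE) blast
      then show ?thesis
        using \<delta> \<open>\<delta> < \<sigma> - \<delta>\<close> by (intro that[of v c]) simp_all
    qed
    have "flow_average \<omega> (\<beta> i) (of_real (tf i) + (\<Sum>k\<in>UNIV. of_real (\<mu> $ k) * of_real (Tf i k)))"
      unfolding \<beta>_def by (rule flow_average_sum[OF tf Tf])
    moreover have "tf i + (\<Sum>k\<in>UNIV. \<mu> $ k * Tf i k) = 0"
    proof -
      have "(T *v \<mu>) $ i = - tf i" using \<mu>(1) by simp
      then show ?thesis by (simp add: T_def matrix_vector_mult_def mult.commute)
    qed
    then have "of_real (tf i) + (\<Sum>k\<in>UNIV. of_real (\<mu> $ k) * of_real (Tf i k)) = (0::complex)"
      by (metis (no_types, lifting) of_real_0 of_real_add of_real_mult of_real_sum sum.cong)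
    ultimately have "flow_average \<omega> (\<beta> i) 0" by simp
    then have c0: "complex_of_real c = 0" by (rule flow_average_unique[OF v(2)])
    have "K * (c4 * E / \<delta> ^ \<nu>) / \<delta> ^ \<nu> = c5 * E / \<delta> ^ (2 * \<nu>)"
      by (simp add: c5_def power_add mult_2)
    then show "\<exists>v. torus_fun (\<sigma> - \<delta>) v \<and> (\<forall>\<theta>\<in>complex_angles (\<sigma> - \<delta>). dv v \<theta> (cvec \<omega>) = \<beta> i \<theta>) \<and>
     (\<forall>\<theta>\<in>complex_angles (\<sigma> - 2 * \<delta>). cmod (v \<theta>) \<le> c5 * E / \<delta> ^ (2 * \<nu>) \<and> (\<forall>j. cmod (dv v \<theta> (e\<^sub>C j)) \<le> c5 * E / \<delta> ^ (2 * \<nu>)))"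
      using v v_bound c0 by (intro exI[of _ v]) (simp add: algebra_simps)
  qed
  from choice[OF this] obtain v where v: "\<forall>i. torus_fun (\<sigma> - \<delta>) (v i) \<and> (\<forall>\<theta>\<in>complex_angles (\<sigma> - \<delta>). dv (v i) \<theta> (cvec \<omega>) = \<beta> i \<theta>) \<and>
     (\<forall>\<theta>\<in>complex_angles (\<sigma> - 2 * \<delta>). cmod (v i \<theta>) \<le> c5 * E / \<delta> ^ (2 * \<nu>) \<and> (\<forall>j. cmod (dv (v i) \<theta> (e\<^sub>C j)) \<le> c5 * E / \<delta> ^ (2 * \<nu>)))" ..
  have const: "f (0, \<theta>) + (\<Sum>k\<in>UNIV. of_real (\<mu> $ k) * l k (0, \<theta>)) + dv s \<theta> (cvec \<omega>)
      = f (0, 0) - of_real x0 - (\<Sum>k\<in>UNIV. of_real (\<mu> $ k) * of_real (x1 k))" if "\<theta> \<in> complex_angles \<sigma>" for \<theta>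
    unfolding s_dv[OF that] s0(2)[OF that] s1(2)[OF that]
    by (simp add: right_diff_distrib sum_subtractf sum_negf)
  show ?thesis
  proof (rule that[of \<mu> s v \<beta>, OF _ s_tf _ _ const \<beta>_eq _ s_bound \<beta>_bound])
    show "\<bar>\<mu> $ i\<bar> \<le> 2 * c2 * E" for i using \<mu>(2)[of i] by (simp only: mult.assoc)
    show "hol (\<beta> i) (complex_angles \<sigma>)" for i by (rule torus_funD(1)[OF \<beta>_tf])
  qed (use v in blast)+
qed


definition m :: nat where "m = 3 * \<nu> + 2"
definition S :: real where "S = c3 * E / \<delta> ^ \<nu>"
definition V :: real where "V = c5 * E / \<delta> ^ (2 * \<nu>)"

lemma E_pow_le: "a \<le> b \<Longrightarrow> E / \<delta> ^ a \<le> E / \<delta> ^ b"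
  using mult_left_mono[OF pow_le[of a b], of E] sizes by simp

lemma A_ge: "2 * c5 \<le> A" "4 * c3 / \<rho> \<le> A" "4 * n * c2 \<le> A" "4 * n * c5 + 2 * c3 \<le> A" "c6 \<le> A" "c7 \<le> A"
    "2 * c4 * c5 \<le> A" "2 * c2 \<le> A" "1 \<le> A" "2 * n * c5 \<le> A"
proof -
  have p: "0 \<le> 2 * c5" "0 \<le> 4 * c3 / \<rho>" "0 \<le> 4 * n * c2" "0 \<le> 2 * n * c5" "0 \<le> 2 * c3" "0 \<le> c6" "0 \<le> c7" "0 \<le> 2 * c4 * c5"
    using c_pos n1 sizes by (auto intro!: mult_nonneg_nonneg divide_nonneg_nonneg)
  show "2 * c5 \<le> A" "4 * c3 / \<rho> \<le> A" "4 * n * c2 \<le> A" "4 * n * c5 + 2 * c3 \<le> A" "c6 \<le> A" "c7 \<le> A"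
    "2 * c4 * c5 \<le> A" "2 * c2 \<le> A" "1 \<le> A" "2 * n * c5 \<le> A"
    using p c_pos unfolding A_def by linarith+
qed

lemma SV_pos: "0 < S" "0 < V"
  using c_pos sizes by (auto simp: S_def V_def)

lemma small:
  assumes sm: "A * E / \<delta> ^ m \<le> 1"
  shows "2 * S \<le> \<rho> / 2" "2 * V \<le> \<delta>" "n * (2 * c2 * E * 2) \<le> 1" "n * V * 2 + S \<le> \<delta> / 2" "V \<le> 1 / (2 * n)"
proof -
  define X where "X = E / \<delta> ^ m"
  have X: "0 < X" using sizes by (simp add: X_def)
  have le: "c * X \<le> 1" if "c \<le> A" for c
    using mult_right_mono[OF that, of X] X sm by (simp add: X_def)
  have e: "E / \<delta> ^ a \<le> X" if "a \<le> m" for a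
    using E_pow_le[OF that] by (simp add: X_def)
  have ed: "E / \<delta> ^ a \<le> \<delta> * X" if "Suc a \<le> m" for a
    using mult_left_mono[OF e[OF that], of \<delta>] sizes by simp
  have S1: "S \<le> c3 * X" and S2: "S \<le> \<delta> * (c3 * X)" and V1: "V \<le> c5 * X" and V2: "V \<le> \<delta> * (c5 * X)"
    using mult_left_mono[OF e[of \<nu>], of c3] mult_left_mono[OF ed[of \<nu>], of c3]
      mult_left_mono[OF e[of "2 * \<nu>"], of c5] mult_left_mono[OF ed[of "2 * \<nu>"], of c5] c_pos
    by (simp_all add: S_def V_def m_def mult_ac)
  have "4 * c3 / \<rho> * X \<le> 1" by (rule le[OF A_ge(2)])
  then have "4 * (c3 * X) \<le> \<rho>" using sizes by (simp add: field_simps)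
  then show "2 * S \<le> \<rho> / 2" using S1 by simp
  have "2 * c5 * X \<le> 1" by (rule le[OF A_ge(1)])
  then have "\<delta> * (2 * c5 * X) \<le> \<delta> * 1" using sizes by (intro mult_left_mono) auto
  then show "2 * V \<le> \<delta>" using V2 by simp
  have "4 * n * c2 * E \<le> 4 * n * c2 * X" using e[of 0] c_pos n1 by (intro mult_left_mono) auto
  also have "\<dots> \<le> 1" by (rule le[OF A_ge(3)])
  finally show "n * (2 * c2 * E * 2) \<le> 1" by simp
  have "n * V * 2 \<le> \<delta> * (2 * n * c5 * X)" using mult_left_mono[OF V2, of "2 * n"] n1 by (simp add: mult_ac)
  then have "n * V * 2 + S \<le> \<delta> * ((2 * n * c5 + c3) * X)" using S2 by (simp add: algebra_simps)
  also have "(2 * n * c5 + c3) * X \<le> 1 / 2" using le[OF A_ge(4)] by (simp add: algebra_simps)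
  then have "\<delta> * ((2 * n * c5 + c3) * X) \<le> \<delta> * (1 / 2)" using sizes by (intro mult_left_mono) auto
  finally show "n * V * 2 + S \<le> \<delta> / 2" by simp
  have "2 * n * c5 * X \<le> 1" by (rule le[OF A_ge(10)])
  then have "c5 * X \<le> 1 / (2 * n)" using n1 by (simp add: field_simps)
  then show "V \<le> 1 / (2 * n)" using V1 by simp
qed

lemma quadratic_error:
  assumes "0 \<le> c" "c \<le> A" "a \<le> m"
  shows "c * E\<^sup>2 / \<delta> ^ a \<le> A * E\<^sup>2 / \<delta> ^ m"
  using assms sizes by (intro frac_le mult_right_mono power_decreasing mult_nonneg_nonneg) auto

text \<open>
  The step is a Newton step: after the corrections have been made, what remains of the error is
  quadratic in \<open>E\<close>, at the price of a power of \<open>\<delta>\<close>.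
\<close>

lemma quadratic_estimates:
  assumes \<kappa>: "\<kappa> * c1 \<le> 1 / (2 * n)" and sm: "A * E / \<delta> ^ m \<le> 1"
  obtains \<mu> :: "real^'n" and s :: "complex^'n \<Rightarrow> complex" and v :: "'n \<Rightarrow> complex^'n \<Rightarrow> complex" and c :: complex
  where "\<And>i. \<bar>\<mu> $ i\<bar> \<le> A * E" "torus_fun \<sigma> s" "\<And>i. torus_fun (\<sigma> - \<delta>) (v i)"
    "\<And>\<theta> j. \<theta> \<in> complex_angles (\<sigma> - \<delta>) \<Longrightarrow> cmod (dv s \<theta> (e\<^sub>C j)) \<le> S"
    "\<And>\<theta> i. \<theta> \<in> complex_angles (\<sigma> - 2 * \<delta>) \<Longrightarrow> cmod (v i \<theta>) \<le> V"
    "\<And>\<theta> i j. \<theta> \<in> complex_angles (\<sigma> - 2 * \<delta>) \<Longrightarrow> cmod (dv (v i) \<theta> (e\<^sub>C j)) \<le> V"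
    "\<And>\<theta>. \<theta> \<in> complex_angles (\<sigma> - \<delta>) \<Longrightarrow>
      cmod (f (grad s \<theta>, \<theta>) + (\<Sum>k\<in>UNIV. of_real (\<mu> $ k) * l k (grad s \<theta>, \<theta>)) - c) \<le> A * E\<^sup>2 / \<delta> ^ m"
    "\<And>\<theta> i. \<theta> \<in> complex_angles (\<sigma> - \<delta>) \<Longrightarrow>
      cmod (pd i f (grad s \<theta>, \<theta>) + (\<Sum>k\<in>UNIV. of_real (\<mu> $ k) * pd i (l k) (grad s \<theta>, \<theta>))
         - of_real (\<omega> $ i) - dv (v i) \<theta> (cvec \<omega>)) \<le> A * E\<^sup>2 / \<delta> ^ m"
    "\<And>\<theta> w i. \<theta> \<in> complex_angles (\<sigma> - 3 * \<delta>) \<Longrightarrow> (\<And>j. cmod (w $ j) \<le> V) \<Longrightarrow>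
      cmod (dv (v i) (\<theta> + w) (cvec \<omega>) - dv (v i) \<theta> (cvec \<omega>)) \<le> A * E\<^sup>2 / \<delta> ^ m"
proof -
  obtain \<mu> :: "real^'n" and s :: "complex^'n \<Rightarrow> complex" and v c \<beta>
  where \<mu>: "\<And>i. \<bar>\<mu> $ i\<bar> \<le> 2 * c2 * E" and tf: "torus_fun \<sigma> s" "\<And>i. torus_fun (\<sigma> - \<delta>) (v i)" and \<beta>_hol: "\<And>i. hol (\<beta> i) (complex_angles \<sigma>)"
    and eqs: "\<And>\<theta>. \<theta> \<in> complex_angles \<sigma> \<Longrightarrow> f (0, \<theta>) + (\<Sum>k\<in>UNIV. of_real (\<mu> $ k) * l k (0, \<theta>)) + dv s \<theta> (cvec \<omega>) = c"
    "\<And>\<theta> i. \<theta> \<in> complex_angles \<sigma> \<Longrightarrow> \<beta> i \<theta> = pd i f (0, \<theta>) - of_real (\<omega> $ i) + (\<Sum>k\<in>UNIV. of_real (\<mu> $ k) * pd i (l k) (0, \<theta>)) + (\<Sum>j\<in>UNIV. Q i j \<theta> * dv s \<theta> (e\<^sub>C j))"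
    "\<And>\<theta> i. \<theta> \<in> complex_angles (\<sigma> - \<delta>) \<Longrightarrow> dv (v i) \<theta> (cvec \<omega>) = \<beta> i \<theta>"
    and s_bound: "\<And>\<theta> j. \<theta> \<in> complex_angles (\<sigma> - \<delta>) \<Longrightarrow> cmod (dv s \<theta> (e\<^sub>C j)) \<le> S"
    and \<beta>_bound: "\<And>\<theta> i. \<theta> \<in> complex_angles (\<sigma> - \<delta>) \<Longrightarrow> cmod (\<beta> i \<theta>) \<le> c4 * E / \<delta> ^ \<nu>"
    and v_bound: "\<And>\<theta> i. \<theta> \<in> complex_angles (\<sigma> - 2 * \<delta>) \<Longrightarrow> cmod (v i \<theta>) \<le> V"
    "\<And>\<theta> i j. \<theta> \<in> complex_angles (\<sigma> - 2 * \<delta>) \<Longrightarrow> cmod (dv (v i) \<theta> (e\<^sub>C j)) \<le> V"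
    by (rule linearised_equations[OF \<kappa>, folded S_def V_def]) (rule that; assumption)
  note small = small[OF sm]
  have cE: "0 \<le> c2 * E" "0 \<le> E * c2" "0 \<le> c2" using c_pos sizes by auto
  have \<theta>_mono: "\<theta> \<in> complex_angles \<sigma>" if "\<theta> \<in> complex_angles (\<sigma> - \<delta>)" for \<theta> :: "complex^'n"
    using that complex_angles_mono[of "\<sigma> - \<delta>" \<sigma>] sizes by auto
  have gs: "cmod (grad s \<theta> $ i) \<le> S" if "\<theta> \<in> complex_angles (\<sigma> - \<delta>)" for \<theta> i
    using s_bound[OF that] by (simp add: grad_def)
  have S_r: "2 * S \<le> r" "2 * S \<le> r / 2" using small(1) sizes by auto
  have gs_in: "(grad s \<theta>, \<theta>) \<in> pdom (r / 2) \<sigma>" if \<theta>: "\<theta> \<in> complex_angles (\<sigma> - \<delta>)" for \<theta>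
  proof -
    have "cmod (grad s \<theta> $ i) < r / 2" for i using gs[OF \<theta>, of i] S_r SV_pos by linarith
    then show ?thesis using \<theta>_mono[OF \<theta>] by simp
  qed
  define g where "g x = f x + (\<Sum>k\<in>UNIV. of_real (\<mu> $ k) * l k x)" for x
  have lk_hol: "hol (\<lambda>x. of_real (\<mu> $ k) * l k x) (pdom r \<sigma>)" for k by (intro hol_mult hol_const l_hol)
  have g_hol: "hol g (pdom r \<sigma>)" unfolding g_def by (intro hol_add f_hol hol_sum lk_hol)
  have g_dv: "dv g x u = dv f x u + (\<Sum>k\<in>UNIV. of_real (\<mu> $ k) * dv (l k) x u)" if x: "x \<in> pdom r \<sigma>" for x u
    unfolding g_def dv_plus[OF f_hol hol_sum[OF lk_hol] x] dv_sum_fun[OF lk_hol x] dv_mult[OF hol_const l_hol x] by simp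
  have g_bound: "cmod (g x) \<le> B + 1" if x: "x \<in> pdom r \<sigma>" for x
  proof -
    have "cmod (g x) \<le> B + n * (2 * c2 * E * 2)"
      unfolding g_def
    proof (intro order_trans[OF norm_triangle_ineq] add_mono f(2) x norm_sum_le_n)
      show "cmod (of_real (\<mu> $ k) * l k x) \<le> 2 * c2 * E * 2" for k
        unfolding norm_mult norm_of_real by (intro mult_mono \<mu> l_bound x) (use cE in auto)
    qed
    then show ?thesis using small(3) by simp
  qed
  have E1: "cmod (g (grad s \<theta>, \<theta>) - c) \<le> A * E\<^sup>2 / \<delta> ^ m" if \<theta>: "\<theta> \<in> complex_angles (\<sigma> - \<delta>)" for \<theta>
  proof -
    note \<theta>' = \<theta>_mono[OF \<theta>]
    have x0: "(0, \<theta>) \<in> pdom r \<sigma>" using \<theta>' r_pos by simp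
    define b where "b j = pd j f (0, \<theta>) - of_real (\<omega> $ j) + (\<Sum>k\<in>UNIV. of_real (\<mu> $ k) * pd j (l k) (0, \<theta>))" for j
    have "dv g (0, \<theta>) (grad s \<theta>, 0) = (\<Sum>j\<in>UNIV. grad s \<theta> $ j * pd j g (0, \<theta>))"
      by (rule dv_momentum_sum[OF g_hol x0])
    also have "\<dots> = (\<Sum>j\<in>UNIV. dv s \<theta> (e\<^sub>C j) * (of_real (\<omega> $ j) + b j))"
      unfolding g_dv[OF x0] by (simp add: grad_def b_def)
    also have "\<dots> = dv s \<theta> (cvec \<omega>) + (\<Sum>j\<in>UNIV. dv s \<theta> (e\<^sub>C j) * b j)"
      unfolding dv_angle_sum[OF torus_funD(1)[OF tf(1)] \<theta>', of "cvec \<omega>"] by (simp add: algebra_simps sum.distrib)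
    finally have "g (0, \<theta>) + dv g (0, \<theta>) (grad s \<theta>, 0) = c + (\<Sum>j\<in>UNIV. dv s \<theta> (e\<^sub>C j) * b j)"
      using eqs(1)[OF \<theta>', unfolded add.assoc] by (simp add: g_def)
    then have "g (grad s \<theta>, \<theta>) - c = (g (grad s \<theta>, \<theta>) - g (0, \<theta>) - dv g (0, \<theta>) (grad s \<theta>, 0)) + (\<Sum>j\<in>UNIV. dv s \<theta> (e\<^sub>C j) * b j)"
      by (simp add: algebra_simps)
    also have "cmod \<dots> \<le> 2 * (B + 1) * S\<^sup>2 / r\<^sup>2 + n * (S * (E + n * (2 * c2 * E * (4 / \<rho>))))"
    proof (intro order_trans[OF norm_triangle_ineq] add_mono norm_sum_le_n)
      show "cmod (g (grad s \<theta>, \<theta>) - g (0, \<theta>) - dv g (0, \<theta>) (grad s \<theta>, 0)) \<le> 2 * (B + 1) * S\<^sup>2 / r\<^sup>2"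
        by (rule action_Cauchy_bounds(2)[OF g_hol g_bound \<theta>' gs[OF \<theta>] SV_pos(1) S_r(1)])
      have "cmod (b j) \<le> E + n * (2 * c2 * E * (4 / \<rho>))" for j
        unfolding b_def
      proof (intro order_trans[OF norm_triangle_ineq] add_mono err(2)[OF \<theta>'] norm_sum_le_n)
        show "cmod (of_real (\<mu> $ k) * pd j (l k) (0, \<theta>)) \<le> 2 * c2 * E * (4 / \<rho>)" for k
          unfolding norm_mult norm_of_real by (intro mult_mono \<mu> pdl_bound) (use cE \<theta>' r_pos in auto)
      qed
      then show "cmod (dv s \<theta> (e\<^sub>C j) * b j) \<le> S * (E + n * (2 * c2 * E * (4 / \<rho>)))" for j
        unfolding norm_mult by (intro mult_mono s_bound[OF \<theta>]) (use SV_pos in auto)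
    qed
    also have "\<dots> \<le> 2 * (B + 1) * S\<^sup>2 / \<rho>\<^sup>2 + n * (S * (E + n * (2 * c2 * E * (4 / \<rho>))))"
      using sizes by (intro add_right_mono divide_left_mono power_mono) auto
    also have "\<dots> = 2 * (B + 1) * c3\<^sup>2 / \<rho>\<^sup>2 * (E\<^sup>2 / \<delta> ^ (2 * \<nu>)) + n * (c3 * (1 + n * (2 * c2 * (4 / \<rho>)))) * (E\<^sup>2 / \<delta> ^ \<nu>)"
    proof -
      have e1: "S\<^sup>2 = c3\<^sup>2 * (E\<^sup>2 / \<delta> ^ (2 * \<nu>))"
        by (simp add: S_def power_divide power_mult_distrib mult.commute[of 2 \<nu>] power_mult)
      have e2: "n * (S * (E + n * (2 * c2 * E * (4 / \<rho>)))) = n * (c3 * (1 + n * (2 * c2 * (4 / \<rho>)))) * (E\<^sup>2 / \<delta> ^ \<nu>)"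
        by (simp add: S_def power2_eq_square algebra_simps)
      show ?thesis unfolding e1 e2 by (simp add: mult_ac)
    qed
    also have "\<dots> \<le> 2 * (B + 1) * c3\<^sup>2 / \<rho>\<^sup>2 * (E\<^sup>2 / \<delta> ^ (2 * \<nu>)) + n * (c3 * (1 + n * (2 * c2 * (4 / \<rho>)))) * (E\<^sup>2 / \<delta> ^ (2 * \<nu>))"
      using sizes c_pos n1 mult_left_mono[OF pow_le[of \<nu> "2 * \<nu>"], of "E\<^sup>2"]
      by (intro add_left_mono mult_left_mono mult_nonneg_nonneg add_nonneg_nonneg) auto
    also have "\<dots> = c6 * E\<^sup>2 / \<delta> ^ (2 * \<nu>)" unfolding c6_def by (simp only: distrib_right times_divide_eq_right add_divide_distrib)
    also have "\<dots> \<le> A * E\<^sup>2 / \<delta> ^ m" by (rule quadratic_error) (use c_pos A_ge in \<open>auto simp: m_def\<close>)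
    finally show ?thesis .
  qed
  have E2: "cmod (pd i f (grad s \<theta>, \<theta>) + (\<Sum>k\<in>UNIV. of_real (\<mu> $ k) * pd i (l k) (grad s \<theta>, \<theta>))
         - of_real (\<omega> $ i) - dv (v i) \<theta> (cvec \<omega>)) \<le> A * E\<^sup>2 / \<delta> ^ m" if \<theta>: "\<theta> \<in> complex_angles (\<sigma> - \<delta>)" for \<theta> i
  proof -
    note \<theta>' = \<theta>_mono[OF \<theta>]
    have x0: "(0, \<theta>) \<in> pdom (r / 2) \<sigma>" using \<theta>' r_pos by simp
    have h: "hol (pd i f) (pdom (r / 2) \<sigma>)" "hol (pd i (l k)) (pdom (r / 2) \<sigma>)" for k
      by (rule hol_subset[OF pdf_hol pdom_mono] hol_subset[OF pdl_hol pdom_mono]; use r_pos in simp)+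
    define d where "d k = pd i (l k) (grad s \<theta>, \<theta>) - pd i (l k) (0, \<theta>)" for k
    have "dv (pd i f) (0, \<theta>) (grad s \<theta>, 0) = (\<Sum>j\<in>UNIV. grad s \<theta> $ j * Q i j \<theta>)"
      unfolding Q_def by (rule dv_momentum_sum[OF h(1) x0])
    then have "(\<Sum>j\<in>UNIV. Q i j \<theta> * dv s \<theta> (e\<^sub>C j)) = dv (pd i f) (0, \<theta>) (grad s \<theta>, 0)"
      by (simp add: grad_def mult.commute)
    then have "pd i f (grad s \<theta>, \<theta>) + (\<Sum>k\<in>UNIV. of_real (\<mu> $ k) * pd i (l k) (grad s \<theta>, \<theta>)) - of_real (\<omega> $ i) - dv (v i) \<theta> (cvec \<omega>)
      = (pd i f (grad s \<theta>, \<theta>) - pd i f (0, \<theta>) - dv (pd i f) (0, \<theta>) (grad s \<theta>, 0)) + (\<Sum>k\<in>UNIV. of_real (\<mu> $ k) * d k)"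
      unfolding eqs(3)[OF \<theta>] eqs(2)[OF \<theta>'] by (simp add: d_def right_diff_distrib sum_subtractf)
    also have "cmod \<dots> \<le> 2 * (2 * B / \<rho>) * S\<^sup>2 / (r / 2)\<^sup>2 + n * (2 * c2 * E * (2 * (4 / \<rho>) * S / (r / 2)))"
    proof (intro order_trans[OF norm_triangle_ineq] add_mono norm_sum_le_n)
      show "cmod (pd i f (grad s \<theta>, \<theta>) - pd i f (0, \<theta>) - dv (pd i f) (0, \<theta>) (grad s \<theta>, 0)) \<le> 2 * (2 * B / \<rho>) * S\<^sup>2 / (r / 2)\<^sup>2"
        by (rule action_Cauchy_bounds(2)[OF h(1) pdf_bound \<theta>' gs[OF \<theta>] SV_pos(1) S_r(2)])
      have "cmod (d k) \<le> 2 * (4 / \<rho>) * S / (r / 2)" for k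
        unfolding d_def by (rule action_Cauchy_bounds(1)[OF h(2) pdl_bound \<theta>' gs[OF \<theta>] SV_pos(1) S_r(2)])
      then show "cmod (of_real (\<mu> $ k) * d k) \<le> 2 * c2 * E * (2 * (4 / \<rho>) * S / (r / 2))" for k
        unfolding norm_mult norm_of_real by (intro mult_mono \<mu>) (use cE in auto)
    qed
    also have "\<dots> \<le> 2 * (2 * B / \<rho>) * S\<^sup>2 / (\<rho> / 2)\<^sup>2 + n * (2 * c2 * E * (2 * (4 / \<rho>) * S / (\<rho> / 2)))"
      using sizes SV_pos cE n1 by (intro add_mono divide_left_mono mult_left_mono power_mono mult_pos_pos zero_less_power) (auto intro!: mult_nonneg_nonneg)
    also have "\<dots> = 2 * (2 * B / \<rho>) * c3\<^sup>2 / (\<rho> / 2)\<^sup>2 * (E\<^sup>2 / \<delta> ^ (2 * \<nu>)) + n * (2 * c2 * (2 * (4 / \<rho>) * c3 / (\<rho> / 2))) * (E\<^sup>2 / \<delta> ^ \<nu>)"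
    proof -
      have e1: "S\<^sup>2 = c3\<^sup>2 * (E\<^sup>2 / \<delta> ^ (2 * \<nu>))"
        by (simp add: S_def power_divide power_mult_distrib mult.commute[of 2 \<nu>] power_mult)
      have e2: "n * (2 * c2 * E * (2 * (4 / \<rho>) * S / (\<rho> / 2))) = n * (2 * c2 * (2 * (4 / \<rho>) * c3 / (\<rho> / 2))) * (E\<^sup>2 / \<delta> ^ \<nu>)"
        by (simp add: S_def power2_eq_square mult_ac)
      show ?thesis unfolding e1 e2 by (simp add: mult_ac)
    qed
    also have "\<dots> \<le> 2 * (2 * B / \<rho>) * c3\<^sup>2 / (\<rho> / 2)\<^sup>2 * (E\<^sup>2 / \<delta> ^ (2 * \<nu>)) + n * (2 * c2 * (2 * (4 / \<rho>) * c3 / (\<rho> / 2))) * (E\<^sup>2 / \<delta> ^ (2 * \<nu>))"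
      using sizes c_pos n1 mult_left_mono[OF pow_le[of \<nu> "2 * \<nu>"], of "E\<^sup>2"]
      by (intro add_left_mono mult_left_mono mult_nonneg_nonneg add_nonneg_nonneg) auto
    also have "\<dots> = c7 * E\<^sup>2 / \<delta> ^ (2 * \<nu>)" unfolding c7_def by (simp only: distrib_right times_divide_eq_right add_divide_distrib)
    also have "\<dots> \<le> A * E\<^sup>2 / \<delta> ^ m" by (rule quadratic_error) (use c_pos A_ge in \<open>auto simp: m_def\<close>)
    finally show ?thesis .
  qed
  have E3: "cmod (dv (v i) (\<theta> + w) (cvec \<omega>) - dv (v i) \<theta> (cvec \<omega>)) \<le> A * E\<^sup>2 / \<delta> ^ m"
    if \<theta>: "\<theta> \<in> complex_angles (\<sigma> - 3 * \<delta>)" and w: "\<And>j. cmod (w $ j) \<le> V" for \<theta> w i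
  proof -
    define R where "R = \<delta> / V"
    have R: "R > 0" "2 \<le> R" using SV_pos small(2) sizes by (auto simp: R_def field_simps)
    have in_A: "\<theta> + t *\<^sub>C w \<in> complex_angles (\<sigma> - \<delta>)" if t: "cmod t < R" for t
    proof -
      have "cmod ((t *\<^sub>C w) $ j) \<le> \<delta>" for j
      proof -
        have "cmod t * cmod (w $ j) \<le> R * V" using t w[of j] R by (intro mult_mono) auto
        then show ?thesis using SV_pos by (simp add: norm_mult R_def)
      qed
      from complex_angles_add[OF \<theta> this] show ?thesis
        using complex_angles_mono[of "\<sigma> - 3 * \<delta> + \<delta>" "\<sigma> - \<delta>"] sizes by auto
    qed
    have "cmod (\<beta> i (\<theta> + w) - \<beta> i \<theta>) \<le> 2 * (c4 * E / \<delta> ^ \<nu>) / R"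
      by (rule hol_Cauchy_bounds(2)[OF \<beta>_hol _ R(1) _ R(2)]) (use in_A \<theta>_mono \<beta>_bound in auto)
    also have "\<dots> = 2 * c4 * c5 * E\<^sup>2 / \<delta> ^ (3 * \<nu> + 1)"
    proof -
      have "3 * \<nu> + 1 = \<nu> + 2 * \<nu> + 1" by simp
      then have eq: "\<delta> ^ (3 * \<nu> + 1) = \<delta> ^ \<nu> * \<delta> ^ (2 * \<nu>) * \<delta>" by (simp only: power_add power_one_right)
      show ?thesis unfolding eq R_def V_def by (simp add: power2_eq_square mult_ac)
    qed
    also have "\<dots> \<le> A * E\<^sup>2 / \<delta> ^ m" by (rule quadratic_error) (use c_pos A_ge in \<open>auto simp: m_def\<close>)
    finally show ?thesis
      using eqs(3)[of "\<theta> + w" i] eqs(3)[of \<theta> i] in_A[of 1] in_A[of 0] R by simp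
  qed
  show ?thesis
  proof (rule that[OF _ tf s_bound v_bound E1[unfolded g_def] E2 E3])
    show "\<bar>\<mu> $ i\<bar> \<le> A * E" for i
      using \<mu>[of i] mult_right_mono[OF A_ge(8), of E] sizes by linarith
  qed
qed

end

section \<open>Canonical transformations affine in the actions\<close>

definition cform :: "('n::finite) cphase \<Rightarrow> 'n cphase \<Rightarrow> complex" where
  "cform a b = cdot (fst a) (snd b) - cdot (snd a) (fst b)"

definition sympl :: "(('n::finite) cphase \<Rightarrow> 'n cphase) \<Rightarrow> 'n cphase \<Rightarrow> bool" where
  "sympl C x \<longleftrightarrow> (\<forall>a b. cform (dv C x a) (dv C x b) = cform a b)"

lemma hol_det:
  fixes M :: "'a::complex_space \<Rightarrow> complex^'n::finite^'n"
  assumes "\<And>i j. hol (\<lambda>x. M x $ i $ j) D"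
  shows "hol (\<lambda>x. det (M x)) D"
  unfolding det_def by (intro hol_sum hol_mult hol_const hol_prod assms)

text \<open>
  Cramer's rule.
\<close>

lemma hol_matrix_inv:
  fixes M :: "'a::complex_space \<Rightarrow> complex^'n::finite^'n"
  assumes M: "\<And>i j. hol (\<lambda>x. M x $ i $ j) D" and D: "open D" and inv: "\<And>x. x \<in> D \<Longrightarrow> invertible (M x)"
  shows "hol (\<lambda>x. matrix_inv (M x) $ i $ j) D"
proof -
  have det: "det (M x) \<noteq> 0" if "x \<in> D" for x
    using inv[OF that] invertible_det_nz by blast
  have eq: "det (\<chi> a b. if b = i then axis j 1 $ a else M x $ a $ b) * inverse (det (M x)) = matrix_inv (M x) $ i $ j"
    if x: "x \<in> D" for x
  proof -
    have "M x *v (matrix_inv (M x) *v axis j 1) = axis j 1"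
      using matrix_inv_mult(1)[OF inv[OF x]] by (simp add: matrix_vector_mul_assoc)
    then have "matrix_inv (M x) *v axis j 1 = (\<chi> k. det (\<chi> a b. if b = k then axis j 1 $ a else M x $ a $ b) / det (M x))"
      using cramer[OF det[OF x]] by blast
    moreover have "(matrix_inv (M x) *v axis j 1) $ i = matrix_inv (M x) $ i $ j"
      by (simp add: matrix_vector_mult_def axis_def if_distrib cong: if_cong)
    ultimately show ?thesis by (simp add: divide_inverse)
  qed
  have "hol (\<lambda>x. det (\<chi> a b. if b = i then axis j 1 $ a else M x $ a $ b) * inverse (det (M x))) D"
  proof (intro hol_mult hol_inverse hol_det det M)
    show "hol (\<lambda>x. (\<chi> a b. if b = i then axis j 1 $ a else M x $ a $ b) $ a $ b) D" for a b
      by (cases "b = i") (simp_all add: hol_const M)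
  qed
  from hol_cong_open[OF D this eq] show ?thesis .
qed

lemma second_dv_sum:
  fixes s :: "complex^'n::finite \<Rightarrow> complex"
  assumes s: "hol s (complex_angles \<sigma>)" and q: "q \<in> complex_angles \<sigma>"
  shows "(\<Sum>j\<in>UNIV. w $ j * dv (\<lambda>\<theta>. dv s \<theta> (e\<^sub>C j)) q u) = dv (\<lambda>\<theta>. dv s \<theta> w) q u"
proof -
  note h = hol_dv[OF open_complex_angles s]
  have hj: "hol (\<lambda>\<theta>. w $ j * dv s \<theta> (e\<^sub>C j)) (complex_angles \<sigma>)" for j by (intro hol_mult hol_const h)
  have "dv (\<lambda>\<theta>. dv s \<theta> w) q u = dv (\<lambda>\<theta>. \<Sum>j\<in>UNIV. w $ j * dv s \<theta> (e\<^sub>C j)) q u"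
    by (rule dv_cong_open[OF open_complex_angles q _ h]) (rule dv_angle_sum[OF s])
  also have "\<dots> = (\<Sum>j\<in>UNIV. dv (\<lambda>\<theta>. w $ j * dv s \<theta> (e\<^sub>C j)) q u)"
    by (rule dv_sum_fun[OF hj q])
  also have "\<dots> = (\<Sum>j\<in>UNIV. w $ j * dv (\<lambda>\<theta>. dv s \<theta> (e\<^sub>C j)) q u)"
    by (intro sum.cong refl) (simp add: dv_mult[OF hol_const h q])
  finally show ?thesis by simp
qed

lemma real_vec_cvec: "(\<And>i. w $ i \<in> \<real>) \<Longrightarrow> \<exists>p. w = cvec p"
  by (intro exI[of _ "\<chi> i. Re (w $ i)"]) (simp add: vec_eq_iff complex_is_Real_iff complex_eq_iff)

text \<open>
  The lift of the angle change \<open>\<psi> \<theta> = \<theta> + v \<theta>\<close> to phase space, followed by the shift of the actions by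
  the closed form \<open>grad s\<close>. With \<open>M\<close> the Jacobian of \<open>\<psi>\<close>, the new and the old actions are related
  by \<open>P = M\<^sup>T y\<close>, \<open>p = y + grad s\<close>.
\<close>

locale angle_lift =
  fixes s :: "complex^'n::finite \<Rightarrow> complex" and v :: "'n \<Rightarrow> complex^'n \<Rightarrow> complex"
    and \<sigma>1 \<sigma>2 \<sigma>3 V S :: real
  assumes s: "torus_fun \<sigma>1 s" and v: "\<And>i. torus_fun \<sigma>1 (v i)"
    and \<sigma>: "0 < \<sigma>3" "\<sigma>3 + V \<le> \<sigma>2" "\<sigma>2 \<le> \<sigma>1" and V: "0 < V" "V \<le> 1 / (2 * real CARD('n))"
    and v_bound: "\<And>\<theta> i. \<theta> \<in> complex_angles \<sigma>2 \<Longrightarrow> cmod (v i \<theta>) \<le> V"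
      "\<And>\<theta> i j. \<theta> \<in> complex_angles \<sigma>2 \<Longrightarrow> cmod (dv (v i) \<theta> (e\<^sub>C j)) \<le> V"
    and s_bound: "\<And>\<theta> j. \<theta> \<in> complex_angles \<sigma>2 \<Longrightarrow> cmod (dv s \<theta> (e\<^sub>C j)) \<le> S"
begin

definition vv :: "complex^'n \<Rightarrow> complex^'n" where "vv \<theta> = (\<chi> i. v i \<theta>)"
definition \<psi> :: "complex^'n \<Rightarrow> complex^'n" where "\<psi> \<theta> = \<theta> + vv \<theta>"
definition M :: "complex^'n \<Rightarrow> complex^'n^'n" where
  "M \<theta> = (\<chi> i j. (if i = j then 1 else 0) + dv (v i) \<theta> (e\<^sub>C j))"
definition N :: "complex^'n \<Rightarrow> complex^'n^'n" where "N \<theta> = matrix_inv (transpose (M \<theta>))"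
definition Y :: "'n cphase \<Rightarrow> complex^'n" where "Y x = N (snd x) *v fst x"
definition C :: "'n cphase \<Rightarrow> 'n cphase" where "C x = (Y x + grad s (\<psi> (snd x)), \<psi> (snd x))"

lemma mono3: "\<theta> \<in> complex_angles \<sigma>3 \<Longrightarrow> \<theta> \<in> complex_angles \<sigma>2" "\<theta> \<in> complex_angles \<sigma>2 \<Longrightarrow> \<theta> \<in> complex_angles \<sigma>1"
  "\<theta> \<in> complex_angles \<sigma>3 \<Longrightarrow> \<theta> \<in> complex_angles \<sigma>1"
  using complex_angles_mono[of \<sigma>3 \<sigma>2] complex_angles_mono[of \<sigma>2 \<sigma>1] \<sigma> V by auto

lemma \<psi>_in: "\<theta> \<in> complex_angles \<sigma>3 \<Longrightarrow> \<psi> \<theta> \<in> complex_angles \<sigma>2"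
proof -
  assume \<theta>: "\<theta> \<in> complex_angles \<sigma>3"
  have "\<psi> \<theta> \<in> complex_angles (\<sigma>3 + V)"
    unfolding \<psi>_def by (rule complex_angles_add[OF \<theta>]) (simp add: vv_def v_bound mono3(1)[OF \<theta>])
  then show ?thesis using complex_angles_mono[OF \<sigma>(2)] by auto
qed

lemma v_hol: "hol (v i) (complex_angles \<sigma>1)" and s_hol: "hol s (complex_angles \<sigma>1)"
  using s v by (auto intro: torus_funD)

lemma vv_hol: "hol vv (complex_angles \<sigma>1)" unfolding vv_def by (intro hol_vec v_hol)
lemma \<psi>_hol: "hol \<psi> (complex_angles \<sigma>1)" unfolding \<psi>_def by (intro hol_add hol_id vv_hol)

lemma dv_\<psi>: "\<theta> \<in> complex_angles \<sigma>1 \<Longrightarrow> dv \<psi> \<theta> u $ j = (\<Sum>i\<in>UNIV. M \<theta> $ j $ i * u $ i)"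
proof -
  assume \<theta>: "\<theta> \<in> complex_angles \<sigma>1"
  have "dv \<psi> \<theta> u = u + (\<chi> i. dv (v i) \<theta> u)"
    unfolding \<psi>_def[abs_def] dv_plus[OF hol_id vv_hol \<theta>] unfolding vv_def[abs_def] dv_vec[OF v_hol \<theta>] by simp
  then have "dv \<psi> \<theta> u $ j = u $ j + (\<Sum>i\<in>UNIV. u $ i * dv (v j) \<theta> (e\<^sub>C i))"
    by (simp flip: dv_angle_sum[OF v_hol \<theta>])
  moreover have "(\<Sum>i\<in>UNIV. M \<theta> $ j $ i * u $ i) = (\<Sum>i\<in>UNIV. (if j = i then u $ i else 0) + u $ i * dv (v j) \<theta> (e\<^sub>C i))"
    by (intro sum.cong refl) (simp add: M_def algebra_simps)
  ultimately show ?thesis by (simp add: sum.distrib)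
qed

lemma M_hol: "hol (\<lambda>\<theta>. M \<theta> $ i $ j) (complex_angles \<sigma>1)"
  by (simp add: M_def hol_add hol_const hol_dv[OF open_complex_angles v_hol])

lemma M_near: "\<theta> \<in> complex_angles \<sigma>2 \<Longrightarrow> cmod (M \<theta> $ i $ k - (if i = k then 1 else 0)) \<le> V"
  using v_bound(2) by (simp add: M_def)

lemma M_near_id: "\<theta> \<in> complex_angles \<sigma>2 \<Longrightarrow> near_id (M \<theta>)"
  using M_near V(2) unfolding near_id_def by (meson order_trans)

lemma MT_near_id: "\<theta> \<in> complex_angles \<sigma>2 \<Longrightarrow> near_id (transpose (M \<theta>))"
  by (rule near_id_transpose[OF M_near_id])

lemma N_inverse: "\<theta> \<in> complex_angles \<sigma>2 \<Longrightarrow> transpose (M \<theta>) ** N \<theta> = mat 1" "\<theta> \<in> complex_angles \<sigma>2 \<Longrightarrow> N \<theta> ** transpose (M \<theta>) = mat 1"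
  unfolding N_def using matrix_inv_mult[OF near_id_invertible[OF MT_near_id]] by auto

lemma N_hol: "hol (\<lambda>\<theta>. N \<theta> $ i $ j) (complex_angles \<sigma>2)"
  unfolding N_def
proof (rule hol_matrix_inv[OF _ open_complex_angles near_id_invertible[OF MT_near_id]])
  show "hol (\<lambda>x. transpose (M x) $ i $ j) (complex_angles \<sigma>2)" for i j
    using hol_subset[OF M_hol[of j i], of "complex_angles \<sigma>2"] mono3(2) by (auto simp: transpose_def)
qed

lemma MY: "snd x \<in> complex_angles \<sigma>2 \<Longrightarrow> (\<Sum>j\<in>UNIV. M (snd x) $ j $ i * Y x $ j) = fst x $ i"
proof -
  assume x: "snd x \<in> complex_angles \<sigma>2"
  have "transpose (M (snd x)) *v Y x = fst x"
    unfolding Y_def by (simp add: matrix_vector_mul_assoc N_inverse[OF x])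
  then have "(transpose (M (snd x)) *v Y x) $ i = fst x $ i" by simp
  then show ?thesis by (simp add: matrix_vector_mult_def transpose_def)
qed

abbreviation D :: "'n cphase set" where "D \<equiv> UNIV \<times> complex_angles \<sigma>3"

lemma open_D: "open D" by (intro open_Times open_UNIV open_complex_angles)

lemma Y_hol: "hol Y D"
proof -
  have h: "hol (\<lambda>x. N (snd x) $ i $ j) D" for i j
    by (rule hol_compose[OF N_hol hol_snd[OF hol_id]]) (use mono3 in auto)
  have "hol (\<lambda>x. \<chi> i. \<Sum>j\<in>UNIV. N (snd x) $ i $ j * fst x $ j) D"
    by (intro hol_vec hol_sum hol_mult h hol_nth hol_fst hol_id)
  then show ?thesis by (simp add: Y_def[abs_def] matrix_vector_mult_def[abs_def])
qed

lemma psi_snd_hol: "hol (\<lambda>x. \<psi> (snd x)) D"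
  by (rule hol_compose[OF \<psi>_hol hol_snd[OF hol_id]]) (use mono3 in auto)

lemma grad_hol: "hol (grad s) (complex_angles \<sigma>1)"
  unfolding grad_def by (intro hol_vec hol_dv[OF open_complex_angles s_hol])

lemma grad_psi_hol: "hol (\<lambda>x. grad s (\<psi> (snd x))) D"
  by (rule hol_compose[OF grad_hol psi_snd_hol]) (auto intro!: mono3(2)[OF \<psi>_in])

lemma C_hol: "hol C D"
  unfolding C_def by (intro hol_Pair hol_add Y_hol grad_psi_hol psi_snd_hol)

lemma Y_near:
  assumes x: "snd x \<in> complex_angles \<sigma>2" "\<And>i. cmod (fst x $ i) \<le> 1"
  shows "cmod (Y x $ i - fst x $ i) \<le> real CARD('n) * V * 2"
proof -
  have eq: "transpose (M (snd x)) *v Y x = fst x"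
    unfolding Y_def by (simp add: matrix_vector_mul_assoc N_inverse[OF x(1)])
  have "cmod (Y x $ i) \<le> 2 * 1" for i
    by (rule near_id_norm[OF MT_near_id[OF x(1)]]) (use eq x in simp)
  then have "cmod ((transpose (M (snd x)) *v Y x) $ i - Y x $ i) \<le> real CARD('n) * V * 2"
  proof (intro near_identity_error)
    show "cmod (transpose (M (snd x)) $ i $ k - (if i = k then 1 else 0)) \<le> V" for i k
      using M_near[OF x(1), of k i] by (simp add: transpose_def eq_commute)
  qed simp
  then show ?thesis unfolding eq by (subst norm_minus_commute)
qed

lemma C_near:
  assumes x: "x \<in> D" "\<And>i. cmod (fst x $ i) \<le> 1"
  shows "cmod (fst (C x) $ i - fst x $ i) \<le> real CARD('n) * V * 2 + S" "cmod (snd (C x) $ i - snd x $ i) \<le> V"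
proof -
  have x3: "snd x \<in> complex_angles \<sigma>3" using x by auto
  have "cmod ((Y x $ i - fst x $ i) + grad s (\<psi> (snd x)) $ i) \<le> real CARD('n) * V * 2 + S"
    by (intro order_trans[OF norm_triangle_ineq] add_mono Y_near x mono3(1) x3)
      (simp add: grad_def s_bound \<psi>_in x3)
  then show "cmod (fst (C x) $ i - fst x $ i) \<le> real CARD('n) * V * 2 + S" by (simp add: C_def algebra_simps)
  show "cmod (snd (C x) $ i - snd x $ i) \<le> V"
    using v_bound(1)[OF mono3(1)[OF x3]] by (simp add: C_def \<psi>_def vv_def)
qed

lemma C_shift: "x \<in> D \<Longrightarrow> C (x + shiftv k) = C x + shiftv k"
proof -
  assume "x \<in> D"
  then have x3: "snd x \<in> complex_angles \<sigma>3" by auto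
  note x1 = mono3(3)[OF x3]
  let ?k = "cvec (lattice_vec k)"
  have vk: "v i (snd x + ?k) = v i (snd x)" for i
    using torus_funD(2)[OF v[of i]] x1 by (simp add: ang_periodic_def)
  then have psi: "\<psi> (snd x + ?k) = \<psi> (snd x) + ?k"
    by (simp add: \<psi>_def vv_def)
  have "dv (v i) (snd x + ?k) u = dv (v i) (snd x) u" for i u
    by (rule dv_translation_invariant[OF v_hol open_complex_angles x1])
      (use torus_funD(2)[OF v[of i]] in \<open>auto simp: ang_periodic_def\<close>)
  then have "Y (x + shiftv k) = Y x" by (simp add: Y_def N_def M_def shiftv_def)
  moreover have "grad s (\<psi> (snd x) + ?k) = grad s (\<psi> (snd x))"
  proof -
    have "dv s (\<psi> (snd x) + ?k) u = dv s (\<psi> (snd x)) u" for u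
      by (rule dv_translation_invariant[OF s_hol open_complex_angles mono3(2)[OF \<psi>_in[OF x3]]])
        (use torus_funD(2)[OF s] in \<open>auto simp: ang_periodic_def\<close>)
    then show ?thesis by (simp add: grad_def)
  qed
  ultimately show ?thesis by (simp add: C_def shiftv_def psi)
qed

lemma \<sigma>_pos: "0 < \<sigma>1" "0 < \<sigma>2" using \<sigma> V by auto

lemma C_real: "\<exists>p' q'. C (cvec p, cvec q) = (cvec p', cvec q')"
proof -
  have q3: "cvec q \<in> complex_angles \<sigma>3" using \<sigma> by simp
  have vr: "v i (cvec q) \<in> \<real>" for i by (rule torus_funD(3)[OF v])
  obtain q' where q': "\<psi> (cvec q) = cvec q'"
    using real_vec_cvec[of "\<psi> (cvec q)"] vr by (auto simp: \<psi>_def vv_def)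
  have Mr: "M (cvec q) $ i $ j \<in> \<real>" for i j
    using torus_funD(3)[OF torus_fun_dv_axis[OF v \<sigma>_pos(1)]] by (simp add: M_def)
  let ?x = "(cvec p, cvec q)"
  have "Y ?x $ i \<in> \<real>" for i
  proof -
    have "transpose (M (cvec q)) *v (\<chi> j. Y ?x $ j - cnj (Y ?x $ j)) = 0"
    proof (rule vec_eq_iff[THEN iffD2], rule)
      fix i
      have e: "(\<Sum>j\<in>UNIV. M (cvec q) $ j $ i * Y ?x $ j) = of_real (p $ i)"
        using MY[of ?x i] mono3(1)[OF q3] by simp
      have "cnj (\<Sum>j\<in>UNIV. M (cvec q) $ j $ i * Y ?x $ j) = (\<Sum>j\<in>UNIV. M (cvec q) $ j $ i * cnj (Y ?x $ j))"
        using Mr by (simp add: cnj_sum Reals_cnj_iff)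
      then have e': "(\<Sum>j\<in>UNIV. M (cvec q) $ j $ i * cnj (Y ?x $ j)) = of_real (p $ i)"
        unfolding e by simp
      show "(transpose (M (cvec q)) *v (\<chi> j. Y ?x $ j - cnj (Y ?x $ j))) $ i = 0 $ i"
        using e e' by (simp add: matrix_vector_mult_def transpose_def right_diff_distrib sum_subtractf)
    qed
    then have "cmod ((\<chi> j. Y ?x $ j - cnj (Y ?x $ j)) $ i) \<le> 2 * 0"
      by (intro near_id_norm[OF MT_near_id[OF mono3(1)[OF q3]]]) simp
    then show ?thesis by (simp add: complex_is_Real_iff complex_eq_iff)
  qed
  moreover have "grad s (\<psi> (cvec q)) $ i \<in> \<real>" for i
    using torus_funD(3)[OF torus_fun_dv_axis[OF s \<sigma>_pos(1)]] by (simp add: q' grad_def)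
  ultimately obtain p' where "Y ?x + grad s (\<psi> (cvec q)) = cvec p'"
    using real_vec_cvec[of "Y ?x + grad s (\<psi> (cvec q))"] by (auto intro: Reals_add)
  then show ?thesis using q' by (intro exI[of _ p'] exI[of _ q']) (simp add: C_def)
qed

text \<open>
  Differentiating \<open>P = M\<^sup>T y\<close> gives \<open>dP = M\<^sup>T dy\<close> plus second derivatives of \<open>\<psi>\<close>, while \<open>dq = M d\<theta>\<close>. In
  the antisymmetric form the Hessians of \<open>\<psi>\<close> and of \<open>s\<close> cancel.
\<close>

lemma C_sympl: "x \<in> D \<Longrightarrow> sympl C x"
  unfolding sympl_def
proof (intro allI)
  fix a b :: "'n cphase" assume x: "x \<in> D"
  then have x3: "snd x \<in> complex_angles \<sigma>3" by auto
  note x1 = mono3(3)[OF x3] and x2 = mono3(1)[OF x3]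
  define \<theta> where "\<theta> = snd x"
  note \<theta>1 = x1[folded \<theta>_def]
  define dq where "dq u = dv \<psi> \<theta> (snd u)" for u :: "'n cphase"
  define dy where "dy u = dv Y x u" for u
  define H where "H j u w = dv (\<lambda>\<theta>. dv (v j) \<theta> (snd w)) \<theta> (snd u)" for j and u w :: "'n cphase"
  have H_sym: "H j u w = H j w u" for j u w
    unfolding H_def by (rule dv_commute[OF open_complex_angles v_hol \<theta>1])
  have dsnd: "dv (\<lambda>x. snd x) x u = snd u" for u
    using dv_snd[OF hol_id[of D] x] by simp
  have dpsi: "dv (\<lambda>x. \<psi> (snd x)) x u = dq u" for u
    using dv_compose[OF \<psi>_hol hol_snd[OF hol_id[of D]] x x1] by (simp add: dsnd dq_def \<theta>_def)
  have dP: "fst u $ i = (\<Sum>j\<in>UNIV. M \<theta> $ j $ i * dy u $ j) + (\<Sum>j\<in>UNIV. dv (\<lambda>\<theta>. dv (v j) \<theta> (e\<^sub>C i)) \<theta> (snd u) * Y x $ j)" for u i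
  proof -
    have hM: "hol (\<lambda>x. M (snd x) $ j $ i) D" for j
      by (rule hol_compose[OF M_hol hol_snd[OF hol_id]]) (use mono3 in auto)
    have hMY: "hol (\<lambda>x. M (snd x) $ j $ i * Y x $ j) D" for j
      by (intro hol_mult hM hol_nth Y_hol)
    have dM: "dv (\<lambda>x. M (snd x) $ j $ i) x u = dv (\<lambda>\<theta>. dv (v j) \<theta> (e\<^sub>C i)) \<theta> (snd u)" for j
    proof -
      have "dv (\<lambda>x. M (snd x) $ j $ i) x u = dv (\<lambda>\<theta>. M \<theta> $ j $ i) \<theta> (snd u)"
        using dv_compose[OF M_hol hol_snd[OF hol_id[of D]] x x1, of j i] by (simp add: dsnd \<theta>_def)
      also have "\<dots> = dv (\<lambda>\<theta>. dv (v j) \<theta> (e\<^sub>C i)) \<theta> (snd u)"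
        using dv_plus[OF hol_const hol_dv[OF open_complex_angles v_hol] \<theta>1] by (simp add: M_def)
      finally show ?thesis .
    qed
    have "fst u $ i = dv (\<lambda>x. fst x $ i) x u"
      using dv_nth[OF hol_fst[OF hol_id[of D]] x] dv_fst[OF hol_id[of D] x] by simp
    also have "\<dots> = dv (\<lambda>x. \<Sum>j\<in>UNIV. M (snd x) $ j $ i * Y x $ j) x u"
    proof (rule dv_cong_open[OF open_D x _ hol_nth[OF hol_fst[OF hol_id]]])
      fix y assume "y \<in> D"
      then have "snd y \<in> complex_angles \<sigma>2" by (auto intro: mono3(1))
      then show "fst y $ i = (\<Sum>j\<in>UNIV. M (snd y) $ j $ i * Y y $ j)" by (rule MY[symmetric])
    qed
    also have "\<dots> = (\<Sum>j\<in>UNIV. dv (\<lambda>x. M (snd x) $ j $ i * Y x $ j) x u)"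
      by (rule dv_sum_fun[OF hMY x])
    also have "\<dots> = (\<Sum>j\<in>UNIV. M \<theta> $ j $ i * dy u $ j + dv (\<lambda>\<theta>. dv (v j) \<theta> (e\<^sub>C i)) \<theta> (snd u) * Y x $ j)"
      by (intro sum.cong refl)
        (simp add: dv_mult[OF hM hol_nth[OF Y_hol] x] dM dv_nth[OF Y_hol x] dy_def \<theta>_def)
    finally show ?thesis by (simp add: sum.distrib)
  qed
  have key: "cdot (fst u) (snd w) = cdot (dy u) (dq w) + (\<Sum>j\<in>UNIV. Y x $ j * H j u w)" for u w
  proof -
    have "cdot (fst u) (snd w) = (\<Sum>i\<in>UNIV. (\<Sum>j\<in>UNIV. M \<theta> $ j $ i * dy u $ j) * snd w $ i)
       + (\<Sum>i\<in>UNIV. (\<Sum>j\<in>UNIV. dv (\<lambda>\<theta>. dv (v j) \<theta> (e\<^sub>C i)) \<theta> (snd u) * Y x $ j) * snd w $ i)"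
      unfolding cdot_def dP[of u] by (simp add: distrib_right sum.distrib)
    also have "(\<Sum>i\<in>UNIV. (\<Sum>j\<in>UNIV. M \<theta> $ j $ i * dy u $ j) * snd w $ i) = (\<Sum>j\<in>UNIV. dy u $ j * (\<Sum>i\<in>UNIV. M \<theta> $ j $ i * snd w $ i))"
      unfolding sum_distrib_left sum_distrib_right by (subst sum.swap) (simp add: mult_ac)
    also have "\<dots> = cdot (dy u) (dq w)"
      unfolding cdot_def dq_def dv_\<psi>[OF \<theta>1] ..
    also have "(\<Sum>i\<in>UNIV. (\<Sum>j\<in>UNIV. dv (\<lambda>\<theta>. dv (v j) \<theta> (e\<^sub>C i)) \<theta> (snd u) * Y x $ j) * snd w $ i)
        = (\<Sum>j\<in>UNIV. Y x $ j * (\<Sum>i\<in>UNIV. snd w $ i * dv (\<lambda>\<theta>. dv (v j) \<theta> (e\<^sub>C i)) \<theta> (snd u)))"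
      unfolding sum_distrib_left sum_distrib_right by (subst sum.swap) (simp add: mult_ac)
    also have "\<dots> = (\<Sum>j\<in>UNIV. Y x $ j * H j u w)"
      unfolding second_dv_sum[OF v_hol \<theta>1] H_def ..
    finally show ?thesis .
  qed
  define q where "q = \<psi> \<theta>"
  have q1: "q \<in> complex_angles \<sigma>1" unfolding q_def \<theta>_def by (rule mono3(2)[OF \<psi>_in[OF x3]])
  have dC: "dv C x u = (dy u + (\<chi> j. dv (\<lambda>\<theta>. dv s \<theta> (e\<^sub>C j)) q (dq u)), dq u)" for u
  proof -
    have hg: "hol (\<lambda>\<theta>. dv s \<theta> (e\<^sub>C j)) (complex_angles \<sigma>1)" for j by (rule hol_dv[OF open_complex_angles s_hol])
    have "dv (\<lambda>x. grad s (\<psi> (snd x))) x u = dv (grad s) q (dq u)"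
      using dv_compose[OF grad_hol psi_snd_hol x] q1 by (simp add: dpsi q_def \<theta>_def)
    also have "\<dots> = (\<chi> j. dv (\<lambda>\<theta>. dv s \<theta> (e\<^sub>C j)) q (dq u))"
      unfolding grad_def by (rule dv_vec[OF hg q1])
    finally show ?thesis
      unfolding C_def[abs_def] dv_Pair[OF hol_add[OF Y_hol grad_psi_hol] psi_snd_hol x] dv_plus[OF Y_hol grad_psi_hol x]
      by (simp add: dy_def dpsi)
  qed
  have Hs: "cdot (\<chi> j. dv (\<lambda>\<theta>. dv s \<theta> (e\<^sub>C j)) q u) w = dv (\<lambda>\<theta>. dv s \<theta> w) q u" for u w
    unfolding cdot_def using second_dv_sum[OF s_hol q1, of w u] by (simp add: mult.commute)
  have cadd: "cdot (u + u') w = cdot u w + cdot u' w" and ccom: "cdot u w = cdot w u" for u u' w :: "complex^'n"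
    by (simp_all add: cdot_def algebra_simps sum.distrib)
  have s_sym: "dv (\<lambda>\<theta>. dv s \<theta> u) q w = dv (\<lambda>\<theta>. dv s \<theta> w) q u" for u w
    by (rule dv_commute[OF open_complex_angles s_hol q1])
  have "cform (dv C x a) (dv C x b) = cdot (dy a) (dq b) - cdot (dy b) (dq a)"
    unfolding cform_def dC fst_conv snd_conv ccom[of "dq a"] cadd Hs using s_sym[of "dq a" "dq b"] by simp
  moreover have "cform a b = cdot (dy a) (dq b) - cdot (dy b) (dq a)"
    unfolding cform_def ccom[of "snd a"] key using H_sym[of _ a b] by simp
  ultimately show "cform (dv C x a) (dv C x b) = cform a b" by simp
qed

lemma C_at_0: "C (0, \<theta>) = (grad s (\<psi> \<theta>), \<psi> \<theta>)"
  by (simp add: C_def Y_def)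

lemma dv_C_at_0:
  assumes \<theta>: "\<theta> \<in> complex_angles \<sigma>3"
  shows "dv C (0, \<theta>) (e\<^sub>P i) = ((\<chi> j. N \<theta> $ j $ i), 0)"
    and "(\<Sum>i\<in>UNIV. M \<theta> $ k $ i * N \<theta> $ j $ i) = (if j = k then 1 else 0)"
proof -
  have x: "(0, \<theta>) \<in> D" using \<theta> by simp
  have "((\<lambda>t. C ((0, \<theta>) + t *\<^sub>C e\<^sub>P i)) has_derivative (\<lambda>t. dv C ((0, \<theta>) + 0 *\<^sub>C e\<^sub>P i) (t *\<^sub>C e\<^sub>P i))) (at 0)"
    by (rule hol_has_derivative_compose[OF C_hol]) (use x in \<open>auto intro!: derivative_eq_intros simp del: cscale_Pair\<close>)
  moreover have "((\<lambda>t. C ((0, \<theta>) + t *\<^sub>C e\<^sub>P i)) has_derivative (\<lambda>t. (t *\<^sub>C (\<chi> j. N \<theta> $ j $ i), 0))) (at 0)"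
  proof -
    have "N \<theta> *v (t *\<^sub>C e\<^sub>C i) = t *\<^sub>C (\<chi> j. N \<theta> $ j $ i)" for t
      by (simp add: vec_eq_iff matrix_vector_mult_def axis_def if_distrib mult.commute cong: if_cong)
    then have "(\<lambda>t. C ((0, \<theta>) + t *\<^sub>C e\<^sub>P i)) = (\<lambda>t. (t *\<^sub>C (\<chi> j. N \<theta> $ j $ i) + grad s (\<psi> \<theta>), \<psi> \<theta>))"
      by (simp add: C_def Y_def)
    then show ?thesis by (auto intro!: derivative_eq_intros)
  qed
  ultimately have "(\<lambda>t. dv C ((0, \<theta>) + 0 *\<^sub>C e\<^sub>P i) (t *\<^sub>C e\<^sub>P i)) = (\<lambda>t. (t *\<^sub>C (\<chi> j. N \<theta> $ j $ i), 0))"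
    by (rule has_derivative_unique)
  from fun_cong[OF this, of 1] show "dv C (0, \<theta>) (e\<^sub>P i) = ((\<chi> j. N \<theta> $ j $ i), 0)"
    by (simp del: cscale_Pair)
  have "(N \<theta> ** transpose (M \<theta>)) $ j $ k = (mat 1 :: complex^'n^'n) $ j $ k"
    using N_inverse(2)[OF mono3(1)[OF \<theta>]] by simp
  then show "(\<Sum>i\<in>UNIV. M \<theta> $ k $ i * N \<theta> $ j $ i) = (if j = k then 1 else 0)"
    by (simp add: matrix_matrix_mult_def transpose_def mat_def mult.commute)
qed

end

section \<open>The iteration\<close>

text \<open>
  The Hamiltonian with its frequency changed by \<open>\<Lambda>\<close>, in the coordinates given by \<open>C\<close>. Keeping the
  original \<open>F\<close> here lets the frequency be changed again in every step.
\<close>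

definition transformed_ham :: "(('n::finite) cphase \<Rightarrow> complex) \<Rightarrow> real^'n \<Rightarrow> ('n cphase \<Rightarrow> 'n cphase) \<Rightarrow> 'n cphase \<Rightarrow> complex" where
  "transformed_ham F \<Lambda> C x = F (C x) + (\<Sum>k\<in>UNIV. of_real (\<Lambda> $ k) * fst (C x) $ k)"

text \<open>
  A complex canonical transformation from the domain of size \<open>r\<close>, \<open>\<sigma>\<close> into the original one, that
  descends to the torus, is real at real points and moves each coordinate by at most \<open>\<kappa>\<close>.
\<close>

definition phase_map :: "real \<Rightarrow> real \<Rightarrow> real \<Rightarrow> real \<Rightarrow> real \<Rightarrow> (('n::finite) cphase \<Rightarrow> 'n cphase) \<Rightarrow> bool" where
  "phase_map r0 \<sigma>0 r \<sigma> \<kappa> C \<longleftrightarrow> hol C (pdom r \<sigma>) \<and> C ` pdom r \<sigma> \<subseteq> pdom r0 \<sigma>0 \<and>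
     (\<forall>x\<in>pdom r \<sigma>. \<forall>k. C (x + shiftv k) = C x + shiftv k) \<and>
     (\<forall>p q. (cvec p, cvec q) \<in> pdom r \<sigma> \<longrightarrow> (\<exists>p' q'. C (cvec p, cvec q) = (cvec p', cvec q'))) \<and>
     (\<forall>x\<in>pdom r \<sigma>. sympl C x) \<and>
     (\<forall>x\<in>pdom r \<sigma>. \<forall>i. cmod (fst (C x) $ i - fst x $ i) \<le> \<kappa> \<and> cmod (snd (C x) $ i - snd x $ i) \<le> \<kappa>)"

definition normal_form_error :: "real^'n::finite \<Rightarrow> real \<Rightarrow> real \<Rightarrow> ('n cphase \<Rightarrow> complex) \<Rightarrow> bool" where
  "normal_form_error \<omega> \<sigma> E f \<longleftrightarrow> (\<forall>\<theta>\<in>complex_angles \<sigma>. cmod (f (0, \<theta>) - f (0, 0)) \<le> E \<and>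
     (\<forall>i. cmod (pd i f (0, \<theta>) - of_real (\<omega> $ i)) \<le> E))"

lemma phase_mapD:
  assumes "phase_map r0 \<sigma>0 r \<sigma> \<kappa> C"
  shows "hol C (pdom r \<sigma>)" "x \<in> pdom r \<sigma> \<Longrightarrow> C x \<in> pdom r0 \<sigma>0"
    "x \<in> pdom r \<sigma> \<Longrightarrow> C (x + shiftv k) = C x + shiftv k"
    "(cvec p, cvec q) \<in> pdom r \<sigma> \<Longrightarrow> \<exists>p' q'. C (cvec p, cvec q) = (cvec p', cvec q')"
    "x \<in> pdom r \<sigma> \<Longrightarrow> sympl C x"
    "x \<in> pdom r \<sigma> \<Longrightarrow> cmod (fst (C x) $ i - fst x $ i) \<le> \<kappa>"
    "x \<in> pdom r \<sigma> \<Longrightarrow> cmod (snd (C x) $ i - snd x $ i) \<le> \<kappa>"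
  using assms unfolding phase_map_def by blast+

lemma shiftv_simps [simp]: "fst (shiftv k) = 0" "snd (shiftv k) = cvec (lattice_vec k)"
  by (simp_all add: shiftv_def)

lemma hol_transformed_ham:
  assumes "hol F D" "hol C E" "C ` E \<subseteq> D"
  shows "hol (transformed_ham F \<Lambda> C) E"
  unfolding transformed_ham_def
  by (intro hol_add hol_sum hol_mult hol_const hol_nth hol_fst hol_compose[OF assms(1,2,3)] assms(2))

lemma phase_fun_transformed_ham:
  assumes F: "phase_fun r0 \<sigma>0 F" and C: "phase_map r0 \<sigma>0 r \<sigma> \<kappa> C"
  shows "phase_fun r \<sigma> (transformed_ham F \<Lambda> C)"
  unfolding phase_fun_def
proof (intro conjI ballI allI impI)
  note C = phase_mapD[OF C]
  show "hol (transformed_ham F \<Lambda> C) (pdom r \<sigma>)"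
    by (rule hol_transformed_ham[OF phase_funD(1)[OF F] C(1)]) (use C(2) in auto)
  show "transformed_ham F \<Lambda> C (x + shiftv k) = transformed_ham F \<Lambda> C x" if "x \<in> pdom r \<sigma>" for x k
    using C(3)[OF that] phase_funD(2)[OF F C(2)[OF that]] by (simp add: transformed_ham_def)
  show "transformed_ham F \<Lambda> C (cvec p, cvec q) \<in> \<real>" if pq: "(cvec p, cvec q) \<in> pdom r \<sigma>" for p q
  proof -
    obtain p' q' where e: "C (cvec p, cvec q) = (cvec p', cvec q')" using C(4)[OF pq] by blast
    have "F (cvec p', cvec q') \<in> \<real>" by (rule phase_funD(3)[OF F]) (use C(2)[OF pq] e in simp)
    then show ?thesis by (simp add: transformed_ham_def e)
  qed
qed

lemma phase_fun_action:
  assumes C: "phase_map r0 \<sigma>0 r \<sigma> \<kappa> C"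
  shows "phase_fun r \<sigma> (\<lambda>x. fst (C x) $ k)"
  unfolding phase_fun_def
proof (intro conjI ballI allI impI)
  note C = phase_mapD[OF C]
  show "hol (\<lambda>x. fst (C x) $ k) (pdom r \<sigma>)" by (intro hol_nth hol_fst C)
  show "fst (C (x + shiftv j)) $ k = fst (C x) $ k" if "x \<in> pdom r \<sigma>" for x j
    using C(3)[OF that] by simp
  show "fst (C (cvec p, cvec q)) $ k \<in> \<real>" if pq: "(cvec p, cvec q) \<in> pdom r \<sigma>" for p q
    using C(4)[OF pq] by auto
qed

lemma transformed_ham_bound:
  fixes F :: "('n::finite) cphase \<Rightarrow> complex"
  assumes F: "\<And>x. x \<in> pdom r0 \<sigma>0 \<Longrightarrow> cmod (F x) \<le> B0" and C: "phase_map r0 \<sigma>0 r \<sigma> \<kappa> C"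
    and \<Lambda>: "\<And>k. \<bar>\<Lambda> $ k\<bar> \<le> 1" and r0: "r0 \<le> 1" and x: "x \<in> pdom r \<sigma>"
  shows "cmod (transformed_ham F \<Lambda> C x) \<le> B0 + real CARD('n)"
proof -
  have Cx: "C x \<in> pdom r0 \<sigma>0" by (rule phase_mapD(2)[OF C x])
  have "cmod (transformed_ham F \<Lambda> C x) \<le> B0 + real CARD('n) * 1"
    unfolding transformed_ham_def
  proof (intro order_trans[OF norm_triangle_ineq] add_mono F Cx norm_sum_le_card)
    fix k
    have "cmod (fst (C x) $ k) \<le> 1" using Cx r0 by (auto simp: pdom_def intro: order_trans[OF less_imp_le])
    then have "cmod (of_real (\<Lambda> $ k) * fst (C x) $ k) \<le> 1 * 1"
      unfolding norm_mult norm_of_real by (intro mult_mono \<Lambda>) auto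
    then show "cmod (of_real (\<Lambda> $ k) * fst (C x) $ k) \<le> 1" by simp
  qed
  then show ?thesis by simp
qed

lemma sympl_compose:
  assumes "hol C E" "hol C' D" "x \<in> D" "C' x \<in> E" "sympl C (C' x)" "sympl C' x"
  shows "sympl (\<lambda>x. C (C' x)) x"
  unfolding sympl_def
proof (intro allI)
  fix a b
  have "cform (dv (\<lambda>x. C (C' x)) x a) (dv (\<lambda>x. C (C' x)) x b) = cform (dv C (C' x) (dv C' x a)) (dv C (C' x) (dv C' x b))"
    by (simp only: dv_compose[OF assms(1-4)])
  also have "\<dots> = cform (dv C' x a) (dv C' x b)" using assms(5) unfolding sympl_def by blast
  also have "\<dots> = cform a b" using assms(6) unfolding sympl_def by blast
  finally show "cform (dv (\<lambda>x. C (C' x)) x a) (dv (\<lambda>x. C (C' x)) x b) = cform a b" .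
qed

text \<open>
  The constants depend on the size \<open>\<rho>\<close> below which the domains never shrink and on the bound \<open>B0\<close>
  of the original Hamiltonian; as every transformed Hamiltonian is a composition with a map into the original domain,
  this bound serves all steps. The transformations are recorded together with their total distance
  \<open>\<kappa>\<close> from the identity, on which the invertibility of the system for the frequency depends.
\<close>

lemma kam_step:
  fixes \<omega> :: "real^'n::finite"
  assumes sol: "cohom_solvable \<omega> K \<nu>" and \<rho>: "0 < \<rho>" and r0: "r0 \<le> 1" "\<sigma>0 \<le> 1" and B0: "0 \<le> B0"
  obtains A m \<kappa>s where "A \<ge> 1" "0 < \<kappa>s" "\<kappa>s \<le> 1"
    "\<And>F r \<sigma> \<delta> \<kappa> E \<Lambda> C. phase_fun r0 \<sigma>0 F \<Longrightarrow> \<forall>x\<in>pdom r0 \<sigma>0. cmod (F x) \<le> B0 \<Longrightarrow>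
      \<rho> \<le> r \<Longrightarrow> r \<le> r0 \<Longrightarrow> \<rho> \<le> \<sigma> \<Longrightarrow> \<sigma> \<le> \<sigma>0 \<Longrightarrow> 0 < \<delta> \<Longrightarrow> 4 * \<delta> \<le> \<rho> \<Longrightarrow> 0 < E \<Longrightarrow> 0 \<le> \<kappa> \<Longrightarrow> \<kappa> \<le> \<kappa>s \<Longrightarrow>
      \<forall>k. \<bar>\<Lambda> $ k\<bar> \<le> 1 \<Longrightarrow> A * E / \<delta> ^ m \<le> 1 \<Longrightarrow>
      phase_map r0 \<sigma>0 r \<sigma> \<kappa> C \<Longrightarrow> normal_form_error \<omega> \<sigma> E (transformed_ham F \<Lambda> C) \<Longrightarrow>
      \<exists>\<Lambda>' C'. phase_map r0 \<sigma>0 (r - \<delta>) (\<sigma> - 3 * \<delta>) (\<kappa> + A * E / \<delta> ^ m) C' \<and>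
        normal_form_error \<omega> (\<sigma> - 3 * \<delta>) (A * E\<^sup>2 / \<delta> ^ m) (transformed_ham F \<Lambda>' C') \<and>
        (\<forall>k. \<bar>\<Lambda>' $ k - \<Lambda> $ k\<bar> \<le> A * E) \<and>
        (\<forall>x\<in>pdom (r - \<delta>) (\<sigma> - 3 * \<delta>). \<forall>i. cmod (fst (C' x) $ i - fst (C x) $ i) \<le> A * E / \<delta> ^ m \<and>
           cmod (snd (C' x) $ i - snd (C x) $ i) \<le> A * E / \<delta> ^ m)"
proof -
  define n where "n = real CARD('n)"
  define B where "B = B0 + n + 1"
  define A0 where "A0 = step_data.A K \<nu> n \<rho> B"
  define c1 where "c1 = step_data.c1 K \<nu> n \<rho> B"
  define m where "m = step_data.m \<nu>"
  define A where "A = max 1 (4 * A0)"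
  (* Up to this distance from the identity the system for the frequency change is within 1 / (2 n)
     of the identity. *)
  define \<kappa>s where "\<kappa>s = min 1 (1 / (2 * n * max c1 1))"
  have n1: "n \<ge> 1" by (simp add: n_def Suc_le_eq)
  have c1m: "0 < max c1 1" by simp
  have \<kappa>s: "0 < \<kappa>s" "\<kappa>s \<le> 1" using n1 c1m by (auto simp: \<kappa>s_def)
  have "\<exists>\<Lambda>' C'. phase_map r0 \<sigma>0 (r - \<delta>) (\<sigma> - 3 * \<delta>) (\<kappa> + A * E / \<delta> ^ m) C' \<and>
        normal_form_error \<omega> (\<sigma> - 3 * \<delta>) (A * E\<^sup>2 / \<delta> ^ m) (transformed_ham F \<Lambda>' C') \<and>
        (\<forall>k. \<bar>\<Lambda>' $ k - \<Lambda> $ k\<bar> \<le> A * E) \<and>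
        (\<forall>x\<in>pdom (r - \<delta>) (\<sigma> - 3 * \<delta>). \<forall>i. cmod (fst (C' x) $ i - fst (C x) $ i) \<le> A * E / \<delta> ^ m \<and>
           cmod (snd (C' x) $ i - snd (C x) $ i) \<le> A * E / \<delta> ^ m)"
    if F: "phase_fun r0 \<sigma>0 F" "\<forall>x\<in>pdom r0 \<sigma>0. cmod (F x) \<le> B0"
      and sz: "\<rho> \<le> r" "r \<le> r0" "\<rho> \<le> \<sigma>" "\<sigma> \<le> \<sigma>0" "0 < \<delta>" "4 * \<delta> \<le> \<rho>" "0 < E" "0 \<le> \<kappa>" "\<kappa> \<le> \<kappa>s"
      and \<Lambda>: "\<forall>k. \<bar>\<Lambda> $ k\<bar> \<le> 1" and sm: "A * E / \<delta> ^ m \<le> 1"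
      and C: "phase_map r0 \<sigma>0 r \<sigma> \<kappa> C" and nf: "normal_form_error \<omega> \<sigma> E (transformed_ham F \<Lambda> C)"
    for F :: "'n cphase \<Rightarrow> complex" and r \<sigma> \<delta> \<kappa> E and \<Lambda> :: "real^'n" and C
  proof -
    define f where "f = transformed_ham F \<Lambda> C"
    define l where "l k x = fst (C x) $ k" for k x
    interpret sd: step_data \<omega> K \<nu> f l n \<rho> r \<sigma> \<delta> B \<kappa> E
    proof unfold_locales
      show "phase_fun r \<sigma> f" unfolding f_def by (rule phase_fun_transformed_ham[OF F(1) C])
      show "cmod (f x) \<le> B" if "x \<in> pdom r \<sigma>" for x
        using transformed_ham_bound[of r0 \<sigma>0 F B0 r \<sigma> \<kappa> C \<Lambda> x] F(2) C \<Lambda> r0 that by (simp add: f_def B_def n_def)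
      show "phase_fun r \<sigma> (l k)" for k unfolding l_def by (rule phase_fun_action[OF C])
      show "cmod (l k x - fst x $ k) \<le> \<kappa>" if "x \<in> pdom r \<sigma>" for k x
        unfolding l_def by (rule phase_mapD(6)[OF C that])
    qed (use sol \<rho> sz r0 B0 n1 \<kappa>s nf in \<open>auto simp: n_def B_def f_def normal_form_error_def\<close>)
    have A0: "sd.A = A0" "sd.c1 = c1" "sd.m = m" by (simp_all add: A0_def c1_def m_def)
    have A1: "A0 \<ge> 1" using sd.A_ge(9) A0 by simp
    have A4: "A = 4 * A0" using A1 by (simp add: A_def)
    have \<kappa>c: "\<kappa> * sd.c1 \<le> 1 / (2 * n)"
    proof -
      have "\<kappa> * c1 \<le> 1 / (2 * n * max c1 1) * max c1 1"
        using sz \<kappa>s_def sd.c_pos(1) A0 n1 by (intro mult_mono mult_nonneg_nonneg divide_nonneg_nonneg) auto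
      then show ?thesis using n1 c1m A0 by (simp add: field_simps)
    qed
    define X where "X = E / \<delta> ^ m"
    have X: "0 < X" using sz by (simp add: X_def)
    have AX: "A * E / \<delta> ^ m = 4 * (A0 * X)" by (simp add: A4 X_def)
    have sm0: "sd.A * E / \<delta> ^ sd.m \<le> 1"
      using sm X A1 unfolding A0 AX by (simp add: X_def)
    note small = sd.small[OF sm0]
    obtain \<mu> :: "real^'n" and s :: "complex^'n \<Rightarrow> complex" and v c where
      \<mu>: "\<And>i. \<bar>\<mu> $ i\<bar> \<le> A0 * E" and stf: "torus_fun \<sigma> s" and vtf: "\<And>i. torus_fun (\<sigma> - \<delta>) (v i)"
      and sb: "\<And>\<theta> j. \<theta> \<in> complex_angles (\<sigma> - \<delta>) \<Longrightarrow> cmod (dv s \<theta> (e\<^sub>C j)) \<le> sd.S"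
      and vb: "\<And>\<theta> i. \<theta> \<in> complex_angles (\<sigma> - 2 * \<delta>) \<Longrightarrow> cmod (v i \<theta>) \<le> sd.V"
        "\<And>\<theta> i j. \<theta> \<in> complex_angles (\<sigma> - 2 * \<delta>) \<Longrightarrow> cmod (dv (v i) \<theta> (e\<^sub>C j)) \<le> sd.V"
      and E1: "\<And>\<theta>. \<theta> \<in> complex_angles (\<sigma> - \<delta>) \<Longrightarrow>
        cmod (f (grad s \<theta>, \<theta>) + (\<Sum>k\<in>UNIV. of_real (\<mu> $ k) * l k (grad s \<theta>, \<theta>)) - c) \<le> A0 * E\<^sup>2 / \<delta> ^ m"
      and E2: "\<And>\<theta> i. \<theta> \<in> complex_angles (\<sigma> - \<delta>) \<Longrightarrow>
        cmod (pd i f (grad s \<theta>, \<theta>) + (\<Sum>k\<in>UNIV. of_real (\<mu> $ k) * pd i (l k) (grad s \<theta>, \<theta>))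
         - of_real (\<omega> $ i) - dv (v i) \<theta> (cvec \<omega>)) \<le> A0 * E\<^sup>2 / \<delta> ^ m"
      and E3: "\<And>\<theta> w i. \<theta> \<in> complex_angles (\<sigma> - 3 * \<delta>) \<Longrightarrow> (\<And>j. cmod (w $ j) \<le> sd.V) \<Longrightarrow>
        cmod (dv (v i) (\<theta> + w) (cvec \<omega>) - dv (v i) \<theta> (cvec \<omega>)) \<le> A0 * E\<^sup>2 / \<delta> ^ m"
    proof (rule sd.quadratic_estimates[OF \<kappa>c sm0], goal_cases)
      case (1 \<mu> s v c)
      show ?thesis
        by (rule that[of \<mu> s v c, folded A0])
          (rule 1(2), rule 1(3), rule 1(4), rule 1(5), assumption, rule 1(6), assumption, rule 1(7), assumption,
           rule 1(8), assumption, rule 1(9), assumption, rule 1(10), assumption, simp)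
    qed
    interpret al: angle_lift s v "\<sigma> - \<delta>" "\<sigma> - 2 * \<delta>" "\<sigma> - 3 * \<delta>" sd.V sd.S
    proof unfold_locales
      show "cmod (dv s \<theta> (e\<^sub>C j)) \<le> sd.S" if "\<theta> \<in> complex_angles (\<sigma> - 2 * \<delta>)" for \<theta> j
        using sb that complex_angles_mono[of "\<sigma> - 2 * \<delta>" "\<sigma> - \<delta>"] sz by auto
    qed (use stf vtf vb small sz sd.SV_pos in \<open>auto intro: torus_fun_subset simp: n_def\<close>)
    note Cp = phase_mapD[OF C]
    (* A bound on the displacement of the new transformation; the line from x through its image stays
       in the old domain up to R times that displacement. *)
    define U where "U = n * sd.V * 2 + sd.S"
    have U_pos: "0 < U" and VU: "sd.V \<le> U"
    proof -
      have "1 * sd.V \<le> n * sd.V" using sd.SV_pos n1 by (intro mult_right_mono) auto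
      then show "0 < U" "sd.V \<le> U" unfolding U_def using sd.SV_pos by linarith+
    qed
    have U_small: "U \<le> \<delta> / 2" using small(4) by (simp add: U_def)
    have U_le: "2 * U \<le> \<delta> * (A0 * X)"
    proof -
      have ed: "E / \<delta> ^ a \<le> \<delta> * X" if "Suc a \<le> m" for a
        using mult_left_mono[OF sd.E_pow_le[of "Suc a" m], of \<delta>] that sz by (simp add: X_def)
      have "sd.V \<le> sd.c5 * (\<delta> * X)" "sd.S \<le> sd.c3 * (\<delta> * X)"
        using mult_left_mono[OF ed[of "2 * \<nu>"], of sd.c5] mult_left_mono[OF ed[of \<nu>], of sd.c3] sd.c_pos
        by (auto simp: sd.V_def sd.S_def sd.m_def simp flip: A0(3))
      then have "n * sd.V \<le> n * (sd.c5 * (\<delta> * X))" "sd.S \<le> sd.c3 * (\<delta> * X)" using n1 by auto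
      then have "2 * U \<le> (4 * n * sd.c5 + 2 * sd.c3) * (\<delta> * X)" by (simp add: U_def algebra_simps)
      also have "\<dots> \<le> A0 * (\<delta> * X)"
        by (rule mult_right_mono) (use sd.A_ge(4) A0 X sz in auto)
      finally show ?thesis by (simp add: mult_ac)
    qed
    have AX1: "0 < A0 * X" using A1 X by simp
    let ?D = "pdom (r - \<delta>) (\<sigma> - 3 * \<delta>) :: 'n cphase set"
    have D: "x \<in> pdom r \<sigma>" "x \<in> al.D" "\<And>i. cmod (fst x $ i) \<le> 1" if "x \<in> ?D" for x
    proof -
      show "x \<in> pdom r \<sigma>" using that pdom_mono[of "r - \<delta>" r "\<sigma> - 3 * \<delta>" \<sigma>] sz by auto
      show "x \<in> al.D" using that by (simp add: mem_Times_iff pdom_def)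
      show "cmod (fst x $ i) \<le> 1" for i
        using that sz r0 by (auto simp: pdom_def intro: order_trans[OF less_imp_le])
    qed
    have C1_near: "cmod (fst (al.C x) $ i - fst x $ i) \<le> U" "cmod (snd (al.C x) $ i - snd x $ i) \<le> U"
      if "x \<in> ?D" for x i
      using al.C_near[OF D(2)[OF that] D(3)[OF that], of i] VU by (auto simp: U_def n_def)
    define R where "R = \<delta> / U"
    have R: "R > 0" "R \<ge> 2" using U_pos U_small sz by (auto simp: R_def field_simps)
    have line: "x + t *\<^sub>C (al.C x - x) \<in> pdom r \<sigma>" if x: "x \<in> ?D" and t: "cmod t < R" for x t
    proof -
      have *: "cmod t * b \<le> \<delta>" if "b \<le> U" "0 \<le> b" for b
      proof -
        have "cmod t * b \<le> R * U" using t that R by (intro mult_mono) auto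
        then show ?thesis using U_pos by (simp add: R_def)
      qed
      have "x + t *\<^sub>C (al.C x - x) \<in> pdom (r - \<delta> + \<delta>) (\<sigma> - 3 * \<delta> + \<delta>)"
        by (rule pdom_add[OF x]) (auto simp: norm_mult intro!: * C1_near x)
      then show ?thesis using pdom_mono[of "r - \<delta> + \<delta>" r "\<sigma> - 3 * \<delta> + \<delta>" \<sigma>] sz by auto
    qed
    have C1_in: "al.C x \<in> pdom r \<sigma>" if "x \<in> ?D" for x
      using line[OF that, of 1] R by simp
    have C1_hol: "hol al.C ?D" by (rule hol_subset[OF al.C_hol]) (use D(2) in blast)
    define C' where "C' x = C (al.C x)" for x
    have move: "cmod (fst (C' x) $ i - fst (C x) $ i) \<le> A * E / \<delta> ^ m"
      "cmod (snd (C' x) $ i - snd (C x) $ i) \<le> A * E / \<delta> ^ m" if x: "x \<in> ?D" for x i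
    proof -
      have b: "2 * \<kappa> / R \<le> A0 * X"
      proof -
        have "2 * \<kappa> / R = \<kappa> * (2 * U / \<delta>)" by (simp add: R_def)
        also have "\<dots> \<le> 1 * (2 * U / \<delta>)" using sz \<kappa>s U_pos by (intro mult_right_mono) auto
        also have "\<dots> \<le> A0 * X" using U_le sz by (simp add: field_simps)
        finally show ?thesis .
      qed
      have u: "U \<le> A0 * X"
      proof -
        have "\<delta> * (A0 * X) \<le> 1 * (A0 * X)" using sz r0 AX1 by (intro mult_right_mono) auto
        then show ?thesis using U_le U_pos by linarith
      qed
      have h: "hol (\<lambda>y. fst (C y) $ i - fst y $ i) (pdom r \<sigma>)" "hol (\<lambda>y. snd (C y) $ i - snd y $ i) (pdom r \<sigma>)"
        by (intro hol_diff hol_nth hol_fst hol_snd Cp(1) hol_id)+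
      have xv: "x + (al.C x - x) = al.C x" by simp
      have "cmod ((fst (C (al.C x)) $ i - fst (al.C x) $ i) - (fst (C x) $ i - fst x $ i)) \<le> 2 * \<kappa> / R"
        using hol_Cauchy_bounds(2)[OF h(1) line[OF x] R(1) Cp(6)[OF line[OF x]] R(2)] unfolding xv .
      moreover have "cmod ((snd (C (al.C x)) $ i - snd (al.C x) $ i) - (snd (C x) $ i - snd x $ i)) \<le> 2 * \<kappa> / R"
        using hol_Cauchy_bounds(2)[OF h(2) line[OF x] R(1) Cp(7)[OF line[OF x]] R(2)] unfolding xv .
      moreover have tri: "cmod (a' - a) \<le> cmod ((a' - b') - (a - b)) + cmod (b' - b)" for a a' b b'
        using norm_triangle_ineq[of "(a' - b') - (a - b)" "b' - b"] by simp
      ultimately show "cmod (fst (C' x) $ i - fst (C x) $ i) \<le> A * E / \<delta> ^ m"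
        "cmod (snd (C' x) $ i - snd (C x) $ i) \<le> A * E / \<delta> ^ m"
        using C1_near[OF x, of i] b u AX1 unfolding C'_def AX
        by (smt (verit) tri)+
    qed
    have pm: "phase_map r0 \<sigma>0 (r - \<delta>) (\<sigma> - 3 * \<delta>) (\<kappa> + A * E / \<delta> ^ m) C'"
      unfolding phase_map_def
    proof (intro conjI ballI allI impI subsetI)
      show "hol C' ?D" unfolding C'_def by (rule hol_compose[OF Cp(1) C1_hol]) (use C1_in in auto)
      show "y \<in> pdom r0 \<sigma>0" if "y \<in> C' ` ?D" for y using that Cp(2)[OF C1_in] by (auto simp: C'_def)
      show "C' (x + shiftv k) = C' x + shiftv k" if "x \<in> ?D" for x k
        unfolding C'_def al.C_shift[OF D(2)[OF that]] by (rule Cp(3)[OF C1_in[OF that]])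
      show "\<exists>p' q'. C' (cvec p, cvec q) = (cvec p', cvec q')" if "(cvec p, cvec q) \<in> ?D" for p q
      proof -
        obtain p' q' where e: "al.C (cvec p, cvec q) = (cvec p', cvec q')" using al.C_real by blast
        show ?thesis unfolding C'_def e by (rule Cp(4)) (use C1_in[OF that] e in simp)
      qed
      show "sympl C' x" if "x \<in> ?D" for x
        unfolding C'_def
        by (rule sympl_compose[OF Cp(1) C1_hol that C1_in[OF that] Cp(5)[OF C1_in[OF that]] al.C_sympl[OF D(2)[OF that]]])
      have tri: "cmod (a' - b) \<le> \<kappa> + z" if "cmod (a - b) \<le> \<kappa>" "cmod (a' - a) \<le> z" for a a' b z
        using norm_triangle_ineq[of "a' - a" "a - b"] that by simp
      show "cmod (fst (C' x) $ i - fst x $ i) \<le> \<kappa> + A * E / \<delta> ^ m" if "x \<in> ?D" for x i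
        by (rule tri[OF Cp(6)[OF D(1)[OF that]] move(1)[OF that]])
      show "cmod (snd (C' x) $ i - snd x $ i) \<le> \<kappa> + A * E / \<delta> ^ m" if "x \<in> ?D" for x i
        by (rule tri[OF Cp(7)[OF D(1)[OF that]] move(2)[OF that]])
    qed
    define g where "g y = f y + (\<Sum>k\<in>UNIV. of_real (\<mu> $ k) * l k y)" for y
    have th: "transformed_ham F (\<Lambda> + \<mu>) C' = (\<lambda>x. g (al.C x))"
      by (simp add: fun_eq_iff transformed_ham_def C'_def g_def f_def l_def sum.distrib algebra_simps)
    have g_hol: "hol g (pdom r \<sigma>)" unfolding g_def by (intro hol_add hol_sum hol_mult hol_const sd.f_hol sd.l_hol)
    have dv_g: "pd i g y = pd i f y + (\<Sum>k\<in>UNIV. of_real (\<mu> $ k) * pd i (l k) y)" if y: "y \<in> pdom r \<sigma>" for i y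
    proof -
      have h: "hol (\<lambda>y. of_real (\<mu> $ k) * l k y) (pdom r \<sigma>)" for k by (intro hol_mult hol_const sd.l_hol)
      have "pd i g y = pd i f y + pd i (\<lambda>y. \<Sum>k\<in>UNIV. of_real (\<mu> $ k) * l k y) y"
        unfolding g_def[abs_def] by (rule dv_plus[OF sd.f_hol hol_sum y]) (rule h)
      also have "pd i (\<lambda>y. \<Sum>k\<in>UNIV. of_real (\<mu> $ k) * l k y) y = (\<Sum>k\<in>UNIV. pd i (\<lambda>y. of_real (\<mu> $ k) * l k y) y)"
        by (rule dv_sum_fun[OF h y])
      also have "\<dots> = (\<Sum>k\<in>UNIV. of_real (\<mu> $ k) * pd i (l k) y)"
        by (intro sum.cong refl) (simp add: dv_mult[OF hol_const sd.l_hol y])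
      finally show ?thesis .
    qed
    define \<epsilon> where "\<epsilon> = A0 * E\<^sup>2 / \<delta> ^ m"
    have \<epsilon>: "A * E\<^sup>2 / \<delta> ^ m = 4 * \<epsilon>" "0 \<le> \<epsilon>" using A1 sz by (simp_all add: A4 \<epsilon>_def)
    have rp: "r - \<delta> > 0" "\<sigma> - 3 * \<delta> > 0" using sz by auto
    have nfe: "normal_form_error \<omega> (\<sigma> - 3 * \<delta>) (A * E\<^sup>2 / \<delta> ^ m) (transformed_ham F (\<Lambda> + \<mu>) C')"
      unfolding normal_form_error_def th \<epsilon>
    proof (intro ballI conjI allI)
      fix \<theta> :: "complex^'n" assume \<theta>: "\<theta> \<in> complex_angles (\<sigma> - 3 * \<delta>)"
      have psi1: "al.\<psi> \<theta> \<in> complex_angles (\<sigma> - \<delta>)" if "\<theta> \<in> complex_angles (\<sigma> - 3 * \<delta>)" for \<theta>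
        by (rule al.mono3(2)[OF al.\<psi>_in[OF that]])
      have e1: "cmod (g (al.C (0, \<theta>)) - c) \<le> \<epsilon>" if "\<theta> \<in> complex_angles (\<sigma> - 3 * \<delta>)" for \<theta>
        using E1[OF psi1[OF that]] by (simp add: al.C_at_0 g_def \<epsilon>_def)
      have "cmod (g (al.C (0, \<theta>)) - g (al.C (0, 0))) \<le> 2 * \<epsilon>"
        using norm_triangle_ineq4[of "g (al.C (0, \<theta>)) - c" "g (al.C (0, 0)) - c"] e1[OF \<theta>] e1[of 0] rp
        by (simp add: complex_angles_def)
      then show "cmod (g (al.C (0, \<theta>)) - g (al.C (0, 0))) \<le> 4 * \<epsilon>" using \<epsilon> by linarith
      fix i
      have x: "(0, \<theta>) \<in> ?D" using \<theta> rp by simp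
      note y = C1_in[OF x]
      define Gv where "Gv j = pd j g (al.C (0, \<theta>))" for j
      (* The gradient u of the new Hamiltonian satisfies M u = G, with G the gradient at the image of the
         torus; so M (u - \<omega>) is G - \<omega> less the derivative of v along \<omega>, which is what v was made for. *)
      define u where "u = (\<chi> i. pd i (\<lambda>x. g (al.C x)) (0, \<theta>))"
      have u: "u $ i = (\<Sum>j\<in>UNIV. al.N \<theta> $ j $ i * Gv j)" for i
        using dv_compose[OF g_hol C1_hol x y, of "e\<^sub>P i"] dv_momentum_sum[OF g_hol y, of "\<chi> j. al.N \<theta> $ j $ i"]
        by (simp add: u_def Gv_def al.dv_C_at_0(1)[OF \<theta>])
      have "cmod ((al.M \<theta> *v (u - cvec \<omega>)) $ k) \<le> 2 * \<epsilon>" for k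
      proof -
        have "(al.M \<theta> *v u) $ k = (\<Sum>i\<in>UNIV. \<Sum>j\<in>UNIV. (al.M \<theta> $ k $ i * al.N \<theta> $ j $ i) * Gv j)"
          by (simp add: matrix_vector_mult_def u sum_distrib_left mult_ac)
        also have "\<dots> = (\<Sum>j\<in>UNIV. (\<Sum>i\<in>UNIV. al.M \<theta> $ k $ i * al.N \<theta> $ j $ i) * Gv j)"
          by (subst sum.swap) (simp add: sum_distrib_right)
        also have "\<dots> = Gv k" by (simp add: al.dv_C_at_0(2)[OF \<theta>] if_distrib[of "\<lambda>z. z * _"] cong: if_cong)
        finally have 1: "(al.M \<theta> *v u) $ k = Gv k" .
        have "(al.M \<theta> *v cvec \<omega>) $ k = (\<Sum>i\<in>UNIV. (if k = i then cvec \<omega> $ i else 0) + cvec \<omega> $ i * dv (v k) \<theta> (e\<^sub>C i))"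
          unfolding matrix_vector_mult_def by (simp only: vec_lambda_beta, intro sum.cong refl) (simp add: al.M_def algebra_simps)
        also have "\<dots> = of_real (\<omega> $ k) + dv (v k) \<theta> (cvec \<omega>)"
          using dv_angle_sum[OF al.v_hol al.mono3(3)[OF \<theta>], of k "cvec \<omega>"] by (simp add: sum.distrib)
        finally have 2: "(al.M \<theta> *v cvec \<omega>) $ k = of_real (\<omega> $ k) + dv (v k) \<theta> (cvec \<omega>)" .
        have 3: "cmod (Gv k - of_real (\<omega> $ k) - dv (v k) (al.\<psi> \<theta>) (cvec \<omega>)) \<le> \<epsilon>"
          using E2[OF psi1[OF \<theta>], of k] dv_g[OF y, of k] by (simp add: Gv_def al.C_at_0 \<epsilon>_def)
        have 4: "cmod (dv (v k) (al.\<psi> \<theta>) (cvec \<omega>) - dv (v k) \<theta> (cvec \<omega>)) \<le> \<epsilon>"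
          using E3[OF \<theta>, of "al.vv \<theta>" k] vb(1)[OF al.mono3(1)[OF \<theta>]] by (simp add: al.\<psi>_def al.vv_def \<epsilon>_def)
        have "(al.M \<theta> *v (u - cvec \<omega>)) $ k = (Gv k - of_real (\<omega> $ k) - dv (v k) (al.\<psi> \<theta>) (cvec \<omega>)) +
            (dv (v k) (al.\<psi> \<theta>) (cvec \<omega>) - dv (v k) \<theta> (cvec \<omega>))"
          by (simp add: matrix_vector_mult_diff_distrib 1 2)
        then show ?thesis using norm_triangle_mono[OF 3 4] by simp
      qed
      from near_id_norm[OF al.M_near_id[OF al.mono3(1)[OF \<theta>]] this, of i]
      show "cmod (pd i (\<lambda>x. g (al.C x)) (0, \<theta>) - of_real (\<omega> $ i)) \<le> 4 * \<epsilon>" by (simp add: u_def)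
    qed
    have \<Lambda>b: "\<bar>(\<Lambda> + \<mu>) $ k - \<Lambda> $ k\<bar> \<le> A * E" for k
      using \<mu>[of k] A1 sz mult_right_mono[of A0 A E] by (simp add: A4)
    show ?thesis
      by (intro exI[of _ "\<Lambda> + \<mu>"] exI[of _ C'] conjI allI ballI pm nfe \<Lambda>b move; assumption)
  qed
  note main = this
  have A: "A \<ge> 1" by (simp add: A_def)
  show ?thesis by (rule that[OF A \<kappa>s main])
qed

lemma geometric_limit:
  fixes z :: "nat \<Rightarrow> 'a::banach"
  assumes z: "\<And>j. norm (z (Suc j) - z j) \<le> X / 2 ^ j"
  shows "z \<longlonglongrightarrow> lim z" "norm (z j - lim z) \<le> 2 * X / 2 ^ j"
proof -
  have X: "0 \<le> X" using order_trans[OF norm_ge_zero z[of 0]] by simp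
  have far: "norm (z (j + k) - z j) \<le> 2 * X / 2 ^ j * (1 - 1 / 2 ^ k)" for j k
  proof (induction k)
    case (Suc k)
    have "norm (z (j + Suc k) - z j) \<le> norm (z (Suc (j + k)) - z (j + k)) + norm (z (j + k) - z j)"
      using norm_triangle_ineq[of "z (Suc (j + k)) - z (j + k)" "z (j + k) - z j"] by simp
    also have "\<dots> \<le> X / 2 ^ (j + k) + 2 * X / 2 ^ j * (1 - 1 / 2 ^ k)"
      by (intro add_mono z Suc.IH)
    also have "\<dots> = 2 * X / 2 ^ j * (1 - 1 / 2 ^ Suc k)"
      by (simp add: power_add field_simps)
    finally show ?case .
  qed simp
  have far': "norm (z (j + k) - z j) \<le> 2 * X / 2 ^ j" for j k
    by (rule order_trans[OF far], rule mult_left_le) (use X in auto)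
  have lim0: "(\<lambda>j. 2 * X / 2 ^ j) \<longlonglongrightarrow> 0"
    using tendsto_mult[OF tendsto_const[of "2 * X"] LIMSEQ_inverse_realpow_zero[of 2]] by (simp add: divide_inverse)
  have "Cauchy z"
  proof (rule metric_CauchyI)
    fix e :: real assume "0 < e"
    then have "\<forall>\<^sub>F j in sequentially. 2 * X / 2 ^ j < e / 2" using order_tendstoD(2)[OF lim0, of "e / 2"] by simp
    then obtain J where J: "2 * X / 2 ^ J < e / 2" unfolding eventually_sequentially by blast
    have near: "dist (z m) (z J) < e / 2" if mJ: "m \<ge> J" for m
    proof -
      obtain a where m: "m = J + a" using le_Suc_ex[OF mJ] by auto
      show ?thesis unfolding m dist_norm by (rule le_less_trans[OF far' J])
    qed
    have "dist (z m) (z n) < e" if "m \<ge> J" "n \<ge> J" for m n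
      using dist_triangle2[of "z m" "z n" "z J"] near[OF that(1)] near[OF that(2)] by linarith
    then show "\<exists>M. \<forall>m\<ge>M. \<forall>n\<ge>M. dist (z m) (z n) < e" by blast
  qed
  then show l: "z \<longlonglongrightarrow> lim z" by (simp add: Cauchy_convergent_iff convergent_LIMSEQ_iff)
  have "(\<lambda>k. norm (z (j + k) - z j)) \<longlonglongrightarrow> norm (lim z - z j)"
    by (intro tendsto_intros) (use LIMSEQ_ignore_initial_segment[OF l, of j] in \<open>simp add: add.commute\<close>)
  then have "norm (lim z - z j) \<le> 2 * X / 2 ^ j"
    by (rule LIMSEQ_le_const2) (use far' in auto)
  then show "norm (z j - lim z) \<le> 2 * X / 2 ^ j" by (simp add: norm_minus_commute)
qed

lemma hol_geometric_limit:
  fixes f :: "nat \<Rightarrow> 'a::complex_space \<Rightarrow> complex"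
  assumes D: "open D" and f: "\<And>j. hol (f j) D"
    and step: "\<And>j x. x \<in> D \<Longrightarrow> cmod (f (Suc j) x - f j x) \<le> X / 2 ^ j"
  shows "hol (\<lambda>x. lim (\<lambda>j. f j x)) D"
    and "x \<in> D \<Longrightarrow> (\<lambda>j. f j x) \<longlonglongrightarrow> lim (\<lambda>j. f j x)"
    and "x \<in> D \<Longrightarrow> (\<lambda>j. dv (f j) x v) \<longlonglongrightarrow> dv (\<lambda>x. lim (\<lambda>j. f j x)) x v"
proof -
  note g = geometric_limit[of "\<lambda>j. f j _", OF step]
  have lim0: "(\<lambda>j. 2 * X / 2 ^ j) \<longlonglongrightarrow> 0"
    using tendsto_mult[OF tendsto_const[of "2 * X"] LIMSEQ_inverse_realpow_zero[of 2]] by (simp add: divide_inverse)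
  have u: "uniform_limit D f (\<lambda>x. lim (\<lambda>j. f j x)) sequentially"
  proof (rule uniform_limitI)
    fix e :: real assume "0 < e"
    from order_tendstoD(2)[OF lim0 this] show "\<forall>\<^sub>F j in sequentially. \<forall>x\<in>D. dist (f j x) (lim (\<lambda>j. f j x)) < e"
    proof eventually_elim
      case (elim j)
      show ?case unfolding dist_norm by (intro ballI le_less_trans[OF g(2) elim])
    qed
  qed
  show "hol (\<lambda>x. lim (\<lambda>j. f j x)) D" by (rule hol_uniform_limit_hol[OF D _ u]) (use f in auto)
  show "(\<lambda>j. f j x) \<longlonglongrightarrow> lim (\<lambda>j. f j x)" if "x \<in> D" by (rule g(1)[OF that])
  show "(\<lambda>j. dv (f j) x v) \<longlonglongrightarrow> dv (\<lambda>x. lim (\<lambda>j. f j x)) x v" if "x \<in> D"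
    by (rule tendsto_dv[OF D _ u _ that]) (use f in auto)
qed

text \<open>
  The derivative is linear in the direction, so its joint continuity follows from that of the finitely
  many derivatives along basis vectors.
\<close>

lemma tendsto_dv_joint:
  fixes F :: "('n::finite) cphase \<Rightarrow> complex"
  assumes D: "open D" and F: "hol F D" and y: "(y \<longlongrightarrow> y0) G" "y0 \<in> D" and u: "(u \<longlongrightarrow> u0) G"
    and yD: "\<And>j. y j \<in> D"
  shows "((\<lambda>j. dv F (y j) (u j)) \<longlongrightarrow> dv F y0 u0) G"
proof -
  have eq: "dv F x v = (\<Sum>b\<in>Basis. (v \<bullet> b) *\<^sub>R dv F x b)" if "x \<in> D" for x v
  proof -
    have "dv F x v = dv F x (\<Sum>b\<in>Basis. (v \<bullet> b) *\<^sub>R b)" by (simp add: euclidean_representation)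
    also have "\<dots> = (\<Sum>b\<in>Basis. (v \<bullet> b) *\<^sub>R dv F x b)"
      using dv_linear[OF F that] by (simp only: linear_sum linear_scale)
    finally show ?thesis .
  qed
  have c: "((\<lambda>j. dv F (y j) b) \<longlongrightarrow> dv F y0 b) G" for b
    by (rule continuous_on_tendsto_compose[OF hol_continuous[OF hol_dv[OF D F]] y]) (use yD in auto)
  have 1: "(\<lambda>j. dv F (y j) (u j)) = (\<lambda>j. \<Sum>b\<in>Basis. (u j \<bullet> b) *\<^sub>R dv F (y j) b)"
    by (rule ext) (rule eq[OF yD])
  have "((\<lambda>j. dv F (y j) (u j)) \<longlongrightarrow> (\<Sum>b\<in>Basis. (u0 \<bullet> b) *\<^sub>R dv F y0 b)) G"
    unfolding 1 by (intro tendsto_intros c u)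
  then show ?thesis by (subst eq[OF y(2)])
qed

text \<open>
  Everything that makes up a canonical transformation passes to the limit, as derivatives converge
  together with the maps. Closeness to the identity places the limit in the original, open, domain.
\<close>

lemma phase_map_limit:
  fixes C :: "nat \<Rightarrow> ('n::finite) cphase \<Rightarrow> 'n cphase"
  assumes C: "\<And>j. phase_map r0 \<sigma>0 r \<sigma> \<kappa> (C j)" and \<kappa>: "r + \<kappa> \<le> r0" "\<sigma> + \<kappa> \<le> \<sigma>0"
    and step: "\<And>j x i. x \<in> pdom r \<sigma> \<Longrightarrow> cmod (fst (C (Suc j) x) $ i - fst (C j x) $ i) \<le> X / 2 ^ j"
      "\<And>j x i. x \<in> pdom r \<sigma> \<Longrightarrow> cmod (snd (C (Suc j) x) $ i - snd (C j x) $ i) \<le> X / 2 ^ j"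
  obtains C' where "phase_map r0 \<sigma>0 r \<sigma> \<kappa> C'" "\<And>x. x \<in> pdom r \<sigma> \<Longrightarrow> (\<lambda>j. C j x) \<longlonglongrightarrow> C' x"
    "\<And>x v. x \<in> pdom r \<sigma> \<Longrightarrow> (\<lambda>j. dv (C j) x v) \<longlonglongrightarrow> dv C' x v"
proof -
  note Cd = phase_mapD[OF C]
  have hf: "hol (\<lambda>x. fst (C j x) $ i) (pdom r \<sigma>)" and hs: "hol (\<lambda>x. snd (C j x) $ i) (pdom r \<sigma>)" for j i
    by (intro hol_nth hol_fst hol_snd Cd(1))+
  note lf = hol_geometric_limit[where f = "\<lambda>j x. fst (C j x) $ i" for i, OF open_pdom hf step(1)]
    and ls = hol_geometric_limit[where f = "\<lambda>j x. snd (C j x) $ i" for i, OF open_pdom hs step(2)]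
  define a where "a i x = lim (\<lambda>j. fst (C j x) $ i)" for i x
  define b where "b i x = lim (\<lambda>j. snd (C j x) $ i)" for i x
  define C' where "C' x = ((\<chi> i. a i x), (\<chi> i. b i x))" for x
  note lf = lf[folded a_def] and ls = ls[folded b_def]
  have hC: "hol C' (pdom r \<sigma>)" unfolding C'_def by (intro hol_Pair hol_vec lf ls)
  have tendsto_cphase: "z \<longlonglongrightarrow> w" if "\<And>i. (\<lambda>j. fst (z j) $ i) \<longlonglongrightarrow> fst w $ i" "\<And>i. (\<lambda>j. snd (z j) $ i) \<longlonglongrightarrow> snd w $ i"
    for z and w :: "'n cphase"
  proof -
    have "(\<lambda>j. (fst (z j), snd (z j))) \<longlonglongrightarrow> (fst w, snd w)"
      by (intro tendsto_Pair vec_tendstoI that)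
    then show ?thesis by simp
  qed
  have lim: "(\<lambda>j. C j x) \<longlonglongrightarrow> C' x" if "x \<in> pdom r \<sigma>" for x
    by (rule tendsto_cphase) (simp_all add: C'_def lf(2) ls(2) that)
  have dlim: "(\<lambda>j. dv (C j) x v) \<longlonglongrightarrow> dv C' x v" if x: "x \<in> pdom r \<sigma>" for x v
  proof -
    have f: "dv (\<lambda>x. fst (C j x) $ i) x v = fst (dv (C j) x v) $ i" for i j
      by (simp only: dv_nth[OF hol_fst[OF Cd(1)] x] dv_fst[OF Cd(1) x])
    have s: "dv (\<lambda>x. snd (C j x) $ i) x v = snd (dv (C j) x v) $ i" for i j
      by (simp only: dv_nth[OF hol_snd[OF Cd(1)] x] dv_snd[OF Cd(1) x])
    have f': "dv (a i) x v = fst (dv C' x v) $ i" for i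
    proof -
      have "a i = (\<lambda>x. fst (C' x) $ i)" by (simp add: C'_def)
      then show ?thesis by (simp only: dv_nth[OF hol_fst[OF hC] x] dv_fst[OF hC x])
    qed
    have s': "dv (b i) x v = snd (dv C' x v) $ i" for i
    proof -
      have "b i = (\<lambda>x. snd (C' x) $ i)" by (simp add: C'_def)
      then show ?thesis by (simp only: dv_nth[OF hol_snd[OF hC] x] dv_snd[OF hC x])
    qed
    have "(\<lambda>j. dv (\<lambda>x. fst (C j x) $ i) x v) \<longlonglongrightarrow> dv (a i) x v" for i by (rule lf(3)) (use x in auto)
    moreover have "(\<lambda>j. dv (\<lambda>x. snd (C j x) $ i) x v) \<longlonglongrightarrow> dv (b i) x v" for i by (rule ls(3)) (use x in auto)
    ultimately show ?thesis unfolding f s f' s' by (rule tendsto_cphase)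
  qed
  have near: "cmod (fst (C' x) $ i - fst x $ i) \<le> \<kappa>" "cmod (snd (C' x) $ i - snd x $ i) \<le> \<kappa>" if x: "x \<in> pdom r \<sigma>" for x i
    by (rule LIMSEQ_le_const2[OF tendsto_norm[OF tendsto_diff[OF tendsto_vec_nth[OF tendsto_fst[OF lim[OF x]]] tendsto_const]]],
        use Cd(6)[OF x] in auto)
      (rule LIMSEQ_le_const2[OF tendsto_norm[OF tendsto_diff[OF tendsto_vec_nth[OF tendsto_snd[OF lim[OF x]]] tendsto_const]]],
        use Cd(7)[OF x] in auto)
  have "phase_map r0 \<sigma>0 r \<sigma> \<kappa> C'"
    unfolding phase_map_def
  proof (intro conjI ballI allI impI subsetI)
    show "hol C' (pdom r \<sigma>)" by (rule hC)
    show "y \<in> pdom r0 \<sigma>0" if y: "y \<in> C' ` pdom r \<sigma>" for y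
    proof -
      obtain x where x: "x \<in> pdom r \<sigma>" "y = C' x" using y by blast
      have "x + (C' x - x) \<in> pdom (r + \<kappa>) (\<sigma> + \<kappa>)" by (rule pdom_add[OF x(1)]) (use near[OF x(1)] in auto)
      then show ?thesis using pdom_mono[OF \<kappa>] x by auto
    qed
    show "C' (x + shiftv k) = C' x + shiftv k" if x: "x \<in> pdom r \<sigma>" for x k
    proof (rule LIMSEQ_unique)
      show "(\<lambda>j. C j (x + shiftv k)) \<longlonglongrightarrow> C' (x + shiftv k)" by (rule lim) (use x in simp)
      show "(\<lambda>j. C j (x + shiftv k)) \<longlonglongrightarrow> C' x + shiftv k"
        unfolding Cd(3)[OF x] by (intro tendsto_add lim x tendsto_const)
    qed
    show "\<exists>p' q'. C' (cvec p, cvec q) = (cvec p', cvec q')" if x: "(cvec p, cvec q) \<in> pdom r \<sigma>" for p q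
    proof -
      have "fst (C' (cvec p, cvec q)) $ i \<in> \<real>" "snd (C' (cvec p, cvec q)) $ i \<in> \<real>" for i
      proof -
        have re: "fst (C j (cvec p, cvec q)) $ i \<in> \<real>" "snd (C j (cvec p, cvec q)) $ i \<in> \<real>" for j
          using Cd(4)[OF x, of j] by auto
        show "fst (C' (cvec p, cvec q)) $ i \<in> \<real>"
          by (rule closed_sequentially[OF closed_complex_Reals _ tendsto_vec_nth[OF tendsto_fst[OF lim[OF x]]]]) (use re in auto)
        show "snd (C' (cvec p, cvec q)) $ i \<in> \<real>"
          by (rule closed_sequentially[OF closed_complex_Reals _ tendsto_vec_nth[OF tendsto_snd[OF lim[OF x]]]]) (use re in auto)
      qed
      then show ?thesis using real_vec_cvec by (metis prod.collapse)
    qed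
    show "sympl C' x" if x: "x \<in> pdom r \<sigma>" for x
      unfolding sympl_def
    proof (intro allI)
      fix u v
      have "(\<lambda>j. cform (dv (C j) x u) (dv (C j) x v)) \<longlonglongrightarrow> cform (dv C' x u) (dv C' x v)"
        unfolding cform_def cdot_def by (intro tendsto_intros dlim x)
      moreover have "cform (dv (C j) x u) (dv (C j) x v) = cform u v" for j
        using Cd(5)[OF x, of j] unfolding sympl_def by blast
      ultimately have "(\<lambda>j. cform u v) \<longlonglongrightarrow> cform (dv C' x u) (dv C' x v)" by simp
      from LIMSEQ_unique[OF this tendsto_const] show "cform (dv C' x u) (dv C' x v) = cform u v" .
    qed
  qed (use near in auto)
  then show ?thesis by (rule that[OF _ lim dlim])
qed

lemma tendsto_transformed_ham:
  assumes F: "hol F (pdom r0 \<sigma>0)" and C: "\<And>j. phase_map r0 \<sigma>0 r \<sigma> \<kappa> (C j)" "phase_map r0 \<sigma>0 r \<sigma> \<kappa> C'"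
    and x: "x \<in> pdom r \<sigma>" and lim: "(\<lambda>j. C j x) \<longlonglongrightarrow> C' x" "\<And>v. (\<lambda>j. dv (C j) x v) \<longlonglongrightarrow> dv C' x v"
    and \<Lambda>: "\<And>k. (\<lambda>j. \<Lambda> j $ k) \<longlonglongrightarrow> \<Lambda>' $ k"
  shows "(\<lambda>j. transformed_ham F (\<Lambda> j) (C j) x) \<longlonglongrightarrow> transformed_ham F \<Lambda>' C' x"
    and "(\<lambda>j. dv (transformed_ham F (\<Lambda> j) (C j)) x v) \<longlonglongrightarrow> dv (transformed_ham F \<Lambda>' C') x v"
proof -
  note in_D = phase_mapD(2)[OF C(1) x] phase_mapD(2)[OF C(2) x]
  have "(\<lambda>j. F (C j x)) \<longlonglongrightarrow> F (C' x)"
    by (rule continuous_on_tendsto_compose[OF hol_continuous[OF F] lim(1)]) (use in_D in auto)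
  then show "(\<lambda>j. transformed_ham F (\<Lambda> j) (C j) x) \<longlonglongrightarrow> transformed_ham F \<Lambda>' C' x"
    unfolding transformed_ham_def by (intro tendsto_intros lim \<Lambda>)
  have dv_th: "dv (transformed_ham F L K) x v = dv F (K x) (dv K x v) + (\<Sum>k\<in>UNIV. of_real (L $ k) * fst (dv K x v) $ k)"
    if K: "phase_map r0 \<sigma>0 r \<sigma> \<kappa> K" for K L
  proof -
    note Kd = phase_mapD[OF K]
    have h1: "hol (\<lambda>x. F (K x)) (pdom r \<sigma>)" by (rule hol_compose[OF F Kd(1)]) (use Kd(2) in auto)
    have h2: "hol (\<lambda>x. fst (K x) $ k) (pdom r \<sigma>)" for k by (intro hol_nth hol_fst Kd(1))
    have h3: "hol (\<lambda>x. of_real (L $ k) * fst (K x) $ k) (pdom r \<sigma>)" for k by (intro hol_mult hol_const h2)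
    have "dv (\<lambda>x. of_real (L $ k) * fst (K x) $ k) x v = of_real (L $ k) * fst (dv K x v) $ k" for k
      by (simp add: dv_mult[OF hol_const h2 x] dv_nth[OF hol_fst[OF Kd(1)] x] dv_fst[OF Kd(1) x])
    then show ?thesis
      unfolding transformed_ham_def[abs_def] dv_plus[OF h1 hol_sum[OF h3] x] dv_sum_fun[OF h3 x]
        dv_compose[OF F Kd(1) x Kd(2)[OF x]] by simp
  qed
  show "(\<lambda>j. dv (transformed_ham F (\<Lambda> j) (C j)) x v) \<longlonglongrightarrow> dv (transformed_ham F \<Lambda>' C') x v"
    unfolding dv_th[OF C(1)] dv_th[OF C(2)]
    by (intro tendsto_intros \<Lambda> lim tendsto_dv_joint[OF open_pdom F _ in_D(2) _ in_D(1)])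
qed

lemma phase_map_mono:
  "phase_map r0 \<sigma>0 r \<sigma> \<kappa> C \<Longrightarrow> r' \<le> r \<Longrightarrow> \<sigma>' \<le> \<sigma> \<Longrightarrow> \<kappa> \<le> \<kappa>' \<Longrightarrow> phase_map r0 \<sigma>0 r' \<sigma>' \<kappa>' C"
proof -
  assume C: "phase_map r0 \<sigma>0 r \<sigma> \<kappa> C" and le: "r' \<le> r" "\<sigma>' \<le> \<sigma>" "\<kappa> \<le> \<kappa>'"
  have D: "x \<in> pdom r \<sigma>" if "x \<in> pdom r' \<sigma>'" for x :: "'a cphase" using pdom_mono[OF le(1,2)] that by auto
  note Cd = phase_mapD[OF C]
  show ?thesis
    unfolding phase_map_def
    using hol_subset[OF Cd(1) pdom_mono[OF le(1,2)]] Cd(2)[OF D] Cd(3)[OF D] Cd(4)[OF D] Cd(5)[OF D]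
      order_trans[OF Cd(6)[OF D] le(3)] order_trans[OF Cd(7)[OF D] le(3)] by (simp add: image_subset_iff)
qed

text \<open>
  The widths are \<open>\<delta>0 / 2 ^ j\<close>. The errors \<open>e / 2 ^ ((m + 1) * j)\<close> are consistent with the quadratic
  estimate if \<open>e\<close> is small: the displacement in the \<open>j\<close>-th step is then \<open>X / 2 ^ j\<close> with
  \<open>X = A * e / \<delta>0 ^ m\<close>, and a step multiplies the error by at most that, hence by at most
  \<open>1 / 2 ^ (m + 1)\<close> once \<open>X\<close> is that small.
\<close>

lemma kam_iteration:
  fixes \<omega> :: "real^'n::finite"
  assumes sol: "cohom_solvable \<omega> K \<nu>" and r0: "0 < r0" "r0 \<le> 1" "0 < \<sigma>0" "\<sigma>0 \<le> 1" and B0: "0 \<le> B0"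
  obtains \<rho> es c where "0 < \<rho>" "2 * \<rho> \<le> r0" "2 * \<rho> \<le> \<sigma>0" "0 < es" "0 < c"
    "\<And>F e. phase_fun r0 \<sigma>0 F \<Longrightarrow> \<forall>x\<in>pdom r0 \<sigma>0. cmod (F x) \<le> B0 \<Longrightarrow> 0 < e \<Longrightarrow> e \<le> es \<Longrightarrow>
      normal_form_error \<omega> \<sigma>0 e F \<Longrightarrow>
      \<exists>\<Lambda> C. phase_map r0 \<sigma>0 \<rho> \<rho> (c * e) C \<and> normal_form_error \<omega> \<rho> 0 (transformed_ham F \<Lambda> C)"
proof -
  define \<rho> where "\<rho> = min r0 \<sigma>0 / 2"
  have \<rho>: "0 < \<rho>" "2 * \<rho> \<le> r0" "2 * \<rho> \<le> \<sigma>0" "\<rho> \<le> 1" using r0 by (auto simp: \<rho>_def)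
  define \<delta>0 where "\<delta>0 = \<rho> / 12"
  have \<delta>0: "0 < \<delta>0" "\<delta>0 \<le> 1" using \<rho> by (auto simp: \<delta>0_def)
  obtain A m \<kappa>s where A: "A \<ge> 1" and \<kappa>s: "0 < \<kappa>s" "\<kappa>s \<le> 1" and kam:
    "\<And>F r \<sigma> \<delta> \<kappa> E \<Lambda> C. phase_fun r0 \<sigma>0 F \<Longrightarrow> \<forall>x\<in>pdom r0 \<sigma>0. cmod (F x) \<le> B0 \<Longrightarrow>
      \<rho> \<le> r \<Longrightarrow> r \<le> r0 \<Longrightarrow> \<rho> \<le> \<sigma> \<Longrightarrow> \<sigma> \<le> \<sigma>0 \<Longrightarrow> 0 < \<delta> \<Longrightarrow> 4 * \<delta> \<le> \<rho> \<Longrightarrow> 0 < E \<Longrightarrow> 0 \<le> \<kappa> \<Longrightarrow> \<kappa> \<le> \<kappa>s \<Longrightarrow>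
      \<forall>k. \<bar>\<Lambda> $ k\<bar> \<le> 1 \<Longrightarrow> A * E / \<delta> ^ m \<le> 1 \<Longrightarrow>
      phase_map r0 \<sigma>0 r \<sigma> \<kappa> C \<Longrightarrow> normal_form_error \<omega> \<sigma> E (transformed_ham F \<Lambda> C) \<Longrightarrow>
      \<exists>\<Lambda>' C'. phase_map r0 \<sigma>0 (r - \<delta>) (\<sigma> - 3 * \<delta>) (\<kappa> + A * E / \<delta> ^ m) C' \<and>
        normal_form_error \<omega> (\<sigma> - 3 * \<delta>) (A * E\<^sup>2 / \<delta> ^ m) (transformed_ham F \<Lambda>' C') \<and>
        (\<forall>k. \<bar>\<Lambda>' $ k - \<Lambda> $ k\<bar> \<le> A * E) \<and>
        (\<forall>x\<in>pdom (r - \<delta>) (\<sigma> - 3 * \<delta>). \<forall>i. cmod (fst (C' x) $ i - fst (C x) $ i) \<le> A * E / \<delta> ^ m \<and>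
           cmod (snd (C' x) $ i - snd (C x) $ i) \<le> A * E / \<delta> ^ m)"
    by (rule kam_step[OF sol \<rho>(1) r0(2,4) B0]) (rule that; assumption)
  define M where "M = A / \<delta>0 ^ m"
  have AM: "A \<le> M" and M: "0 < M"
  proof -
    have "A / 1 \<le> A / \<delta>0 ^ m" using \<delta>0 A by (intro divide_left_mono) (auto intro: power_le_one)
    then show "A \<le> M" "0 < M" using A by (auto simp: M_def)
  qed
  define es where "es = min (1 / 2 ^ (m + 1)) (min \<kappa>s \<rho> / 2) / M"
  have es: "0 < es" using M \<kappa>s \<rho> by (simp add: es_def)
  have main: "\<exists>\<Lambda> C. phase_map r0 \<sigma>0 \<rho> \<rho> (2 * M * e) C \<and> normal_form_error \<omega> \<rho> 0 (transformed_ham F \<Lambda> C)"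
    if F: "phase_fun r0 \<sigma>0 F" "\<forall>x\<in>pdom r0 \<sigma>0. cmod (F x) \<le> B0" and e: "0 < e" "e \<le> es"
      and nf: "normal_form_error \<omega> \<sigma>0 e F" for F :: "'n cphase \<Rightarrow> complex" and e
  proof -
    define X where "X = M * e"
    have X: "0 < X" "X * 2 ^ (m + 1) \<le> 1" "2 * X \<le> \<kappa>s" "2 * X \<le> \<rho>" "A * e \<le> X"
    proof -
      have "X \<le> M * es" using e M by (simp add: X_def)
      also have "\<dots> = min (1 / 2 ^ (m + 1)) (min \<kappa>s \<rho> / 2)" using M by (simp add: es_def)
      finally have "X \<le> 1 / 2 ^ (m + 1)" and 2: "X \<le> \<kappa>s / 2" "X \<le> \<rho> / 2" by auto
      then show "X * 2 ^ (m + 1) \<le> 1" by (simp add: field_simps)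
      show "2 * X \<le> \<kappa>s" "2 * X \<le> \<rho>" using 2 by auto
      show "0 < X" "A * e \<le> X" using e M AM by (auto simp: X_def)
    qed
    define t where "t j = (1 / 2 :: real) ^ j" for j :: nat
    have t: "0 < t j" "t j \<le> 1" "t (Suc j) = t j / 2" for j
      by (auto simp: t_def power_le_one)
    define r where "r j = r0 - 2 * \<delta>0 * (1 - t j)" for j
    define \<sigma> where "\<sigma> j = \<sigma>0 - 6 * \<delta>0 * (1 - t j)" for j
    define E where "E j = e * t j ^ (m + 1)" for j
    define P where "P j = (\<lambda>(\<Lambda>, C). phase_map r0 \<sigma>0 (r j) (\<sigma> j) (2 * X * (1 - t j)) C \<and>
        normal_form_error \<omega> (\<sigma> j) (E j) (transformed_ham F \<Lambda> C) \<and> (\<forall>k. \<bar>\<Lambda> $ k\<bar> \<le> 2 * X * (1 - t j)))" for j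
    define Q where "Q j = (\<lambda>(\<Lambda> :: real^'n, C :: 'n cphase \<Rightarrow> 'n cphase) (\<Lambda>' :: real^'n, C' :: 'n cphase \<Rightarrow> 'n cphase). (\<forall>k. \<bar>\<Lambda>' $ k - \<Lambda> $ k\<bar> \<le> X / 2 ^ j) \<and>
        (\<forall>x\<in>pdom \<rho> \<rho>. \<forall>i. cmod (fst (C' x) $ i - fst (C x) $ i) \<le> X / 2 ^ j \<and>
           cmod (snd (C' x) $ i - snd (C x) $ i) \<le> X / 2 ^ j))" for j
    have \<rho>j: "\<rho> \<le> r j" "r j \<le> r0" "\<rho> \<le> \<sigma> j" "\<sigma> j \<le> \<sigma>0" for j
    proof -
      have "0 \<le> \<delta>0 * (1 - t j)" "\<delta>0 * (1 - t j) \<le> \<delta>0 * 1"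
        using t[of j] \<delta>0 by (auto intro!: mult_left_mono simp del: mult_1_right)
      then show "\<rho> \<le> r j" "r j \<le> r0" "\<rho> \<le> \<sigma> j" "\<sigma> j \<le> \<sigma>0"
        using \<rho> unfolding r_def \<sigma>_def \<delta>0_def by linarith+
    qed
    have base: "\<exists>s. P 0 s"
    proof (intro exI[of _ "(0, \<lambda>x. x)"])
      have "transformed_ham F 0 (\<lambda>x. x) = F" by (simp add: fun_eq_iff transformed_ham_def)
      moreover have "phase_map r0 \<sigma>0 r0 \<sigma>0 0 (\<lambda>x :: 'n cphase. x)"
        unfolding phase_map_def by (auto simp: hol_id sympl_def)
      ultimately show "P 0 (0, \<lambda>x. x)" using nf by (simp add: P_def r_def \<sigma>_def t_def E_def)
    qed
    have step: "\<exists>s'. P (Suc j) s' \<and> Q j s s'" if s: "P j s" for j s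
    proof -
      obtain \<Lambda> C where sL: "s = (\<Lambda>, C)" by force
      have p: "phase_map r0 \<sigma>0 (r j) (\<sigma> j) (2 * X * (1 - t j)) C"
        "normal_form_error \<omega> (\<sigma> j) (E j) (transformed_ham F \<Lambda> C)" "\<And>k. \<bar>\<Lambda> $ k\<bar> \<le> 2 * X * (1 - t j)"
        using s by (auto simp: P_def sL)
      define \<delta> where "\<delta> = \<delta>0 * t j"
      have move: "A * E j / \<delta> ^ m = X * t j"
        using \<delta>0 t(1)[of j] by (simp add: E_def \<delta>_def X_def M_def field_simps)
      have Xt: "X * t j = X / 2 ^ j" by (simp add: t_def power_divide)
      have Xt': "0 \<le> X * t j" "X * t j \<le> X" using X t[of j] mult_left_le[of "t j" X] by simp_all
      have kap: "2 * X * (1 - t j) = 2 * X - 2 * (X * t j)" by (simp add: algebra_simps)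
      have "(A * E j) * E j / \<delta> ^ m = E j * (X * t j)" unfolding move[symmetric] by simp
      also have "\<dots> \<le> E j * (1 / 2 ^ (m + 1))"
      proof (rule mult_left_mono)
        have "X \<le> 1 / 2 ^ (m + 1)" using X(2) by (simp add: field_simps)
        then show "X * t j \<le> 1 / 2 ^ (m + 1)" using Xt' by linarith
      qed (use e t in \<open>simp add: E_def less_imp_le\<close>)
      also have "\<dots> = E (Suc j)" by (simp add: E_def t(3) power_divide)
      finally have EE: "A * (E j)\<^sup>2 / \<delta> ^ m \<le> E (Suc j)" by (simp add: power2_eq_square)
      have AE: "A * E j \<le> X * t j"
      proof -
        have "t j ^ (m + 1) \<le> t j ^ 1" by (rule power_decreasing) (use t[of j] in auto)
        then have "(A * e) * t j ^ (m + 1) \<le> X * t j" using X A e t[of j] by (intro mult_mono) auto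
        then show ?thesis by (simp add: E_def)
      qed
      have X1: "2 * X \<le> 1" using X \<kappa>s by linarith
      have "\<exists>\<Lambda>' C'. phase_map r0 \<sigma>0 (r j - \<delta>) (\<sigma> j - 3 * \<delta>) (2 * X * (1 - t j) + A * E j / \<delta> ^ m) C' \<and>
        normal_form_error \<omega> (\<sigma> j - 3 * \<delta>) (A * (E j)\<^sup>2 / \<delta> ^ m) (transformed_ham F \<Lambda>' C') \<and>
        (\<forall>k. \<bar>\<Lambda>' $ k - \<Lambda> $ k\<bar> \<le> A * E j) \<and>
        (\<forall>x\<in>pdom (r j - \<delta>) (\<sigma> j - 3 * \<delta>). \<forall>i. cmod (fst (C' x) $ i - fst (C x) $ i) \<le> A * E j / \<delta> ^ m \<and>
           cmod (snd (C' x) $ i - snd (C x) $ i) \<le> A * E j / \<delta> ^ m)"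
      proof (rule kam[OF F \<rho>j _ _ _ _ _ _ _ p(1,2)])
        show "0 < \<delta>" using \<delta>0 t by (simp add: \<delta>_def)
        have "\<delta> \<le> \<delta>0" using \<delta>0 t[of j] by (simp add: \<delta>_def mult_left_le)
        then show "4 * \<delta> \<le> \<rho>" using \<rho> by (simp add: \<delta>0_def)
        show "0 < E j" using e t by (simp add: E_def)
        show "0 \<le> 2 * X * (1 - t j)" "2 * X * (1 - t j) \<le> \<kappa>s" unfolding kap using X Xt' by auto
        show "\<forall>k. \<bar>\<Lambda> $ k\<bar> \<le> 1"
        proof
          show "\<bar>\<Lambda> $ k\<bar> \<le> 1" for k using p(3)[of k] X1 Xt' unfolding kap by linarith
        qed
        show "A * E j / \<delta> ^ m \<le> 1" unfolding move using X1 Xt' by linarith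
      qed
      then obtain \<Lambda>' C' where n: "phase_map r0 \<sigma>0 (r j - \<delta>) (\<sigma> j - 3 * \<delta>) (2 * X * (1 - t j) + X * t j) C'"
        "normal_form_error \<omega> (\<sigma> j - 3 * \<delta>) (A * (E j)\<^sup>2 / \<delta> ^ m) (transformed_ham F \<Lambda>' C')"
        "\<forall>k. \<bar>\<Lambda>' $ k - \<Lambda> $ k\<bar> \<le> A * E j"
        "\<forall>x\<in>pdom (r j - \<delta>) (\<sigma> j - 3 * \<delta>). \<forall>i. cmod (fst (C' x) $ i - fst (C x) $ i) \<le> X * t j \<and>
           cmod (snd (C' x) $ i - snd (C x) $ i) \<le> X * t j"
        unfolding move by auto
      have rs: "r j - \<delta> = r (Suc j)" "\<sigma> j - 3 * \<delta> = \<sigma> (Suc j)"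
        by (simp_all add: r_def \<sigma>_def \<delta>_def t(3) algebra_simps)
      have ks: "2 * X * (1 - t j) + X * t j = 2 * X * (1 - t (Suc j))" by (simp add: t(3) algebra_simps)
      have "P (Suc j) (\<Lambda>', C')"
        unfolding P_def prod.case
      proof (intro conjI allI)
        show "phase_map r0 \<sigma>0 (r (Suc j)) (\<sigma> (Suc j)) (2 * X * (1 - t (Suc j))) C'" using n(1) by (simp add: rs ks)
        show "normal_form_error \<omega> (\<sigma> (Suc j)) (E (Suc j)) (transformed_ham F \<Lambda>' C')"
          using n(2) EE unfolding normal_form_error_def rs by (meson order_trans)
        show "\<bar>\<Lambda>' $ k\<bar> \<le> 2 * X * (1 - t (Suc j))" for k
          using n(3)[rule_format, of k] p(3)[of k] AE unfolding ks[symmetric] by linarith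
      qed
      moreover have "Q j s (\<Lambda>', C')"
        unfolding Q_def sL prod.case
      proof (intro conjI allI ballI)
        show "\<bar>\<Lambda>' $ k - \<Lambda> $ k\<bar> \<le> X / 2 ^ j" for k using n(3)[rule_format, of k] AE Xt by linarith
        fix x :: "'n cphase" and i assume "x \<in> pdom \<rho> \<rho>"
        then have "x \<in> pdom (r j - \<delta>) (\<sigma> j - 3 * \<delta>)"
          using pdom_mono[OF \<rho>j(1,3)[of "Suc j"]] by (auto simp: rs)
        then show "cmod (fst (C' x) $ i - fst (C x) $ i) \<le> X / 2 ^ j" "cmod (snd (C' x) $ i - snd (C x) $ i) \<le> X / 2 ^ j"
          using n(4) Xt by auto
      qed
      ultimately show ?thesis by blast
    qed
    obtain s where s: "\<And>j. P j (s j)" "\<And>j. Q j (s j) (s (Suc j))"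
      using dependent_nat_choice[of P Q, OF base step] by blast
    define \<Lambda> where "\<Lambda> j = fst (s j)" for j
    define C where "C j = snd (s j)" for j
    have sj: "s j = (\<Lambda> j, C j)" for j by (simp add: \<Lambda>_def C_def)
    have \<kappa>j: "2 * X * (1 - t j) \<le> 2 * X" for j using X t[of j] by (intro mult_left_le) auto
    have pm: "phase_map r0 \<sigma>0 \<rho> \<rho> (2 * X) (C j)" for j
      by (rule phase_map_mono[OF _ \<rho>j(1)[of j] \<rho>j(3)[of j] \<kappa>j[of j]]) (use s(1)[of j] in \<open>simp add: P_def sj\<close>)
    have Qj: "\<bar>\<Lambda> (Suc j) $ k - \<Lambda> j $ k\<bar> \<le> X / 2 ^ j"
      "x \<in> pdom \<rho> \<rho> \<Longrightarrow> cmod (fst (C (Suc j) x) $ i - fst (C j x) $ i) \<le> X / 2 ^ j"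
      "x \<in> pdom \<rho> \<rho> \<Longrightarrow> cmod (snd (C (Suc j) x) $ i - snd (C j x) $ i) \<le> X / 2 ^ j" for j k x i
      using s(2)[of j] by (auto simp: Q_def sj)
    have \<rho>X: "\<rho> + 2 * X \<le> r0" "\<rho> + 2 * X \<le> \<sigma>0" using \<rho> X by auto
    obtain C' where C': "phase_map r0 \<sigma>0 \<rho> \<rho> (2 * X) C'"
      and lim: "\<And>x. x \<in> pdom \<rho> \<rho> \<Longrightarrow> (\<lambda>j. C j x) \<longlonglongrightarrow> C' x"
        "\<And>x v. x \<in> pdom \<rho> \<rho> \<Longrightarrow> (\<lambda>j. dv (C j) x v) \<longlonglongrightarrow> dv C' x v"
      by (rule phase_map_limit[OF pm \<rho>X Qj(2,3)]) (assumption, assumption, (rule that; assumption))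
    define \<Lambda>' where "\<Lambda>' = (\<chi> k. lim (\<lambda>j. \<Lambda> j $ k))"
    have \<Lambda>lim: "(\<lambda>j. \<Lambda> j $ k) \<longlonglongrightarrow> \<Lambda>' $ k" for k
      using geometric_limit(1)[of "\<lambda>j. \<Lambda> j $ k" X] Qj(1) by (simp add: \<Lambda>'_def)
    define f where "f j = transformed_ham F (\<Lambda> j) (C j)" for j
    define f' where "f' = transformed_ham F \<Lambda>' C'"
    have flim: "(\<lambda>j. f j x) \<longlonglongrightarrow> f' x" "(\<lambda>j. dv (f j) x v) \<longlonglongrightarrow> dv f' x v" if x: "x \<in> pdom \<rho> \<rho>" for x v
      unfolding f_def f'_def
      using tendsto_transformed_ham[OF phase_funD(1)[OF F(1)] pm C' x lim(1)[OF x] lim(2)[OF x] \<Lambda>lim] by auto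
    (* The error bounds converge on both sides, to the error of the limit and to 0. *)
    have Elim: "E \<longlonglongrightarrow> 0"
    proof -
      have "(\<lambda>j. e * ((1 / 2) ^ (m + 1)) ^ j) \<longlonglongrightarrow> e * 0"
        by (intro tendsto_intros LIMSEQ_power_zero) (simp add: norm_power power_one_over divide_simps less_1_mult one_less_power del: power_Suc)
      moreover have "E = (\<lambda>j. e * ((1 / 2) ^ (m + 1)) ^ j)" 
        by (simp only: fun_eq_iff E_def t_def power_mult[symmetric] mult.commute[of "m + 1"]) simp
      ultimately show ?thesis by simp
    qed
    have err: "cmod (f j (0, \<theta>) - f j (0, 0)) \<le> E j" "cmod (pd i (f j) (0, \<theta>) - of_real (\<omega> $ i)) \<le> E j"
      if "\<theta> \<in> complex_angles \<rho>" for j \<theta> i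
    proof -
      have "\<theta> \<in> complex_angles (\<sigma> j)" using complex_angles_mono[OF \<rho>j(3)] that by blast
      then show "cmod (f j (0, \<theta>) - f j (0, 0)) \<le> E j" "cmod (pd i (f j) (0, \<theta>) - of_real (\<omega> $ i)) \<le> E j"
        using s(1)[of j] by (auto simp: P_def sj normal_form_error_def f_def)
    qed
    have "normal_form_error \<omega> \<rho> 0 f'"
      unfolding normal_form_error_def
    proof (intro ballI conjI allI)
      fix \<theta> :: "complex^'n" assume \<theta>: "\<theta> \<in> complex_angles \<rho>"
      have x: "(0, \<theta>) \<in> pdom \<rho> \<rho>" "(0, 0) \<in> pdom \<rho> \<rho>" using \<theta> \<rho> by (auto simp: complex_angles_def)
      show "cmod (f' (0, \<theta>) - f' (0, 0)) \<le> 0"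
        by (rule LIMSEQ_le[OF tendsto_norm[OF tendsto_diff[OF flim(1)[OF x(1)] flim(1)[OF x(2)]]] Elim]) (use err(1)[OF \<theta>] in auto)
      show "cmod (pd i f' (0, \<theta>) - of_real (\<omega> $ i)) \<le> 0" for i
        by (rule LIMSEQ_le[OF tendsto_norm[OF tendsto_diff[OF flim(2)[OF x(1)] tendsto_const]] Elim]) (use err(2)[OF \<theta>] in auto)
    qed
    then show ?thesis using C' by (auto simp: f'_def X_def mult.assoc)
  qed
  show ?thesis by (rule that[OF \<rho>(1-3) es _ main]) (use M in auto)
qed

section \<open>Real analyticity\<close>

definition emb :: "('n::finite) rphase \<Rightarrow> 'n cphase" where
  "emb x = (cvec (fst x), cvec (snd x))"

definition repart :: "('n::finite) cphase \<Rightarrow> 'n rphase" where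
  "repart z = ((\<chi> i. Re (fst z $ i)), (\<chi> i. Re (snd z $ i)))"

lemma emb_simps [simp]: "fst (emb x) = cvec (fst x)" "snd (emb x) = cvec (snd x)" "repart (emb x) = x"
  by (simp_all add: emb_def repart_def prod_eq_iff vec_eq_iff)

lemma emb_linear: "linear emb"
  by (rule linearI) (simp_all add: emb_def prod_eq_iff vec_eq_iff complex_eq_iff)

lemma repart_linear: "linear repart"
  by (rule linearI) (simp_all add: repart_def prod_eq_iff vec_eq_iff)

lemma emb_bounded_linear: "bounded_linear emb" and repart_bounded_linear: "bounded_linear repart"
  using emb_linear repart_linear by (simp_all add: linear_conv_bounded_linear)

lemma emb_in_pdom [simp]: "0 < \<sigma> \<Longrightarrow> emb x \<in> pdom r \<sigma> \<longleftrightarrow> (\<forall>i. \<bar>fst x $ i\<bar> < r)"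
  by (simp add: emb_def complex_angles_def)

lemma emb_shift: "emb (x + (0, lattice_vec k)) = emb x + shiftv k"
  by (simp add: emb_def shiftv_def prod_eq_iff vec_eq_iff)

lemma emb_inj: "emb x = emb y \<Longrightarrow> x = y"
  by (metis emb_simps(3))

lemma cform_emb: "cform (emb a) (emb b) = of_real (symplectic_form a b)"
  by (simp add: cform_def cdot_def symplectic_form_def case_prod_beta inner_vec_def)

lemma has_sum_sum_fun:
  fixes f :: "'i \<Rightarrow> 'a \<Rightarrow> 'b::real_normed_vector"
  assumes "finite I" "\<And>i. i \<in> I \<Longrightarrow> (f i has_sum s i) A"
  shows "((\<lambda>x. \<Sum>i\<in>I. f i x) has_sum (\<Sum>i\<in>I. s i)) A"
  using assms
proof (induction I rule: finite_induct)
  case (insert i I)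
  then have "((\<lambda>x. f i x + (\<Sum>i\<in>I. f i x)) has_sum (s i + (\<Sum>i\<in>I. s i))) A"
    by (intro has_sum_add) auto
  with insert(1,2) show ?case by simp
qed (simp add: has_sum_0)

lemma real_analytic_on_componentwise:
  fixes g :: "'a::euclidean_space \<Rightarrow> 'b::euclidean_space"
  assumes g: "\<And>b. b \<in> Basis \<Longrightarrow> real_analytic_on (\<lambda>x. g x \<bullet> b) S"
  shows "real_analytic_on g S"
  unfolding real_analytic_on_def
proof
  fix x assume x: "x \<in> S"
  have "\<forall>b\<in>Basis. \<exists>r. \<exists>a. r > 0 \<and> (\<forall>y\<in>ball x r.
      ((\<lambda>\<alpha>. (\<Prod>i\<in>Basis. ((y - x) \<bullet> i) ^ \<alpha> i) *\<^sub>R a \<alpha>) has_sum g y \<bullet> b) (Basis \<rightarrow>\<^sub>E (UNIV :: nat set)))"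
    using g x unfolding real_analytic_on_def by fast
  from bchoice[OF this] obtain r where "\<forall>b\<in>Basis. \<exists>a. r b > 0 \<and> (\<forall>y\<in>ball x (r b).
      ((\<lambda>\<alpha>. (\<Prod>i\<in>Basis. ((y - x) \<bullet> i) ^ \<alpha> i) *\<^sub>R a \<alpha>) has_sum g y \<bullet> b) (Basis \<rightarrow>\<^sub>E (UNIV :: nat set)))" ..
  from bchoice[OF this] obtain a where a: "\<forall>b\<in>Basis. r b > 0 \<and> (\<forall>y\<in>ball x (r b).
      ((\<lambda>\<alpha>. (\<Prod>i\<in>Basis. ((y - x) \<bullet> i) ^ \<alpha> i) *\<^sub>R a b \<alpha>) has_sum g y \<bullet> b) (Basis \<rightarrow>\<^sub>E (UNIV :: nat set)))" ..
  define R where "R = Min (r ` Basis)"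
  have R: "0 < R" and Rle: "R \<le> r b" if "b \<in> Basis" for b
    using a that by (auto simp: R_def)
  have R0: "0 < R" using R nonempty_Basis by blast
  have "((\<lambda>\<alpha>. (\<Prod>i\<in>Basis. ((y - x) \<bullet> i) ^ \<alpha> i) *\<^sub>R (\<Sum>b\<in>Basis. a b \<alpha> *\<^sub>R b)) has_sum g y) (Basis \<rightarrow>\<^sub>E (UNIV :: nat set))"
    if y: "y \<in> ball x R" for y
  proof -
    have "((\<lambda>\<alpha>. \<Sum>b\<in>Basis. ((\<Prod>i\<in>Basis. ((y - x) \<bullet> i) ^ \<alpha> i) *\<^sub>R a b \<alpha>) *\<^sub>R b) has_sum (\<Sum>b\<in>Basis. (g y \<bullet> b) *\<^sub>R b))
        (Basis \<rightarrow>\<^sub>E (UNIV :: nat set))"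
    proof (rule has_sum_sum_fun[OF finite_Basis])
      fix b :: 'b assume b: "b \<in> Basis"
      have "y \<in> ball x (r b)" using y Rle[OF b] by simp
      then show "((\<lambda>\<alpha>. ((\<Prod>i\<in>Basis. ((y - x) \<bullet> i) ^ \<alpha> i) *\<^sub>R a b \<alpha>) *\<^sub>R b) has_sum (g y \<bullet> b) *\<^sub>R b) (Basis \<rightarrow>\<^sub>E (UNIV :: nat set))"
        by (intro has_sum_bounded_linear[OF bounded_linear_scaleR_left]) (use a b in blast)
    qed
    then show ?thesis by (simp add: euclidean_representation scaleR_sum_right)
  qed
  then show "\<exists>r>0. \<exists>a. \<forall>y\<in>ball x r.
      ((\<lambda>\<alpha>. (\<Prod>i\<in>Basis. ((y - x) \<bullet> i) ^ \<alpha> i) *\<^sub>R a \<alpha>) has_sum g y) (Basis \<rightarrow>\<^sub>E (UNIV :: nat set))"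
    using R0 by (intro exI[of _ R] conjI exI[of _ "\<lambda>\<alpha>. \<Sum>b\<in>Basis. a b \<alpha> *\<^sub>R b"] ballI) auto
qed

text \<open>
  The complex power series in the coordinates of the real space, restricted to real arguments: its real
  part has the real parts of the coefficients.
\<close>

lemma real_analytic_on_hol:
  fixes f :: "('n::finite) cphase \<Rightarrow> complex"
  assumes D: "open D" and f: "hol f D" and S: "emb ` S \<subseteq> D"
  shows "real_analytic_on (\<lambda>x. Re (f (emb x))) S"
  unfolding real_analytic_on_def
proof
  fix x assume x: "x \<in> S"
  then have ex: "emb x \<in> D" using S by auto
  obtain d1 where d1: "d1 > 0" "ball (emb x) d1 \<subseteq> D" using D ex by (meson open_contains_ball)
  have "isCont f (emb x)" using hol_continuous[OF f] D ex by (simp add: continuous_on_eq_continuous_at)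
  then obtain d2 where d2: "d2 > 0" "\<And>y. dist y (emb x) < d2 \<Longrightarrow> dist (f y) (f (emb x)) < 1"
    unfolding continuous_at_eps_delta by (meson zero_less_one)
  define d where "d = min d1 d2"
  define M where "M = (\<Sum>b\<in>Basis. norm (emb b :: 'n cphase)) + 1"
  have M: "M > 0" unfolding M_def by (intro add_nonneg_pos sum_nonneg) auto
  define R where "R = d / M"
  have R: "R > 0" using d1 d2 M by (simp add: R_def d_def)
  have near: "norm (\<Sum>b\<in>Basis. z b *\<^sub>C emb b :: 'n cphase) < d" if z: "\<forall>b\<in>Basis. cmod (z b) < R" for z
  proof -
    have "norm (\<Sum>b\<in>Basis. z b *\<^sub>C emb b :: 'n cphase) \<le> (\<Sum>b\<in>Basis. R * norm (emb b :: 'n cphase))"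
      by (intro sum_norm_le) (use z in \<open>auto simp: less_imp_le intro!: mult_right_mono\<close>)
    also have "\<dots> = R * (M - 1)" by (simp add: M_def sum_distrib_left)
    also have "\<dots> < R * M" using R by (intro mult_strict_left_mono) auto
    also have "\<dots> = d" using M by (simp add: R_def)
    finally show ?thesis .
  qed
  have "\<exists>a. (\<forall>\<alpha>\<in>PiE Basis (\<lambda>_. UNIV). cmod (a \<alpha>) \<le> (cmod (f (emb x)) + 1) * (\<Prod>b\<in>Basis. (1 / R) ^ \<alpha> b)) \<and>
    (\<forall>z. (\<forall>b\<in>Basis. cmod (z b) < R) \<longrightarrow>
      ((\<lambda>\<alpha>. a \<alpha> * (\<Prod>b\<in>Basis. z b ^ \<alpha> b)) has_sum f (emb x + (\<Sum>b\<in>Basis. z b *\<^sub>C emb b))) (PiE Basis (\<lambda>_. UNIV)))"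
  proof (rule hol_power_series[OF finite_Basis R D f])
    fix z :: "'n rphase \<Rightarrow> complex" assume z: "\<forall>b\<in>Basis. cmod (z b) < R"
    let ?y = "emb x + (\<Sum>b\<in>Basis. z b *\<^sub>C emb b)"
    have dy: "dist ?y (emb x) < d" using near[OF z] by (simp add: dist_norm)
    have "?y \<in> D" using d1(2) dy by (auto simp: d_def dist_commute)
    moreover have "dist (f ?y) (f (emb x)) < 1" using d2(2) dy by (simp add: d_def)
    then have "cmod (f ?y) \<le> cmod (f (emb x)) + 1"
      using norm_triangle_ineq2[of "f ?y" "f (emb x)"] by (simp add: dist_norm)
    ultimately show "?y \<in> D \<and> cmod (f ?y) \<le> cmod (f (emb x)) + 1" ..
  qed
  then obtain a where a: "\<And>z. \<forall>b\<in>Basis. cmod (z b) < R \<Longrightarrow>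
      ((\<lambda>\<alpha>. a \<alpha> * (\<Prod>b\<in>Basis. z b ^ \<alpha> b)) has_sum f (emb x + (\<Sum>b\<in>Basis. z b *\<^sub>C emb b))) (PiE Basis (\<lambda>_. UNIV))"
    by blast
  have "((\<lambda>\<alpha>. (\<Prod>b\<in>Basis. ((y - x) \<bullet> b) ^ \<alpha> b) *\<^sub>R Re (a \<alpha>)) has_sum Re (f (emb y))) (Basis \<rightarrow>\<^sub>E (UNIV :: nat set))"
    if y: "y \<in> ball x R" for y
  proof -
    define z where "z b = complex_of_real ((y - x) \<bullet> b)" for b
    have z: "\<forall>b\<in>Basis. cmod (z b) < R"
    proof
      fix b :: "'n rphase" assume b: "b \<in> Basis"
      have "\<bar>(y - x) \<bullet> b\<bar> \<le> norm (y - x)" by (rule Basis_le_norm[OF b])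
      then show "cmod (z b) < R" using y by (simp add: z_def dist_norm norm_minus_commute)
    qed
    have "(\<Sum>b\<in>Basis. z b *\<^sub>C emb b) = emb (\<Sum>b\<in>Basis. ((y - x) \<bullet> b) *\<^sub>R b)"
      unfolding z_def cscale_of_real by (simp only: linear_sum[OF emb_linear] linear_scale[OF emb_linear])
    also have "\<dots> = emb y - emb x" by (simp add: euclidean_representation linear_diff[OF emb_linear])
    finally have "((\<lambda>\<alpha>. a \<alpha> * (\<Prod>b\<in>Basis. z b ^ \<alpha> b)) has_sum f (emb y)) (PiE Basis (\<lambda>_. UNIV))"
      using a[OF z] by simp
    from has_sum_Re[OF this] show ?thesis
      unfolding z_def by (simp flip: of_real_power of_real_prod add: mult.commute)
  qed
  then show "\<exists>r>0. \<exists>a. \<forall>y\<in>ball x r.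
      ((\<lambda>\<alpha>. (\<Prod>b\<in>Basis. ((y - x) \<bullet> b) ^ \<alpha> b) *\<^sub>R a \<alpha>) has_sum Re (f (emb y))) (Basis \<rightarrow>\<^sub>E (UNIV :: nat set))"
    using R by (intro exI[of _ R] conjI exI[of _ "\<lambda>\<alpha>. Re (a \<alpha>)"] ballI) auto
qed

section \<open>The real canonical transformation\<close>

locale complex_normal_form =
  fixes \<omega> \<Lambda> :: "real^'n::finite" and F :: "'n cphase \<Rightarrow> complex" and C :: "'n cphase \<Rightarrow> 'n cphase" and r0 \<sigma>0 \<rho> \<kappa> :: real
  assumes F: "phase_fun r0 \<sigma>0 F" and C: "phase_map r0 \<sigma>0 \<rho> \<rho> \<kappa> C" and \<rho>: "0 < \<rho>" "4 * \<kappa> \<le> \<rho>"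
    and nf: "normal_form_error \<omega> \<rho> 0 (transformed_ham F \<Lambda> C)"
begin

definition U :: "'n rphase set" where "U = {x. \<forall>i. \<bar>fst x $ i\<bar> < \<rho> / 2}"
definition T :: "'n rphase \<Rightarrow> 'n rphase" where "T x = repart (C (emb x))"

lemmas Cd = phase_mapD[OF C]

lemma open_U: "open U"
proof -
  have "U = (\<Inter>i\<in>UNIV. {x. \<bar>fst x $ i\<bar> < \<rho> / 2})" by (auto simp: U_def)
  moreover have "open {x :: 'n rphase. \<bar>fst x $ i\<bar> < \<rho> / 2}" for i
    by (intro open_Collect_less continuous_intros)
  ultimately show ?thesis by (simp only:) (intro open_INT ballI finite)
qed

lemma U_neighbourhood: "torus_neighbourhood U"
  unfolding torus_neighbourhood_def using open_U \<rho> by (auto simp: U_def)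

lemma emb_U: "x \<in> U \<Longrightarrow> emb x \<in> pdom \<rho> \<rho>" "x \<in> U \<Longrightarrow> emb x \<in> pdom (\<rho> / 2) (\<rho> / 2)"
proof -
  assume x: "x \<in> U"
  then show "emb x \<in> pdom (\<rho> / 2) (\<rho> / 2)" using \<rho> by (simp add: U_def)
  have "\<bar>fst x $ i\<bar> < \<rho>" for i 
  proof -
    have "\<bar>fst x $ i\<bar> < \<rho> / 2" using x by (simp add: U_def)
    then show ?thesis using \<rho>(1) by linarith
  qed
  then show "emb x \<in> pdom \<rho> \<rho>" using \<rho> by simp
qed

lemma emb_T: "x \<in> U \<Longrightarrow> emb (T x) = C (emb x)"
proof -
  assume "x \<in> U"
  then obtain p' q' where "C (emb x) = (cvec p', cvec q')" using Cd(4)[of "fst x" "snd x"] emb_U(1) by (auto simp: emb_def)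
  then have "C (emb x) = emb (p', q')" by (simp add: emb_def)
  then show ?thesis by (simp add: T_def)
qed

text \<open>
  At real points the complex derivative maps real vectors to real ones, because it is also the
  derivative of \<open>emb \<circ> T\<close>. So the real symplectic identity is the complex one.
\<close>

lemma T_derivative:
  assumes x: "x \<in> U"
  shows "\<exists>T'. (T has_derivative T') (at x) \<and> (\<forall>a b. symplectic_form (T' a) (T' b) = symplectic_form a b)"
proof -
  define T' where "T' v = repart (dv C (emb x) (emb v))" for v
  have c: "((\<lambda>x. C (emb x)) has_derivative (\<lambda>v. dv C (emb x) (emb v))) (at x)"
    by (rule hol_has_derivative_compose[OF Cd(1) emb_U(1)[OF x] bounded_linear_imp_has_derivative[OF emb_bounded_linear]])
  have T: "(T has_derivative T') (at x)"
    unfolding T_def[abs_def] T'_def by (rule bounded_linear.has_derivative[OF repart_bounded_linear c])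
  have "((\<lambda>x. emb (T x)) has_derivative (\<lambda>v. dv C (emb x) (emb v))) (at x)"
    by (rule has_derivative_transform_within_open[OF c open_U x]) (simp add: emb_T)
  from has_derivative_unique[OF this bounded_linear.has_derivative[OF emb_bounded_linear T]]
  have e: "dv C (emb x) (emb v) = emb (T' v)" for v by metis
  have "symplectic_form (T' a) (T' b) = symplectic_form a b" for a b
  proof -
    have "cform (dv C (emb x) (emb a)) (dv C (emb x) (emb b)) = cform (emb a) (emb b)"
      using Cd(5)[OF emb_U(1)[OF x]] unfolding sympl_def by blast
    then show ?thesis unfolding e cform_emb by simp
  qed
  then show ?thesis using T by blast
qed

text \<open>
  The displacement \<open>C - id\<close> is at most \<open>\<kappa>\<close> on the larger domain, so by Cauchy estimates and the mean
  value inequality it is a contraction by \<open>1 / 2\<close> in the maximum norm on the convex set \<open>U\<close>.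
\<close>

lemma T_inj: "inj_on T U"
proof (rule inj_onI, rule ccontr)
  fix x y assume x: "x \<in> U" and y: "y \<in> U" and eq: "T x = T y" and ne: "x \<noteq> y"
  have Ceq: "C (emb x) = C (emb y)" using emb_T[OF x] emb_T[OF y] eq by simp
  define v where "v = emb x - emb y"
  (* The maximum norm a of the difference v would be at most a / 2. *)
  define S where "S = range (\<lambda>i. cmod (fst v $ i)) \<union> range (\<lambda>i. cmod (snd v $ i))"
  define a where "a = Max S"
  have le: "cmod (fst v $ i) \<le> a" "cmod (snd v $ i) \<le> a" for i
    unfolding a_def by (rule Max_ge; auto simp: S_def)+
  have a_in: "a \<in> S" unfolding a_def by (rule Max_in) (auto simp: S_def)
  have a0: "0 < a"
  proof (rule ccontr)
    assume "\<not> 0 < a"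
    then have "cmod (fst v $ i) \<le> 0" "cmod (snd v $ i) \<le> 0" for i using le[of i] by linarith+
    then have "v = 0" by (simp add: prod_eq_iff vec_eq_iff)
    then show False using emb_inj[of x y] ne by (simp add: v_def)
  qed
  have seg: "cmod (g (emb x) - g (emb y)) \<le> a / 2"
    if g: "hol g (pdom \<rho> \<rho>)" "\<And>z. z \<in> pdom \<rho> \<rho> \<Longrightarrow> cmod (g z) \<le> \<kappa>" for g
  proof -
    have in_U: "emb y + t *\<^sub>C v \<in> pdom (\<rho> / 2) (\<rho> / 2)" if t: "t \<in> closed_segment 0 1" for t
    proof -
      obtain u where u: "t = of_real u" "0 \<le> u" "u \<le> 1" using t by (auto simp: closed_segment_def scaleR_conv_of_real)
      have "emb y + t *\<^sub>C v = emb (y + u *\<^sub>R (x - y))"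
        unfolding u(1) cscale_of_real v_def
        by (simp only: linear_add[OF emb_linear] linear_scale[OF emb_linear] linear_diff[OF emb_linear])
      moreover have "\<bar>fst (y + u *\<^sub>R (x - y)) $ i\<bar> < \<rho> / 2" for i
      proof -
        have "convex {- (\<rho> / 2) <..< \<rho> / 2}" by simp
        moreover have "fst y $ i \<in> {- (\<rho> / 2) <..< \<rho> / 2}" "fst x $ i \<in> {- (\<rho> / 2) <..< \<rho> / 2}"
        proof -
          have "\<bar>fst x $ i\<bar> < \<rho> / 2" "\<bar>fst y $ i\<bar> < \<rho> / 2" using x y unfolding U_def by blast+
          then show "fst y $ i \<in> {- (\<rho> / 2) <..< \<rho> / 2}" "fst x $ i \<in> {- (\<rho> / 2) <..< \<rho> / 2}"
            unfolding greaterThanLessThan_iff abs_less_iff by argo+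
        qed
        ultimately have "(1 - u) *\<^sub>R (fst y $ i) + u *\<^sub>R (fst x $ i) \<in> {- (\<rho> / 2) <..< \<rho> / 2}"
          by (rule convexD) (use u in auto)
        moreover have "(1 - u) *\<^sub>R (fst y $ i) + u *\<^sub>R (fst x $ i) = fst (y + u *\<^sub>R (x - y)) $ i"
          by (simp add: algebra_simps)
        ultimately show ?thesis unfolding abs_less_iff greaterThanLessThan_iff by argo
      qed
      ultimately show ?thesis using \<rho> by simp
    qed
    have in_D: "emb y + t *\<^sub>C v \<in> pdom \<rho> \<rho>" if "t \<in> closed_segment 0 1" for t
      using in_U[OF that] pdom_mono[of "\<rho> / 2" \<rho> "\<rho> / 2" \<rho>] \<rho> by auto
    have "cmod (g (emb y + 1 *\<^sub>C v) - g (emb y + 0 *\<^sub>C v)) \<le> a / 2 * cmod (1 - 0)"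
    proof (rule field_differentiable_bound[OF convex_closed_segment])
      fix t :: complex assume t: "t \<in> closed_segment 0 1"
      show "((\<lambda>t. g (emb y + t *\<^sub>C v)) has_field_derivative dv g (emb y + t *\<^sub>C v) v) (at t within closed_segment 0 1)"
        by (rule has_field_derivative_at_within, rule hol_line(2)[OF g(1) in_D t])
      define R where "R = \<rho> / (2 * a)"
      have "cmod (dv g (emb y + t *\<^sub>C v) v) \<le> \<kappa> / R"
      proof (rule hol_Cauchy_bounds(1)[OF g(1)])
        show R0: "0 < R" using \<rho> a0 by (simp add: R_def)
        fix s assume s: "cmod s < R"
        have b: "cmod s * b \<le> \<rho> / 2" if "b \<le> a" "0 \<le> b" for b
        proof -
          have "cmod s * b \<le> R * a" using s that R0 by (intro mult_mono) auto
          then show ?thesis using a0 by (simp add: R_def)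
        qed
        have "emb y + t *\<^sub>C v + s *\<^sub>C v \<in> pdom (\<rho> / 2 + \<rho> / 2) (\<rho> / 2 + \<rho> / 2)"
          by (rule pdom_add[OF in_U[OF t]]) (use b[OF le(1) norm_ge_zero] b[OF le(2) norm_ge_zero] in \<open>simp_all add: norm_mult\<close>)
        then show "emb y + t *\<^sub>C v + s *\<^sub>C v \<in> pdom \<rho> \<rho>" by simp
        then show "cmod (g (emb y + t *\<^sub>C v + s *\<^sub>C v)) \<le> \<kappa>" by (rule g(2))
      qed
      also have "\<kappa> / R \<le> a / 2"
      proof -
        have "\<kappa> * (4 * a) \<le> \<rho> * a" using \<rho>(2) a0 by simp
        then show ?thesis using \<rho> by (simp add: R_def field_simps)
      qed
      finally show "cmod (dv g (emb y + t *\<^sub>C v) v) \<le> a / 2" .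
    qed auto
    then show ?thesis by (simp add: v_def)
  qed
  have half: "cmod (fst v $ i) \<le> a / 2" "cmod (snd v $ i) \<le> a / 2" for i
  proof -
    have "hol (\<lambda>z. fst (C z) $ i - fst z $ i) (pdom \<rho> \<rho>)" "hol (\<lambda>z. snd (C z) $ i - snd z $ i) (pdom \<rho> \<rho>)"
      by (intro hol_diff hol_nth hol_fst hol_snd Cd(1) hol_id)+
    from seg[OF this(1) Cd(6)] seg[OF this(2) Cd(7)]
    show "cmod (fst v $ i) \<le> a / 2" "cmod (snd v $ i) \<le> a / 2"
      unfolding Ceq by (simp_all add: v_def norm_minus_commute)
  qed
  obtain i where "a = cmod (fst v $ i) \<or> a = cmod (snd v $ i)" using a_in by (auto simp: S_def)
  then have "a \<le> a / 2" using half[of i] by argo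
  then show False using a0 by simp
qed

lemma T_canonical: "canonical_on T U"
  unfolding canonical_on_def
proof (intro conjI ballI allI impI)
  show "T (p, q + lattice_vec k) = T (p, q) + (0, lattice_vec k)" if pq: "(p, q) \<in> U" for p q k
  proof (rule emb_inj)
    have pq': "(p, q + lattice_vec k) \<in> U" using pq by (simp add: U_def)
    have "emb (T (p, q + lattice_vec k)) = C (emb ((p, q) + (0, lattice_vec k)))" by (simp add: emb_T[OF pq'])
    also have "\<dots> = emb (T (p, q)) + shiftv k" unfolding emb_shift emb_T[OF pq] by (rule Cd(3)[OF emb_U(1)[OF pq]])
    also have "\<dots> = emb (T (p, q) + (0, lattice_vec k))" by (rule emb_shift[symmetric])
    finally show "emb (T (p, q + lattice_vec k)) = emb (T (p, q) + (0, lattice_vec k))" .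
  qed
qed (use T_inj T_derivative in auto)

lemma T_near: "x \<in> U \<Longrightarrow> dist (T x) x \<le> 2 * real CARD('n) * \<kappa>"
proof -
  assume x: "x \<in> U"
  have "\<bar>fst (T x) $ i - fst x $ i\<bar> \<le> \<kappa>" "\<bar>snd (T x) $ i - snd x $ i\<bar> \<le> \<kappa>" for i
    using Cd(6,7)[OF emb_U(1)[OF x], of i] unfolding emb_T[OF x, symmetric]
    by (simp_all flip: of_real_diff)
  then have c: "\<bar>(fst (T x) - fst x) $ i\<bar> \<le> \<kappa>" "\<bar>(snd (T x) - snd x) $ i\<bar> \<le> \<kappa>" for i by simp_all
  have "norm (fst (T x) - fst x) \<le> real CARD('n) * \<kappa>" "norm (snd (T x) - snd x) \<le> real CARD('n) * \<kappa>"
    using order_trans[OF norm_le_l1_cart sum_bounded_above[of UNIV, OF c(1)]]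
      order_trans[OF norm_le_l1_cart sum_bounded_above[of UNIV, OF c(2)]] by simp_all
  moreover have "dist (T x) x \<le> norm (fst (T x) - fst x) + norm (snd (T x) - snd x)"
    unfolding dist_prod_def dist_norm by (rule sqrt_sum_squares_le_sum) auto
  ultimately show ?thesis by linarith
qed

lemma T_analytic: "real_analytic_on T U"
proof (rule real_analytic_on_componentwise)
  fix b :: "'n rphase"
  define f where "f z = (\<Sum>i\<in>UNIV. fst (C z) $ i * of_real (fst b $ i)) + (\<Sum>i\<in>UNIV. snd (C z) $ i * of_real (snd b $ i))" for z
  have "hol f (pdom \<rho> \<rho>)" unfolding f_def
    by (intro hol_add hol_sum hol_mult hol_const hol_nth hol_fst hol_snd Cd(1))
  from real_analytic_on_hol[OF open_pdom this, of U] have "real_analytic_on (\<lambda>x. Re (f (emb x))) U" using emb_U(1) by blast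
  moreover have "(\<lambda>x. Re (f (emb x))) = (\<lambda>x. T x \<bullet> b)"
    by (simp add: fun_eq_iff f_def T_def repart_def inner_prod_def inner_vec_def)
  ultimately show "real_analytic_on (\<lambda>x. T x \<bullet> b) U" by simp
qed

definition f where "f = transformed_ham F \<Lambda> C"
definition R :: "'n rphase \<Rightarrow> real" where "R x = Re (f (emb x)) - Re (f 0) - \<omega> \<bullet> fst x"

lemma f_phase: "phase_fun \<rho> \<rho> f" unfolding f_def by (rule phase_fun_transformed_ham[OF F C])

lemma f_at_torus: "f (0, cvec q) = f 0" "pd i f (0, cvec q) = of_real (\<omega> $ i)"
proof -
  have q: "cvec q \<in> complex_angles \<rho>" using \<rho> by simp
  note b = bspec[OF nf[unfolded normal_form_error_def, folded f_def] q]
  have "cmod (f (0, cvec q) - f (0, 0)) \<le> 0" "cmod (pd i f (0, cvec q) - of_real (\<omega> $ i)) \<le> 0" using b by blast+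
  then have "f (0, cvec q) - f (0, 0) = 0" "pd i f (0, cvec q) - of_real (\<omega> $ i) = 0" by (simp_all only: norm_le_zero_iff)
  then show "f (0, cvec q) = f 0" "pd i f (0, cvec q) = of_real (\<omega> $ i)"
    by (simp_all only: right_minus_eq zero_prod_def)
qed

text \<open>
  The vanishing of the error of the normal form says that on \<open>p = 0\<close> the Hamiltonian is constant and
  has the gradient \<open>\<omega>\<close> in \<open>p\<close>.
\<close>

lemma R_quadratic: "quadratic_remainder R U"
  unfolding quadratic_remainder_def
proof (intro conjI allI impI)
  define g where "g z = f z - f 0 - (\<Sum>i\<in>UNIV. of_real (\<omega> $ i) * fst z $ i)" for z
  have "hol g (pdom \<rho> \<rho>)" unfolding g_def
    by (intro hol_diff hol_const hol_sum hol_mult hol_nth hol_fst hol_id phase_funD(1)[OF f_phase])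
  from real_analytic_on_hol[OF open_pdom this, of U] have "real_analytic_on (\<lambda>x. Re (g (emb x))) U" using emb_U(1) by blast
  moreover have "(\<lambda>x. Re (g (emb x))) = R" by (simp add: fun_eq_iff g_def R_def inner_vec_def)
  ultimately show "real_analytic_on R U" by simp
  show "R (p, q + lattice_vec k) = R (p, q)" if pq: "(p, q) \<in> U" for p q k
    using phase_funD(2)[OF f_phase emb_U(1)[OF pq], of k] emb_shift[of "(p, q)" k] by (simp add: R_def)
  show "R (0, q) = 0" for q
  proof -
    have c0: "cvec 0 = (0 :: complex^'n)" by (simp add: vec_eq_iff)
    show ?thesis using f_at_torus(1)[of q] by (simp add: R_def emb_def c0)
  qed
  show "((\<lambda>p. R (p, q)) has_derivative (\<lambda>_. 0)) (at 0)" for q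
  proof -
    have x: "emb (0, q) \<in> pdom \<rho> \<rho>" using \<rho> by simp
    have l: "bounded_linear (\<lambda>p :: real^'n. emb (p, 0 :: real^'n))"
      by (rule bounded_linear_compose[OF emb_bounded_linear]) (intro bounded_linear_intros)
    have "((\<lambda>p. emb (p, 0) + emb (0, q)) has_derivative (\<lambda>u. emb (u, 0) + 0)) (at 0)"
      by (intro has_derivative_add bounded_linear_imp_has_derivative[OF l] has_derivative_const)
    moreover have "(\<lambda>p. emb (p, 0) + emb (0, q)) = (\<lambda>p. emb (p, q))" by (simp add: linear_add[OF emb_linear, symmetric])
    ultimately have e: "((\<lambda>p. emb (p, q)) has_derivative (\<lambda>u. emb (u, 0))) (at 0)" by simp
    have "((\<lambda>p. f (emb (p, q))) has_derivative (\<lambda>u. dv f (emb (0, q)) (emb (u, 0)))) (at 0)"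
      by (rule hol_has_derivative_compose[OF phase_funD(1)[OF f_phase] x e])
    moreover have "dv f (emb (0, q)) (emb (u, 0)) = of_real (\<omega> \<bullet> u)" for u
    proof -
      have c0: "cvec 0 = (0 :: complex^'n)" by (simp add: vec_eq_iff)
      have "dv f (emb (0, q)) (emb (u, 0)) = (\<Sum>j\<in>UNIV. cvec u $ j * pd j f (0, cvec q))"
        using dv_momentum_sum[OF phase_funD(1)[OF f_phase] x, of "cvec u"] by (simp add: emb_def c0)
      then show ?thesis by (simp add: f_at_torus(2) inner_vec_def mult.commute)
    qed
    ultimately have "((\<lambda>p. f (emb (p, q))) has_derivative (\<lambda>u. of_real (\<omega> \<bullet> u))) (at 0)" by simp
    from bounded_linear.has_derivative[OF bounded_linear_Re this]
    have "((\<lambda>p. Re (f (emb (p, q)))) has_derivative (\<lambda>u. \<omega> \<bullet> u)) (at 0)" by simp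
    then have "((\<lambda>p. Re (f (emb (p, q))) - Re (f 0) - \<omega> \<bullet> p) has_derivative (\<lambda>u. \<omega> \<bullet> u - 0 - \<omega> \<bullet> u)) (at 0)"
      by (intro has_derivative_diff has_derivative_const bounded_linear_imp_has_derivative bounded_linear_inner_right)
    then show ?thesis by (simp add: R_def)
  qed
qed

lemma ham_normal_form:
  assumes "x \<in> U"
  shows "transformed_ham F \<Lambda> C (emb x) = of_real (Re (f 0) + \<omega> \<bullet> fst x + R x)"
proof -
  have "f (emb x) \<in> \<real>" using phase_funD(3)[OF f_phase] emb_U(1)[OF assms] by (simp add: emb_def)
  then show ?thesis by (simp add: R_def f_def[symmetric])
qed

end

section \<open>Smallness of the perturbation\<close>

text \<open>
  The power series converges absolutely at a point other than its centre, and its absolute value there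
  dominates the function at all points closer to the centre.
\<close>

lemma real_analytic_on_bounded_near:
  fixes f :: "real \<Rightarrow> complex"
  assumes f: "real_analytic_on f S" and x: "x \<in> S"
  obtains r B where "r > 0" "\<And>y. \<bar>y - x\<bar> < r \<Longrightarrow> cmod (f y) \<le> B"
proof -
  let ?I = "Basis \<rightarrow>\<^sub>E (UNIV :: nat set) :: (real \<Rightarrow> nat) set"
  obtain r a where r: "r > 0" and a: "\<And>y. y \<in> ball x r \<Longrightarrow>
      ((\<lambda>\<alpha>. (\<Prod>b\<in>Basis. ((y - x) \<bullet> b) ^ \<alpha> b) *\<^sub>R a \<alpha>) has_sum f y) ?I"
    using f x unfolding real_analytic_on_def by blast
  define t where "t y \<alpha> = (y - x) ^ \<alpha> 1 *\<^sub>R a \<alpha>" for y and \<alpha> :: "real \<Rightarrow> nat"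
  have t: "(t y has_sum f y) ?I" if "y \<in> ball x r" for y
    using a[OF that] by (simp add: t_def[abs_def])
  define z where "z = x + r / 2"
  have "t z summable_on ?I" using t[of z] r by (auto simp: z_def dist_norm intro: has_sum_imp_summable)
  then have "(\<lambda>\<alpha>. norm (t z \<alpha>)) summable_on ?I" using summable_on_iff_abs_summable_on_complex by blast
  then have s: "((\<lambda>\<alpha>. norm (t z \<alpha>)) has_sum infsum (\<lambda>\<alpha>. norm (t z \<alpha>)) ?I) ?I" by (rule has_sum_infsum)
  have "cmod (f y) \<le> infsum (\<lambda>\<alpha>. norm (t z \<alpha>)) ?I" if y: "\<bar>y - x\<bar> < r / 2" for y
  proof (rule norm_infsum_le[OF t s])
    show "y \<in> ball x r" using y r by (simp add: dist_norm abs_minus_commute)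
    fix \<alpha> :: "real \<Rightarrow> nat"
    have "\<bar>y - x\<bar> ^ \<alpha> 1 \<le> \<bar>z - x\<bar> ^ \<alpha> 1" by (rule power_mono) (use y r in \<open>auto simp: z_def\<close>)
    then show "norm (t y \<alpha>) \<le> norm (t z \<alpha>)" by (simp add: t_def power_abs mult_right_mono)
  qed
  then show ?thesis using r by (intro that[of "r / 2"]) auto
qed

lemma vec_norm_le_sum: "norm (x :: complex^'n::finite) \<le> (\<Sum>i\<in>UNIV. cmod (x $ i))"
  unfolding norm_vec_def by (rule L2_set_le_sum) simp

text \<open>
  A bounded family of holomorphic functions is equicontinuous on the smaller domain. Up to periods
  that domain is relatively compact, so smallness at finitely many points suffices.
\<close>

lemma uniform_vanishing:
  fixes g :: "real \<Rightarrow> ('n::finite) cphase \<Rightarrow> complex"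
  assumes r: "0 < r" "0 < \<sigma>" and \<epsilon>0: "0 < \<epsilon>0"
    and g: "\<And>\<epsilon>. \<bar>\<epsilon>\<bar> < \<epsilon>0 \<Longrightarrow> hol (g \<epsilon>) (pdom r \<sigma>)"
    and inv: "\<And>\<epsilon> x k. \<bar>\<epsilon>\<bar> < \<epsilon>0 \<Longrightarrow> x \<in> pdom r \<sigma> \<Longrightarrow> g \<epsilon> (x + shiftv k) = g \<epsilon> x"
    and B: "\<And>\<epsilon> x. \<bar>\<epsilon>\<bar> < \<epsilon>0 \<Longrightarrow> x \<in> pdom r \<sigma> \<Longrightarrow> cmod (g \<epsilon> x) \<le> B"
    and point: "\<And>x \<eta>. x \<in> pdom r \<sigma> \<Longrightarrow> \<eta> > 0 \<Longrightarrow> \<exists>d>0. \<forall>\<epsilon>. \<bar>\<epsilon>\<bar> < d \<longrightarrow> cmod (g \<epsilon> x) \<le> \<eta>"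
    and \<eta>: "\<eta> > 0"
  obtains d where "d > 0" "d \<le> \<epsilon>0" "\<And>\<epsilon> x. \<bar>\<epsilon>\<bar> < d \<Longrightarrow> x \<in> pdom (r / 2) (\<sigma> / 2) \<Longrightarrow> cmod (g \<epsilon> x) \<le> \<eta>"
proof -
  let ?D = "pdom (r / 2) (\<sigma> / 2) :: 'n cphase set"
  have D: "x \<in> pdom r \<sigma>" if "x \<in> ?D" for x using that pdom_mono[of "r / 2" r "\<sigma> / 2" \<sigma>] r by auto
  define B1 where "B1 = max B 1"
  define s where "s = min r \<sigma> / 2"
  have s: "0 < s" "s \<le> r / 2" "s \<le> \<sigma> / 2" using r by (auto simp: s_def)
  (* At this distance the ratio R of the Cauchy estimate is at least 2 and 2 B1 / R is at most \<eta> / 2. *)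
  define d0 where "d0 = s * min (1 / 2) (\<eta> / (4 * B1))"
  have B1: "B1 \<ge> 1" by (simp add: B1_def)
  have m0: "0 < min (1 / 2) (\<eta> / (4 * B1))" using B1 \<eta> by simp
  have d0: "0 < d0" using s m0 by (simp add: d0_def)
  have equi: "cmod (g \<epsilon> y - g \<epsilon> x) \<le> \<eta> / 2" if x: "x \<in> ?D" and \<epsilon>: "\<bar>\<epsilon>\<bar> < \<epsilon>0" and y: "dist x y < d0" for x y \<epsilon>
  proof -
    define R where "R = s / d0"
    have R: "0 < R" using s d0 by (simp add: R_def)
    have R1: "R * min (1 / 2) (\<eta> / (4 * B1)) = 1" using s m0 by (simp add: R_def d0_def)
    have "R * min (1 / 2) (\<eta> / (4 * B1)) \<le> R * (1 / 2)" "R * min (1 / 2) (\<eta> / (4 * B1)) \<le> R * (\<eta> / (4 * B1))"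
      using R by (intro mult_left_mono; simp)+
    then have R2: "2 \<le> R" and R3: "4 * B1 \<le> R * \<eta>" unfolding R1 using B1 by (auto simp: field_simps)
    have line: "x + t *\<^sub>C (y - x) \<in> pdom r \<sigma>" if t: "cmod t < R" for t
    proof -
      have b: "cmod t * b \<le> s" if "b \<le> dist x y" "0 \<le> b" for b
      proof -
        have "cmod t * b \<le> R * d0" using t that y R by (intro mult_mono) auto
        then show ?thesis using d0 by (simp add: R_def)
      qed
      have nf: "norm (fst z) \<le> norm z" "norm (snd z) \<le> norm z" for z :: "'n cphase"
        using norm_fst_le[of "fst z" "snd z"] norm_snd_le[of "snd z" "fst z"] by simp_all
      have n: "cmod (fst (y - x) $ i) \<le> dist x y" "cmod (snd (y - x) $ i) \<le> dist x y" for i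
        using order_trans[OF Finite_Cartesian_Product.norm_nth_le nf(1)[of "y - x"]] order_trans[OF Finite_Cartesian_Product.norm_nth_le nf(2)[of "y - x"]]
        by (simp_all add: dist_norm norm_minus_commute)
      have "x + t *\<^sub>C (y - x) \<in> pdom (r / 2 + s) (\<sigma> / 2 + s)"
        by (rule pdom_add[OF x]) (use b[OF n(1) norm_ge_zero] b[OF n(2) norm_ge_zero] in \<open>simp_all add: norm_mult\<close>)
      then show ?thesis using pdom_mono[of "r / 2 + s" r "\<sigma> / 2 + s" \<sigma>] s by auto
    qed
    have "cmod (g \<epsilon> (x + (y - x)) - g \<epsilon> x) \<le> 2 * B1 / R"
      by (rule hol_Cauchy_bounds(2)[OF g[OF \<epsilon>] line R _ R2])
        (use order_trans[OF B[OF \<epsilon> line], of _ B1] in \<open>auto simp: B1_def\<close>)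
    also have "\<dots> \<le> \<eta> / 2" using R3 R by (simp add: field_simps)
    finally show ?thesis by simp
  qed
  define K where "K = {x \<in> ?D. \<forall>i. 0 \<le> Re (snd x $ i) \<and> Re (snd x $ i) \<le> 2 * pi}"
  have "bounded K"
    unfolding bounded_iff
  proof (intro exI ballI)
    fix x assume x: "x \<in> K"
    have "norm x \<le> norm (fst x) + norm (snd x)" by (metis norm_Pair_le prod.collapse)
    also have "\<dots> \<le> (\<Sum>i\<in>(UNIV :: 'n set). r) + (\<Sum>i\<in>(UNIV :: 'n set). 2 * pi + \<sigma>)"
    proof (intro add_mono order_trans[OF vec_norm_le_sum] sum_mono)
      fix i
      have "cmod (fst x $ i) < r / 2" using x by (auto simp: K_def pdom_def)
      then show "cmod (fst x $ i) \<le> r" using r by linarith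
      have "\<bar>Im (snd x $ i)\<bar> < \<sigma> / 2" "0 \<le> Re (snd x $ i)" "Re (snd x $ i) \<le> 2 * pi"
        using x by (auto simp: K_def pdom_def complex_angles_def)
      then show "cmod (snd x $ i) \<le> 2 * pi + \<sigma>" using cmod_le[of "snd x $ i"] r by linarith
    qed
    finally show "norm x \<le> (\<Sum>i\<in>(UNIV :: 'n set). r) + (\<Sum>i\<in>(UNIV :: 'n set). 2 * pi + \<sigma>)" .
  qed
  then have cK: "compact (closure K)" by (simp add: compact_eq_bounded_closed bounded_closure)
  have sub: "closure K \<subseteq> (\<Union>x\<in>K. ball x d0)"
  proof
    fix x assume "x \<in> closure K"
    then obtain y where "y \<in> K" "dist y x < d0" using d0 closure_approachable by blast
    then show "x \<in> (\<Union>x\<in>K. ball x d0)" by auto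
  qed
  obtain N where N: "N \<subseteq> K" "finite N" "closure K \<subseteq> (\<Union>x\<in>N. ball x d0)"
    by (rule compactE_image[of "closure K" K "\<lambda>x. ball x d0", OF cK _ sub]) (rule open_ball, (rule that; assumption))
  have "\<forall>x\<in>N. \<exists>d. d > 0 \<and> (\<forall>\<epsilon>. \<bar>\<epsilon>\<bar> < d \<longrightarrow> cmod (g \<epsilon> x) \<le> \<eta> / 2)"
    using point[of _ "\<eta> / 2"] \<eta> N(1) D by (force simp: K_def)
  from bchoice[OF this] obtain dd where dd: "\<forall>x\<in>N. dd x > 0 \<and> (\<forall>\<epsilon>. \<bar>\<epsilon>\<bar> < dd x \<longrightarrow> cmod (g \<epsilon> x) \<le> \<eta> / 2)" ..
  define d where "d = Min (insert \<epsilon>0 (dd ` N))"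
  have d: "d > 0" "d \<le> \<epsilon>0" and d_le: "\<And>x. x \<in> N \<Longrightarrow> d \<le> dd x" using N(2) dd \<epsilon>0 by (auto simp: d_def)
  have "cmod (g \<epsilon> x) \<le> \<eta>" if \<epsilon>: "\<bar>\<epsilon>\<bar> < d" and x: "x \<in> ?D" for \<epsilon> x
  proof -
    (* The translation that brings the angles into the fundamental cube. *)
    define k where "k = (\<chi> j. - \<lfloor>Re (snd x $ j) / (2 * pi)\<rfloor>)"
    have \<epsilon>': "\<bar>\<epsilon>\<bar> < \<epsilon>0" using \<epsilon> d by linarith
    have "x + shiftv k \<in> K"
    proof -
      have "Re (snd (x + shiftv k) $ j) = 2 * pi * frac (Re (snd x $ j) / (2 * pi))" for j
        by (simp add: k_def lattice_vec_def frac_def algebra_simps)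
      moreover have "0 \<le> frac z" "frac z \<le> 1" for z :: real using frac_lt_1[of z] by auto
      ultimately have "0 \<le> Re (snd (x + shiftv k) $ j)" "Re (snd (x + shiftv k) $ j) \<le> 2 * pi" for j
        by (simp_all add: mult_left_le)
      moreover have "x + shiftv k \<in> ?D" using x by (simp only: pdom_shiftv)
      ultimately show ?thesis unfolding K_def by blast
    qed
    then obtain c where c: "c \<in> N" "dist c (x + shiftv k) < d0" using N(3) closure_subset[of K] by auto
    have "cmod (g \<epsilon> (x + shiftv k) - g \<epsilon> c) \<le> \<eta> / 2"
      by (rule equi[OF _ \<epsilon>' c(2)]) (use c N(1) in \<open>auto simp: K_def\<close>)
    moreover have "cmod (g \<epsilon> c) \<le> \<eta> / 2" using dd c(1) d_le[OF c(1)] \<epsilon> by auto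
    ultimately have "cmod (g \<epsilon> (x + shiftv k)) \<le> \<eta>"
      using norm_triangle_sub[of "g \<epsilon> (x + shiftv k)" "g \<epsilon> c"] by linarith
    then show ?thesis using inv[OF \<epsilon>' D[OF x]] by simp
  qed
  then show ?thesis by (rule that[OF d])
qed

text \<open>
  Take for \<open>\<delta> \<epsilon>\<close> slightly more than the infimum of all \<open>\<eta>\<close> with \<open>P \<epsilon> \<eta>\<close>; the infimum itself
  need not be attained.
\<close>

lemma vanishing_choice:
  fixes P :: "real \<Rightarrow> real \<Rightarrow> bool"
  assumes mono: "\<And>\<epsilon> \<eta> \<eta>'. P \<epsilon> \<eta> \<Longrightarrow> \<eta> \<le> \<eta>' \<Longrightarrow> P \<epsilon> \<eta>'"
    and ev: "\<And>\<eta>. \<eta> > 0 \<Longrightarrow> \<exists>d>0. \<forall>\<epsilon>. \<bar>\<epsilon>\<bar> < d \<longrightarrow> P \<epsilon> \<eta>"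
  shows "\<exists>\<epsilon>s>0. \<exists>\<delta>. (\<delta> \<longlongrightarrow> 0) (at 0) \<and> (\<forall>\<epsilon>. \<bar>\<epsilon>\<bar> < \<epsilon>s \<longrightarrow> P \<epsilon> (\<delta> \<epsilon>))"
proof -
  obtain \<epsilon>s where \<epsilon>s: "\<epsilon>s > 0" "\<And>\<epsilon>. \<bar>\<epsilon>\<bar> < \<epsilon>s \<Longrightarrow> P \<epsilon> 1" using ev[of 1] by auto
  define A where "A \<epsilon> = {\<eta>. \<eta> > 0 \<and> P \<epsilon> \<eta>}" for \<epsilon>
  (* The value at 0 does not affect the limit; it only has to be admissible. *)
  define \<delta> where "\<delta> \<epsilon> = (if \<epsilon> = 0 then 1 else Inf (A \<epsilon>) + \<bar>\<epsilon>\<bar>)" for \<epsilon>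
  have bdd: "bdd_below (A \<epsilon>)" for \<epsilon> by (rule bdd_belowI[of _ 0]) (auto simp: A_def)
  have "P \<epsilon> (\<delta> \<epsilon>)" if \<epsilon>: "\<bar>\<epsilon>\<bar> < \<epsilon>s" for \<epsilon>
  proof (cases "\<epsilon> = 0")
    case True
    then show ?thesis using \<epsilon>s(2)[of 0] \<epsilon>s(1) by (simp add: \<delta>_def)
  next
    case False
    have "1 \<in> A \<epsilon>" using \<epsilon>s(2)[OF \<epsilon>] by (simp add: A_def)
    then have "A \<epsilon> \<noteq> {}" by blast
    then obtain \<eta> where "\<eta> \<in> A \<epsilon>" "\<eta> < Inf (A \<epsilon>) + \<bar>\<epsilon>\<bar>"
      using cInf_lessD[of "A \<epsilon>" "Inf (A \<epsilon>) + \<bar>\<epsilon>\<bar>"] False by auto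
    then show ?thesis using mono[of \<epsilon> \<eta> "\<delta> \<epsilon>"] False by (simp add: A_def \<delta>_def)
  qed
  moreover have "(\<delta> \<longlongrightarrow> 0) (at 0)"
  proof (rule LIM_I)
    fix e :: real assume e: "0 < e"
    obtain d where d: "d > 0" "\<And>\<epsilon>. \<bar>\<epsilon>\<bar> < d \<Longrightarrow> P \<epsilon> (e / 2)" using ev[of "e / 2"] e by auto
    have "norm (\<delta> \<epsilon> - 0) < e" if \<epsilon>: "\<epsilon> \<noteq> 0" "\<bar>\<epsilon>\<bar> < min d (e / 2)" for \<epsilon>
    proof -
      have m: "e / 2 \<in> A \<epsilon>" using d(2)[of \<epsilon>] \<epsilon> e by (simp add: A_def)
      have "Inf (A \<epsilon>) \<le> e / 2" by (rule cInf_lower[OF m bdd])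
      moreover have "0 \<le> Inf (A \<epsilon>)" 
      proof (rule cInf_greatest)
        show "A \<epsilon> \<noteq> {}" using m by blast
      qed (simp add: A_def)
      ultimately show ?thesis using \<epsilon> by (simp add: \<delta>_def)
    qed
    then show "\<exists>s>0. \<forall>\<epsilon>. \<epsilon> \<noteq> 0 \<and> norm (\<epsilon> - 0) < s \<longrightarrow> norm (\<delta> \<epsilon> - 0) < e"
      using d e by (intro exI[of _ "min d (e / 2)"]) auto
  qed
  ultimately show ?thesis using \<epsilon>s(1) by blast
qed

lemma real_holomorphic_on_hol: "real_holomorphic_on f D \<Longrightarrow> hol f D"
  unfolding hol_def
proof
  fix z assume "real_holomorphic_on f D" "z \<in> D"
  then obtain a b where d: "(f has_derivative (\<lambda>(u, v). cdot a u + cdot b v)) (at z)"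
    unfolding real_holomorphic_on_def by blast
  have "(case c *\<^sub>C w of (u, v) \<Rightarrow> cdot a u + cdot b v) = c *\<^sub>C (case w of (u, v) \<Rightarrow> cdot a u + cdot b v)" for c w
    by (cases w) (simp add: cdot_def sum_distrib_left algebra_simps)
  with d show "\<exists>f'. (f has_derivative f') (at z) \<and> (\<forall>c v. f' (c *\<^sub>C v) = c *\<^sub>C f' v)" by blast
qed

lemma real_holomorphic_on_phase_fun:
  assumes f: "real_holomorphic_on f D" and D: "pdom r \<sigma> \<subseteq> D"
  shows "phase_fun r \<sigma> f"
  unfolding phase_fun_def
proof (intro conjI ballI allI impI)
  show "hol f (pdom r \<sigma>)" by (rule hol_subset[OF real_holomorphic_on_hol[OF f] D])
  show "f (x + shiftv k) = f x" if x: "x \<in> pdom r \<sigma>" for x k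
  proof -
    have "(fst x, snd x) \<in> D" using x D by auto
    then have "f (fst x, snd x + cvec (lattice_vec k)) = f (fst x, snd x)" using f unfolding real_holomorphic_on_def by blast
    moreover have "x + shiftv k = (fst x, snd x + cvec (lattice_vec k))" by (simp add: shiftv_def prod_eq_iff)
    ultimately show ?thesis by simp
  qed
  show "f (cvec p, cvec q) \<in> \<real>" if "(cvec p, cvec q) \<in> pdom r \<sigma>" for p q
    using f D that unfolding real_holomorphic_on_def by blast
qed

section \<open>Kolmogorov normal form\<close>

lemma hamiltonian_add:
  "hamiltonian (\<omega> + \<Lambda>) h H1 \<epsilon> z = hamiltonian \<omega> h H1 \<epsilon> z + (\<Sum>k\<in>UNIV. of_real (\<Lambda> $ k) * fst z $ k)"
  by (simp add: hamiltonian_def cdot_def case_prod_beta sum.distrib algebra_simps)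

text \<open>
  At \<open>p = 0\<close> the function \<open>h\<close> vanishes to second order, so that the error comes from the perturbation
  alone; its gradient there is bounded by a Cauchy estimate.
\<close>

lemma hamiltonian_near_normal_form:
  fixes h :: "complex^'n::finite \<Rightarrow> complex"
  assumes h: "phase_fun r \<sigma> (\<lambda>(p, q). h p)" "(h has_derivative (\<lambda>_. 0)) (at 0)"
    and Hp: "phase_fun r \<sigma> (\<lambda>z. Hp z \<epsilon>)" and r: "0 < r" "r \<le> 1"
    and small: "\<And>x. x \<in> pdom r \<sigma> \<Longrightarrow> cmod (of_real \<epsilon> * Hp x \<epsilon>) \<le> \<eta>" and \<sigma>: "0 < \<sigma>"
  shows "phase_fun r \<sigma> (hamiltonian \<omega> h Hp \<epsilon>)"
    and "normal_form_error \<omega> \<sigma> (2 * \<eta> / r) (hamiltonian \<omega> h Hp \<epsilon>)"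
proof -
  define l where "l x = (\<Sum>j\<in>UNIV. of_real (\<omega> $ j) * fst x $ j)" for x :: "'n cphase"
  define u where "u x = h (fst x)" for x :: "'n cphase"
  define g where "g x = of_real \<epsilon> * Hp x \<epsilon>" for x
  have eq: "hamiltonian \<omega> h Hp \<epsilon> = (\<lambda>x. l x + u x + g x)"
    by (simp add: hamiltonian_def l_def u_def g_def cdot_def case_prod_beta fun_eq_iff)
  have u: "phase_fun r \<sigma> u" 
  proof -
    have "(\<lambda>(p, q). h p) = u" by (simp add: fun_eq_iff u_def)
    then show ?thesis using h(1) by simp
  qed
  have hl: "hol l (pdom r \<sigma>)" unfolding l_def by (intro hol_sum hol_mult hol_const hol_nth hol_fst hol_id)
  have hu: "hol u (pdom r \<sigma>)" by (rule phase_funD(1)[OF u])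
  have hg: "hol g (pdom r \<sigma>)" unfolding g_def by (intro hol_mult hol_const phase_funD(1)[OF Hp])
  show "phase_fun r \<sigma> (hamiltonian \<omega> h Hp \<epsilon>)"
    unfolding phase_fun_def eq
  proof (intro conjI ballI allI impI)
    show "hol (\<lambda>x. l x + u x + g x) (pdom r \<sigma>)" by (intro hol_add hl hu hg)
    show "l (x + shiftv k) + u (x + shiftv k) + g (x + shiftv k) = l x + u x + g x" if "x \<in> pdom r \<sigma>" for x k
      using phase_funD(2)[OF u that] phase_funD(2)[OF Hp that] by (simp add: l_def g_def)
    show "l (cvec p, cvec q) + u (cvec p, cvec q) + g (cvec p, cvec q) \<in> \<real>" if "(cvec p, cvec q) \<in> pdom r \<sigma>" for p q
      using phase_funD(3)[OF u that] phase_funD(3)[OF Hp that] by (auto simp: l_def g_def)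
  qed
  have "(0, 0) \<in> pdom r \<sigma>" using r \<sigma> by (simp add: complex_angles_def)
  from order_trans[OF norm_ge_zero small[OF this]] have \<eta>0: "0 \<le> \<eta>" .
  have "\<eta> * r \<le> \<eta> * 1" by (rule mult_left_mono[OF r(2) \<eta>0])
  then have "2 * \<eta> \<le> 2 * \<eta> / r" using r(1) by (simp add: pos_le_divide_eq)
  moreover have "\<eta> / r \<le> 2 * \<eta> / r" by (rule divide_right_mono) (use \<eta>0 r in auto)
  ultimately have le: "2 * \<eta> \<le> 2 * \<eta> / r" "\<eta> / r \<le> 2 * \<eta> / r" .
  show "normal_form_error \<omega> \<sigma> (2 * \<eta> / r) (hamiltonian \<omega> h Hp \<epsilon>)"
    unfolding normal_form_error_def eq
  proof (intro ballI conjI allI)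
    fix \<theta> :: "complex^'n" assume \<theta>: "\<theta> \<in> complex_angles \<sigma>"
    have x: "(0, \<theta>) \<in> pdom r \<sigma>" "(0, 0) \<in> pdom r \<sigma>" using \<theta> r \<sigma> by (auto simp: complex_angles_def)
    have "cmod (g (0, \<theta>) - g (0, 0)) \<le> 2 * \<eta>"
      using norm_triangle_ineq4[of "g (0, \<theta>)" "g (0, 0)"] small[OF x(1)] small[OF x(2)] by (simp add: g_def)
    then show "cmod (l (0, \<theta>) + u (0, \<theta>) + g (0, \<theta>) - (l (0, 0) + u (0, 0) + g (0, 0))) \<le> 2 * \<eta> / r"
      using le by (simp add: l_def u_def)
    fix i
    have hlj: "hol (\<lambda>x. of_real (\<omega> $ j) * fst x $ j) (pdom r \<sigma>)" for j :: 'n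
      by (intro hol_mult hol_const hol_nth hol_fst hol_id)
    have n: "dv (\<lambda>x. fst x $ j) (0, \<theta>) (e\<^sub>P i) = (if i = j then 1 else 0)" for j
      using dv_nth[OF hol_fst[OF hol_id] x(1), of j "e\<^sub>P i"] dv_fst[OF hol_id x(1), of "e\<^sub>P i"] by (simp add: axis_def)
    have "pd i (\<lambda>x. of_real (\<omega> $ j) * fst x $ j) (0, \<theta>) = (if i = j then of_real (\<omega> $ j) else 0)" for j
      using dv_mult[OF hol_const hol_nth[OF hol_fst[OF hol_id]] x(1), of "of_real (\<omega> $ j)" j "e\<^sub>P i"] by (simp add: n)
    then have dl: "pd i l (0, \<theta>) = of_real (\<omega> $ i)"
      unfolding l_def[abs_def] dv_sum_fun[OF hlj x(1)] by simp
    have "((\<lambda>x. h (fst x)) has_derivative (\<lambda>_. 0)) (at (0, \<theta>))"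
      by (rule has_derivative_compose[of fst fst "(0, \<theta>)" UNIV h "\<lambda>_. 0"])
        (use h(2) in \<open>auto intro: derivative_eq_intros\<close>)
    then have du: "pd i u (0, \<theta>) = 0" unfolding u_def[abs_def] by (simp add: dv_eqI)
    have dg: "cmod (pd i g (0, \<theta>)) \<le> \<eta> / r"
      by (rule pd_bound_at_0[OF hg _ r(1) \<theta>]) (simp add: g_def small)
    have "pd i (\<lambda>x. l x + u x + g x) (0, \<theta>) = of_real (\<omega> $ i) + pd i g (0, \<theta>)"
      by (simp only: dv_plus[OF hol_add[OF hl hu] hg x(1)] dv_plus[OF hl hu x(1)] dl du add_0_right)
    then show "cmod (pd i (\<lambda>x. l x + u x + g x) (0, \<theta>) - of_real (\<omega> $ i)) \<le> 2 * \<eta> / r"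
      using dg le by simp
  qed
qed

theorem theorem1p1:
  fixes G :: "(real^'n) set"
    and \<rho>0 \<sigma>0 \<epsilon>0 \<gamma> \<tau> :: real
    and h :: "complex^'n \<Rightarrow> complex"
    and H1 :: "('n::finite) cphase \<Rightarrow> real \<Rightarrow> complex"
    and \<omega> :: "real^'n"
  assumes G: "open G" "0 \<in> G"
    and pos: "\<rho>0 > 0" "\<sigma>0 > 0" "\<epsilon>0 > 0"
    and h_holomorphic: "real_holomorphic_on (\<lambda>(p, q). h p) (complex_domain G \<rho>0 \<sigma>0)"
    and h_quadratic: "h 0 = 0" "(h has_derivative (\<lambda>_. 0)) (at 0)"
    and H1_holomorphic:
      "\<And>\<epsilon>. \<bar>\<epsilon>\<bar> < \<epsilon>0 \<Longrightarrow> real_holomorphic_on (\<lambda>z. H1 z \<epsilon>) (complex_domain G \<rho>0 \<sigma>0)"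
    and H1_analytic:
      "\<And>z. z \<in> complex_domain G \<rho>0 \<sigma>0 \<Longrightarrow> real_analytic_on (H1 z) {-\<epsilon>0<..<\<epsilon>0}"
    and H_bounded:
      "\<exists>\<omega>0. bounded {hamiltonian \<omega>0 h H1 \<epsilon> z |\<epsilon> z. \<bar>\<epsilon>\<bar> < \<epsilon>0 \<and> z \<in> complex_domain G \<rho>0 \<sigma>0}"
    and dioph: "\<gamma> > 0" "\<tau> \<ge> real CARD('n) - 1" "diophantine \<gamma> \<tau> \<omega>"
  shows "\<exists>\<epsilon>s>0. \<exists>\<delta>::real \<Rightarrow> real. (\<delta> \<longlongrightarrow> 0) (at 0) \<and>
    (\<forall>\<epsilon>. \<bar>\<epsilon>\<bar> < \<epsilon>s \<longrightarrow>
      (\<exists>(\<omega>0::real^'n) U C.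
         torus_neighbourhood U \<and> C ` U \<subseteq> G \<times> UNIV \<and>
         real_analytic_on C U \<and> canonical_on C U \<and>
         (\<forall>x\<in>U. dist (C x) x \<le> \<delta> \<epsilon>) \<and>
         (\<exists>(c::real) R. quadratic_remainder R U \<and>
            (\<forall>P Q p q. (P, Q) \<in> U \<longrightarrow> (p, q) = C (P, Q) \<longrightarrow>
               hamiltonian \<omega>0 h H1 \<epsilon> (cvec p, cvec q) = complex_of_real (c + \<omega> \<bullet> P + R (P, Q))))))"
proof -
  let ?n = "real CARD('n)"
  have n1: "?n \<ge> 1" by (simp add: Suc_le_eq)
  obtain K \<nu> where sol: "cohom_solvable \<omega> K \<nu>"
    by (rule cohomological_solution[OF dioph(1,3)]) (use cohom_solvable_def in blast)
  obtain d where d: "d > 0" "ball 0 d \<subseteq> G" using G by (meson open_contains_ball)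
  (* Small enough for real actions with coordinates below r to lie in G. *)
  define r where "r = min (min \<rho>0 1) (d / (?n + 1))"
  define \<sigma> where "\<sigma> = min \<sigma>0 1"
  have r: "0 < r" "r \<le> 1" "r \<le> \<rho>0" "r \<le> d / (?n + 1)" and \<sigma>: "0 < \<sigma>" "\<sigma> \<le> 1" "\<sigma> \<le> \<sigma>0"
    using pos d by (auto simp: r_def \<sigma>_def)
  have in_G: "p \<in> G" if p: "\<And>i. \<bar>p $ i\<bar> < r" for p
  proof -
    have "norm p \<le> (\<Sum>i\<in>(UNIV :: 'n set). r)"
      by (rule order_trans[OF norm_le_l1_cart sum_mono]) (use p less_imp_le in blast)
    also have "\<dots> = ?n * r" by simp
    also have "\<dots> \<le> ?n * (d / (?n + 1))" by (rule mult_left_mono[OF r(4)]) simp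
    also have "\<dots> < d" using d by (simp add: field_simps)
    finally show ?thesis using d by auto
  qed
  have sub: "pdom r \<sigma> \<subseteq> complex_domain G \<rho>0 \<sigma>0"
  proof
    fix x :: "'n cphase" assume x: "x \<in> pdom r \<sigma>"
    then have "cmod (complex_of_real (0 $ j) - fst x $ j) < \<rho>0" for j
      using r by (auto simp: pdom_def intro: less_le_trans)
    then have "fst x \<in> polydisc \<rho>0 0" unfolding polydisc_def by blast
    then have 1: "fst x \<in> complex_actions \<rho>0 G" using G(2) unfolding complex_actions_def by blast
    have "snd x \<in> complex_angles \<sigma>" using x unfolding pdom_def by blast
    then have "snd x \<in> complex_angles \<sigma>0" using complex_angles_mono[OF \<sigma>(3)] by blast
    with 1 show "x \<in> complex_domain G \<rho>0 \<sigma>0" by (simp add: complex_domain_def mem_Times_iff)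
  qed
  have h: "phase_fun r \<sigma> (\<lambda>(p, q). h p)" by (rule real_holomorphic_on_phase_fun[OF h_holomorphic sub])
  have H1: "phase_fun r \<sigma> (\<lambda>z. H1 z \<epsilon>)" if "\<bar>\<epsilon>\<bar> < \<epsilon>0" for \<epsilon>
    by (rule real_holomorphic_on_phase_fun[OF H1_holomorphic[OF that] sub])
  obtain \<omega>b B where B: "\<And>\<epsilon> z. \<bar>\<epsilon>\<bar> < \<epsilon>0 \<Longrightarrow> z \<in> complex_domain G \<rho>0 \<sigma>0 \<Longrightarrow> cmod (hamiltonian \<omega>b h H1 \<epsilon> z) \<le> B"
    using H_bounded unfolding bounded_iff by blast
  define g where "g \<epsilon> x = of_real \<epsilon> * H1 x \<epsilon>" for \<epsilon> x
  have g_hol: "hol (g \<epsilon>) (pdom r \<sigma>)" if "\<bar>\<epsilon>\<bar> < \<epsilon>0" for \<epsilon>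
    unfolding g_def by (intro hol_mult hol_const phase_funD(1)[OF H1[OF that]])
  have g_inv: "g \<epsilon> (x + shiftv k) = g \<epsilon> x" if "\<bar>\<epsilon>\<bar> < \<epsilon>0" "x \<in> pdom r \<sigma>" for \<epsilon> x k
    using phase_funD(2)[OF H1[OF that(1)] that(2)] by (simp add: g_def)
  have g_bound: "cmod (g \<epsilon> x) \<le> 2 * B" if \<epsilon>: "\<bar>\<epsilon>\<bar> < \<epsilon>0" and x: "x \<in> pdom r \<sigma>" for \<epsilon> x
  proof -
    have x': "x \<in> complex_domain G \<rho>0 \<sigma>0" using x sub by blast
    have "g \<epsilon> x = hamiltonian \<omega>b h H1 \<epsilon> x - hamiltonian \<omega>b h H1 0 x"
      by (simp add: g_def hamiltonian_def case_prod_beta)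
    then show ?thesis
      using norm_triangle_ineq4[of "hamiltonian \<omega>b h H1 \<epsilon> x" "hamiltonian \<omega>b h H1 0 x"] B[OF \<epsilon> x'] B[of 0, OF _ x'] pos
      by simp
  qed
  have g_point: "\<exists>d>0. \<forall>\<epsilon>. \<bar>\<epsilon>\<bar> < d \<longrightarrow> cmod (g \<epsilon> x) \<le> \<eta>" if x: "x \<in> pdom r \<sigma>" and \<eta>: "\<eta> > 0" for x \<eta>
  proof -
    have "real_analytic_on (H1 x) {-\<epsilon>0<..<\<epsilon>0}" by (rule H1_analytic) (use x sub in blast)
    moreover have "0 \<in> {-\<epsilon>0<..<\<epsilon>0}" using pos by simp
    ultimately obtain t M where t: "t > 0" "\<And>\<epsilon>. \<bar>\<epsilon> - 0\<bar> < t \<Longrightarrow> cmod (H1 x \<epsilon>) \<le> M"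
      by (rule real_analytic_on_bounded_near) (rule that; assumption)
    have M: "0 \<le> M" using order_trans[OF norm_ge_zero t(2)[of 0]] t(1) by simp
    have "cmod (g \<epsilon> x) \<le> \<eta>" if \<epsilon>: "\<bar>\<epsilon>\<bar> < min t (\<eta> / (M + 1))" for \<epsilon>
    proof -
      have "cmod (g \<epsilon> x) \<le> \<eta> / (M + 1) * M"
        unfolding g_def norm_mult norm_of_real by (intro mult_mono) (use \<epsilon> t(2)[of \<epsilon>] M \<eta> in auto)
      also have "\<dots> \<le> \<eta>" using M \<eta> by (simp add: field_simps)
      finally show ?thesis .
    qed
    then show ?thesis using t(1) M \<eta> by (intro exI[of _ "min t (\<eta> / (M + 1))"]) auto
  qed
  (* The given bound holds for some frequency; another one changes it by a bounded amount, as the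
     actions are at most 1. *)
  define B0 where "B0 = B + (\<Sum>k\<in>UNIV. \<bar>(\<omega> - \<omega>b) $ k\<bar>)"
  have F_bound: "cmod (hamiltonian \<omega> h H1 \<epsilon> x) \<le> B0" if \<epsilon>: "\<bar>\<epsilon>\<bar> < \<epsilon>0" and x: "x \<in> pdom r \<sigma>" for \<epsilon> x
  proof -
    have x': "x \<in> complex_domain G \<rho>0 \<sigma>0" using x sub by blast
    have x1: "cmod (fst x $ k) \<le> 1" for k
      using x r by (auto simp: pdom_def intro: order_trans[OF less_imp_le])
    have "hamiltonian \<omega> h H1 \<epsilon> x = hamiltonian \<omega>b h H1 \<epsilon> x + (\<Sum>k\<in>UNIV. of_real ((\<omega> - \<omega>b) $ k) * fst x $ k)"
      using hamiltonian_add[of \<omega>b "\<omega> - \<omega>b" h H1 \<epsilon> x] by simp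
    also have "cmod \<dots> \<le> B + (\<Sum>k\<in>UNIV. \<bar>(\<omega> - \<omega>b) $ k\<bar>)"
    proof (intro order_trans[OF norm_triangle_ineq] add_mono B[OF \<epsilon> x'] sum_norm_le)
      fix k
      show "cmod (of_real ((\<omega> - \<omega>b) $ k) * fst x $ k) \<le> \<bar>(\<omega> - \<omega>b) $ k\<bar>"
        unfolding norm_mult norm_of_real by (rule mult_left_le[OF x1 abs_ge_zero])
    qed
    finally show ?thesis by (simp add: B0_def)
  qed
  have B0: "0 \<le> B0"
  proof -
    have "(0 :: 'n cphase) \<in> pdom r \<sigma>" using r \<sigma> by (simp add: pdom_def complex_angles_def)
    from order_trans[OF norm_ge_zero F_bound[of 0, OF _ this]] show ?thesis using pos by simp
  qed
  (* The perturbation is uniformly small on the domain of half the size only. *)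
  define r2 where "r2 = r / 2"
  define \<sigma>2 where "\<sigma>2 = \<sigma> / 2"
  have r2: "0 < r2" "r2 \<le> 1" "r2 \<le> r" and \<sigma>2: "0 < \<sigma>2" "\<sigma>2 \<le> 1" "\<sigma>2 \<le> \<sigma>"
    using r \<sigma> by (auto simp: r2_def \<sigma>2_def)
  obtain \<rho> es c where \<rho>: "0 < \<rho>" and es: "0 < es" and c: "0 < c" and kam:
    "\<And>F e. phase_fun r2 \<sigma>2 F \<Longrightarrow> \<forall>x\<in>pdom r2 \<sigma>2. cmod (F x) \<le> B0 \<Longrightarrow> 0 < e \<Longrightarrow> e \<le> es \<Longrightarrow>
      normal_form_error \<omega> \<sigma>2 e F \<Longrightarrow>
      \<exists>\<Lambda> C. phase_map r2 \<sigma>2 \<rho> \<rho> (c * e) C \<and> normal_form_error \<omega> \<rho> 0 (transformed_ham F \<Lambda> C)"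
    by (rule kam_iteration[OF sol r2(1,2) \<sigma>2(1,2) B0]) (rule that; assumption)
  define P where "P \<epsilon> \<eta> \<longleftrightarrow> (\<exists>(\<omega>0::real^'n) U C.
         torus_neighbourhood U \<and> C ` U \<subseteq> G \<times> UNIV \<and>
         real_analytic_on C U \<and> canonical_on C U \<and>
         (\<forall>x\<in>U. dist (C x) x \<le> \<eta>) \<and>
         (\<exists>(c::real) R. quadratic_remainder R U \<and>
            (\<forall>P Q p q. (P, Q) \<in> U \<longrightarrow> (p, q) = C (P, Q) \<longrightarrow>
               hamiltonian \<omega>0 h H1 \<epsilon> (cvec p, cvec q) = complex_of_real (c + \<omega> \<bullet> P + R (P, Q)))))" for \<epsilon> \<eta>
  have "\<exists>\<epsilon>s>0. \<exists>\<delta>::real \<Rightarrow> real. (\<delta> \<longlongrightarrow> 0) (at 0) \<and> (\<forall>\<epsilon>. \<bar>\<epsilon>\<bar> < \<epsilon>s \<longrightarrow> P \<epsilon> (\<delta> \<epsilon>))"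
  proof (rule vanishing_choice)
    show "P \<epsilon> \<eta>'" if "P \<epsilon> \<eta>" "\<eta> \<le> \<eta>'" for \<epsilon> \<eta> \<eta>'
    proof -
      have w: "(\<forall>x\<in>U. dist (C x) x \<le> \<eta>) \<Longrightarrow> (\<forall>x\<in>U. dist (C x) x \<le> \<eta>')" for U and C :: "'n rphase \<Rightarrow> 'n rphase"
        using that(2) by (meson order_trans)
      show ?thesis using that(1) unfolding P_def by (elim exE conjE) (intro exI conjI w; assumption)
    qed
    fix \<eta> :: real assume \<eta>: "0 < \<eta>"
    (* The displacement c e has to be at most \<eta> / (2 n), and at most \<rho> / 4 for injectivity. *)
    define e where "e = min es (min (\<eta> / (2 * ?n * c)) (\<rho> / (4 * c)))"
    have e: "0 < e" "e \<le> es" using es c \<rho> \<eta> n1 by (auto simp: e_def)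
    have e2: "c * e \<le> \<eta> / (2 * ?n)" "c * e \<le> \<rho> / 4"
    proof -
      have "e \<le> \<eta> / (2 * ?n * c)" "e \<le> \<rho> / (4 * c)" by (simp_all add: e_def)
      then show "c * e \<le> \<eta> / (2 * ?n)" "c * e \<le> \<rho> / 4" using c n1 by (simp_all add: field_simps)
    qed
    have ep: "0 < e * r2 / 2" using e r2 by simp
    obtain d where d: "d > 0" "d \<le> \<epsilon>0"
      and small: "\<And>\<epsilon> x. \<bar>\<epsilon>\<bar> < d \<Longrightarrow> x \<in> pdom (r / 2) (\<sigma> / 2) \<Longrightarrow> cmod (g \<epsilon> x) \<le> e * r2 / 2"
      by (rule uniform_vanishing[of r \<sigma> \<epsilon>0 g "2 * B" "e * r2 / 2", OF r(1) \<sigma>(1) pos(3) g_hol g_inv g_bound g_point ep])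
        (assumption | rule that)+
    have "P \<epsilon> \<eta>" if \<epsilon>: "\<bar>\<epsilon>\<bar> < d" for \<epsilon>
    proof -
      have \<epsilon>': "\<bar>\<epsilon>\<bar> < \<epsilon>0" using \<epsilon> d by linarith
      define F where "F = hamiltonian \<omega> h H1 \<epsilon>"
      have D2: "x \<in> pdom r \<sigma>" if "x \<in> pdom r2 \<sigma>2" for x :: "'n cphase" using that pdom_mono[OF r2(3) \<sigma>2(3)] by blast
      note near = hamiltonian_near_normal_form[where Hp = H1 and \<epsilon> = \<epsilon> and \<eta> = "e * r2 / 2",
          OF phase_fun_subset[OF h r2(3) \<sigma>2(3)] h_quadratic(2) phase_fun_subset[OF H1[OF \<epsilon>'] r2(3) \<sigma>2(3)] r2(1,2)
          small[OF \<epsilon>, folded r2_def \<sigma>2_def, unfolded g_def] \<sigma>2(1)]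
      have F: "phase_fun r2 \<sigma>2 F" unfolding F_def by (rule near(1)) assumption
      have "normal_form_error \<omega> \<sigma>2 (2 * (e * r2 / 2) / r2) F" unfolding F_def by (rule near(2)) assumption
      then have nf: "normal_form_error \<omega> \<sigma>2 e F" using r2 by simp
      have "\<forall>x\<in>pdom r2 \<sigma>2. cmod (F x) \<le> B0" using F_bound[OF \<epsilon>' D2] by (simp add: F_def)
      from kam[OF F this e nf] obtain \<Lambda> C where C: "phase_map r2 \<sigma>2 \<rho> \<rho> (c * e) C"
        and nf0: "normal_form_error \<omega> \<rho> 0 (transformed_ham F \<Lambda> C)" by blast
      interpret complex_normal_form \<omega> \<Lambda> F C r2 \<sigma>2 \<rho> "c * e"
        by unfold_locales (use F C \<rho> e2 nf0 in auto)
      have range: "T ` U \<subseteq> G \<times> UNIV"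
      proof
        fix y assume "y \<in> T ` U"
        then obtain x where x: "x \<in> U" "y = T x" by blast
        have "emb y \<in> pdom r2 \<sigma>2" unfolding x(2) emb_T[OF x(1)] by (rule Cd(2)[OF emb_U(1)[OF x(1)]])
        then have "\<bar>fst y $ i\<bar> < r2" for i using \<sigma>2 by simp
        then have "fst y \<in> G" using in_G r2(3) by (meson less_le_trans)
        then show "y \<in> G \<times> UNIV" by (simp add: mem_Times_iff)
      qed
      have near_id: "dist (T x) x \<le> \<eta>" if "x \<in> U" for x
      proof -
        have "2 * ?n * (c * e) \<le> 2 * ?n * (\<eta> / (2 * ?n))" using e2(1) by (rule mult_left_mono) simp
        also have "\<dots> = \<eta>" using n1 by simp
        finally show ?thesis using T_near[OF that] by linarith
      qed
      have ham: "hamiltonian (\<omega> + \<Lambda>) h H1 \<epsilon> (cvec p, cvec q) = complex_of_real (Re (f 0) + \<omega> \<bullet> a + R (a, b))"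
        if x: "(a, b) \<in> U" and pq: "(p, q) = T (a, b)" for a b p q
      proof -
        have z: "(cvec p, cvec q) = C (emb (a, b))" using emb_T[OF x] by (simp add: pq[symmetric] emb_def)
        show ?thesis
          unfolding hamiltonian_add F_def[symmetric] z
          using ham_normal_form[OF x] by (simp add: transformed_ham_def)
      qed
      show ?thesis
        unfolding P_def
        by (intro exI[of _ "\<omega> + \<Lambda>"] exI[of _ U] exI[of _ T] exI[of _ "Re (f 0)"] exI[of _ R] conjI allI impI ballI
            U_neighbourhood range T_analytic T_canonical near_id R_quadratic ham; assumption)
    qed
    then show "\<exists>d>0. \<forall>\<epsilon>. \<bar>\<epsilon>\<bar> < d \<longrightarrow> P \<epsilon> \<eta>" using d(1) by blast
  qed
  then show ?thesis unfolding P_def .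
qed

end
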